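(* Assume (LIP), (SLG), (H1), (H2), (H3), fix $\mu_0\in\mathcal P_c(\mathbb R^d)$, $y_0\in\mathbb R^c$ (initial time $0$), and let $\psi\colon\mathcal P_2(\mathbb R^d)\to\mathbb R$ and $J(\mathbf u)=\psi(\boldsymbol\mu(T;\mathbf u))$ for $\mathbf u\in\mathcal U$. (a) If $\psi$ is lower semicontinuous with respect to $W_2$, then $J$ attains its minimum over $\mathcal U$. (b) Let $\mathbf u^\star\in\mathcal U$ with solution $(\boldsymbol\mu^\star,\mathbf y^\star)$ and flow $\mathbf\Phi^\star$, and assume $\psi$ is Wasserstein differentiable at $\boldsymbol\mu^\star(T)$. Let $\mathfrak p^\star=(\mathbf p^\star,\mathbf q^\star)\in C([0,T];H(\mu_0))$ be the unique solution of the backward adjoint equation $-\dot{\mathfrak p}(t)=\mathcal A(t)^*\mathfrak p(t)$ with terminal condition $\mathfrak p(T)=\big(D_\mu\psi[\boldsymbol\mu^\star(T)](\mathbf\Phi^\star(T,\cdot)),0\big)$. Then for every $\delta\mathbf u\in L^2([0,T],\mathbb R^c)$ with $\mathbf u^\varepsilon=\mathbf u^\star+\varepsilon\delta\mathbf u\in\mathcal U$ for all small $\varepsilon>0$, the corresponding solutions satisfy $\psi(\boldsymbol\mu^\varepsilon(T))=\psi(\boldsymbol\mu^\star(T))+\varepsilon\int_0^T\mathbf q^\star(t)\cdot\delta\mathbf u(t)\,dt+o(\varepsilon)$ as $\varepsilon\to0^+$. (c) If in addition $\mathbf u^\star$ is a local minimizer of $J$ on $\mathcal U$ with respect to the strong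 $L^2([0,T],\mathbb R^c)$ topology, then for almost every $t\in[0,T]$, $\mathbf q^\star(t)\cdot\mathbf u^\star(t)=\min_{\omega\in U}\mathbf q^\star(t)\cdot\omega$.
   Context: Setting. $d,c\ge1$, $T>0$; $\mathcal P_2(\mathbb R^n)$, $\mathcal P_c(\mathbb R^n)$ are the Borel probability measures with finite second moment, resp. compact support; $W_2$ the 2-Wasserstein distance; $f_\#\mu$ pushforward; $m_\infty(\mu)=\sup\{\|x\|:x\in\operatorname{supp}\mu\}$; $\mathfrak d((\mu_1,y_1),(\mu_2,y_2))=W_2(\mu_1,\mu_2)+\|y_1-y_2\|$. $U\subset\mathbb R^c$ compact convex, $\mathcal U=L^2([0,T],U)$ the measurable $U$-valued controls. $F\colon\mathcal P_c(\mathbb R^d)\times\mathbb R^d\times\mathbb R^c\to\mathbb R^d$, $(\mu,x,y)\mapsto F[\mu](x,y)$, $G\colon\mathcal P_c(\mathbb R^d)\times\mathbb R^c\to\mathbb R^c$. System (S): $\partial_t\mu+\nabla_x\cdot(F[\mu](\cdot,y)\mu)=0$, $\dot y=G[\mu](y)+\mathbf u(t)$, $\mu(0)=\mu_0$, $y(0)=y_0$ (weak sense for the PDE with equi-compactly supported $\boldsymbol\mu(t)$, Carathéodory for the ODE); $(\boldsymbol\mu(\cdot;\mathbf u),\mathbf y(\cdot;\mathbf u))$ denotes its solution. (LIP): $\exists\mathbf L$ with $\|F[\mu_1](x_1,y_1)-F[\mu_2](x_2,y_2)\|\le\mathbf L(\|x_1-x_2\|+\mathfrak d((\mu_1,y_1),(\mu_2,y_2)))$,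 $\|G[\mu_1](y_1)-G[\mu_2](y_2)\|\le\mathbf L\mathfrak d((\mu_1,y_1),(\mu_2,y_2))$. (SLG): $\exists\mathbf C$ with $\|F[\mu](x,y)\|\le\mathbf C(1+\|x\|+\|y\|+m_\infty(\mu))$, $\|G[\mu](y)\|\le\mathbf C(1+\|y\|+m_\infty(\mu))$. Under these, solutions exist uniquely and $\boldsymbol\mu(t)=\mathbf\Phi(t,\cdot)_\#\mu_0$ with flow $\mathbf\Phi(0,x)=x$, $\partial_t\mathbf\Phi(t,x)=F[\boldsymbol\mu(t)](\mathbf\Phi(t,x),\mathbf y(t))$. Wasserstein gradients: $\mathrm{Tan}_\mu\mathcal P_2(\mathbb R^n)$ is the $L^2(\mu)$-closure of $\{\nabla\phi:\phi\in C_c^\infty\}$; $\varphi$ is Wasserstein differentiable at $\mu$ if there is $\xi\in\mathrm{Tan}_\mu$ with $\varphi(\nu)=\varphi(\mu)+\int\langle\xi(x),y-x\rangle d\gamma(x,y)+o(W_2(\mu,\nu))$ for all $\nu\in\mathcal P_2$ and all optimal couplings $\gamma$ of $(\mu,\nu)$; $\xi$ is unique, denoted $D_\mu\varphi[\mu]$ (componentwise, as matrix rows, for vector-valued maps). $D_\mu F[\mu]_{(x,y)}(\zeta)\in\mathbb R^{d\times d}$ is the Wasserstein gradient of $\nu\mapsto F[\nu](x,y)$ at $\mu$ evaluated at $\zeta$; likewise $D_\mu G[\mu]_y(\zeta)\in\mathbb R^{c\times d}$. (H1) $F,G$ differentiable in $x,y$ and Wasserstein differentiable in $\mu$. (H2)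 $(\mu,x,y)\mapsto D_{x,y}F[\mu](x,y)$, $(\mu,y)\mapsto D_yG[\mu](y)$ continuous. (H3) $(\mu,x,y,\zeta)\mapsto D_\mu F[\mu]_{(x,y)}(\zeta)$, $(\mu,y,\zeta)\mapsto D_\mu G[\mu]_y(\zeta)$ continuous (everywhere-defined representatives). $H(\mu_0)=L^2(\mathbb R^d,\mathbb R^d;\mu_0)\times\mathbb R^c$ with inner product $((w_1,v_1),(w_2,v_2))=\int w_1\cdot w_2\,d\mu_0+v_1\cdot v_2$. Along the reference $(\boldsymbol\mu^\star,\mathbf y^\star,\mathbf\Phi^\star)$, $\mathcal A(t)=(\mathcal A_w(t),\mathcal A_v(t))\in\mathcal L(H(\mu_0))$ acts on $(w,v)$ by $(\mathcal A_w(t)(w,v))(x)=D_xF[\boldsymbol\mu^\star(t)](\mathbf\Phi^\star(t,x),\mathbf y^\star(t))w(x)+D_yF[\boldsymbol\mu^\star(t)](\mathbf\Phi^\star(t,x),\mathbf y^\star(t))v+\int D_\mu F[\boldsymbol\mu^\star(t)]_{(\mathbf\Phi^\star(t,x),\mathbf y^\star(t))}(\mathbf\Phi^\star(t,\zeta))w(\zeta)\,d\mu_0(\zeta)$, $\mathcal A_v(t)(w,v)=D_yG[\boldsymbol\mu^\star(t)](\mathbf y^\star(t))v+\int D_\mu G[\boldsymbol\mu^\star(t)]_{\mathbf y^\star(t)}(\mathbf\Phi^\star(t,\zeta))w(\zeta)\,d\mu_0(\zeta)$. $\mathcal A(t)^*$ is its Hilbert adjoint in $H(\mu_0)$; explicitly,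 for $\mathfrak p=(p,q)$: $(\mathcal A(t)^*\mathfrak p)_w(x)=D_xF[\boldsymbol\mu^\star(t)](\mathbf\Phi^\star(t,x),\mathbf y^\star(t))^\top p(x)+D_\mu G[\boldsymbol\mu^\star(t)]_{\mathbf y^\star(t)}(\mathbf\Phi^\star(t,x))^\top q+\int D_\mu F[\boldsymbol\mu^\star(t)]_{(\mathbf\Phi^\star(t,\zeta),\mathbf y^\star(t))}(\mathbf\Phi^\star(t,x))^\top p(\zeta)\,d\mu_0(\zeta)$ and $(\mathcal A(t)^*\mathfrak p)_v=\int D_yF[\boldsymbol\mu^\star(t)](\mathbf\Phi^\star(t,\zeta),\mathbf y^\star(t))^\top p(\zeta)\,d\mu_0(\zeta)+D_yG[\boldsymbol\mu^\star(t)](\mathbf y^\star(t))^\top q$. The backward adjoint equation is understood in integral form: $\mathfrak p(t)=\mathfrak p(T)+\int_t^T\mathcal A(s)^*\mathfrak p(s)\,ds$. *)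

theory Defs
  imports "HOL-Probability.Probability"
begin

definition P2 :: "(real^'n) measure set" where
  "P2 = {\<mu>. sets \<mu> = sets borel \<and> prob_space \<mu> \<and>
              (\<integral>\<^sup>+ x. ennreal ((norm x)\<^sup>2) \<partial>\<mu>) < \<infinity>}"

definition supp :: "(real^'n) measure \<Rightarrow> (real^'n) set" where
  "supp \<mu> = {x. \<forall>e>0. emeasure \<mu> (ball x e) > 0}"

definition Pc :: "(real^'n) measure set" where
  "Pc = {\<mu>. sets \<mu> = sets borel \<and> prob_space \<mu> \<and> compact (supp \<mu>)}"

definition m_inf :: "(real^'n) measure \<Rightarrow> real" where
  "m_inf \<mu> = Sup (norm ` supp \<mu>)"

definition couplings :: "(real^'n) measure \<Rightarrow> (real^'n) measure \<Rightarrow> ((real^'n) \<times> (real^'n)) measure set" where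
  "couplings \<mu> \<nu> = {\<gamma>. sets \<gamma> = sets borel \<and> distr \<gamma> borel fst = \<mu> \<and> distr \<gamma> borel snd = \<nu>}"

definition transport_cost :: "((real^'n) \<times> (real^'n)) measure \<Rightarrow> ennreal" where
  "transport_cost \<gamma> = (\<integral>\<^sup>+ z. ennreal ((dist (fst z) (snd z))\<^sup>2) \<partial>\<gamma>)"

definition W2 :: "(real^'n) measure \<Rightarrow> (real^'n) measure \<Rightarrow> real" where
  "W2 \<mu> \<nu> = sqrt (enn2real (INF \<gamma>\<in>couplings \<mu> \<nu>. transport_cost \<gamma>))"

definition optimal_coupling :: "(real^'n) measure \<Rightarrow> (real^'n) measure \<Rightarrow> ((real^'n) \<times> (real^'n)) measure \<Rightarrow> bool" where
  "optimal_coupling \<mu> \<nu> \<gamma> \<longleftrightarrow> \<gamma> \<in> couplings \<mu> \<nu> \<and>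
       transport_cost \<gamma> = (INF \<gamma>'\<in>couplings \<mu> \<nu>. transport_cost \<gamma>')"

primrec Ck :: "nat \<Rightarrow> (real^'n \<Rightarrow> real) \<Rightarrow> bool" where
  "Ck 0 f \<longleftrightarrow> continuous_on UNIV f"
| "Ck (Suc k) f \<longleftrightarrow> (\<forall>x. f differentiable (at x)) \<and>
      (\<forall>i. Ck k (\<lambda>x. frechet_derivative f (at x) (axis i 1)))"

definition test_fun :: "(real^'n \<Rightarrow> real) \<Rightarrow> bool" where
  "test_fun \<phi> \<longleftrightarrow> (\<forall>k. Ck k \<phi>) \<and> (\<exists>K. compact K \<and> (\<forall>x. x \<notin> K \<longrightarrow> \<phi> x = 0))"

definition grad :: "(real^'n \<Rightarrow> real) \<Rightarrow> real^'n \<Rightarrow> real^'n" where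
  "grad \<phi> x = (\<chi> i. frechet_derivative \<phi> (at x) (axis i 1))"

definition in_Tan :: "(real^'n) measure \<Rightarrow> (real^'n \<Rightarrow> real^'n) \<Rightarrow> bool" where
  "in_Tan \<mu> \<xi> \<longleftrightarrow> \<xi> \<in> borel_measurable borel \<and>
     (\<integral>\<^sup>+ x. ennreal ((norm (\<xi> x))\<^sup>2) \<partial>\<mu>) < \<infinity> \<and>
     (\<forall>e>0. \<exists>\<phi>. test_fun \<phi> \<and>
        (\<integral>\<^sup>+ x. ennreal ((norm (\<xi> x - grad \<phi> x))\<^sup>2) \<partial>\<mu>) < ennreal e)"

text \<open>xi is the Wasserstein gradient of phi at mu, where phi is considered on the domain D
  (D = P2 for psi, D = Pc for F and G, which are only defined on Pc).\<close>
definition wgrad :: "(real^'n) measure set \<Rightarrow> ((real^'n) measure \<Rightarrow> real) \<Rightarrow> (real^'n) measure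
                      \<Rightarrow> (real^'n \<Rightarrow> real^'n) \<Rightarrow> bool" where
  "wgrad D \<phi> \<mu> \<xi> \<longleftrightarrow> in_Tan \<mu> \<xi> \<and>
     (\<forall>e>0. \<exists>\<delta>>0. \<forall>\<nu>\<in>D. W2 \<mu> \<nu> < \<delta> \<longrightarrow>
        (\<forall>\<gamma>. optimal_coupling \<mu> \<nu> \<gamma> \<longrightarrow>
           \<bar>\<phi> \<nu> - \<phi> \<mu> - (\<integral>z. \<xi> (fst z) \<bullet> (snd z - fst z) \<partial>\<gamma>)\<bar> \<le> e * W2 \<mu> \<nu>))"

definition wdiff :: "(real^'n) measure set \<Rightarrow> ((real^'n) measure \<Rightarrow> real) \<Rightarrow> (real^'n) measure \<Rightarrow> bool" where
  "wdiff D \<phi> \<mu> \<longleftrightarrow> (\<exists>\<xi>. wgrad D \<phi> \<mu> \<xi>)"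

definition W2_lsc :: "((real^'n) measure \<Rightarrow> real) \<Rightarrow> bool" where
  "W2_lsc \<psi> \<longleftrightarrow> (\<forall>\<mu>\<in>P2. \<forall>e>0. \<exists>\<delta>>0. \<forall>\<nu>\<in>P2. W2 \<mu> \<nu> < \<delta> \<longrightarrow> \<psi> \<nu> > \<psi> \<mu> - e)"

definition LIP ::
  "((real^'d) measure \<Rightarrow> real^'d \<Rightarrow> real^'c \<Rightarrow> real^'d) \<Rightarrow> ((real^'d) measure \<Rightarrow> real^'c \<Rightarrow> real^'c) \<Rightarrow> bool" where
  "LIP F G \<longleftrightarrow> (\<exists>L. (\<forall>\<mu>1\<in>Pc. \<forall>\<mu>2\<in>Pc. \<forall>x1 x2 y1 y2.
        norm (F \<mu>1 x1 y1 - F \<mu>2 x2 y2) \<le> L * (dist x1 x2 + (W2 \<mu>1 \<mu>2 + dist y1 y2))) \<and>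
     (\<forall>\<mu>1\<in>Pc. \<forall>\<mu>2\<in>Pc. \<forall>y1 y2.
        norm (G \<mu>1 y1 - G \<mu>2 y2) \<le> L * (W2 \<mu>1 \<mu>2 + dist y1 y2)))"

definition SLG ::
  "((real^'d) measure \<Rightarrow> real^'d \<Rightarrow> real^'c \<Rightarrow> real^'d) \<Rightarrow> ((real^'d) measure \<Rightarrow> real^'c \<Rightarrow> real^'c) \<Rightarrow> bool" where
  "SLG F G \<longleftrightarrow> (\<exists>C. (\<forall>\<mu>\<in>Pc. \<forall>x y. norm (F \<mu> x y) \<le> C * (1 + norm x + norm y + m_inf \<mu>)) \<and>
     (\<forall>\<mu>\<in>Pc. \<forall>y. norm (G \<mu> y) \<le> C * (1 + norm y + m_inf \<mu>)))"

definition H1 ::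
  "((real^'d) measure \<Rightarrow> real^'d \<Rightarrow> real^'c \<Rightarrow> real^'d) \<Rightarrow> ((real^'d) measure \<Rightarrow> real^'c \<Rightarrow> real^'c) \<Rightarrow>
   ((real^'d) measure \<Rightarrow> real^'d \<Rightarrow> real^'c \<Rightarrow> real^'d^'d) \<Rightarrow>
   ((real^'d) measure \<Rightarrow> real^'d \<Rightarrow> real^'c \<Rightarrow> real^'c^'d) \<Rightarrow>
   ((real^'d) measure \<Rightarrow> real^'c \<Rightarrow> real^'c^'c) \<Rightarrow>
   ((real^'d) measure \<Rightarrow> real^'d \<Rightarrow> real^'c \<Rightarrow> real^'d \<Rightarrow> real^'d^'d) \<Rightarrow>
   ((real^'d) measure \<Rightarrow> real^'c \<Rightarrow> real^'d \<Rightarrow> real^'d^'c) \<Rightarrow> bool" where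
  "H1 F G DxF DyF DyG DmuF DmuG \<longleftrightarrow>
     (\<forall>\<mu>\<in>Pc. \<forall>x y.
        ((\<lambda>x'. F \<mu> x' y) has_derivative (\<lambda>h. DxF \<mu> x y *v h)) (at x) \<and>
        ((\<lambda>y'. F \<mu> x y') has_derivative (\<lambda>h. DyF \<mu> x y *v h)) (at y) \<and>
        (\<forall>i. wgrad Pc (\<lambda>\<nu>. F \<nu> x y $ i) \<mu> (\<lambda>\<zeta>. DmuF \<mu> x y \<zeta> $ i))) \<and>
     (\<forall>\<mu>\<in>Pc. \<forall>y.
        ((\<lambda>y'. G \<mu> y') has_derivative (\<lambda>h. DyG \<mu> y *v h)) (at y) \<and>
        (\<forall>i. wgrad Pc (\<lambda>\<nu>. G \<nu> y $ i) \<mu> (\<lambda>\<zeta>. DmuG \<mu> y \<zeta> $ i)))"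

definition H2 ::
  "((real^'d) measure \<Rightarrow> real^'d \<Rightarrow> real^'c \<Rightarrow> real^'d^'d) \<Rightarrow>
   ((real^'d) measure \<Rightarrow> real^'d \<Rightarrow> real^'c \<Rightarrow> real^'c^'d) \<Rightarrow>
   ((real^'d) measure \<Rightarrow> real^'c \<Rightarrow> real^'c^'c) \<Rightarrow> bool" where
  "H2 DxF DyF DyG \<longleftrightarrow>
     (\<forall>\<mu>\<in>Pc. \<forall>x y. \<forall>e>0. \<exists>\<delta>>0. \<forall>\<mu>'\<in>Pc. \<forall>x' y'.
        W2 \<mu> \<mu>' + dist x x' + dist y y' < \<delta> \<longrightarrow>
          norm (DxF \<mu>' x' y' - DxF \<mu> x y) < e \<and> norm (DyF \<mu>' x' y' - DyF \<mu> x y) < e) \<and>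
     (\<forall>\<mu>\<in>Pc. \<forall>y. \<forall>e>0. \<exists>\<delta>>0. \<forall>\<mu>'\<in>Pc. \<forall>y'.
        W2 \<mu> \<mu>' + dist y y' < \<delta> \<longrightarrow> norm (DyG \<mu>' y' - DyG \<mu> y) < e)"

definition H3 ::
  "((real^'d) measure \<Rightarrow> real^'d \<Rightarrow> real^'c \<Rightarrow> real^'d \<Rightarrow> real^'d^'d) \<Rightarrow>
   ((real^'d) measure \<Rightarrow> real^'c \<Rightarrow> real^'d \<Rightarrow> real^'d^'c) \<Rightarrow> bool" where
  "H3 DmuF DmuG \<longleftrightarrow>
     (\<forall>\<mu>\<in>Pc. \<forall>x y \<zeta>. \<forall>e>0. \<exists>\<delta>>0. \<forall>\<mu>'\<in>Pc. \<forall>x' y' \<zeta>'.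
        W2 \<mu> \<mu>' + dist x x' + dist y y' + dist \<zeta> \<zeta>' < \<delta> \<longrightarrow>
          norm (DmuF \<mu>' x' y' \<zeta>' - DmuF \<mu> x y \<zeta>) < e) \<and>
     (\<forall>\<mu>\<in>Pc. \<forall>y \<zeta>. \<forall>e>0. \<exists>\<delta>>0. \<forall>\<mu>'\<in>Pc. \<forall>y' \<zeta>'.
        W2 \<mu> \<mu>' + dist y y' + dist \<zeta> \<zeta>' < \<delta> \<longrightarrow> norm (DmuG \<mu>' y' \<zeta>' - DmuG \<mu> y \<zeta>) < e)"

text \<open>Admissible controls: measurable on [0,T], a.e. U-valued (U compact, so square integrable).\<close>
definition admissible :: "(real^'c) set \<Rightarrow> real \<Rightarrow> (real \<Rightarrow> real^'c) \<Rightarrow> bool" where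
  "admissible U T u \<longleftrightarrow> set_borel_measurable lborel {0..T} u \<and>
     (AE t in lborel. t \<in> {0..T} \<longrightarrow> u t \<in> U)"

definition L2_on :: "real \<Rightarrow> (real \<Rightarrow> real^'c) \<Rightarrow> bool" where
  "L2_on T v \<longleftrightarrow> set_borel_measurable lborel {0..T} v \<and>
     (\<integral>\<^sup>+ t\<in>{0..T}. ennreal ((norm (v t))\<^sup>2) \<partial>lborel) < \<infinity>"

definition L2dist_sq :: "real \<Rightarrow> (real \<Rightarrow> real^'c) \<Rightarrow> (real \<Rightarrow> real^'c) \<Rightarrow> ennreal" where
  "L2dist_sq T u v = (\<integral>\<^sup>+ t\<in>{0..T}. ennreal ((norm (u t - v t))\<^sup>2) \<partial>lborel)"

definition is_solution ::
  "((real^'d) measure \<Rightarrow> real^'d \<Rightarrow> real^'c \<Rightarrow> real^'d) \<Rightarrow> ((real^'d) measure \<Rightarrow> real^'c \<Rightarrow> real^'c) \<Rightarrow>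
   (real^'d) measure \<Rightarrow> real^'c \<Rightarrow> real \<Rightarrow> (real \<Rightarrow> real^'c) \<Rightarrow>
   (real \<Rightarrow> (real^'d) measure) \<Rightarrow> (real \<Rightarrow> real^'c) \<Rightarrow> bool" where
  "is_solution F G \<mu>0 y0 T u \<mu> y \<longleftrightarrow>
     (\<forall>t\<in>{0..T}. \<mu> t \<in> Pc) \<and>
     (\<exists>K. compact K \<and> (\<forall>t\<in>{0..T}. supp (\<mu> t) \<subseteq> K)) \<and>
     (\<forall>\<phi>. test_fun \<phi> \<longrightarrow> (\<forall>t\<in>{0..T}.
        set_integrable lborel {0..t} (\<lambda>s. \<integral>x. grad \<phi> x \<bullet> F (\<mu> s) x (y s) \<partial>(\<mu> s)) \<and>
        (\<integral>x. \<phi> x \<partial>(\<mu> t)) = (\<integral>x. \<phi> x \<partial>\<mu>0) +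
           (LINT s:{0..t}|lborel. \<integral>x. grad \<phi> x \<bullet> F (\<mu> s) x (y s) \<partial>(\<mu> s)))) \<and>
     (\<forall>t\<in>{0..T}.
        set_integrable lborel {0..t} (\<lambda>s. G (\<mu> s) (y s) + u s) \<and>
        y t = y0 + (LINT s:{0..t}|lborel. G (\<mu> s) (y s) + u s))"

definition is_flow ::
  "((real^'d) measure \<Rightarrow> real^'d \<Rightarrow> real^'c \<Rightarrow> real^'d) \<Rightarrow> real \<Rightarrow>
   (real \<Rightarrow> (real^'d) measure) \<Rightarrow> (real \<Rightarrow> real^'c) \<Rightarrow> (real \<Rightarrow> real^'d \<Rightarrow> real^'d) \<Rightarrow> bool" where
  "is_flow F T \<mu> y \<Phi> \<longleftrightarrow> (\<forall>x. \<Phi> 0 x = x \<and> (\<forall>t\<in>{0..T}.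
      set_integrable lborel {0..t} (\<lambda>s. F (\<mu> s) (\<Phi> s x) (y s)) \<and>
      \<Phi> t x = x + (LINT s:{0..t}|lborel. F (\<mu> s) (\<Phi> s x) (y s))))"

definition Astar_w ::
  "((real^'d) measure \<Rightarrow> real^'d \<Rightarrow> real^'c \<Rightarrow> real^'d^'d) \<Rightarrow>
   ((real^'d) measure \<Rightarrow> real^'c \<Rightarrow> real^'d \<Rightarrow> real^'d^'c) \<Rightarrow>
   ((real^'d) measure \<Rightarrow> real^'d \<Rightarrow> real^'c \<Rightarrow> real^'d \<Rightarrow> real^'d^'d) \<Rightarrow>
   (real \<Rightarrow> (real^'d) measure) \<Rightarrow> (real \<Rightarrow> real^'c) \<Rightarrow> (real \<Rightarrow> real^'d \<Rightarrow> real^'d) \<Rightarrow>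
   (real^'d) measure \<Rightarrow> real \<Rightarrow> (real^'d \<Rightarrow> real^'d) \<Rightarrow> real^'c \<Rightarrow> real^'d \<Rightarrow> real^'d" where
  "Astar_w DxF DmuG DmuF \<mu> y \<Phi> \<mu>0 t p q x =
     transpose (DxF (\<mu> t) (\<Phi> t x) (y t)) *v p x
     + transpose (DmuG (\<mu> t) (y t) (\<Phi> t x)) *v q
     + (\<integral>\<zeta>. transpose (DmuF (\<mu> t) (\<Phi> t \<zeta>) (y t) (\<Phi> t x)) *v p \<zeta> \<partial>\<mu>0)"

definition Astar_v ::
  "((real^'d) measure \<Rightarrow> real^'d \<Rightarrow> real^'c \<Rightarrow> real^'c^'d) \<Rightarrow>
   ((real^'d) measure \<Rightarrow> real^'c \<Rightarrow> real^'c^'c) \<Rightarrow>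
   (real \<Rightarrow> (real^'d) measure) \<Rightarrow> (real \<Rightarrow> real^'c) \<Rightarrow> (real \<Rightarrow> real^'d \<Rightarrow> real^'d) \<Rightarrow>
   (real^'d) measure \<Rightarrow> real \<Rightarrow> (real^'d \<Rightarrow> real^'d) \<Rightarrow> real^'c \<Rightarrow> real^'c" where
  "Astar_v DyF DyG \<mu> y \<Phi> \<mu>0 t p q =
     (\<integral>\<zeta>. transpose (DyF (\<mu> t) (\<Phi> t \<zeta>) (y t)) *v p \<zeta> \<partial>\<mu>0)
     + transpose (DyG (\<mu> t) (y t)) *v q"

definition in_L2 :: "(real^'d) measure \<Rightarrow> (real^'d \<Rightarrow> real^'d) \<Rightarrow> bool" where
  "in_L2 \<mu>0 w \<longleftrightarrow> w \<in> borel_measurable \<mu>0 \<and> (\<integral>\<^sup>+ x. ennreal ((norm (w x))\<^sup>2) \<partial>\<mu>0) < \<infinity>"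

text \<open>p = (p,q) in C([0,T]; H(mu0)) solving p(t) = p(T) + int_t^T A(s)^* p(s) ds
  (Bochner integral in H(mu0), stated weakly, i.e. tested against every element of H(mu0),
   which is equivalent for continuous integrands).\<close>
definition adjoint_solution ::
  "((real^'d) measure \<Rightarrow> real^'d \<Rightarrow> real^'c \<Rightarrow> real^'d^'d) \<Rightarrow>
   ((real^'d) measure \<Rightarrow> real^'d \<Rightarrow> real^'c \<Rightarrow> real^'c^'d) \<Rightarrow>
   ((real^'d) measure \<Rightarrow> real^'c \<Rightarrow> real^'c^'c) \<Rightarrow>
   ((real^'d) measure \<Rightarrow> real^'d \<Rightarrow> real^'c \<Rightarrow> real^'d \<Rightarrow> real^'d^'d) \<Rightarrow>
   ((real^'d) measure \<Rightarrow> real^'c \<Rightarrow> real^'d \<Rightarrow> real^'d^'c) \<Rightarrow>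
   (real^'d) measure \<Rightarrow> real \<Rightarrow>
   (real \<Rightarrow> (real^'d) measure) \<Rightarrow> (real \<Rightarrow> real^'c) \<Rightarrow> (real \<Rightarrow> real^'d \<Rightarrow> real^'d) \<Rightarrow>
   (real \<Rightarrow> real^'d \<Rightarrow> real^'d) \<Rightarrow> (real \<Rightarrow> real^'c) \<Rightarrow> bool" where
  "adjoint_solution DxF DyF DyG DmuF DmuG \<mu>0 T \<mu> y \<Phi> p q \<longleftrightarrow>
     (\<forall>t\<in>{0..T}. in_L2 \<mu>0 (p t)) \<and>
     (\<forall>t\<in>{0..T}. \<forall>e>0. \<exists>\<delta>>0. \<forall>s\<in>{0..T}. \<bar>s - t\<bar> < \<delta> \<longrightarrow>
        (\<integral>\<^sup>+ x. ennreal ((norm (p s x - p t x))\<^sup>2) \<partial>\<mu>0) + ennreal ((norm (q s - q t))\<^sup>2) < ennreal e) \<and>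
     (\<forall>t\<in>{0..T}. \<forall>w v. in_L2 \<mu>0 w \<longrightarrow>
        set_integrable lborel {t..T} (\<lambda>s.
           (\<integral>x. Astar_w DxF DmuG DmuF \<mu> y \<Phi> \<mu>0 s (p s) (q s) x \<bullet> w x \<partial>\<mu>0)
           + Astar_v DyF DyG \<mu> y \<Phi> \<mu>0 s (p s) (q s) \<bullet> v) \<and>
        (\<integral>x. p t x \<bullet> w x \<partial>\<mu>0) + q t \<bullet> v =
          (\<integral>x. p T x \<bullet> w x \<partial>\<mu>0) + q T \<bullet> v +
          (LINT s:{t..T}|lborel.
             (\<integral>x. Astar_w DxF DmuG DmuF \<mu> y \<Phi> \<mu>0 s (p s) (q s) x \<bullet> w x \<partial>\<mu>0)
             + Astar_v DyF DyG \<mu> y \<Phi> \<mu>0 s (p s) (q s) \<bullet> v))"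

end

theory Submission
  imports Defs
begin

text \<open>A weak solution is transported by its own flow, \<open>\<mu> t = \<Phi>(t)\<^sub># \<mu>\<^sub>0\<close>, because functions that increase
  along the flow and separate a compact set from far away points have nondecreasing integrals.
  Hence the system is an ordinary differential equation for \<open>(\<Phi>, y)\<close> driven by the primitive of the
  control, and the solution depends on this primitive in a Lipschitz way with respect to the sup norm.

  Primitives of admissible controls are sup norm compact, since \<open>U\<close> is compact and convex; this gives (a).

  For (b), a Wasserstein gradient is a limit of gradients of test functions, so its first-order expansion
  holds for every coupling, not only for optimal ones, and the coupling of \<open>\<mu>\<^sup>\<star>(t)\<close> and \<open>\<mu>\<^sup>\<epsilon>(t)\<close> induced by the two flows
  is admissible. Therefore \<open>(\<Phi>\<^sup>\<epsilon> - \<Phi>\<^sup>\<star>, y\<^sup>\<epsilon> - y\<^sup>\<star>)\<close> solves the linearised equation up to \<open>o(\<epsilon>)\<close>,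
  and pairing it with the adjoint state turns the derivative of \<open>\<psi>\<close> into \<open>\<integral> q \<bullet> \<delta>u\<close>.

  For (c), replace \<open>u\<^sup>\<star>\<close> by a point \<open>\<omega>\<close> of a countable dense subset of \<open>U\<close> exactly where \<open>q \<bullet> (\<omega> - u\<^sup>\<star>) < 0\<close>
  and apply (b): this set of times must be null.\<close>

subsection \<open>Realising measures on a box as images of measures on the line\<close>

text \<open>Three obstacles shape the proof. A test function transported backwards along the flow of
  a Lipschitz field is in general not smooth, so the weak equation cannot be tested with it; the
  transport formula is obtained instead from one-sided inequalities on closed sets. Next,
  Wasserstein differentiability speaks of optimal couplings only, and would be void where none
  existed. A Skorokhod representation of random vectors supplies them through Fatou's lemma; the
  same representation turns narrow convergence into \<open>W2\<close> convergence and extracts limit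
  controls. Finally, minimising controls converge only weakly. Since they enter additively,
  subtracting the primitive of the control from \<open>y\<close> leaves an equation with continuous
  right-hand side, to which Picard and Gronwall arguments in exponentially weighted norms apply.
  Differences of trajectories are measured uniformly over the compact set
  \<open>supp \<mu>0\<close>, which also controls \<open>W2\<close> through the coupling given by a
  common starting point. The adjoint state is merely square integrable in space, so it is paired
  with displacement fields that are continuous.\<close>

text \<open>Reading binary digits as ternary digits \<open>0\<close> and \<open>2\<close> and interleaving the coordinates embeds the box
  into the Cantor set, on which the inverse map is continuous. It extends continuously to the line,
  so that Skorokhod's theorem for real random variables yields the theorem for vectors.\<close>

definition bdigit :: "nat \<Rightarrow> real \<Rightarrow> bool" where
  "bdigit j t \<longleftrightarrow> odd \<lfloor>2 ^ Suc j * t\<rfloor>"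

definition cantor :: "(nat \<Rightarrow> bool) \<Rightarrow> real" where
  "cantor b = (\<Sum>k. 2 * of_bool (b k) / 3 ^ Suc k)"

lemma floor_double: "\<lfloor>2 * t\<rfloor> = 2 * \<lfloor>t\<rfloor> + of_bool (odd \<lfloor>2 * t\<rfloor>)" for t :: real
proof -
  have "\<lfloor>2 * t\<rfloor> div 2 = \<lfloor>t\<rfloor>"
    using floor_divide_real_eq_div[of 2 "2 * t"] by simp
  then show ?thesis
    using div_mult_mod_eq[of "\<lfloor>2 * t\<rfloor>" 2] by (auto simp: odd_iff_mod_2_eq_one even_iff_mod_2_eq_zero)
qed

lemma sum_bdigit:
  assumes "0 \<le> t" "t < 1"
  shows "(\<Sum>j<n. of_bool (bdigit j t) / 2 ^ Suc j) = of_int \<lfloor>2 ^ n * t\<rfloor> / (2 ^ n :: real)"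
proof (induction n)
  case 0
  have "\<lfloor>t\<rfloor> = 0" using assms by linarith
  then show ?case by simp
next
  case (Suc n)
  have "\<lfloor>2 ^ Suc n * t\<rfloor> = 2 * \<lfloor>2 ^ n * t\<rfloor> + of_bool (bdigit n t)"
    using floor_double[of "2 ^ n * t"] by (simp add: bdigit_def mult.assoc)
  then have "real_of_int \<lfloor>2 ^ Suc n * t\<rfloor> = 2 * of_int \<lfloor>2 ^ n * t\<rfloor> + of_bool (bdigit n t)"
    by simp
  with Suc show ?case by (simp add: field_simps)
qed

lemma bdigit_sums:
  assumes "0 \<le> t" "t < 1"
  shows "(\<lambda>j. of_bool (bdigit j t) / 2 ^ Suc j) sums (t :: real)"
  unfolding sums_def sum_bdigit[OF assms]
proof (rule real_tendsto_sandwich[of "\<lambda>n. t - 1 / 2 ^ n" _ _ "\<lambda>n. t"])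
  show "\<forall>\<^sub>F n in sequentially. t - 1 / 2 ^ n \<le> real_of_int \<lfloor>2 ^ n * t\<rfloor> / 2 ^ n"
  proof (intro always_eventually allI)
    fix n :: nat
    have "2 ^ n * t - 1 \<le> real_of_int \<lfloor>2 ^ n * t\<rfloor>" by linarith
    then have "(2 ^ n * t - 1) / 2 ^ n \<le> real_of_int \<lfloor>2 ^ n * t\<rfloor> / 2 ^ n" by (intro divide_right_mono) auto
    then show "t - 1 / 2 ^ n \<le> real_of_int \<lfloor>2 ^ n * t\<rfloor> / 2 ^ n" by (simp add: diff_divide_distrib)
  qed
  show "\<forall>\<^sub>F n in sequentially. real_of_int \<lfloor>2 ^ n * t\<rfloor> / 2 ^ n \<le> t"
    by (intro always_eventually allI) (simp add: field_simps)
  have "(\<lambda>n. (1/2::real) ^ n) \<longlonglongrightarrow> 0" by (rule LIMSEQ_realpow_zero) auto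
  then have "(\<lambda>n. t - (1/2) ^ n) \<longlonglongrightarrow> t - 0" by (rule tendsto_diff[OF tendsto_const])
  then show "(\<lambda>n. t - 1 / 2 ^ n) \<longlonglongrightarrow> t" by (simp add: power_divide)
qed simp

lemma summable_cantor: "summable (\<lambda>k. 2 * of_bool (b k) / (3::real) ^ Suc k)"
proof (rule summable_comparison_test')
  show "summable (\<lambda>k. (2/3) * (1/3::real) ^ k)" by (intro summable_mult summable_geometric) auto
  show "norm (2 * of_bool (b k) / (3::real) ^ Suc k) \<le> (2/3) * (1/3) ^ k" for k
    by (simp add: power_divide field_simps)
qed

text \<open>The geometric series of weights from position \<open>n\<close> on sums to
  \<open>1 / 3 ^ n\<close>, half of the weight \<open>2 / 3 ^ n\<close> of the digit before it. The
  spare half separates codes with different digits.\<close>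

lemma cantor_tail: "(\<Sum>k. 2 * of_bool (b (k + n)) / (3::real) ^ Suc (k + n)) \<in> {0..1 / 3 ^ n}"
proof -
  have s: "summable (\<lambda>k. 2 * of_bool (b (k + n)) / (3::real) ^ Suc (k + n))"
    using summable_cantor[of b] by (subst summable_iff_shift)
  have g: "(\<lambda>k. (2 / 3 ^ Suc n) * (1/3::real) ^ k) sums ((2 / 3 ^ Suc n) * (1 / (1 - 1/3)))"
    by (intro sums_mult geometric_sums) auto
  have "(\<Sum>k. 2 * of_bool (b (k + n)) / (3::real) ^ Suc (k + n)) \<le> (\<Sum>k. (2 / 3 ^ Suc n) * (1/3::real) ^ k)"
    by (intro suminf_le s sums_summable[OF g]) (auto simp: power_divide power_add field_simps)
  also have "\<dots> = 1 / 3 ^ n" using sums_unique[OF g] by simp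
  finally show ?thesis using suminf_nonneg[OF s] by (auto simp del: power_Suc)
qed

lemma cantor_range: "cantor b \<in> {0..1}"
  using cantor_tail[of b 0] by (simp add: cantor_def)

text \<open>At the first difference the larger code gains \<open>2 / 3 ^ Suc k\<close>, and the
  later digits can take back at most \<open>1 / 3 ^ Suc k\<close>.\<close>

lemma cantor_less:
  assumes "\<not> a k" "b k" "\<And>j. j < k \<Longrightarrow> a j = b j"
  shows "cantor a + 1 / 3 ^ Suc k \<le> cantor b"
proof -
  have split: "cantor c = (\<Sum>j. 2 * of_bool (c (j + Suc k)) / 3 ^ Suc (j + Suc k))
      + ((\<Sum>j<k. 2 * of_bool (c j) / 3 ^ Suc j) + 2 * of_bool (c k) / 3 ^ Suc k)" for c
    unfolding cantor_def by (subst suminf_split_initial_segment[OF summable_cantor, of _ "Suc k"]) simp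
  have "(\<Sum>j<k. 2 * of_bool (a j) / (3::real) ^ Suc j) = (\<Sum>j<k. 2 * of_bool (b j) / 3 ^ Suc j)"
    using assms(3) by (intro sum.cong) auto
  then show ?thesis
    using cantor_tail[of a "Suc k"] cantor_tail[of b "Suc k"] assms(1,2)
    unfolding split[of a] split[of b] by auto
qed

text \<open>This is the modulus of continuity of decoding: if the digits differed somewhere,
  \<open>cantor_less\<close> at the first difference would keep the codes apart.\<close>

lemma cantor_close:
  assumes "\<bar>cantor a - cantor b\<bar> < 1 / 3 ^ n" "k < n"
  shows "a k = b k"
proof (rule ccontr)
  assume "a k \<noteq> b k"
  define m where "m = (LEAST j. a j \<noteq> b j)"
  have m: "a m \<noteq> b m" "m \<le> k" and less: "\<And>j. j < m \<Longrightarrow> a j = b j"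
    unfolding m_def using LeastI[of "\<lambda>j. a j \<noteq> b j" k] Least_le[of "\<lambda>j. a j \<noteq> b j" k] \<open>a k \<noteq> b k\<close>
    by (blast dest: not_less_Least)+
  have "(3::real) ^ Suc m \<le> 3 ^ n" using m(2) assms(2) by (intro power_increasing) auto
  then have "1 / 3 ^ n \<le> (1 / 3 ^ Suc m :: real)" by (intro divide_left_mono) auto
  moreover have "1 / 3 ^ Suc m \<le> \<bar>cantor a - cantor b\<bar>"
    using m(1) cantor_less[of a m b] cantor_less[of b m a] less by (cases "a m") fastforce+
  ultimately show False using assms(1) by linarith
qed

lemma inj_cantor: "inj cantor"
proof (rule injI, rule ext)
  fix a b k assume "cantor a = cantor b"
  then show "a k = b k" by (intro cantor_close[of a b "Suc k"]) auto
qed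

text \<open>After \<open>n\<close> common digits both tails lie in an interval of length
  \<open>1 / 2 ^ n\<close>. There is no gap as in base 3, since different binary sequences may have
  the same sum.\<close>

lemma binary_tail:
  fixes b b' :: "nat \<Rightarrow> bool"
  assumes "\<And>j. j < n \<Longrightarrow> b j = b' j"
  shows "\<bar>(\<Sum>j. of_bool (b j) / 2 ^ Suc j) - (\<Sum>j. of_bool (b' j) / 2 ^ Suc j)\<bar> \<le> (1 / 2 ^ n :: real)"
proof -
  have s: "summable (\<lambda>j. of_bool (c j) / (2::real) ^ Suc j)" for c
  proof (rule summable_comparison_test')
    show "summable (\<lambda>k. (1/2) * (1/2::real) ^ k)" by (intro summable_mult summable_geometric) auto
    show "norm (of_bool (c k) / (2::real) ^ Suc k) \<le> (1/2) * (1/2) ^ k" for k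
      by (simp add: power_divide field_simps)
  qed
  have split: "(\<Sum>j. of_bool (c j) / 2 ^ Suc j) = (\<Sum>j. of_bool (c (j + n)) / 2 ^ Suc (j + n))
      + (\<Sum>j<n. of_bool (c j) / (2::real) ^ Suc j)" for c
    by (rule suminf_split_initial_segment[OF s])
  have tail: "(\<Sum>j. of_bool (c (j + n)) / (2::real) ^ Suc (j + n)) \<in> {0..1 / 2 ^ n}" for c
  proof -
    have s': "summable (\<lambda>j. of_bool (c (j + n)) / (2::real) ^ Suc (j + n))"
      using s[of c] by (subst summable_iff_shift)
    have g: "(\<lambda>k. (1 / 2 ^ Suc n) * (1/2::real) ^ k) sums ((1 / 2 ^ Suc n) * (1 / (1 - 1/2)))"
      by (intro sums_mult geometric_sums) auto
    have "(\<Sum>k. of_bool (c (k + n)) / (2::real) ^ Suc (k + n)) \<le> (\<Sum>k. (1 / 2 ^ Suc n) * (1/2::real) ^ k)"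
      by (intro suminf_le s' sums_summable[OF g]) (auto simp: power_divide power_add field_simps)
    also have "\<dots> = 1 / 2 ^ n" using sums_unique[OF g] by simp
    finally show ?thesis using suminf_nonneg[OF s'] by (auto simp del: power_Suc)
  qed
  have "(\<Sum>j<n. of_bool (b j) / (2::real) ^ Suc j) = (\<Sum>j<n. of_bool (b' j) / 2 ^ Suc j)"
    using assms by (intro sum.cong) auto
  then show ?thesis unfolding split[of b] split[of b'] using tail[of b] tail[of b'] by (simp only: atLeastAtMost_iff) linarith
qed

lemma unit_box_coding:
  obtains c :: "real \<Rightarrow> 'a::euclidean_space" and s :: "'a \<Rightarrow> real"
  where "continuous_on UNIV c" "s \<in> borel_measurable borel" "\<And>x. s x \<in> {0..1}"
    "\<And>x. \<forall>i\<in>Basis. 0 \<le> x \<bullet> i \<and> x \<bullet> i < 1 \<Longrightarrow> c (s x) = x"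
proof -
  \<comment> \<open>\<open>g\<close> runs through the finite \<open>Basis\<close> with repetitions,
    so that every first component of \<open>prod_decode\<close> names a coordinate. \<open>m\<close>
    fixes one index per basis vector, and \<open>dec\<close> reads the digits stored under these
    indices.\<close>
  define g :: "nat \<Rightarrow> 'a" where "g = from_nat_into Basis"
  have "\<exists>m. g m = i" if "i \<in> Basis" for i
    using that from_nat_into_surj[of "Basis :: 'a set" i] by (auto simp: g_def countable_finite)
  then obtain m where m: "\<And>i. i \<in> Basis \<Longrightarrow> g (m i) = i" by metis
  define dig where "dig x k = bdigit (snd (prod_decode k)) (x \<bullet> g (fst (prod_decode k)))" for x k
  define dec where "dec b = (\<Sum>i\<in>Basis. (\<Sum>j. of_bool (b (prod_encode (m i, j))) / 2 ^ Suc j) *\<^sub>R i)" 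
    for b :: "nat \<Rightarrow> bool"
  define h where "h = dec \<circ> inv cantor"
  have h: "h (cantor b) = dec b" for b by (simp add: h_def inv_f_f[OF inj_cantor])
  \<comment> \<open>Uniform continuity extends the decoding to the closure of the Cantor set, and a
    function on a closed set extends continuously to the line.\<close>
  have "uniformly_continuous_on (range cantor) h"
    unfolding uniformly_continuous_on_def
  proof (intro allI impI)
    fix e :: real assume "e > 0"
    obtain n where n: "(1/2 :: real) ^ n < e / DIM('a)"
      using real_arch_pow_inv[of "e / DIM('a)" "1/2"] \<open>e > 0\<close> by auto
    \<comment> \<open>Below position \<open>K\<close> lie the first \<open>n\<close> digits of every
      coordinate, so codes that agree up to \<open>K\<close> decode to points whose coordinates
      differ by at most \<open>1 / 2 ^ n\<close>.\<close>
    define K where "K = Suc (Max ((\<lambda>(i, j). prod_encode (m i, j)) ` (Basis \<times> {..<n})))"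
    have K: "prod_encode (m i, j) < K" if "i \<in> Basis" "j < n" for i j
      unfolding K_def less_Suc_eq_le using that by (intro Max_ge) force+
    show "\<exists>d>0. \<forall>x\<in>range cantor. \<forall>x'\<in>range cantor. dist x' x < d \<longrightarrow> dist (h x') (h x) < e"
    proof (intro exI[of _ "1 / 3 ^ K"] conjI ballI impI)
      fix x x' assume "x \<in> range cantor" "x' \<in> range cantor" and d: "dist x' x < 1 / 3 ^ K"
      then obtain a b where ab: "x = cantor a" "x' = cantor b" by auto
      then have eq: "a k = b k" if "k < K" for k
        using d that by (intro cantor_close[of a b K]) (auto simp: dist_real_def abs_minus_commute)
      have "dist (h x') (h x) = norm (\<Sum>i\<in>Basis. ((\<Sum>j. of_bool (b (prod_encode (m i, j))) / 2 ^ Suc j)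
          - (\<Sum>j. of_bool (a (prod_encode (m i, j))) / 2 ^ Suc j)) *\<^sub>R i)"
        by (simp add: ab h dec_def dist_norm sum_subtractf scaleR_diff_left)
      also have "\<dots> \<le> (\<Sum>i\<in>(Basis :: 'a set). 1 / 2 ^ n)"
        using K eq by (intro sum_norm_le) (auto intro!: binary_tail simp del: power_Suc)
      also have "\<dots> = DIM('a) * (1/2) ^ n" by (simp add: power_divide)
      also have "\<dots> < e" using n by (simp add: field_simps)
      finally show "dist (h x') (h x) < e" .
    qed simp
  qed
  then obtain h' where h': "uniformly_continuous_on (closure (range cantor)) h'"
      "\<And>x. x \<in> range cantor \<Longrightarrow> h x = h' x"
    by (rule uniformly_continuous_on_extension_on_closure) blast
  obtain c where c: "continuous_on UNIV c" "\<And>x. x \<in> closure (range cantor) \<Longrightarrow> c x = h' x"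
    using Dugundji[of UNIV UNIV "closure (range cantor)" h'] h'(1)
    by (auto intro: uniformly_continuous_imp_continuous)
  have [measurable]: "Measurable.pred borel (bdigit j)" for j
    unfolding bdigit_def by measurable
  show thesis
  proof
    show "continuous_on UNIV c" by fact
    show "(\<lambda>x. cantor (dig x)) \<in> borel_measurable borel"
      unfolding cantor_def dig_def by measurable
    show "cantor (dig x) \<in> {0..1}" for x by (rule cantor_range)
    fix x :: 'a assume x: "\<forall>i\<in>Basis. 0 \<le> x \<bullet> i \<and> x \<bullet> i < 1"
    have "c (cantor (dig x)) = h' (cantor (dig x))"
      using closure_subset[of "range cantor"] by (intro c(2)) auto
    also have "\<dots> = dec (dig x)" using h'(2)[of "cantor (dig x)"] by (simp add: h)
    also have "\<dots> = (\<Sum>i\<in>Basis. (\<Sum>j. of_bool (bdigit j (x \<bullet> i)) / 2 ^ Suc j) *\<^sub>R i)"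
      using m unfolding dec_def dig_def by (intro sum.cong) auto
    also have "\<dots> = (\<Sum>i\<in>Basis. (x \<bullet> i) *\<^sub>R i)"
      using sums_unique[OF bdigit_sums] x by (intro sum.cong) (auto simp del: power_Suc)
    also have "\<dots> = x" by (rule euclidean_representation)
    finally show "c (cantor (dig x)) = x" .
  qed
qed

lemma ball_coding:
  fixes R :: real
  obtains c :: "real \<Rightarrow> 'a::euclidean_space" and s :: "'a \<Rightarrow> real"
  where "continuous_on UNIV c" "s \<in> borel_measurable borel" "\<And>x. s x \<in> {0..1}"
    "\<And>x. norm x \<le> R \<Longrightarrow> c (s x) = x"
proof -
  obtain c :: "real \<Rightarrow> 'a" and s where cs: "continuous_on UNIV c" "s \<in> borel_measurable borel"
    "\<And>x. s x \<in> {0..1}" "\<And>x. \<forall>i\<in>Basis. 0 \<le> x \<bullet> i \<and> x \<bullet> i < 1 \<Longrightarrow> c (s x) = x"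
    using unit_box_coding by blast
  \<comment> \<open>Dividing by \<open>r\<close> brings the coordinates of the ball into
    \<open>[-1/3, 1/3]\<close>; the shift by \<open>v\<close> then moves them inside the unit box.
    Adding 1 keeps \<open>r\<close> positive for every \<open>R\<close>.\<close>
  define r where "r = 3 * (\<bar>R\<bar> + 1)"
  have r: "r > 0" by (simp add: r_def)
  define v :: 'a where "v = (\<Sum>i\<in>Basis. (1/2) *\<^sub>R i)"
  show thesis
  proof
    show "continuous_on UNIV (\<lambda>t. r *\<^sub>R (c t - v))" by (intro continuous_intros cs(1))
    show "(\<lambda>x. s ((1/r) *\<^sub>R x + v)) \<in> borel_measurable borel"
      using cs(2) by measurable
    show "s ((1/r) *\<^sub>R x + v) \<in> {0..1}" for x by (rule cs)
    fix x :: 'a assume x: "norm x \<le> R"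
    have "c (s ((1/r) *\<^sub>R x + v)) = (1/r) *\<^sub>R x + v"
    proof (rule cs(4), rule ballI)
      fix i :: 'a assume i: "i \<in> Basis"
      have "\<bar>x \<bullet> i\<bar> \<le> r / 3" using Basis_le_norm[OF i, of x] x by (simp add: r_def)
      then have "\<bar>(x \<bullet> i) / r\<bar> \<le> 1/3" using r by (simp add: field_simps)
      moreover have "v \<bullet> i = 1/2" using i by (simp add: v_def inner_sum_left inner_Basis if_distrib cong: if_cong)
      ultimately show "0 \<le> ((1/r) *\<^sub>R x + v) \<bullet> i \<and> ((1/r) *\<^sub>R x + v) \<bullet> i < 1"
        by (auto simp: inner_add_left abs_if split: if_splits)
    qed
    then show "r *\<^sub>R (c (s ((1/r) *\<^sub>R x + v)) - v) = x" using r by simp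
  qed
qed

text \<open>The codes are real numbers in \<open>[0, 1]\<close>, so their laws are tight. A
  subsequence converges weakly, Skorokhod's theorem on the line realises it by pointwise convergent
  variables, and the continuous decoding carries both the laws and the convergence back. The law of
  the limit \<open>Y'\<close> is left open; each application identifies it by testing with
  continuous functions.\<close>

theorem prokhorov_skorohod:
  fixes \<gamma> :: "nat \<Rightarrow> 'a::euclidean_space measure"
  assumes sets: "\<And>n. sets (\<gamma> n) = sets borel" and prob: "\<And>n. prob_space (\<gamma> n)"
    and bdd: "\<And>n. AE x in \<gamma> n. norm x \<le> R"
  shows "\<exists>r (\<Omega> :: real measure) Y (Y' :: real \<Rightarrow> 'a). strict_mono (r :: nat \<Rightarrow> nat) \<and> prob_space \<Omega> \<and>
    (\<forall>n. Y n \<in> borel_measurable \<Omega>) \<and> (\<forall>n. distr \<Omega> borel (Y n) = \<gamma> (r n)) \<and> Y' \<in> borel_measurable \<Omega> \<and>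
    (\<forall>\<omega>\<in>space \<Omega>. (\<lambda>n. Y n \<omega>) \<longlonglongrightarrow> Y' \<omega>)"
proof -
  obtain c :: "real \<Rightarrow> 'a" and s where c: "continuous_on UNIV c" and s: "s \<in> borel_measurable borel"
    and s01: "\<And>x. s x \<in> {0..1}" and cs: "\<And>x. norm x \<le> R \<Longrightarrow> c (s x) = x"
    using ball_coding[of R] by blast
  have [measurable]: "c \<in> borel_measurable borel" "s \<in> borel_measurable borel"
    using c s by (auto intro: borel_measurable_continuous_onI)
  have s' [measurable]: "s \<in> borel_measurable (\<gamma> n)" for n using s sets by (simp cong: measurable_cong_sets)
  define \<rho> where "\<rho> n = distr (\<gamma> n) borel s" for n
  have rd: "real_distribution (\<rho> n)" for n
    unfolding \<rho>_def by (rule prob_space.real_distribution_distr[OF prob s'])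
  have "tight \<rho>"
    unfolding tight_def
  proof (intro conjI allI impI rd)
    fix \<epsilon> :: real assume "\<epsilon> > 0"
    show "\<exists>a b. a < b \<and> (\<forall>n. 1 - \<epsilon> < measure (\<rho> n) {a<..b})"
    proof (rule exI[of _ "-1"], rule exI[of _ 2], intro conjI allI)
      fix n
      interpret \<rho>: real_distribution "\<rho> n" by (rule rd)
      have "AE x in \<rho> n. x \<in> {-1<..2}"
        unfolding \<rho>_def
      proof (subst AE_distr_iff)
        have "-1 < s x \<and> s x \<le> 2" for x using s01[of x] by auto
        then show "AE x in \<gamma> n. s x \<in> {-1<..2}" by simp
      qed auto
      then have "measure (\<rho> n) {-1<..2} = 1" using \<rho>.prob_eq_1[of "{-1<..2}"] by auto
      then show "1 - \<epsilon> < measure (\<rho> n) {-1<..2}" using \<open>\<epsilon> > 0\<close> by simp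
    qed simp
  qed
  from tight_imp_convergent_subsubsequence[OF this strict_mono_id]
  obtain r M where r: "strict_mono r" and M: "real_distribution M" "weak_conv_m (\<rho> \<circ> r) M" by auto
  have rd': "real_distribution ((\<rho> \<circ> r) n)" for n by (simp add: rd)
  obtain \<Omega> :: "real measure" and Z Z' where Z: "prob_space \<Omega>" "\<forall>n. Z n \<in> borel_measurable \<Omega>"
    "\<forall>n. distr \<Omega> borel (Z n) = (\<rho> \<circ> r) n" "Z' \<in> measurable \<Omega> lborel"
    "\<forall>x\<in>space \<Omega>. (\<lambda>n. Z n x) \<longlonglongrightarrow> Z' x"
    using Skorohod[OF rd' M] by blast
  have [measurable]: "Z n \<in> borel_measurable \<Omega>" "Z' \<in> borel_measurable \<Omega>" for n
    using Z(2,4) by auto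
  show ?thesis
  proof (intro exI[of _ r] exI[of _ \<Omega>] exI[of _ "\<lambda>n \<omega>. c (Z n \<omega>)"] exI[of _ "\<lambda>\<omega>. c (Z' \<omega>)"] conjI allI ballI)
    show "strict_mono r" "prob_space \<Omega>" by fact+
    show "(\<lambda>\<omega>. c (Z n \<omega>)) \<in> borel_measurable \<Omega>" for n by measurable
    show "(\<lambda>\<omega>. c (Z' \<omega>)) \<in> borel_measurable \<Omega>" by measurable
    show "(\<lambda>n. c (Z n \<omega>)) \<longlonglongrightarrow> c (Z' \<omega>)" if "\<omega> \<in> space \<Omega>" for \<omega>
      using c Z(5) that by (auto intro: continuous_on_tendsto_compose)
    show "distr \<Omega> borel (\<lambda>\<omega>. c (Z n \<omega>)) = \<gamma> (r n)" for n
    proof -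
      have Z3: "distr \<Omega> borel (Z n) = distr (\<gamma> (r n)) borel s" using Z(3) by (simp add: \<rho>_def)
      have "distr \<Omega> borel (\<lambda>\<omega>. c (Z n \<omega>)) = distr (distr \<Omega> borel (Z n)) borel c"
        by (subst distr_distr) (auto simp: comp_def)
      also have "\<dots> = distr (\<gamma> (r n)) borel (\<lambda>x. c (s x))"
        unfolding Z3 by (subst distr_distr) (auto simp: comp_def)
      also have "\<dots> = distr (\<gamma> (r n)) borel (\<lambda>x. x)"
        using bdd[of "r n"] cs by (intro distr_cong_AE) (auto elim: eventually_mono intro: measurable_ident_sets[OF sets])
      also have "\<dots> = \<gamma> (r n)" using sets by (intro distr_id2) auto
      finally show ?thesis .
    qed
  qed
qed

subsection \<open>Compactly supported measures and couplings\<close>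

lemma borel_measurable_fst_snd [measurable]:
  "fst \<in> borel_measurable borel" "snd \<in> borel_measurable borel"
  by (intro borel_measurable_continuous_onI continuous_on_fst continuous_on_snd continuous_on_id)+

lemma closed_supp:
  assumes s: "sets \<mu> = sets borel"
  shows "closed (supp \<mu>)"
proof -
  have "\<exists>e>0. ball x e \<subseteq> - supp \<mu>" if x: "x \<in> - supp \<mu>" for x
  proof -
    obtain e where e: "e > 0" "emeasure \<mu> (ball x e) = 0"
      using x by (auto simp: supp_def zero_less_iff_neq_zero)
    have "y \<in> - supp \<mu>" if y: "y \<in> ball x e" for y
    proof -
      obtain d where "d > 0" "ball y d \<subseteq> ball x e"
        using openE[OF open_ball y] by metis
      then have "emeasure \<mu> (ball y d) \<le> emeasure \<mu> (ball x e)"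
        using s by (intro emeasure_mono) auto
      then show ?thesis using e \<open>d > 0\<close> by (auto simp: supp_def zero_less_iff_neq_zero)
    qed
    then show ?thesis using e(1) by blast
  qed
  then show ?thesis unfolding closed_def open_contains_ball by blast
qed

lemma PcD:
  assumes "\<mu> \<in> Pc"
  shows Pc_sets: "sets \<mu> = sets borel" and Pc_prob: "prob_space \<mu>" and Pc_compact: "compact (supp \<mu>)"
  using assms by (auto simp: Pc_def)

text \<open>The complement of the support is covered by null balls; by the Lindelof property
  countably many of them suffice.\<close>

lemma emeasure_compl_supp:
  assumes s: "sets \<mu> = sets borel"
  shows "emeasure \<mu> (- supp \<mu>) = 0"
proof -
  define \<F> where "\<F> = {ball x e |x e. emeasure \<mu> (ball x e) = 0}"
  obtain \<F>' where \<F>': "\<F>' \<subseteq> \<F>" "countable \<F>'" "\<Union>\<F>' = \<Union>\<F>"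
    using Lindelof[of \<F>] by (auto simp: \<F>_def)
  have "(\<Union>A\<in>\<F>'. A) \<in> null_sets \<mu>"
    using \<F>' s by (intro null_sets_UN') (auto simp: \<F>_def null_sets_def)
  moreover have "- supp \<mu> \<subseteq> \<Union>\<F>"
    by (force simp: supp_def \<F>_def zero_less_iff_neq_zero)
  moreover have "- supp \<mu> \<in> sets \<mu>"
    using closed_supp[OF s] s by auto
  ultimately show ?thesis
    using null_sets_subset[of "\<Union>\<F>'" \<mu> "- supp \<mu>"] \<F>'(3) by (auto simp: null_sets_def)
qed

lemma AE_supp: "\<mu> \<in> Pc \<Longrightarrow> AE x in \<mu>. x \<in> supp \<mu>"
  using emeasure_compl_supp[of \<mu>] closed_supp[of \<mu>] Pc_sets[of \<mu>]
  by (intro AE_I[of _ _ "- supp \<mu>"]) auto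

lemma supp_subset:
  assumes s: "sets \<mu> = sets borel" and "closed K" "AE x in \<mu>. x \<in> K"
  shows "supp \<mu> \<subseteq> K"
proof
  fix x assume x: "x \<in> supp \<mu>"
  show "x \<in> K"
  proof (rule ccontr)
    assume "x \<notin> K"
    then obtain e where e: "e > 0" "ball x e \<subseteq> - K"
      using \<open>closed K\<close> open_contains_ball[of "- K"] by (auto simp: closed_def)
    have "emeasure \<mu> (ball x e) \<le> emeasure \<mu> (- K)"
      using e assms(2) s by (intro emeasure_mono) auto
    also have "\<dots> = 0"
      using assms(2,3) s by (subst (asm) AE_iff_measurable[of "- K"]) (auto simp: sets_eq_imp_space_eq[OF s])
    finally show False using x e(1) by (auto simp: supp_def zero_less_iff_neq_zero)
  qed
qed

lemma Pc_I:
  assumes "sets \<mu> = sets borel" "prob_space \<mu>" "compact K" "AE x in \<mu>. x \<in> K"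
  shows "\<mu> \<in> Pc" "supp \<mu> \<subseteq> K"
proof -
  show *: "supp \<mu> \<subseteq> K" using assms by (intro supp_subset compact_imp_closed)
  then have "supp \<mu> = K \<inter> supp \<mu>" by auto
  moreover have "compact (K \<inter> supp \<mu>)" using assms(3) closed_supp[OF assms(1)] by (rule compact_Int_closed)
  ultimately show "\<mu> \<in> Pc" using assms(1,2) by (simp add: Pc_def)
qed

lemma supp_nonempty: "\<mu> \<in> Pc \<Longrightarrow> supp \<mu> \<noteq> {}"
  using emeasure_compl_supp[of \<mu>] Pc_sets[of \<mu>] prob_space.emeasure_space_1[OF Pc_prob, of \<mu>]
  by (auto simp: sets_eq_imp_space_eq)

lemma Pc_bounded:
  assumes "\<mu> \<in> Pc" obtains R where "R > 0" "AE x in \<mu>. norm x \<le> R" "supp \<mu> \<subseteq> cball 0 R"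
proof -
  obtain R where "R > 0" "\<And>x. x \<in> supp \<mu> \<Longrightarrow> norm x \<le> R"
    using compact_imp_bounded[OF Pc_compact[OF assms]] by (auto simp: bounded_pos)
  then show thesis using AE_supp[OF assms] by (intro that[of R]) (auto elim: eventually_mono)
qed

lemma Pc_subset_P2: "Pc \<subseteq> P2"
proof
  fix \<mu> :: "(real^'n) measure" assume \<mu>: "\<mu> \<in> Pc"
  interpret prob_space \<mu> using \<mu> by (rule Pc_prob)
  obtain R where R: "R > 0" "AE x in \<mu>. norm x \<le> R" using \<mu> by (rule Pc_bounded)
  have "(\<integral>\<^sup>+ x. ennreal ((norm x)\<^sup>2) \<partial>\<mu>) \<le> (\<integral>\<^sup>+ x. ennreal (R\<^sup>2) \<partial>\<mu>)"
    using R by (intro nn_integral_mono_AE) (auto elim!: eventually_mono intro!: ennreal_leI power_mono)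
  also have "\<dots> < \<infinity>" by (simp add: emeasure_space_1)
  finally show "\<mu> \<in> P2" using \<mu> by (auto simp: P2_def Pc_def)
qed

lemma Pc_distr:
  assumes "\<mu> \<in> Pc" "f \<in> borel_measurable borel" "continuous_on (supp \<mu>) f"
  shows "distr \<mu> borel f \<in> Pc" "supp (distr \<mu> borel f) \<subseteq> f ` supp \<mu>"
proof -
  have m: "f \<in> borel_measurable \<mu>" using assms(2) by (simp only: measurable_cong_sets[OF Pc_sets[OF assms(1)] refl])
  have K: "compact (f ` supp \<mu>)" using assms Pc_compact by (auto intro: compact_continuous_image)
  have "AE x in distr \<mu> borel f. x \<in> f ` supp \<mu>"
    using m AE_supp[OF assms(1)] compact_imp_closed[OF K]
    by (subst AE_distr_iff) (auto elim: eventually_mono)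
  then show "distr \<mu> borel f \<in> Pc" "supp (distr \<mu> borel f) \<subseteq> f ` supp \<mu>"
    using Pc_I[of "distr \<mu> borel f" "f ` supp \<mu>"] K prob_space.prob_space_distr[OF Pc_prob[OF assms(1)] m] by auto
qed

text \<open>The functions \<open>max 0 (1 - real n * infdist x C)\<close> decrease to the indicator
  of the closed set \<open>C\<close>, and closed sets form an intersection-stable generator of the
  Borel sets.\<close>

lemma measure_eq_continuous:
  fixes M N :: "'a::metric_space measure"
  assumes M: "sets M = sets borel" "finite_measure M" and N: "sets N = sets borel" "finite_measure N"
    and eq: "\<And>f :: 'a \<Rightarrow> real. continuous_on UNIV f \<Longrightarrow> (\<And>x. 0 \<le> f x \<and> f x \<le> 1) \<Longrightarrow> (\<integral>x. f x \<partial>M) = (\<integral>x. f x \<partial>N)"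
  shows "M = N"
proof -
  interpret M: finite_measure M by fact
  interpret N: finite_measure N by fact
  have *: "(\<lambda>n. \<integral>x. max 0 (1 - real n * infdist x C) \<partial>M) \<longlonglongrightarrow> measure M C"
    if C: "closed C" "C \<noteq> {}" and M: "sets M = sets borel" "finite_measure M" for C and M :: "'a measure"
  proof -
    interpret finite_measure M by (rule M(2))
    have "(\<lambda>n. \<integral>x. max 0 (1 - real n * infdist x C) \<partial>M) \<longlonglongrightarrow> (\<integral>x. indicator C x \<partial>M)"
    proof (rule integral_dominated_convergence[where w="\<lambda>_. 1"])
      show "indicator C \<in> borel_measurable M"
        by (rule borel_measurable_indicator) (simp only: M(1), rule borel_closed[OF C(1)])
      have "(\<lambda>x. max 0 (1 - real n * infdist x C)) \<in> borel_measurable borel" for n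
        by (intro borel_measurable_continuous_onI continuous_intros)
      then show "(\<lambda>x. max 0 (1 - real n * infdist x C)) \<in> borel_measurable M" for n
        by (simp only: measurable_cong_sets[OF M(1) refl])
      show "AE x in M. (\<lambda>n. max 0 (1 - real n * infdist x C)) \<longlonglongrightarrow> indicator C x"
      proof (rule AE_I2)
        fix x
        show "(\<lambda>n. max 0 (1 - real n * infdist x C)) \<longlonglongrightarrow> indicator C x"
        proof (cases "x \<in> C")
          case False
          then have "infdist x C > 0" using C by (intro infdist_pos_not_in_closed)
          then obtain N where "1 < real N * infdist x C" using reals_Archimedean3 by blast
          then have "max 0 (1 - real n * infdist x C) = 0" if "n \<ge> N" for n
          proof -
            have "real N * infdist x C \<le> real n * infdist x C"
              using that by (intro mult_right_mono) (auto simp: infdist_nonneg)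
            then show ?thesis using \<open>1 < real N * infdist x C\<close> by simp
          qed
          then show ?thesis using False by (intro tendsto_eventually eventually_sequentiallyI[of N]) simp
        qed (simp add: infdist_zero)
      qed
      show "AE x in M. norm (max 0 (1 - real n * infdist x C)) \<le> 1" for n
        using infdist_nonneg[of _ C] by (intro AE_I2) simp
      show "integrable M (\<lambda>_. 1 :: real)" by (rule integrable_const)
    qed
    moreover have "space M = UNIV" using sets_eq_imp_space_eq[OF M(1)] by simp
    ultimately show ?thesis by simp
  qed
  have cl: "emeasure M C = emeasure N C" if "closed C" for C
  proof (cases "C = {}")
    case False
    have "(\<integral>x. max 0 (1 - real n * infdist x C) \<partial>M) = (\<integral>x. max 0 (1 - real n * infdist x C) \<partial>N)" for n
      by (intro eq continuous_intros) (auto simp: infdist_nonneg)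
    then have "(\<lambda>n. \<integral>x. max 0 (1 - real n * infdist x C) \<partial>M) \<longlonglongrightarrow> measure N C"
      using *[OF that False N] by (simp only:)
    then have "measure M C = measure N C"
      by (rule LIMSEQ_unique[OF *[OF that False M]])
    then show ?thesis by (simp add: M.emeasure_eq_measure N.emeasure_eq_measure)
  qed simp
  show ?thesis
  proof (rule measure_eqI_generator_eq[where E="{C. closed C}" and A="\<lambda>_. UNIV" and \<Omega>=UNIV])
    show "sets M = sigma_sets UNIV {C. closed C}" "sets N = sigma_sets UNIV {C. closed C}"
      using M(1) N(1) by (simp_all add: borel_eq_closed)
  qed (auto simp: cl Int_stable_def)
qed

section \<open>Couplings and the quadratic Wasserstein distance\<close>

lemma transport_cost_distr:
  assumes [measurable]: "X \<in> borel_measurable \<Omega>" "Y \<in> borel_measurable \<Omega>"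
  shows "transport_cost (distr \<Omega> borel (\<lambda>\<omega>. (X \<omega>, Y \<omega>))) = (\<integral>\<^sup>+ \<omega>. ennreal ((dist (X \<omega>) (Y \<omega>))\<^sup>2) \<partial>\<Omega>)"
  unfolding transport_cost_def by (subst nn_integral_distr) auto

lemma coupling_distr:
  assumes [measurable]: "X \<in> borel_measurable \<Omega>" "Y \<in> borel_measurable \<Omega>"
  shows "distr \<Omega> borel (\<lambda>\<omega>. (X \<omega>, Y \<omega>)) \<in> couplings (distr \<Omega> borel X) (distr \<Omega> borel Y)"
  unfolding couplings_def by (simp add: distr_distr comp_def)

lemma W2_nonneg [simp]: "W2 \<mu> \<nu> \<ge> 0"
  by (simp add: W2_def)

lemma W2_le:
  assumes "\<gamma> \<in> couplings \<mu> \<nu>" "transport_cost \<gamma> \<le> ennreal (c\<^sup>2)" "c \<ge> 0"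
  shows "W2 \<mu> \<nu> \<le> c"
proof -
  have "(INF \<gamma>\<in>couplings \<mu> \<nu>. transport_cost \<gamma>) \<le> ennreal (c\<^sup>2)"
    using assms by (auto intro: INF_lower2)
  then have "enn2real (INF \<gamma>\<in>couplings \<mu> \<nu>. transport_cost \<gamma>) \<le> c\<^sup>2"
    by (simp add: enn2real_leI)
  then show ?thesis unfolding W2_def using assms(3) by (simp add: real_le_lsqrt)
qed

text \<open>Two random vectors on the same space are coupled by their joint law. Later the common
  space is that of the starting points, so that a uniform bound on trajectories bounds
  \<open>W2\<close>.\<close>

lemma W2_distr_le:
  assumes "prob_space \<Omega>" and [measurable]: "X \<in> borel_measurable \<Omega>" "Y \<in> borel_measurable \<Omega>"
    and "AE \<omega> in \<Omega>. dist (X \<omega>) (Y \<omega>) \<le> c" "c \<ge> 0"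
  shows "W2 (distr \<Omega> borel X) (distr \<Omega> borel Y) \<le> c"
proof (rule W2_le)
  interpret prob_space \<Omega> by fact
  show "distr \<Omega> borel (\<lambda>\<omega>. (X \<omega>, Y \<omega>)) \<in> couplings (distr \<Omega> borel X) (distr \<Omega> borel Y)"
    by (rule coupling_distr) measurable
  have "(\<integral>\<^sup>+ \<omega>. ennreal ((dist (X \<omega>) (Y \<omega>))\<^sup>2) \<partial>\<Omega>) \<le> (\<integral>\<^sup>+ \<omega>. ennreal (c\<^sup>2) \<partial>\<Omega>)"
    using assms(4) by (intro nn_integral_mono_AE) (auto elim!: eventually_mono intro!: ennreal_leI power_mono)
  then show "transport_cost (distr \<Omega> borel (\<lambda>\<omega>. (X \<omega>, Y \<omega>))) \<le> ennreal (c\<^sup>2)"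
    by (simp add: transport_cost_distr emeasure_space_1)
qed fact

lemma coupling_AE:
  assumes "\<gamma> \<in> couplings \<mu> \<nu>"
  shows "AE x in \<mu>. P x \<Longrightarrow> AE z in \<gamma>. P (fst z)" "AE x in \<nu>. P x \<Longrightarrow> AE z in \<gamma>. P (snd z)"
proof -
  have \<gamma>: "sets \<gamma> = sets borel" "distr \<gamma> borel fst = \<mu>" "distr \<gamma> borel snd = \<nu>"
    using assms by (auto simp: couplings_def)
  note [measurable_cong] = \<gamma>(1)
  show "AE z in \<gamma>. P (fst z)" if "AE x in \<mu>. P x"
    using that unfolding \<gamma>(2)[symmetric] by (rule AE_distrD[rotated]) measurable
  show "AE z in \<gamma>. P (snd z)" if "AE x in \<nu>. P x"
    using that unfolding \<gamma>(3)[symmetric] by (rule AE_distrD[rotated]) measurable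
qed

lemma coupling_prob:
  assumes "\<gamma> \<in> couplings \<mu> \<nu>" "prob_space \<mu>"
  shows "prob_space \<gamma>"
proof -
  have [measurable_cong]: "sets \<gamma> = sets borel" using assms by (auto simp: couplings_def)
  have "fst \<in> borel_measurable \<gamma>" by measurable
  moreover have "prob_space (distr \<gamma> borel fst)" using assms by (simp add: couplings_def)
  ultimately show ?thesis by (rule prob_space_distrD)
qed

text \<open>Direct method: a minimising sequence of couplings is realised by pointwise convergent
  variables, the marginals survive in the limit, and Fatou's lemma gives lower semicontinuity of the
  cost.\<close>

lemma optimal_coupling_exists:
  assumes \<mu>: "\<mu> \<in> Pc" and \<nu>: "\<nu> \<in> Pc"
  obtains \<gamma> where "optimal_coupling \<mu> \<nu> \<gamma>"
proof -
  interpret \<mu>: prob_space \<mu> using \<mu> by (rule Pc_prob)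
  interpret \<nu>: prob_space \<nu> using \<nu> by (rule Pc_prob)
  obtain R1 where R1: "AE x in \<mu>. norm x \<le> R1" using Pc_bounded[OF \<mu>] by blast
  obtain R2 where R2: "AE x in \<nu>. norm x \<le> R2" using Pc_bounded[OF \<nu>] by blast
  have s: "sets (\<mu> \<Otimes>\<^sub>M \<nu>) = sets borel"
    using Pc_sets[OF \<mu>] Pc_sets[OF \<nu>] by (simp add: borel_prod[symmetric] cong: sets_pair_measure_cong)
  have "\<mu> \<Otimes>\<^sub>M \<nu> \<in> couplings \<mu> \<nu>"
  proof -
    have distr_pair_snd: "distr (\<mu> \<Otimes>\<^sub>M \<nu>) \<nu> snd = \<nu>"
    proof (rule measure_eqI)
      fix A assume A: "A \<in> sets (distr (\<mu> \<Otimes>\<^sub>M \<nu>) \<nu> snd)"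
      then have "emeasure (distr (\<mu> \<Otimes>\<^sub>M \<nu>) \<nu> snd) A = emeasure (\<mu> \<Otimes>\<^sub>M \<nu>) (space \<mu> \<times> A)"
        by (auto simp: emeasure_distr space_pair_measure dest: sets.sets_into_space intro!: arg_cong2[where f=emeasure])
      with A show "emeasure (distr (\<mu> \<Otimes>\<^sub>M \<nu>) \<nu> snd) A = emeasure \<nu> A"
        by (simp add: \<nu>.emeasure_pair_measure_Times \<mu>.emeasure_space_1)
    qed simp
    have "distr (\<mu> \<Otimes>\<^sub>M \<nu>) borel fst = distr (\<mu> \<Otimes>\<^sub>M \<nu>) \<mu> fst" "distr (\<mu> \<Otimes>\<^sub>M \<nu>) borel snd = distr (\<mu> \<Otimes>\<^sub>M \<nu>) \<nu> snd"
      using Pc_sets[OF \<mu>] Pc_sets[OF \<nu>] by (auto intro: distr_cong)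
    then show ?thesis using s by (simp add: couplings_def \<nu>.distr_pair_fst distr_pair_snd)
  qed
  then have ne: "transport_cost ` couplings \<mu> \<nu> \<noteq> {}" by auto
  from ennreal_Inf_countable_INF[OF this]
  obtain f where f: "decseq f" "range f \<subseteq> transport_cost ` couplings \<mu> \<nu>" "(INF \<gamma>\<in>couplings \<mu> \<nu>. transport_cost \<gamma>) = (INF i. f i)"
    by auto
  have "\<forall>n. \<exists>\<gamma>. \<gamma> \<in> couplings \<mu> \<nu> \<and> transport_cost \<gamma> = f n" using f(2) by (metis image_iff rangeI subsetD)
  then obtain \<gamma> where \<gamma>: "\<And>n. \<gamma> n \<in> couplings \<mu> \<nu>" "\<And>n. transport_cost (\<gamma> n) = f n" by metis
  have lim: "f \<longlonglongrightarrow> (INF \<gamma>\<in>couplings \<mu> \<nu>. transport_cost \<gamma>)"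
    unfolding f(3) using f(1) by (rule LIMSEQ_INF)
  have "AE z in \<gamma> n. norm z \<le> R1 + R2" for n
    using coupling_AE(1)[OF \<gamma>(1)[of n] R1] coupling_AE(2)[OF \<gamma>(1)[of n] R2]
  proof eventually_elim
    case (elim z)
    then show ?case using norm_Pair_le[of "fst z" "snd z"] by simp
  qed
  note pk3 = this
  have pk1: "sets (\<gamma> n) = sets borel" and pk2: "prob_space (\<gamma> n)" for n
    using \<gamma>(1)[of n] coupling_prob[OF \<gamma>(1) \<mu>.prob_space_axioms] by (auto simp: couplings_def)
  obtain r and \<Omega> :: "real measure" and Y Y' where Y': "strict_mono r" "prob_space \<Omega>" "\<forall>n. Y n \<in> borel_measurable \<Omega>"
    "\<forall>n. distr \<Omega> borel (Y n) = \<gamma> (r n)" "Y' \<in> borel_measurable \<Omega>"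
    "\<forall>\<omega>\<in>space \<Omega>. (\<lambda>n. Y n \<omega>) \<longlonglongrightarrow> Y' \<omega>"
    using prokhorov_skorohod[of \<gamma>, OF pk1 pk2 pk3] by blast
  note Y = Y'(1,2) Y'(3)[rule_format] Y'(4)[rule_format] Y'(5) Y'(6)[rule_format]
  interpret \<Omega>: prob_space \<Omega> by fact
  note [measurable] = Y(3,5)
  \<comment> \<open>A marginal that is the same for all couplings of the sequence is inherited by
    the limit, because the integrals of continuous test functions are constant along the
    sequence.\<close>
  have marg: "distr \<Omega> borel (\<lambda>\<omega>. \<pi> (Y' \<omega>)) = \<kappa>"
    if \<pi>: "continuous_on UNIV \<pi>" and \<kappa>: "\<And>n. distr (\<gamma> n) borel \<pi> = \<kappa>" "sets \<kappa> = sets borel" "prob_space \<kappa>"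
    for \<pi> :: "(real^'a) \<times> (real^'a) \<Rightarrow> real^'a" and \<kappa>
  proof (rule measure_eq_continuous)
    have [measurable]: "\<pi> \<in> borel_measurable borel" using \<pi> by (rule borel_measurable_continuous_onI)
    show "sets \<kappa> = sets borel" "finite_measure \<kappa>" using \<kappa> by (auto simp: prob_space_def)
    have [measurable_cong]: "sets (\<gamma> n) = sets borel" for n by (rule pk1)
    have "\<pi> \<in> borel_measurable (\<gamma> n)" for n by measurable
    then have eq: "\<kappa> = distr \<Omega> borel (\<lambda>\<omega>. \<pi> (Y n \<omega>))" for n
      unfolding \<kappa>(1)[of "r n", symmetric] Y(4)[of n, symmetric] by (subst distr_distr) (auto simp: comp_def)
    show "finite_measure (distr \<Omega> borel (\<lambda>\<omega>. \<pi> (Y' \<omega>)))" by (intro \<Omega>.finite_measure_distr) measurable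
    fix f :: "real^'a \<Rightarrow> real" assume f: "continuous_on UNIV f" "\<And>x. 0 \<le> f x \<and> f x \<le> 1"
    have [measurable]: "f \<in> borel_measurable borel" using f(1) by (rule borel_measurable_continuous_onI)
    have "(\<lambda>n. \<integral>\<omega>. f (\<pi> (Y n \<omega>)) \<partial>\<Omega>) \<longlonglongrightarrow> (\<integral>\<omega>. f (\<pi> (Y' \<omega>)) \<partial>\<Omega>)"
    proof (rule integral_dominated_convergence[where w="\<lambda>_. 1"])
      show "AE x in \<Omega>. (\<lambda>n. f (\<pi> (Y n x))) \<longlonglongrightarrow> f (\<pi> (Y' x))"
        using \<pi> f(1) Y(6) by (intro AE_I2) (auto intro!: continuous_on_tendsto_compose[of UNIV f] continuous_on_tendsto_compose[of UNIV \<pi>])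
    qed (use f(2) in auto)
    moreover have "(\<integral>\<omega>. f (\<pi> (Y n \<omega>)) \<partial>\<Omega>) = (\<integral>x. f x \<partial>\<kappa>)" for n
      unfolding eq[of n] by (subst integral_distr) auto
    ultimately show "(\<integral>x. f x \<partial>distr \<Omega> borel (\<lambda>\<omega>. \<pi> (Y' \<omega>))) = (\<integral>x. f x \<partial>\<kappa>)"
      by (subst integral_distr) (auto dest: LIMSEQ_unique[OF _ tendsto_const])
  qed simp
  have cY': "distr \<Omega> borel Y' \<in> couplings \<mu> \<nu>"
    unfolding couplings_def using \<gamma>(1) Pc_sets[OF \<mu>] Pc_sets[OF \<nu>] \<mu>.prob_space_axioms \<nu>.prob_space_axioms
    by (auto simp: distr_distr comp_def couplings_def intro!: marg continuous_intros)
  have "transport_cost (distr \<Omega> borel Y') = (\<integral>\<^sup>+ \<omega>. ennreal ((dist (fst (Y' \<omega>)) (snd (Y' \<omega>)))\<^sup>2) \<partial>\<Omega>)"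
    unfolding transport_cost_def by (subst nn_integral_distr) auto
  also have "\<dots> = (\<integral>\<^sup>+ \<omega>. liminf (\<lambda>n. ennreal ((dist (fst (Y n \<omega>)) (snd (Y n \<omega>)))\<^sup>2)) \<partial>\<Omega>)"
    by (intro nn_integral_cong lim_imp_Liminf[symmetric] tendsto_intros Y(6)) auto
  also have "\<dots> \<le> liminf (\<lambda>n. \<integral>\<^sup>+ \<omega>. ennreal ((dist (fst (Y n \<omega>)) (snd (Y n \<omega>)))\<^sup>2) \<partial>\<Omega>)"
    by (intro nn_integral_liminf) measurable
  also have "(\<lambda>n. \<integral>\<^sup>+ \<omega>. ennreal ((dist (fst (Y n \<omega>)) (snd (Y n \<omega>)))\<^sup>2) \<partial>\<Omega>) = f \<circ> r"
  proof
    fix n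
    have "f (r n) = transport_cost (distr \<Omega> borel (Y n))" by (simp add: \<gamma> Y)
    also have "\<dots> = (\<integral>\<^sup>+ \<omega>. ennreal ((dist (fst (Y n \<omega>)) (snd (Y n \<omega>)))\<^sup>2) \<partial>\<Omega>)"
      unfolding transport_cost_def by (subst nn_integral_distr) auto
    finally show "(\<integral>\<^sup>+ \<omega>. ennreal ((dist (fst (Y n \<omega>)) (snd (Y n \<omega>)))\<^sup>2) \<partial>\<Omega>) = (f \<circ> r) n" by simp
  qed
  also have "liminf (f \<circ> r) = (INF \<gamma>\<in>couplings \<mu> \<nu>. transport_cost \<gamma>)"
    using LIMSEQ_subseq_LIMSEQ[OF lim Y(1)] by (intro lim_imp_Liminf) auto
  finally have "transport_cost (distr \<Omega> borel Y') = (INF \<gamma>\<in>couplings \<mu> \<nu>. transport_cost \<gamma>)"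
    using cY' by (intro antisym INF_lower)
  then show thesis using cY' by (intro that[of "distr \<Omega> borel Y'"]) (simp add: optimal_coupling_def)
qed

text \<open>Otherwise some subsequence stays at distance \<open>e\<close>. A further subsequence is
  realised by pointwise convergent variables, whose limit has law \<open>\<nu>\<close> by narrow
  convergence. The joint law of \<open>Y'\<close> and \<open>Y n\<close> couples
  \<open>\<nu>\<close> with the sequence, and by dominated convergence its cost tends to 0, a
  contradiction.\<close>

lemma narrow_imp_W2:
  fixes \<mu> :: "nat \<Rightarrow> (real^'n) measure"
  assumes \<mu>: "\<And>n. sets (\<mu> n) = sets borel" "\<And>n. prob_space (\<mu> n)" "\<And>n. AE x in \<mu> n. norm x \<le> R"
    and \<nu>: "sets \<nu> = sets borel" "prob_space \<nu>"
    and conv: "\<And>f :: real^'n \<Rightarrow> real. continuous_on UNIV f \<Longrightarrow> (\<lambda>n. \<integral>x. f x \<partial>\<mu> n) \<longlonglongrightarrow> (\<integral>x. f x \<partial>\<nu>)"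
  shows "(\<lambda>n. W2 \<nu> (\<mu> n)) \<longlonglongrightarrow> 0"
proof (rule ccontr)
  assume "\<not> ?thesis"
  then obtain e where e: "e > 0" "\<And>N. \<exists>n\<ge>N. W2 \<nu> (\<mu> n) \<ge> e"
    by (auto simp: LIMSEQ_iff not_less)
  then obtain s :: "nat \<Rightarrow> nat" where s: "strict_mono s" "\<And>n. W2 \<nu> (\<mu> (s n)) \<ge> e"
    using infinite_enumerate[of "{n. W2 \<nu> (\<mu> n) \<ge> e}"] by (auto simp: infinite_nat_iff_unbounded_le)
  obtain r and \<Omega> :: "real measure" and Y Y' where Y': "strict_mono r" "prob_space \<Omega>" "\<forall>n. Y n \<in> borel_measurable \<Omega>"
    "\<forall>n. distr \<Omega> borel (Y n) = \<mu> (s (r n))" "Y' \<in> borel_measurable \<Omega>"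
    "\<forall>\<omega>\<in>space \<Omega>. (\<lambda>n. Y n \<omega>) \<longlonglongrightarrow> Y' \<omega>"
    using prokhorov_skorohod[of "\<lambda>n. \<mu> (s n)", OF \<mu>] by blast
  note Y = Y'(1,2) Y'(3)[rule_format] Y'(4)[rule_format] Y'(5) Y'(6)[rule_format]
  interpret \<Omega>: prob_space \<Omega> by fact
  note [measurable] = Y(3,5)
  have sr: "strict_mono (s \<circ> r)" using s(1) Y(1) by (rule strict_mono_o)
  have \<nu>eq: "distr \<Omega> borel Y' = \<nu>"
  proof (rule measure_eq_continuous)
    show "finite_measure (distr \<Omega> borel Y')" by (intro \<Omega>.finite_measure_distr) measurable
    show "finite_measure \<nu>" using \<nu> by (simp add: prob_space_def)
    fix f :: "real^'n \<Rightarrow> real" assume f: "continuous_on UNIV f" "\<And>x. 0 \<le> f x \<and> f x \<le> 1"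
    have [measurable]: "f \<in> borel_measurable borel" using f(1) by (rule borel_measurable_continuous_onI)
    have "(\<lambda>n. \<integral>\<omega>. f (Y n \<omega>) \<partial>\<Omega>) \<longlonglongrightarrow> (\<integral>\<omega>. f (Y' \<omega>) \<partial>\<Omega>)"
    proof (rule integral_dominated_convergence[where w="\<lambda>_. 1"])
      show "AE x in \<Omega>. (\<lambda>n. f (Y n x)) \<longlonglongrightarrow> f (Y' x)"
        using f(1) Y(6) by (intro AE_I2) (auto intro!: continuous_on_tendsto_compose[of UNIV f])
    qed (use f(2) in auto)
    moreover have "(\<integral>\<omega>. f (Y n \<omega>) \<partial>\<Omega>) = (\<integral>x. f x \<partial>\<mu> (s (r n)))" for n
      unfolding Y(4)[of n, symmetric] by (subst integral_distr) auto
    moreover have "(\<lambda>n. \<integral>x. f x \<partial>\<mu> (s (r n))) \<longlonglongrightarrow> (\<integral>x. f x \<partial>\<nu>)"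
      using LIMSEQ_subseq_LIMSEQ[OF conv[OF f(1)] sr] by (simp add: comp_def)
    ultimately show "(\<integral>x. f x \<partial>distr \<Omega> borel Y') = (\<integral>x. f x \<partial>\<nu>)"
      by (subst integral_distr) (auto intro: LIMSEQ_unique)
  qed (use \<nu> in auto)
  have bY: "AE \<omega> in \<Omega>. \<forall>n. norm (Y n \<omega>) \<le> R"
    unfolding AE_all_countable
  proof
    fix n
    have "AE x in distr \<Omega> borel (Y n). norm x \<le> R" unfolding Y(4) by (rule \<mu>(3))
    then show "AE \<omega> in \<Omega>. norm (Y n \<omega>) \<le> R" by (subst (asm) AE_distr_iff) auto
  qed
  have bd: "AE \<omega> in \<Omega>. norm ((dist (Y' \<omega>) (Y n \<omega>))\<^sup>2) \<le> (2 * R)\<^sup>2" for n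
    using bY AE_space
  proof eventually_elim
    case (elim \<omega>)
    have "norm (Y' \<omega>) \<le> R"
      using elim tendsto_norm[OF Y(6)[OF elim(2)]] by (intro LIMSEQ_le_const2) auto
    then have "dist (Y' \<omega>) (Y n \<omega>) \<le> 2 * R"
      using spec[OF elim(1), of n] norm_triangle_ineq4[of "Y' \<omega>" "Y n \<omega>"] by (simp add: dist_norm)
    then show ?case using power_mono[of "dist (Y' \<omega>) (Y n \<omega>)" "2 * R" 2] by simp
  qed
  have "(\<lambda>n. \<integral>\<omega>. (dist (Y' \<omega>) (Y n \<omega>))\<^sup>2 \<partial>\<Omega>) \<longlonglongrightarrow> (\<integral>\<omega>. 0 \<partial>\<Omega>)"
  proof (rule integral_dominated_convergence[where w="\<lambda>_. (2 * R)\<^sup>2"])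
    have lim: "(\<lambda>n. dist (Y' \<omega>) (Y n \<omega>)) \<longlonglongrightarrow> 0" if "\<omega> \<in> space \<Omega>" for \<omega>
      using tendsto_dist[OF tendsto_const Y(6)[OF that], of "Y' \<omega>"] by simp
    show "AE \<omega> in \<Omega>. (\<lambda>n. (dist (Y' \<omega>) (Y n \<omega>))\<^sup>2) \<longlonglongrightarrow> 0"
      using tendsto_power[OF lim, of _ 2] by (intro AE_I2) simp
    show "AE \<omega> in \<Omega>. norm ((dist (Y' \<omega>) (Y n \<omega>))\<^sup>2) \<le> (2 * R)\<^sup>2" for n
      by (rule bd)
  qed auto
  then have "(\<lambda>n. \<integral>\<omega>. (dist (Y' \<omega>) (Y n \<omega>))\<^sup>2 \<partial>\<Omega>) \<longlonglongrightarrow> 0" by simp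
  then have "\<forall>\<^sub>F n in sequentially. (\<integral>\<omega>. (dist (Y' \<omega>) (Y n \<omega>))\<^sup>2 \<partial>\<Omega>) < (e/2)\<^sup>2"
    using \<open>e > 0\<close> by (intro order_tendstoD) auto
  then obtain n where n: "(\<integral>\<omega>. (dist (Y' \<omega>) (Y n \<omega>))\<^sup>2 \<partial>\<Omega>) < (e/2)\<^sup>2"
    using eventually_happens[of _ sequentially] by auto
  have "integrable \<Omega> (\<lambda>\<omega>. (dist (Y' \<omega>) (Y n \<omega>))\<^sup>2)"
    by (rule \<Omega>.integrable_const_bound[OF bd]) measurable
  then have "transport_cost (distr \<Omega> borel (\<lambda>\<omega>. (Y' \<omega>, Y n \<omega>))) \<le> ennreal ((e/2)\<^sup>2)"
    using n by (simp add: transport_cost_distr nn_integral_eq_integral ennreal_leI)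
  then have "W2 \<nu> (\<mu> (s (r n))) \<le> e/2"
    using coupling_distr[of Y' \<Omega> "Y n"] \<open>e > 0\<close> unfolding \<nu>eq Y(4) by (intro W2_le) auto
  then show False using s(2)[of "r n"] \<open>e > 0\<close> by simp
qed

subsection \<open>Smooth functions\<close>

text \<open>\<open>Ck\<close> speaks of \<open>frechet_derivative\<close>, a choice operator.
  Uniqueness of derivatives lets an explicit formula \<open>D\<close> stand for it.\<close>

lemma CkI:
  assumes "\<And>x. (f has_derivative D x) (at x)" "\<And>i. Ck k (\<lambda>x. D x (axis i 1))"
  shows "Ck (Suc k) f"
proof -
  have "frechet_derivative f (at x) = D x" for x
    using frechet_derivative_at[OF assms(1)] by simp
  then show ?thesis using assms by (auto simp: differentiable_def)
qed

lemma Ck_has_derivative: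
  "Ck (Suc k) f \<Longrightarrow> (f has_derivative frechet_derivative f (at x)) (at x)"
  by (simp add: frechet_derivative_works)

lemma Ck_partial: "Ck (Suc k) f \<Longrightarrow> Ck k (\<lambda>x. frechet_derivative f (at x) (axis i 1))"
  by simp

lemma Ck_Suc: "Ck (Suc k) f \<Longrightarrow> Ck k f"
proof (induction k arbitrary: f)
  case 0
  then show ?case
    by (auto intro!: differentiable_imp_continuous_on differentiable_at_imp_differentiable_on)
qed (auto simp del: Ck.simps(1))

lemma Ck_const: "Ck k (\<lambda>x. c)"
  by (induction k arbitrary: c) (auto intro!: CkI[where D="\<lambda>x h. 0"] simp del: Ck.simps(2))

lemma Ck_add: "Ck k f \<Longrightarrow> Ck k g \<Longrightarrow> Ck k (\<lambda>x. f x + g x)"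
proof (induction k arbitrary: f g)
  case (Suc k)
  show ?case
  proof (rule CkI)
    show "((\<lambda>x. f x + g x) has_derivative
        (\<lambda>h. frechet_derivative f (at x) h + frechet_derivative g (at x) h)) (at x)" for x
      by (intro derivative_intros Ck_has_derivative[OF Suc.prems(1)] Ck_has_derivative[OF Suc.prems(2)])
  qed (intro Suc.IH Ck_partial[OF Suc.prems(1)] Ck_partial[OF Suc.prems(2)])
qed (simp add: continuous_on_add)

lemma Ck_mult: "Ck k f \<Longrightarrow> Ck k g \<Longrightarrow> Ck k (\<lambda>x. f x * g x)"
proof (induction k arbitrary: f g)
  case (Suc k)
  show ?case
  proof (rule CkI)
    show "((\<lambda>x. f x * g x) has_derivative
        (\<lambda>h. f x * frechet_derivative g (at x) h + frechet_derivative f (at x) h * g x)) (at x)" for x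
      by (intro has_derivative_mult Ck_has_derivative[OF Suc.prems(1)] Ck_has_derivative[OF Suc.prems(2)])
  qed (intro Suc.IH Ck_add Ck_partial[OF Suc.prems(1)] Ck_partial[OF Suc.prems(2)]
      Ck_Suc[OF Suc.prems(1)] Ck_Suc[OF Suc.prems(2)])
qed (simp add: continuous_on_mult)

lemma Ck_inverse: "Ck k f \<Longrightarrow> (\<And>x. f x \<noteq> 0) \<Longrightarrow> Ck k (\<lambda>x. inverse (f x))"
proof (induction k arbitrary: f)
  case (Suc k)
  show ?case
  proof (rule CkI)
    show "((\<lambda>x. inverse (f x)) has_derivative
        (\<lambda>h. (- 1) * (inverse (f x) * frechet_derivative f (at x) h * inverse (f x)))) (at x)" for x
      using Deriv.has_derivative_inverse[OF Suc.prems(2) Ck_has_derivative[OF Suc.prems(1)]] by simp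
  qed (intro Ck_mult Ck_const Suc.IH Ck_partial[OF Suc.prems(1)] Ck_Suc[OF Suc.prems(1)] Suc.prems(2))
qed (simp add: continuous_on_inverse)

lemma Ck_linear: "bounded_linear f \<Longrightarrow> Ck k f"
  by (cases k) (auto intro!: CkI[where D="\<lambda>x. f"] Ck_const bounded_linear_imp_has_derivative
    linear_continuous_on simp del: Ck.simps(2))

lemma Ck_real_polynomial: "real_polynomial_function p \<Longrightarrow> Ck k p"
  by (induction p rule: real_polynomial_function.induct) (auto intro: Ck_linear Ck_const Ck_add Ck_mult)

section \<open>Flat functions, smooth steps and cutoffs\<close>

definition beta :: "nat \<Rightarrow> real \<Rightarrow> real" where
  "beta m s = (if s \<le> 0 then 0 else inverse s ^ m * exp (- inverse s))"

lemma beta_tendsto_0: "(beta m \<longlongrightarrow> 0) (at 0)"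
proof -
  have "((\<lambda>x. inverse x ^ m / exp (inverse x)) \<longlongrightarrow> (0::real)) (at_right 0)"
    by (rule filterlim_compose[OF tendsto_power_div_exp_0 filterlim_inverse_at_top_right])
  then have "(beta m \<longlongrightarrow> 0) (at_right 0)"
    by (rule Lim_transform_eventually)
      (auto simp: beta_def exp_minus field_simps eventually_at_filter)
  moreover have "(beta m \<longlongrightarrow> 0) (at_left 0)"
    by (rule tendsto_eventually) (auto simp: beta_def eventually_at_filter)
  ultimately show ?thesis by (simp add: filterlim_split_at)
qed

text \<open>Derivatives of the family stay in its linear span, so smoothness of all orders follows
  by induction over all \<open>m\<close> at once. At 0 the difference quotient is again a member,
  \<open>beta (Suc m)\<close>, which tends to 0.\<close>

lemma beta_deriv: "(beta m has_real_derivative beta (m + 2) s - real m * beta (Suc m) s) (at s)"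
proof (cases "s = 0")
  case True
  have "(beta (Suc m) \<longlongrightarrow> 0) (at 0)" by (rule beta_tendsto_0)
  then have "((\<lambda>h. (beta m (0 + h) - beta m 0) / h) \<longlongrightarrow> 0) (at 0)"
    by (rule Lim_transform_eventually) (auto simp: beta_def eventually_at_filter field_simps)
  then show ?thesis by (simp add: True DERIV_def beta_def)
next
  case False
  show ?thesis
  proof (cases "s < 0")
    case True
    have "((\<lambda>x. 0) has_real_derivative 0) (at s)" by simp
    then have "(beta m has_real_derivative 0) (at s)"
      by (rule has_field_derivative_transform_within_open[of _ _ _ "{..<0}"]) (use True in \<open>auto simp: beta_def\<close>)
    then show ?thesis using True by (simp add: beta_def)
  next
    case f: False
    with False have s: "s > 0" by simp
    have "((\<lambda>x. inverse x ^ m * exp (- inverse x)) has_real_derivative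
       real m * inverse s ^ (m - 1) * (- (inverse s ^ 2)) * exp (- inverse s) + inverse s ^ m * (exp (- inverse s) * inverse s ^ 2)) (at s)"
      using s by (auto intro!: derivative_eq_intros simp: power2_eq_square)
    moreover have "real m * inverse s ^ (m - 1) * (- (inverse s ^ 2)) * exp (- inverse s) + inverse s ^ m * (exp (- inverse s) * inverse s ^ 2)
       = beta (m + 2) s - real m * beta (Suc m) s"
      using s by (cases m) (auto simp: beta_def power2_eq_square power_add algebra_simps)
    ultimately have "((\<lambda>x. inverse x ^ m * exp (- inverse x)) has_real_derivative beta (m + 2) s - real m * beta (Suc m) s) (at s)"
      by simp
    then show ?thesis
      by (rule has_field_derivative_transform_within_open[of _ _ _ "{0<..}"]) (use s in \<open>auto simp: beta_def\<close>)
  qed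
qed

lemma Ck_beta: "(\<And>k. Ck k f) \<Longrightarrow> Ck k (\<lambda>x. beta m (f x))"
proof (induction k arbitrary: m)
  case 0
  have "continuous_on UNIV (beta m)"
    using DERIV_isCont[OF beta_deriv] by (simp add: continuous_on_eq_continuous_at)
  moreover have "continuous_on UNIV f" using 0[of 0] by simp
  ultimately show ?case by (auto intro: continuous_on_compose2)
next
  case (Suc k)
  show ?case
  proof (rule CkI)
    show "((\<lambda>x. beta m (f x)) has_derivative
        (\<lambda>h. frechet_derivative f (at x) h * (beta (m + 2) (f x) + (- real m) * beta (Suc m) (f x)))) (at x)" for x
      using has_derivative_compose[OF Ck_has_derivative[OF Suc.prems, of x]
        beta_deriv[of m "f x", unfolded has_field_derivative_def]] by (simp add: mult.commute)
  qed (intro Ck_mult Ck_add Ck_const Suc.IH Suc.prems Ck_partial[OF Suc.prems])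
qed

definition sstep :: "real \<Rightarrow> real" where
  "sstep s = beta 0 s * inverse (beta 0 s + beta 0 (1 - s))"

lemma sstep_denom: "beta 0 s + beta 0 (1 - s) > 0"
  by (auto simp: beta_def intro: add_pos_pos)

lemma beta_nonneg: "beta m s \<ge> 0"
  by (simp add: beta_def)

lemma Ck_sstep: "(\<And>k. Ck k f) \<Longrightarrow> Ck k (\<lambda>x. sstep (f x))"
  unfolding sstep_def diff_conv_add_uminus using sstep_denom Ck_mult[OF Ck_const[of _ "- 1"]]
  by (intro Ck_mult Ck_inverse Ck_add Ck_beta Ck_const)
    (auto simp: less_imp_neq[symmetric] simp del: Ck.simps)

lemma sstep_0: "s \<le> 0 \<Longrightarrow> sstep s = 0"
  and sstep_1: "s \<ge> 1 \<Longrightarrow> sstep s = 1"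
  by (auto simp: sstep_def beta_def)

lemma sstep_range: "0 \<le> sstep s" "sstep s \<le> 1"
  using sstep_denom[of s] beta_nonneg[of 0 s] beta_nonneg[of 0 "1 - s"]
  by (auto simp: sstep_def field_simps)

text \<open>The derivative of \<open>sstep\<close> by the quotient rule, after the two terms with
  \<open>beta 2 s * beta 0 s\<close> have cancelled. What is left is a sum of nonnegative terms, so
  monotonicity of the step is visible.\<close>

definition sstep' :: "real \<Rightarrow> real" where
  "sstep' s = (beta 2 s * beta 0 (1 - s) + beta 0 s * beta 2 (1 - s)) / (beta 0 s + beta 0 (1 - s))\<^sup>2"

lemma sstep_deriv: "(sstep has_real_derivative sstep' s) (at s)"
proof -
  have b: "(beta 0 has_real_derivative beta 2 s) (at s)" for s using beta_deriv[of 0 s] by (simp add: numeral_2_eq_2)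
  have b': "((\<lambda>x. beta 0 (1 - x)) has_real_derivative - beta 2 (1 - s)) (at s)"
  proof -
    have "((\<lambda>x. 1 - x) has_real_derivative - 1) (at s)" by (auto intro!: derivative_eq_intros)
    from DERIV_chain2[OF b this] show ?thesis by simp
  qed
  have "((\<lambda>s. beta 0 s / (beta 0 s + beta 0 (1 - s))) has_real_derivative sstep' s) (at s)"
    using sstep_denom[of s]
    by (auto intro!: derivative_eq_intros b b' simp: sstep'_def power2_eq_square field_simps)
  then show ?thesis unfolding sstep_def by (simp add: divide_inverse)
qed

lemma sstep'_nonneg: "sstep' s \<ge> 0"
  by (simp add: sstep'_def beta_nonneg)

lemma continuous_sstep': "continuous_on UNIV sstep'"
proof -
  have b: "continuous_on UNIV (beta m)" for m
    using DERIV_isCont[OF beta_deriv] by (simp add: continuous_on_eq_continuous_at)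
  have b': "continuous_on UNIV (\<lambda>s. beta m (1 - s))" for m
    by (rule continuous_on_compose2[OF b]) (auto intro: continuous_intros)
  show ?thesis unfolding sstep'_def
    using sstep_denom by (intro continuous_intros b b') (metis less_irrefl power_eq_0_iff)
qed

text \<open>\<open>R\<close> bounds the squared norm, which keeps the argument of the step
  polynomial: the value is 1 where \<open>x \<bullet> x \<le> R\<close> and 0 where
  \<open>x \<bullet> x \<ge> R + 1\<close>.\<close>

definition cutoff :: "real \<Rightarrow> real^'n \<Rightarrow> real" where
  "cutoff R x = sstep (R + 1 - x \<bullet> x)"

lemma Ck_cmult: "Ck k f \<Longrightarrow> Ck k (\<lambda>x. c * f x)"
  by (intro Ck_mult Ck_const)

lemma Ck_sum: "finite I \<Longrightarrow> (\<And>i. i \<in> I \<Longrightarrow> Ck k (f i)) \<Longrightarrow> Ck k (\<lambda>x. \<Sum>i\<in>I. f i x)"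
  by (induction I rule: finite_induct) (auto intro!: Ck_const Ck_add simp del: Ck.simps)

lemma Ck_inner_self: "Ck k (\<lambda>x :: real^'n. (x - a) \<bullet> (x - a))"
proof -
  have l: "Ck k (\<lambda>x :: real^'n. x $ i)" for i by (intro Ck_linear bounded_linear_vec_nth)
  have "Ck k (\<lambda>x :: real^'n. \<Sum>i\<in>UNIV. (x $ i + - (a $ i)) * (x $ i + - (a $ i)))"
    by (intro Ck_sum finite Ck_mult Ck_add Ck_const l)
  then show ?thesis by (simp add: inner_vec_def)
qed

lemma Ck_cutoff: "Ck k (cutoff R)"
proof -
  have "Ck k (\<lambda>x :: real^'n. R + 1 + (- 1) * ((x - 0) \<bullet> (x - 0)))" for k
    by (intro Ck_add Ck_const Ck_cmult Ck_inner_self)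
  from Ck_sstep[OF this] show ?thesis by (simp add: cutoff_def[abs_def])
qed

lemma test_fun_cutoff:
  assumes "\<And>k. Ck k f"
  shows "test_fun (\<lambda>x. cutoff R x * f x)"
  unfolding test_fun_def
proof (intro conjI allI exI[of _ "cball 0 (sqrt (\<bar>R\<bar> + 1))"] impI)
  fix x :: "real^'a" assume "x \<notin> cball 0 (sqrt (\<bar>R\<bar> + 1))"
  then have "\<bar>R\<bar> + 1 < (norm x)\<^sup>2" using real_le_rsqrt[of "norm x" "\<bar>R\<bar> + 1"] by (auto simp: not_le[symmetric])
  then show "cutoff R x * f x = 0" by (simp add: cutoff_def sstep_0 power2_norm_eq_inner)
qed (auto intro: Ck_mult Ck_cutoff assms)

lemma grad_eqI: "(f has_derivative (\<lambda>h. v \<bullet> h)) (at x) \<Longrightarrow> grad f x = v"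
  unfolding grad_def by (simp add: frechet_derivative_at[symmetric] vec_eq_iff inner_axis)

lemma Ck_has_grad:
  assumes "Ck (Suc k) f"
  shows "(f has_derivative (\<lambda>h. grad f x \<bullet> h)) (at x)"
proof -
  let ?D = "frechet_derivative f (at x)"
  have D: "(f has_derivative ?D) (at x)" using assms by (rule Ck_has_derivative)
  have "?D h = grad f x \<bullet> h" for h
  proof -
    have "?D h = ?D (\<Sum>i\<in>UNIV. h $ i *\<^sub>R axis i 1)" by (simp add: basis_expansion scalar_mult_eq_scaleR[symmetric])
    also have "\<dots> = (\<Sum>i\<in>UNIV. h $ i * ?D (axis i 1))"
      using has_derivative_linear[OF D] by (simp add: linear_sum linear_cmul)
    finally show ?thesis by (simp add: grad_def inner_vec_def mult.commute)
  qed
  then show ?thesis using D by (metis ext)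
qed

lemma continuous_grad: "Ck (Suc k) f \<Longrightarrow> continuous_on UNIV (grad f)"
  unfolding grad_def
proof (intro continuous_on_vec_lambda)
  fix i assume "Ck (Suc k) f"
  then have "Ck k (\<lambda>x. frechet_derivative f (at x) (axis i 1))" by simp
  then have "Ck 0 (\<lambda>x. frechet_derivative f (at x) (axis i 1))"
    by (induction k) (blast intro: Ck_Suc)+
  then show "continuous_on UNIV (\<lambda>x. frechet_derivative f (at x) (axis i 1))" by simp
qed

lemma cutoff_local:
  fixes x :: "real^'n"
  assumes f: "\<And>k. Ck k f" and x: "x \<bullet> x < R"
  shows "cutoff R x * f x = f x" "grad (\<lambda>x. cutoff R x * f x) x = grad f x"
proof -
  have c: "cutoff R y = 1" if "y \<bullet> y < R" for y :: "real^'n" using that by (simp add: cutoff_def sstep_1)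
  then show "cutoff R x * f x = f x" using x by simp
  have "(f has_derivative (\<lambda>h. grad f x \<bullet> h)) (at x)" by (rule Ck_has_grad[OF f])
  then have "((\<lambda>x. cutoff R x * f x) has_derivative (\<lambda>h. grad f x \<bullet> h)) (at x)"
    by (rule has_derivative_transform_within_open[of _ _ _ _ "{y. y \<bullet> y < R}"])
      (use x c in \<open>auto intro!: open_Collect_less continuous_intros\<close>)
  then show "grad (\<lambda>x. cutoff R x * f x) x = grad f x" by (rule grad_eqI)
qed

lemma grad_outside:
  assumes "compact K" "\<And>x. x \<notin> K \<Longrightarrow> f x = 0" "x \<notin> K"
  shows "grad f x = 0"
proof (rule grad_eqI)
  have "((\<lambda>x. 0) has_derivative (\<lambda>h. 0)) (at x)" by simp
  then have "(f has_derivative (\<lambda>h. 0)) (at x)"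
    by (rule has_derivative_transform_within_open[of _ _ _ _ "- K"])
      (use assms in \<open>auto intro: compact_imp_closed\<close>)
  then show "(f has_derivative (\<lambda>h. 0 \<bullet> h)) (at x)" by simp
qed

lemma grad_bounded:
  assumes "\<And>k. Ck k f" "compact K" "\<And>x. x \<notin> K \<Longrightarrow> f x = 0"
  obtains B where "B > 0" "\<And>x. norm (grad f x) \<le> B"
proof -
  have "compact (grad f ` K)"
    using continuous_grad[OF assms(1)] assms(2) by (intro compact_continuous_image) (auto intro: continuous_on_subset)
  then obtain B where "B > 0" "\<And>x. x \<in> K \<Longrightarrow> norm (grad f x) \<le> B"
    using compact_imp_bounded[of "grad f ` K"] by (auto simp: bounded_pos)
  then have "norm (grad f x) \<le> B" for x
    using grad_outside[OF assms(2,3)] \<open>B > 0\<close> by (cases "x \<in> K") auto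
  then show thesis using \<open>B > 0\<close> that by blast
qed

lemma test_fun_grad_bounded:
  assumes "test_fun \<phi>" obtains B where "B > 0" "\<And>x. norm (grad \<phi> x) \<le> B"
proof -
  obtain K where "compact K" "\<And>x. x \<notin> K \<Longrightarrow> \<phi> x = 0" "\<And>k. Ck k \<phi>" using assms by (auto simp: test_fun_def)
  then show thesis using grad_bounded[of \<phi> K] that by metis
qed

text \<open>The components of the gradient are again smooth with compact support, so their own
  gradients are bounded. Hence \<open>grad \<phi>\<close> is globally Lipschitz, with constant the
  sum over the components, and the linearisation error is quadratic everywhere.\<close>

lemma test_fun_taylor:
  assumes "test_fun \<phi>"
  obtains C where "C > 0" "\<And>x y. \<bar>\<phi> y - \<phi> x - grad \<phi> x \<bullet> (y - x)\<bar> \<le> C * (dist x y)\<^sup>2"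
proof -
  obtain K where K: "compact K" "\<And>x. x \<notin> K \<Longrightarrow> \<phi> x = 0" and \<phi>: "\<And>k. Ck k \<phi>" using assms by (auto simp: test_fun_def)
  have "\<exists>B>0. \<forall>x y. \<bar>grad \<phi> x $ i - grad \<phi> y $ i\<bar> \<le> B * norm (x - y)" for i
  proof -
    let ?g = "\<lambda>x. grad \<phi> x $ i"
    have g: "Ck k ?g" for k using \<phi>[of "Suc k"] by (simp add: grad_def)
    have "?g x = 0" if "x \<notin> K" for x using grad_outside[OF K that] by simp
    then obtain B where B: "B > 0" "\<And>x. norm (grad ?g x) \<le> B" using grad_bounded[OF g K(1)] by metis
    have "norm (?g x - ?g y) \<le> B * norm (x - y)" for x y
    proof (rule differentiable_bound[OF convex_UNIV])
      show "(?g has_derivative (\<lambda>h. grad ?g x \<bullet> h)) (at x within UNIV)" for x using Ck_has_grad[OF g] by simp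
      show "onorm (\<lambda>h. grad ?g x \<bullet> h) \<le> B" for x
        using B(1) order_trans[OF Cauchy_Schwarz_ineq2 mult_right_mono[OF B(2)]] by (intro onorm_bound) auto
    qed auto
    then show ?thesis using B(1) by auto
  qed
  then obtain B where B: "\<And>i. B i > 0" "\<And>i x y. \<bar>grad \<phi> x $ i - grad \<phi> y $ i\<bar> \<le> B i * norm (x - y)" by metis
  define C where "C = (\<Sum>i\<in>UNIV. B i)"
  have lip: "norm (grad \<phi> x - grad \<phi> y) \<le> C * norm (x - y)" for x y
  proof -
    have "norm (grad \<phi> x - grad \<phi> y) \<le> (\<Sum>i\<in>UNIV. \<bar>(grad \<phi> x - grad \<phi> y) $ i\<bar>)" by (rule norm_le_l1_cart)
    also have "\<dots> \<le> (\<Sum>i\<in>UNIV. B i * norm (x - y))" using B(2) by (intro sum_mono) simp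
    finally show ?thesis by (simp add: C_def sum_distrib_right)
  qed
  show thesis
  proof
    show "C > 0" unfolding C_def using B(1) by (intro sum_pos) auto
    fix x y
    have "norm (\<phi> y - \<phi> x - grad \<phi> x \<bullet> (y - x)) \<le> norm (y - x) * (C * norm (y - x))"
    proof (rule differentiable_bound_linearization[where S="closed_segment x y" and f'="\<lambda>z h. grad \<phi> z \<bullet> h"])
      show "(\<phi> has_derivative (\<lambda>h. grad \<phi> z \<bullet> h)) (at z within closed_segment x y)" for z
        using Ck_has_grad[OF \<phi>] by (rule has_derivative_at_withinI)
      show "x + t *\<^sub>R (y - x) \<in> closed_segment x y" if "t \<in> {0..1}" for t
        using that by (auto simp: closed_segment_def algebra_simps intro!: exI[of _ t])
      fix z assume z: "z \<in> closed_segment x y"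
      have "((\<lambda>h. grad \<phi> z \<bullet> h) - (\<lambda>h. grad \<phi> x \<bullet> h)) = (\<lambda>h. (grad \<phi> z - grad \<phi> x) \<bullet> h)"
        by (auto simp: inner_diff_left)
      moreover have "onorm (\<lambda>h. (grad \<phi> z - grad \<phi> x) \<bullet> h) \<le> norm (grad \<phi> z - grad \<phi> x)"
        by (intro onorm_bound norm_ge_zero) (simp add: Cauchy_Schwarz_ineq2)
      moreover have "norm (grad \<phi> z - grad \<phi> x) \<le> C * norm (y - x)"
        using lip[of z x] segment_bound(1)[OF z] \<open>C > 0\<close> by (meson mult_left_mono less_imp_le order_trans)
      ultimately show "onorm ((\<lambda>h. grad \<phi> z \<bullet> h) - (\<lambda>h. grad \<phi> x \<bullet> h)) \<le> C * norm (y - x)" by simp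
    qed simp
    then show "\<bar>\<phi> y - \<phi> x - grad \<phi> x \<bullet> (y - x)\<bar> \<le> C * (dist x y)\<^sup>2"
      by (simp add: dist_norm norm_minus_commute power2_eq_square ac_simps)
  qed
qed

lemma test_fun_bounded:
  assumes "test_fun \<phi>" obtains B where "\<And>x. \<bar>\<phi> x\<bar> \<le> B"
proof -
  obtain K where K: "compact K" "\<And>x. x \<notin> K \<Longrightarrow> \<phi> x = 0" and \<phi>: "Ck 0 \<phi>" using assms by (auto simp: test_fun_def simp del: Ck.simps)
  have "compact (\<phi> ` K)"
    using \<phi> K(1) by (intro compact_continuous_image) (auto intro: continuous_on_subset)
  then obtain B where "B > 0" "\<And>x. x \<in> K \<Longrightarrow> norm (\<phi> x) \<le> B"
    using compact_imp_bounded[of "\<phi> ` K"] by (auto simp: bounded_pos)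
  then show thesis using K(2) by (intro that[of B]) (metis less_imp_le norm_zero real_norm_def)
qed

subsection \<open>Wasserstein gradients and arbitrary couplings\<close>

text \<open>A tangent vector field is nearly a gradient, and for a gradient the linear term is
  \<open>\<integral>\<phi> d\<nu> - \<integral>\<phi> d\<mu>\<close> up to a quadratic error, whichever coupling is used.\<close>

lemma gradient_coupling:
  fixes \<gamma> :: "((real^'n) \<times> (real^'n)) measure"
  assumes \<mu>: "prob_space \<mu>" and \<gamma>: "\<gamma> \<in> couplings \<mu> \<nu>" and cost: "transport_cost \<gamma> \<le> ennreal (c\<^sup>2)" and c: "c > 0"
    and \<phi>: "test_fun \<phi>" and C: "\<And>x y. \<bar>\<phi> y - \<phi> x - grad \<phi> x \<bullet> (y - x)\<bar> \<le> C * (dist x y)\<^sup>2" "C > 0"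
    and \<xi>: "\<xi> \<in> borel_measurable borel" and e: "e > 0"
    and close: "(\<integral>\<^sup>+ x. ennreal ((norm (\<xi> x - grad \<phi> x))\<^sup>2) \<partial>\<mu>) \<le> ennreal (e\<^sup>2)"
  shows "\<bar>(\<integral>z. \<xi> (fst z) \<bullet> (snd z - fst z) \<partial>\<gamma>) - ((\<integral>x. \<phi> x \<partial>\<nu>) - (\<integral>x. \<phi> x \<partial>\<mu>))\<bar> \<le> e * c + C * c\<^sup>2"
proof -
  interpret \<gamma>: prob_space \<gamma> using \<gamma> \<mu> by (rule coupling_prob)
  have \<gamma>': "sets \<gamma> = sets borel" "distr \<gamma> borel fst = \<mu>" "distr \<gamma> borel snd = \<nu>"
    using \<gamma> by (auto simp: couplings_def)
  note [measurable_cong] = \<gamma>'(1)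
  note [measurable] = \<xi>
  have Ck\<phi>: "Ck k \<phi>" for k using \<phi> by (simp add: test_fun_def)
  have [measurable]: "\<phi> \<in> borel_measurable borel" "grad \<phi> \<in> borel_measurable borel"
    using Ck\<phi>[of 0] continuous_grad[OF Ck\<phi>] by (auto intro: borel_measurable_continuous_onI)
  obtain B where B: "B > 0" "\<And>x. norm (grad \<phi> x) \<le> B" using \<phi> by (rule test_fun_grad_bounded) blast
  obtain B' where B': "\<And>x. \<bar>\<phi> x\<bar> \<le> B'" using \<phi> by (rule test_fun_bounded) blast
  let ?a = "\<lambda>z. (norm (\<xi> (fst z) - grad \<phi> (fst z)))\<^sup>2" and ?b = "\<lambda>z. (norm (snd z - fst z))\<^sup>2"
  have "(\<integral>\<^sup>+ z. ennreal (?a z) \<partial>\<gamma>) = (\<integral>\<^sup>+ x. ennreal ((norm (\<xi> x - grad \<phi> x))\<^sup>2) \<partial>distr \<gamma> borel fst)"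
    by (subst nn_integral_distr) auto
  also have "\<dots> \<le> ennreal (e\<^sup>2)" using close by (simp add: \<gamma>'(2))
  finally have na: "(\<integral>\<^sup>+ z. ennreal (?a z) \<partial>\<gamma>) \<le> ennreal (e\<^sup>2)" .
  have nb: "(\<integral>\<^sup>+ z. ennreal (?b z) \<partial>\<gamma>) \<le> ennreal (c\<^sup>2)"
    using cost by (simp add: transport_cost_def dist_norm norm_minus_commute)
  have ia: "integrable \<gamma> ?a" and ib: "integrable \<gamma> ?b"
    using na nb by (auto intro!: integrableI_nonneg le_less_trans[OF na] le_less_trans[OF nb] simp del: ennreal_power)
  have la: "(\<integral>z. ?a z \<partial>\<gamma>) \<le> e\<^sup>2" and lb: "(\<integral>z. ?b z \<partial>\<gamma>) \<le> c\<^sup>2"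
    using na nb by (auto simp: nn_integral_eq_integral[OF ia] nn_integral_eq_integral[OF ib] simp del: ennreal_power)
  let ?d = "\<lambda>z. (\<xi> (fst z) - grad \<phi> (fst z)) \<bullet> (snd z - fst z)"
  let ?g = "\<lambda>z. grad \<phi> (fst z) \<bullet> (snd z - fst z)"
  \<comment> \<open>Young's inequality in place of the Cauchy-Schwarz inequality for integrals. The
    weights \<open>c / e\<close> and \<open>e / c\<close> are balanced so that the integral of
    \<open>?w\<close> is at most \<open>e * c\<close>; the pointwise bound also yields integrability
    of \<open>?d\<close>.\<close>
  let ?w = "\<lambda>z. (c / e * ?a z + e / c * ?b z) / 2"
  have d_le: "\<bar>?d z\<bar> \<le> ?w z" for z
  proof -
    let ?x = "norm (\<xi> (fst z) - grad \<phi> (fst z))" and ?y = "norm (snd z - fst z)"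
    have "0 \<le> (sqrt (c / e) * ?x - sqrt (e / c) * ?y)\<^sup>2" by simp
    also have "\<dots> = c / e * ?x\<^sup>2 + e / c * ?y\<^sup>2 - 2 * (sqrt (c / e) * sqrt (e / c)) * (?x * ?y)"
      using c e by (simp add: power2_diff power_mult_distrib)
    also have "sqrt (c / e) * sqrt (e / c) = 1" using c e by (simp add: real_sqrt_mult[symmetric])
    finally have "?x * ?y \<le> ?w z" by simp
    then show ?thesis using Cauchy_Schwarz_ineq2 order_trans by blast
  qed
  have iw: "integrable \<gamma> ?w" using ia ib by auto
  have id: "integrable \<gamma> ?d"
    by (rule Bochner_Integration.integrable_bound[OF iw]) (use d_le in \<open>auto intro!: AE_I2 intro: order_trans[OF _ abs_ge_self]\<close>)
  have ig: "integrable \<gamma> ?g"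
  proof (rule Bochner_Integration.integrable_bound[of _ "\<lambda>z. B * (1 + ?b z)"])
    have "\<bar>?g z\<bar> \<le> B * (1 + ?b z)" for z
    proof -
      have "norm (snd z - fst z) \<le> 1 + ?b z"
        using self_le_power[of "norm (snd z - fst z)" 2] by (cases "norm (snd z - fst z) \<ge> 1") (auto intro: order_trans add_increasing2)
      then have "norm (grad \<phi> (fst z)) * norm (snd z - fst z) \<le> B * (1 + ?b z)"
        using B by (intro mult_mono) auto
      then show ?thesis using Cauchy_Schwarz_ineq2 order_trans by blast
    qed
    then show "AE z in \<gamma>. norm (?g z) \<le> norm (B * (1 + ?b z))" by (intro AE_I2) (auto intro: order_trans[OF _ abs_ge_self])
  qed (use ib in auto)
  have if1: "integrable \<gamma> (\<lambda>z. \<phi> (fst z))" and if2: "integrable \<gamma> (\<lambda>z. \<phi> (snd z))"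
    using B' by (auto intro!: \<gamma>.integrable_const_bound[of _ B'])
  have "(\<integral>x. \<phi> x \<partial>\<nu>) = (\<integral>z. \<phi> (snd z) \<partial>\<gamma>)" "(\<integral>x. \<phi> x \<partial>\<mu>) = (\<integral>z. \<phi> (fst z) \<partial>\<gamma>)"
    unfolding \<gamma>'(2,3)[symmetric] by (auto simp: integral_distr)
  moreover have "(\<integral>z. \<xi> (fst z) \<bullet> (snd z - fst z) \<partial>\<gamma>) = (\<integral>z. ?d z \<partial>\<gamma>) + (\<integral>z. ?g z \<partial>\<gamma>)"
    unfolding Bochner_Integration.integral_add[OF id ig, symmetric] by (simp add: inner_diff_left)
  ultimately have "(\<integral>z. \<xi> (fst z) \<bullet> (snd z - fst z) \<partial>\<gamma>) - ((\<integral>x. \<phi> x \<partial>\<nu>) - (\<integral>x. \<phi> x \<partial>\<mu>))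
      = (\<integral>z. ?d z \<partial>\<gamma>) - (\<integral>z. \<phi> (snd z) - \<phi> (fst z) - ?g z \<partial>\<gamma>)"
    using ig if1 if2 by simp
  moreover have "\<bar>\<integral>z. ?d z \<partial>\<gamma>\<bar> \<le> e * c"
  proof -
    have "\<bar>\<integral>z. ?d z \<partial>\<gamma>\<bar> \<le> (\<integral>z. \<bar>?d z\<bar> \<partial>\<gamma>)" by (rule integral_abs_bound)
    also have "\<dots> \<le> (\<integral>z. ?w z \<partial>\<gamma>)"
      by (intro integral_mono integrable_abs id iw d_le)
    also have "\<dots> = (c / e * (\<integral>z. ?a z \<partial>\<gamma>) + e / c * (\<integral>z. ?b z \<partial>\<gamma>)) / 2" using ia ib by simp
    also have "\<dots> \<le> (c / e * e\<^sup>2 + e / c * c\<^sup>2) / 2"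
      using la lb c e by (intro divide_right_mono add_mono mult_left_mono) auto
    also have "\<dots> = e * c" using c e by (simp add: power2_eq_square)
    finally show ?thesis .
  qed
  moreover have "\<bar>\<integral>z. \<phi> (snd z) - \<phi> (fst z) - ?g z \<partial>\<gamma>\<bar> \<le> C * c\<^sup>2"
  proof -
    have "\<bar>\<integral>z. \<phi> (snd z) - \<phi> (fst z) - ?g z \<partial>\<gamma>\<bar> \<le> (\<integral>z. \<bar>\<phi> (snd z) - \<phi> (fst z) - ?g z\<bar> \<partial>\<gamma>)"
      by (rule integral_abs_bound)
    also have "\<dots> \<le> (\<integral>z. C * ?b z \<partial>\<gamma>)"
    proof (intro integral_mono integrable_abs)
      show "\<bar>\<phi> (snd z) - \<phi> (fst z) - ?g z\<bar> \<le> C * ?b z" for z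
        using C(1)[of "snd z" "fst z"] by (simp add: dist_norm norm_minus_commute)
    qed (use if1 if2 ig ib in auto)
    also have "\<dots> \<le> C * c\<^sup>2" using lb C(2) by simp
    finally show ?thesis .
  qed
  ultimately show ?thesis by linarith
qed

text \<open>By \<open>gradient_coupling\<close> the linear term is nearly the difference of two
  integrals of the same test function \<open>\<eta>\<close>, a quantity independent of the coupling.
  So the terms of the given and of an optimal coupling nearly agree. The target is taken in
  \<open>Pc\<close>, where an optimal coupling exists, as well as in the domain \<open>D\<close> of
  the functional.\<close>

lemma wgrad_coupling:
  assumes w: "wgrad D \<phi> \<mu> \<xi>" and \<mu>: "\<mu> \<in> Pc" and e: "e > 0"
  obtains \<delta> where "\<delta> > 0" "\<And>\<nu> \<gamma> c. \<nu> \<in> D \<Longrightarrow> \<nu> \<in> Pc \<Longrightarrow> \<gamma> \<in> couplings \<mu> \<nu> \<Longrightarrow> transport_cost \<gamma> \<le> ennreal (c\<^sup>2) \<Longrightarrow>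
    0 < c \<Longrightarrow> c < \<delta> \<Longrightarrow> \<bar>\<phi> \<nu> - \<phi> \<mu> - (\<integral>z. \<xi> (fst z) \<bullet> (snd z - fst z) \<partial>\<gamma>)\<bar> \<le> e * c"
proof -
  \<comment> \<open>Five errors add up: one \<open>e'\<close> from differentiability, one from each
    of the two couplings for approximating \<open>\<xi>\<close> by \<open>grad \<eta>\<close>, and
    twice the quadratic error, which the bound \<open>e' / (2 * C)\<close> on \<open>c\<close> keeps
    below \<open>e' / 2 * c\<close>.\<close>
  define e' where "e' = e / 4"
  have e': "e' > 0" using e by (simp add: e'_def)
  have T: "in_Tan \<mu> \<xi>" using w by (simp add: wgrad_def)
  then obtain \<eta> where \<eta>: "test_fun \<eta>" "(\<integral>\<^sup>+ x. ennreal ((norm (\<xi> x - grad \<eta> x))\<^sup>2) \<partial>\<mu>) < ennreal (e'\<^sup>2)"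
    unfolding in_Tan_def using e' by (meson zero_less_power)
  have \<xi>: "\<xi> \<in> borel_measurable borel" using T by (simp add: in_Tan_def)
  obtain C where C: "C > 0" "\<And>x y. \<bar>\<eta> y - \<eta> x - grad \<eta> x \<bullet> (y - x)\<bar> \<le> C * (dist x y)\<^sup>2"
    using \<eta>(1) by (rule test_fun_taylor) blast
  obtain \<delta>1 where \<delta>1: "\<delta>1 > 0" "\<And>\<nu> \<gamma>. \<nu> \<in> D \<Longrightarrow> W2 \<mu> \<nu> < \<delta>1 \<Longrightarrow> optimal_coupling \<mu> \<nu> \<gamma> \<Longrightarrow>
      \<bar>\<phi> \<nu> - \<phi> \<mu> - (\<integral>z. \<xi> (fst z) \<bullet> (snd z - fst z) \<partial>\<gamma>)\<bar> \<le> e' * W2 \<mu> \<nu>"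
    using w e' unfolding wgrad_def by blast
  show thesis
  proof (rule that[of "min \<delta>1 (e' / (2 * C))"])
    show "min \<delta>1 (e' / (2 * C)) > 0" using \<delta>1 e' C by simp
    fix \<nu> \<gamma> c
    assume \<nu>: "\<nu> \<in> D" "\<nu> \<in> Pc" and \<gamma>: "\<gamma> \<in> couplings \<mu> \<nu>" "transport_cost \<gamma> \<le> ennreal (c\<^sup>2)"
      and c: "0 < c" "c < min \<delta>1 (e' / (2 * C))"
    have W: "W2 \<mu> \<nu> \<le> c" using \<gamma> c by (intro W2_le) auto
    obtain \<gamma>' where opt: "optimal_coupling \<mu> \<nu> \<gamma>'" using \<mu> \<nu>(2) by (rule optimal_coupling_exists)
    then have \<gamma>': "\<gamma>' \<in> couplings \<mu> \<nu>" "transport_cost \<gamma>' \<le> ennreal (c\<^sup>2)"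
      using \<gamma> by (auto simp: optimal_coupling_def intro: INF_lower order_trans)
    note G = gradient_coupling[OF Pc_prob[OF \<mu>] _ _ c(1) \<eta>(1) C(2,1) \<xi> e' less_imp_le[OF \<eta>(2)]]
    have "\<bar>\<phi> \<nu> - \<phi> \<mu> - (\<integral>z. \<xi> (fst z) \<bullet> (snd z - fst z) \<partial>\<gamma>')\<bar> \<le> e' * W2 \<mu> \<nu>"
      using W c by (intro \<delta>1(2) \<nu> opt) auto
    moreover have "e' * W2 \<mu> \<nu> \<le> e' * c" using W e' by (intro mult_left_mono) auto
    moreover have "C * c\<^sup>2 \<le> e' / 2 * c"
    proof -
      have "C * c \<le> e' / 2" using c C(1) by (simp add: field_simps)
      then have "C * c * c \<le> e' / 2 * c" using c by (intro mult_right_mono) auto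
      then show ?thesis by (simp add: power2_eq_square mult.assoc)
    qed
    moreover have "e' * c + e' * c + e' * c + e' / 2 * c + e' / 2 * c = e * c" by (simp add: e'_def)
    ultimately show "\<bar>\<phi> \<nu> - \<phi> \<mu> - (\<integral>z. \<xi> (fst z) \<bullet> (snd z - fst z) \<partial>\<gamma>)\<bar> \<le> e * c"
      using G[OF \<gamma>] G[OF \<gamma>'] by linarith
  qed
qed

subsection \<open>Ordinary differential equations in Banach spaces\<close>

lemma continuous_on_pair_compose:
  assumes "continuous_on (S \<times> UNIV) (\<lambda>(t, x). g t x)" "continuous_on A f" "continuous_on A h" "\<And>a. a \<in> A \<Longrightarrow> f a \<in> S"
  shows "continuous_on A (\<lambda>a. g (f a) (h a))"
  using continuous_on_compose2[OF assms(1) continuous_on_Pair[OF assms(2,3)]] assms(4) by (auto simp: image_subset_iff)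

lemma exp_weight_integral:
  fixes t L :: real
  assumes "0 \<le> t" "L > 0"
  shows "((\<lambda>s. L * exp (2 * L * s)) has_integral (exp (2 * L * t) - 1) / 2) {0..t}"
proof -
  have "((\<lambda>s. L * exp (2 * L * s)) has_integral exp (2 * L * t) / 2 - exp (2 * L * 0) / 2) {0..t}"
    by (rule fundamental_theorem_of_calculus[OF assms(1)])
      (auto intro!: derivative_eq_intros simp: has_real_derivative_iff_has_vector_derivative[symmetric])
  then show ?thesis by (simp add: diff_divide_distrib)
qed

text \<open>The weight \<open>exp (2 * L * t)\<close> is chosen because \<open>L\<close> times its
  integral is at most half of it. This gives a contraction factor 1/2 on the whole time interval at
  once, for existence as well as for a priori bounds.\<close>

lemma weighted_integral_bound:
  fixes f :: "real \<Rightarrow> 'a::banach"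
  assumes t: "0 \<le> t" and L: "L > 0" and f: "f integrable_on {0..t}"
    and le: "\<And>s. s \<in> {0..t} \<Longrightarrow> norm (f s) \<le> L * exp (2 * L * s) * D" and D: "D \<ge> 0"
  shows "norm (integral {0..t} f) \<le> exp (2 * L * t) * D / 2"
proof -
  have "((\<lambda>s. L * exp (2 * L * s) * D) has_integral (exp (2 * L * t) - 1) / 2 * D) {0..t}"
    using exp_weight_integral[OF t L] by (rule has_integral_mult_left)
  then have "norm (integral {0..t} f) \<le> (exp (2 * L * t) - 1) / 2 * D"
    using integral_norm_bound_integral[OF f _ le] by (metis has_integral_integrable integral_unique)
  also have "\<dots> \<le> exp (2 * L * t) * D / 2" using D by (simp add: field_simps)
  finally show ?thesis .
qed

text \<open>The unknown of the fixed point problem is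
  \<open>exp (- (2 * L * t)) *\<^sub>R w t\<close>, which turns the exponentially weighted norm into
  the ordinary sup norm of bounded continuous functions. Banach's theorem then applies with factor
  1/2.\<close>

theorem picard:
  fixes B :: "real \<Rightarrow> 'a::banach \<Rightarrow> 'a"
  assumes T: "T \<ge> 0" and L: "L > 0"
    and cont: "\<And>w. continuous_on {0..T} w \<Longrightarrow> continuous_on {0..T} (\<lambda>s. B s (w s))"
    and lip: "\<And>s v w. s \<in> {0..T} \<Longrightarrow> norm (B s v - B s w) \<le> L * norm (v - w)"
  obtains w where "continuous_on {0..T} w" "\<And>t. t \<in> {0..T} \<Longrightarrow> w t = w0 + integral {0..t} (\<lambda>s. B s (w s))"
proof -
  \<comment> \<open>Clamping time to \<open>[0, T]\<close> makes every curve on the interval a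
    bounded continuous function on the whole line.\<close>
  define c where "c t = max 0 (min T t)" for t
  have c: "c t \<in> {0..T}" "t \<in> {0..T} \<Longrightarrow> c t = t" for t using T by (auto simp: c_def)
  have cc: "continuous_on UNIV c" unfolding c_def by (intro continuous_intros)
  define I where "I v t = w0 + integral {0..t} (\<lambda>s. B s (exp (2 * L * s) *\<^sub>R apply_bcontfun v s))" for v :: "real \<Rightarrow>\<^sub>C 'a" and t
  have B: "continuous_on {0..T} (\<lambda>s. B s (exp (2 * L * s) *\<^sub>R apply_bcontfun v s))" for v
    by (intro cont continuous_intros continuous_on_apply_bcontfun)
  have cI: "continuous_on {0..T} (I v)" for v
    unfolding I_def using B[of v] by (intro continuous_intros indefinite_integral_continuous_1 integrable_continuous_real)
  define A where "A v t = exp (- (2 * L * c t)) *\<^sub>R I v (c t)" for v t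
  have A: "A v \<in> bcontfun" for v
  proof -
    have 1: "continuous_on {0..T} (\<lambda>t. exp (- (2 * L * t)) *\<^sub>R I v t)" by (intro continuous_intros cI)
    then have "compact ((\<lambda>t. exp (- (2 * L * t)) *\<^sub>R I v t) ` {0..T})" by (rule compact_continuous_image) simp
    then obtain b where "\<And>t. t \<in> {0..T} \<Longrightarrow> norm (exp (- (2 * L * t)) *\<^sub>R I v t) \<le> b"
      using compact_imp_bounded by (fastforce simp: bounded_iff)
    then have "norm (A v t) \<le> b" for t using c by (simp add: A_def)
    moreover have "continuous_on UNIV (A v)"
      unfolding A_def using c cc by (intro continuous_on_compose2[OF 1 cc]) auto
    ultimately show ?thesis by (intro bcontfun_normI)
  qed
  have "dist (Bcontfun (A v)) (Bcontfun (A w)) \<le> 1/2 * dist v w" for v w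
  proof (rule dist_bound)
    fix t
    let ?t = "c t"
    have t: "?t \<in> {0..T}" by (rule c)
    have i: "(\<lambda>s. B s (exp (2 * L * s) *\<^sub>R apply_bcontfun u s)) integrable_on {0..?t}" for u
      using t by (intro integrable_continuous_real continuous_on_subset[OF B]) auto
    have "I v ?t - I w ?t = integral {0..?t} (\<lambda>s. B s (exp (2 * L * s) *\<^sub>R apply_bcontfun v s) - B s (exp (2 * L * s) *\<^sub>R apply_bcontfun w s))"
      unfolding I_def by (simp add: integral_diff[OF i i])
    also have "norm \<dots> \<le> exp (2 * L * ?t) * dist v w / 2"
    proof (rule weighted_integral_bound)
      fix s assume s: "s \<in> {0..?t}"
      have "norm (B s (exp (2 * L * s) *\<^sub>R apply_bcontfun v s) - B s (exp (2 * L * s) *\<^sub>R apply_bcontfun w s))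
        \<le> L * norm (exp (2 * L * s) *\<^sub>R apply_bcontfun v s - exp (2 * L * s) *\<^sub>R apply_bcontfun w s)"
        using s t by (intro lip) auto
      also have "\<dots> = L * exp (2 * L * s) * dist (apply_bcontfun v s) (apply_bcontfun w s)"
        by (simp add: scaleR_diff_right[symmetric] dist_norm)
      also have "\<dots> \<le> L * exp (2 * L * s) * dist v w" using L by (intro mult_left_mono dist_bounded) auto
      finally show "norm (B s (exp (2 * L * s) *\<^sub>R apply_bcontfun v s) - B s (exp (2 * L * s) *\<^sub>R apply_bcontfun w s))
        \<le> L * exp (2 * L * s) * dist v w" .
    qed (use t L i in \<open>auto intro: integrable_diff\<close>)
    finally have "exp (- (2 * L * ?t)) * norm (I v ?t - I w ?t) \<le> exp (- (2 * L * ?t)) * (exp (2 * L * ?t) * dist v w / 2)"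
      by (intro mult_left_mono) auto
    also have "\<dots> = 1/2 * dist v w" by (simp add: exp_minus field_simps)
    finally show "dist (apply_bcontfun (Bcontfun (A v)) t) (apply_bcontfun (Bcontfun (A w)) t) \<le> 1/2 * dist v w"
      by (simp add: Bcontfun_inverse[OF A] A_def dist_norm scaleR_diff_right[symmetric])
  qed
  then have "\<exists>!v. Bcontfun (A v) = v" by (intro banach_fix_type[of "1/2"]) auto
  then obtain v where v: "Bcontfun (A v) = v" by blast
  define w where "w t = exp (2 * L * t) *\<^sub>R apply_bcontfun v t" for t
  show thesis
  proof
    show "continuous_on {0..T} w" unfolding w_def by (intro continuous_intros continuous_on_apply_bcontfun)
    fix t assume t: "t \<in> {0..T}"
    have "apply_bcontfun v t = A v t" using Bcontfun_inverse[OF A, of v] v by simp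
    then have "w t = I v t" using c(2)[OF t] by (simp add: w_def A_def exp_minus)
    then show "w t = w0 + integral {0..t} (\<lambda>s. B s (w s))" by (simp add: I_def w_def)
  qed
qed

text \<open>At the time \<open>s\<close> where \<open>exp (- (2 * L * t)) * f t\<close> is maximal,
  the integral is at most \<open>f s / 2\<close>, so that \<open>f s \<le> 2 * a\<close>. This
  explains the factor 2 in the bound.\<close>

lemma gronwall:
  fixes f :: "real \<Rightarrow> real"
  assumes T: "T \<ge> 0" and L: "L > 0" and f: "continuous_on {0..T} f" "\<And>t. t \<in> {0..T} \<Longrightarrow> 0 \<le> f t"
    and le: "\<And>t. t \<in> {0..T} \<Longrightarrow> f t \<le> a + integral {0..t} (\<lambda>s. L * f s)"
    and t: "t \<in> {0..T}"
  shows "f t \<le> 2 * a * exp (2 * L * t)"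
proof -
  obtain s where s: "s \<in> {0..T}" "\<And>t. t \<in> {0..T} \<Longrightarrow> exp (- (2 * L * t)) * f t \<le> exp (- (2 * L * s)) * f s"
  proof -
    have "continuous_on {0..T} (\<lambda>t. exp (- (2 * L * t)) * f t)" by (intro continuous_intros f)
    moreover have "{0..T} \<noteq> {}" using T by simp
    ultimately have "\<exists>s\<in>{0..T}. \<forall>t\<in>{0..T}. exp (- (2 * L * t)) * f t \<le> exp (- (2 * L * s)) * f s"
      by (intro continuous_attains_sup compact_Icc)
    then show thesis using that by blast
  qed
  define N where "N = exp (- (2 * L * s)) * f s"
  have N: "N \<ge> 0" using f(2)[OF s(1)] by (simp add: N_def)
  have fle: "f t \<le> exp (2 * L * t) * N" if "t \<in> {0..T}" for t
    using s(2)[OF that] unfolding N_def[symmetric] by (simp add: exp_minus field_simps)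
  have "f s \<le> a + integral {0..s} (\<lambda>s. L * f s)" using le s(1) .
  also have "integral {0..s} (\<lambda>s. L * f s) \<le> norm (integral {0..s} (\<lambda>s. L * f s))" by simp
  also have "\<dots> \<le> exp (2 * L * s) * N / 2"
  proof (rule weighted_integral_bound)
    show "(\<lambda>s. L * f s) integrable_on {0..s}"
      using s(1) f(1) by (intro integrable_continuous_real continuous_intros continuous_on_subset[OF f(1)]) auto
    show "norm (L * f t) \<le> L * exp (2 * L * t) * N" if "t \<in> {0..s}" for t
      using fle[of t] f(2)[of t] that s(1) L by (auto simp: mult.assoc)
  qed (use s(1) L N in auto)
  also have "exp (2 * L * s) * N = f s" by (simp add: N_def exp_minus field_simps)
  finally have "f s \<le> 2 * a" by simp
  moreover have "N \<le> f s" unfolding N_def using L s(1) f(2)[OF s(1)] by (intro mult_left_le_one_le) auto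
  ultimately have "N \<le> 2 * a" by simp
  then have "exp (2 * L * t) * N \<le> exp (2 * L * t) * (2 * a)" by (intro mult_left_mono) auto
  with fle[OF t] have "f t \<le> exp (2 * L * t) * (2 * a)" by (rule order_trans)
  then show ?thesis by (simp only: mult.commute)
qed

section \<open>Flows of Lipschitz vector fields\<close>

definition flow_of :: "(real \<Rightarrow> real^'d \<Rightarrow> real^'d) \<Rightarrow> real \<Rightarrow> (real \<Rightarrow> real^'d \<Rightarrow> real^'d) \<Rightarrow> bool" where
  "flow_of b T \<Phi> \<longleftrightarrow> (\<forall>x. continuous_on {0..T} (\<lambda>t. \<Phi> t x) \<and>
     (\<forall>t\<in>{0..T}. \<Phi> t x = x + integral {0..t} (\<lambda>s. b s (\<Phi> s x))))"

locale lipschitz_field =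
  fixes b :: "real \<Rightarrow> real^'d \<Rightarrow> real^'d" and T L :: real
  assumes T: "T > 0" and L: "L > 0"
    and b_cont: "continuous_on ({0..T} \<times> UNIV) (\<lambda>(t, x). b t x)"
    and b_lip: "\<And>t x y. t \<in> {0..T} \<Longrightarrow> norm (b t x - b t y) \<le> L * norm (x - y)"
begin

lemma b_cont_comp:
  assumes "continuous_on S f" "continuous_on S g" "\<And>s. s \<in> S \<Longrightarrow> f s \<in> {0..T}"
  shows "continuous_on S (\<lambda>s. b (f s) (g s))"
  using b_cont assms by (rule continuous_on_pair_compose)

lemma flow_exists: obtains \<Phi> where "flow_of b T \<Phi>"
proof -
  have "\<exists>w. continuous_on {0..T} w \<and> (\<forall>t\<in>{0..T}. w t = x + integral {0..t} (\<lambda>s. b s (w s)))" for x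
  proof (rule picard[of T L b x])
    show "continuous_on {0..T} (\<lambda>s. b s (w s))" if "continuous_on {0..T} w" for w
      using that by (intro b_cont_comp continuous_intros) auto
  qed (use T L b_lip in auto)
  then obtain w where w: "\<And>x. continuous_on {0..T} (w x) \<and> (\<forall>t\<in>{0..T}. w x t = x + integral {0..t} (\<lambda>s. b s (w x s)))"
    by metis
  show thesis by (rule that[of "\<lambda>t x. w x t"]) (use w in \<open>auto simp: flow_of_def\<close>)
qed

context
  fixes \<Phi> assumes \<Phi>: "flow_of b T \<Phi>"
begin

lemma flow_0: "\<Phi> 0 x = x"
proof -
  have "0 \<in> {0..T}" using T by simp
  then have "\<Phi> 0 x = x + integral {0..0} (\<lambda>s. b s (\<Phi> s x))" using \<Phi> unfolding flow_of_def by blast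
  then show ?thesis by simp
qed

lemma flow_lip: assumes "t \<in> {0..T}" shows "norm (\<Phi> t x - \<Phi> t y) \<le> 2 * norm (x - y) * exp (2 * L * t)"
proof (rule gronwall[of T L "\<lambda>t. norm (\<Phi> t x - \<Phi> t y)"])
  have c: "continuous_on {0..T} (\<lambda>t. \<Phi> t x)" for x using \<Phi> by (simp add: flow_of_def)
  show "continuous_on {0..T} (\<lambda>t. norm (\<Phi> t x - \<Phi> t y))" by (intro continuous_intros c)
  fix t assume t: "t \<in> {0..T}"
  have cb: "continuous_on {0..t} (\<lambda>s. b s (\<Phi> s x))" for x
    using t by (intro b_cont_comp continuous_intros continuous_on_subset[OF c]) auto
  have "\<Phi> t x - \<Phi> t y = (x - y) + integral {0..t} (\<lambda>s. b s (\<Phi> s x) - b s (\<Phi> s y))"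
    using \<Phi> t by (simp add: flow_of_def integral_diff integrable_continuous_real cb)
  also have "norm \<dots> \<le> norm (x - y) + norm (integral {0..t} (\<lambda>s. b s (\<Phi> s x) - b s (\<Phi> s y)))"
    by (rule norm_triangle_ineq)
  also have "norm (integral {0..t} (\<lambda>s. b s (\<Phi> s x) - b s (\<Phi> s y))) \<le> integral {0..t} (\<lambda>s. L * norm (\<Phi> s x - \<Phi> s y))"
    using t by (intro integral_norm_bound_integral integrable_continuous_real continuous_intros cb
      continuous_on_subset[OF c] b_lip) auto
  finally show "norm (\<Phi> t x - \<Phi> t y) \<le> norm (x - y) + integral {0..t} (\<lambda>s. L * norm (\<Phi> s x - \<Phi> s y))" by simp
qed (use T L assms in auto)

text \<open>Joint continuity follows from continuity in time at one fixed point together with a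
  Lipschitz constant in space, \<open>K\<close>, that serves all times.\<close>

lemma flow_cont: "continuous_on ({0..T} \<times> UNIV) (\<lambda>(t, x). \<Phi> t x)"
  unfolding continuous_on_iff
proof (intro ballI allI impI)
  fix p :: "real \<times> (real^'d)" and e :: real assume p: "p \<in> {0..T} \<times> UNIV" and e: "e > 0"
  obtain t x where tx: "p = (t, x)" "t \<in> {0..T}" using p by auto
  define K where "K = 2 * exp (2 * L * T)"
  have K: "K > 0" by (simp add: K_def)
  have "continuous_on {0..T} (\<lambda>t. \<Phi> t x)" using \<Phi> by (simp add: flow_of_def)
  then obtain d where d: "d > 0" "\<And>s. s \<in> {0..T} \<Longrightarrow> dist s t < d \<Longrightarrow> dist (\<Phi> s x) (\<Phi> t x) < e / 2"
    unfolding continuous_on_iff using tx(2) e by (metis half_gt_zero)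
  show "\<exists>d>0. \<forall>q\<in>{0..T} \<times> UNIV. dist q p < d \<longrightarrow> dist (case q of (t, x) \<Rightarrow> \<Phi> t x) (case p of (t, x) \<Rightarrow> \<Phi> t x) < e"
  proof (intro exI[of _ "min d (e / (2 * K))"] conjI ballI impI)
    fix q :: "real \<times> (real^'d)" assume q: "q \<in> {0..T} \<times> UNIV" "dist q p < min d (e / (2 * K))"
    obtain s y where sy: "q = (s, y)" "s \<in> {0..T}" using q by auto
    have "dist s t < d" using q(2) dist_fst_le[of q p] by (simp add: tx sy)
    moreover have "dist y x < e / (2 * K)" using q(2) dist_snd_le[of q p] by (simp add: tx sy)
    moreover have "norm (\<Phi> s y - \<Phi> s x) \<le> K * norm (y - x)"
    proof -
      have "exp (2 * L * s) \<le> exp (2 * L * T)" using sy(2) L by simp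
      then have "2 * norm (y - x) * exp (2 * L * s) \<le> 2 * norm (y - x) * exp (2 * L * T)" by (intro mult_left_mono) auto
      then show ?thesis using flow_lip[OF sy(2), of y x] by (simp add: K_def mult_ac)
    qed
    ultimately have "dist (\<Phi> s x) (\<Phi> t x) < e / 2" "norm (\<Phi> s y - \<Phi> s x) < e / 2"
      using d(2)[OF sy(2)] K by (auto simp: dist_norm field_simps)
    then show "dist (case q of (t, x) \<Rightarrow> \<Phi> t x) (case p of (t, x) \<Rightarrow> \<Phi> t x) < e"
      using dist_triangle[of "\<Phi> s y" "\<Phi> t x" "\<Phi> s x"] by (simp add: sy tx dist_norm)
  qed (use d e K in auto)
qed

lemma flow_cont_x: assumes "t \<in> {0..T}" shows "continuous_on UNIV (\<Phi> t)"
  by (rule continuous_on_pair_compose[OF flow_cont continuous_on_const continuous_on_id]) (rule assms)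

lemma flow_deriv:
  assumes "t \<in> {0..T}"
  shows "((\<lambda>t. \<Phi> t x) has_vector_derivative b t (\<Phi> t x)) (at t within {0..T})"
proof -
  have c: "continuous_on {0..T} (\<lambda>t. \<Phi> t x)" using \<Phi> by (simp add: flow_of_def)
  have "continuous_on {0..T} (\<lambda>s. b s (\<Phi> s x))" by (intro b_cont_comp continuous_intros c) auto
  from integral_has_vector_derivative[OF this assms]
  have "((\<lambda>t. x + integral {0..t} (\<lambda>s. b s (\<Phi> s x))) has_vector_derivative 0 + b t (\<Phi> t x)) (at t within {0..T})"
    by (intro has_vector_derivative_add has_vector_derivative_const)
  then have "((\<lambda>t. x + integral {0..t} (\<lambda>s. b s (\<Phi> s x))) has_vector_derivative b t (\<Phi> t x)) (at t within {0..T})"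
    by simp
  then show ?thesis
    by (rule has_vector_derivative_transform[OF assms, rotated]) (use \<Phi> in \<open>simp add: flow_of_def\<close>)
qed

end

end

subsection \<open>Narrowly continuous paths of measures\<close>

lemma integrable_continuous_Pc:
  fixes f :: "real^'n \<Rightarrow> 'b::{banach, second_countable_topology}"
  assumes "\<nu> \<in> Pc" "continuous_on UNIV f"
  shows "integrable \<nu> f"
proof -
  interpret prob_space \<nu> using assms(1) by (rule Pc_prob)
  have "compact (f ` supp \<nu>)"
    using assms Pc_compact by (intro compact_continuous_image) (auto intro: continuous_on_subset)
  then obtain B where B: "\<And>x. x \<in> supp \<nu> \<Longrightarrow> norm (f x) \<le> B"
    using compact_imp_bounded by (fastforce simp: bounded_iff)
  have "f \<in> borel_measurable \<nu>"
    using borel_measurable_continuous_onI[OF assms(2)] by (simp only: measurable_cong_sets[OF Pc_sets[OF assms(1)] refl])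
  moreover have "AE x in \<nu>. norm (f x) \<le> B"
    using AE_supp[OF assms(1)] by eventually_elim (rule B)
  ultimately show ?thesis by (intro integrable_const_bound)
qed

lemma integral_diff_le_Pc:
  fixes f g :: "real^'n \<Rightarrow> real"
  assumes "\<nu> \<in> Pc" "continuous_on UNIV f" "continuous_on UNIV g" "\<And>x. x \<in> supp \<nu> \<Longrightarrow> \<bar>f x - g x\<bar> \<le> e"
  shows "\<bar>(\<integral>x. f x \<partial>\<nu>) - (\<integral>x. g x \<partial>\<nu>)\<bar> \<le> e"
proof -
  interpret prob_space \<nu> using assms(1) by (rule Pc_prob)
  have i: "integrable \<nu> f" "integrable \<nu> g" using assms by (auto intro: integrable_continuous_Pc)
  have "\<bar>(\<integral>x. f x \<partial>\<nu>) - (\<integral>x. g x \<partial>\<nu>)\<bar> = \<bar>\<integral>x. f x - g x \<partial>\<nu>\<bar>" using i by simp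
  also have "\<dots> \<le> (\<integral>x. \<bar>f x - g x\<bar> \<partial>\<nu>)" by (rule integral_abs_bound)
  also have "\<dots> \<le> (\<integral>x. e \<partial>\<nu>)"
    using i AE_supp[OF assms(1)] assms(4) by (intro integral_mono_AE integrable_abs) (auto elim: eventually_mono)
  finally show ?thesis by (simp add: prob_space)
qed

locale narrow_path =
  fixes \<mu> :: "real \<Rightarrow> (real^'n) measure" and T R :: real
  assumes Pc: "\<And>t. t \<in> {0..T} \<Longrightarrow> \<mu> t \<in> Pc"
    and bdd: "\<And>t. t \<in> {0..T} \<Longrightarrow> supp (\<mu> t) \<subseteq> cball 0 R"
    and narrow: "\<And>f :: real^'n \<Rightarrow> real. continuous_on UNIV f \<Longrightarrow> continuous_on {0..T} (\<lambda>t. \<integral>x. f x \<partial>\<mu> t)"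
begin

text \<open>Uniform continuity of \<open>g\<close> on the compact set
  \<open>{0..T} \<times> cball 0 R\<close> controls the change of the integrand; narrow continuity
  controls the change of the measure.\<close>

lemma continuous_param:
  fixes g :: "real \<Rightarrow> real^'n \<Rightarrow> real"
  assumes g: "continuous_on ({0..T} \<times> UNIV) (\<lambda>(t, x). g t x)"
  shows "continuous_on {0..T} (\<lambda>t. \<integral>x. g t x \<partial>\<mu> t)"
  unfolding continuous_on_iff
proof (intro ballI allI impI)
  fix t e :: real assume t: "t \<in> {0..T}" and e: "e > 0"
  have gx: "continuous_on UNIV (g s)" if "s \<in> {0..T}" for s
    by (rule continuous_on_pair_compose[OF g continuous_on_const continuous_on_id]) (rule that)
  have "uniformly_continuous_on ({0..T} \<times> cball 0 R) (\<lambda>(t, x). g t x)"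
    by (intro compact_uniformly_continuous continuous_on_subset[OF g] compact_Times) auto
  then obtain d1 where d1: "d1 > 0" "\<And>p q. p \<in> {0..T} \<times> cball 0 R \<Longrightarrow> q \<in> {0..T} \<times> cball 0 R \<Longrightarrow> dist q p < d1 \<Longrightarrow>
      dist (case q of (t, x) \<Rightarrow> g t x) (case p of (t, x) \<Rightarrow> g t x) < e / 2"
    unfolding uniformly_continuous_on_def using e by (metis half_gt_zero)
  obtain d2 where d2: "d2 > 0" "\<And>s. s \<in> {0..T} \<Longrightarrow> dist s t < d2 \<Longrightarrow> dist (\<integral>x. g t x \<partial>\<mu> s) (\<integral>x. g t x \<partial>\<mu> t) < e / 2"
    using narrow[OF gx[OF t]] t e unfolding continuous_on_iff by (metis half_gt_zero)
  show "\<exists>d>0. \<forall>s\<in>{0..T}. dist s t < d \<longrightarrow> dist (\<integral>x. g s x \<partial>\<mu> s) (\<integral>x. g t x \<partial>\<mu> t) < e"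
  proof (intro exI[of _ "min d1 d2"] conjI ballI impI)
    fix s assume s: "s \<in> {0..T}" "dist s t < min d1 d2"
    have "\<bar>(\<integral>x. g s x \<partial>\<mu> s) - (\<integral>x. g t x \<partial>\<mu> s)\<bar> \<le> e / 2"
    proof (rule integral_diff_le_Pc[OF Pc[OF s(1)] gx[OF s(1)] gx[OF t]])
      fix x assume "x \<in> supp (\<mu> s)"
      then have "x \<in> cball 0 R" using bdd[OF s(1)] by auto
      moreover have "dist (s, x) (t, x) < d1" using s(2) by (simp add: dist_Pair_Pair)
      ultimately show "\<bar>g s x - g t x\<bar> \<le> e / 2"
        using d1(2)[of "(t, x)" "(s, x)"] s(1) t by (simp add: dist_real_def)
    qed
    moreover have "dist (\<integral>x. g t x \<partial>\<mu> s) (\<integral>x. g t x \<partial>\<mu> t) < e / 2" using d2 s by auto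
    ultimately show "dist (\<integral>x. g s x \<partial>\<mu> s) (\<integral>x. g t x \<partial>\<mu> t) < e" unfolding dist_real_def by linarith
  qed (use d1 d2 in auto)
qed

lemma W2_tendsto:
  assumes t: "t \<in> {0..T}" and s: "\<And>n. s n \<in> {0..T}" "s \<longlonglongrightarrow> t"
  shows "(\<lambda>n. W2 (\<mu> t) (\<mu> (s n))) \<longlonglongrightarrow> 0"
proof (rule narrow_imp_W2)
  show "AE x in \<mu> (s n). norm x \<le> R" for n
    using AE_supp[OF Pc[OF s(1), of n]] bdd[OF s(1), of n] by (auto elim!: eventually_mono)
  show "(\<lambda>n. \<integral>x. f x \<partial>\<mu> (s n)) \<longlonglongrightarrow> (\<integral>x. f x \<partial>\<mu> t)" if "continuous_on UNIV f" for f :: "real^'n \<Rightarrow> real"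
    using continuous_on_tendsto_compose[OF narrow[OF that] s(2) t] s(1) by simp
qed (use Pc_sets[OF Pc] Pc_prob[OF Pc] t s(1) in auto)

end

subsection \<open>Weak solutions of the continuity equation\<close>

locale weak_path =
  fixes \<mu> :: "real \<Rightarrow> (real^'n) measure" and b :: "real \<Rightarrow> real^'n \<Rightarrow> real^'n"
    and \<mu>0 :: "(real^'n) measure" and T R :: real
  assumes T: "T > 0"
    and Pc: "\<And>t. t \<in> {0..T} \<Longrightarrow> \<mu> t \<in> Pc" and bdd: "\<And>t. t \<in> {0..T} \<Longrightarrow> supp (\<mu> t) \<subseteq> cball 0 R"
    and Pc0: "\<mu>0 \<in> Pc" and bdd0: "supp \<mu>0 \<subseteq> cball 0 R"
    and bx: "\<And>t. t \<in> {0..T} \<Longrightarrow> continuous_on UNIV (b t)"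
    and weak: "\<And>\<phi> t. test_fun \<phi> \<Longrightarrow> t \<in> {0..T} \<Longrightarrow>
       set_integrable lborel {0..t} (\<lambda>s. \<integral>x. grad \<phi> x \<bullet> b s x \<partial>\<mu> s) \<and>
       (\<integral>x. \<phi> x \<partial>\<mu> t) = (\<integral>x. \<phi> x \<partial>\<mu>0) + (LINT s:{0..t}|lborel. \<integral>x. grad \<phi> x \<bullet> b s x \<partial>\<mu> s)"
begin

text \<open>Multiplication by a cutoff equal to 1 around the ball containing all supports changes no
  integral, so the weak equation may be tested with smooth functions of arbitrary support,
  polynomials in particular.\<close>

lemma weak_smooth:
  assumes \<phi>: "\<And>k. Ck k \<phi>" and t: "t \<in> {0..T}"
  shows "(\<lambda>s. \<integral>x. grad \<phi> x \<bullet> b s x \<partial>\<mu> s) integrable_on {0..t}"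
    and "(\<integral>x. \<phi> x \<partial>\<mu> t) = (\<integral>x. \<phi> x \<partial>\<mu>0) + integral {0..t} (\<lambda>s. \<integral>x. grad \<phi> x \<bullet> b s x \<partial>\<mu> s)"
proof -
  \<comment> \<open>The parameter is a squared radius. Adding 1 makes the cutoff constant in a
    neighbourhood of the ball, so that gradients agree on its boundary too.\<close>
  define \<eta> where "\<eta> x = cutoff (R\<^sup>2 + 1) x * \<phi> x" for x
  have \<eta>: "test_fun \<eta>" unfolding \<eta>_def using \<phi> by (rule test_fun_cutoff)
  then have C\<eta>: "Ck k \<eta>" for k by (simp add: test_fun_def)
  have R: "x \<bullet> x < R\<^sup>2 + 1" if "x \<in> cball 0 R" for x :: "real^'n"
    using that power_mono[of "norm x" R 2] by (simp add: power2_norm_eq_inner)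
  have loc: "\<eta> x = \<phi> x" "grad \<eta> x = grad \<phi> x" if "x \<in> cball 0 R" for x
    unfolding \<eta>_def using cutoff_local[OF \<phi> R[OF that]] by auto
  have cont: "continuous_on UNIV \<eta>" "continuous_on UNIV \<phi>" using C\<eta>[of 0] \<phi>[of 0] by auto
  have eq: "(\<integral>x. \<eta> x \<partial>\<nu>) = (\<integral>x. \<phi> x \<partial>\<nu>)" if "\<nu> \<in> Pc" "supp \<nu> \<subseteq> cball 0 R" for \<nu>
  proof (rule integral_cong_AE)
    show "\<eta> \<in> borel_measurable \<nu>" "\<phi> \<in> borel_measurable \<nu>"
      using integrable_continuous_Pc[OF that(1) cont(1)] integrable_continuous_Pc[OF that(1) cont(2)] by auto
    show "AE x in \<nu>. \<eta> x = \<phi> x" using AE_supp[OF that(1)] that(2) loc(1) by (auto elim!: eventually_mono)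
  qed
  have eqg: "(\<integral>x. grad \<eta> x \<bullet> b s x \<partial>\<mu> s) = (\<integral>x. grad \<phi> x \<bullet> b s x \<partial>\<mu> s)" if s: "s \<in> {0..T}" for s
  proof (rule integral_cong_AE)
    have "continuous_on UNIV (\<lambda>x. grad \<eta> x \<bullet> b s x)" "continuous_on UNIV (\<lambda>x. grad \<phi> x \<bullet> b s x)"
      by (intro continuous_intros bx s continuous_grad[OF C\<eta>] continuous_grad[OF \<phi>])+
    then show "(\<lambda>x. grad \<eta> x \<bullet> b s x) \<in> borel_measurable (\<mu> s)" "(\<lambda>x. grad \<phi> x \<bullet> b s x) \<in> borel_measurable (\<mu> s)"
      using integrable_continuous_Pc[OF Pc[OF s]] by blast+
    show "AE x in \<mu> s. grad \<eta> x \<bullet> b s x = grad \<phi> x \<bullet> b s x"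
      using AE_supp[OF Pc[OF s]] bdd[OF s] loc(2) by (auto elim!: eventually_mono)
  qed
  note w = weak[OF \<eta> t]
  have 1: "(\<lambda>s. \<integral>x. grad \<eta> x \<bullet> b s x \<partial>\<mu> s) integrable_on {0..t}"
    using w by (intro set_borel_integral_eq_integral(1)) auto
  have 2: "(\<integral>x. \<eta> x \<partial>\<mu> t) = (\<integral>x. \<eta> x \<partial>\<mu>0) + integral {0..t} (\<lambda>s. \<integral>x. grad \<eta> x \<bullet> b s x \<partial>\<mu> s)"
    using w set_borel_integral_eq_integral(2)[of "{0..t}"] by auto
  have sub: "s \<in> {0..T}" if "s \<in> {0..t}" for s using that t by auto
  show "(\<lambda>s. \<integral>x. grad \<phi> x \<bullet> b s x \<partial>\<mu> s) integrable_on {0..t}"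
    using 1 by (rule integrable_eq) (use eqg sub in auto)
  have "integral {0..t} (\<lambda>s. \<integral>x. grad \<eta> x \<bullet> b s x \<partial>\<mu> s) = integral {0..t} (\<lambda>s. \<integral>x. grad \<phi> x \<bullet> b s x \<partial>\<mu> s)"
    by (rule integral_cong) (use eqg sub in auto)
  then show "(\<integral>x. \<phi> x \<partial>\<mu> t) = (\<integral>x. \<phi> x \<partial>\<mu>0) + integral {0..t} (\<lambda>s. \<integral>x. grad \<phi> x \<bullet> b s x \<partial>\<mu> s)"
    using 2 eq[OF Pc[OF t] bdd[OF t]] eq[OF Pc0 bdd0] by simp
qed

lemma smooth_cont:
  assumes \<phi>: "\<And>k. Ck k \<phi>"
  shows "continuous_on {0..T} (\<lambda>t. \<integral>x. \<phi> x \<partial>\<mu> t)"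
proof -
  have "T \<in> {0..T}" using T by simp
  then have "continuous_on {0..T} (\<lambda>t. (\<integral>x. \<phi> x \<partial>\<mu>0) + integral {0..t} (\<lambda>s. \<integral>x. grad \<phi> x \<bullet> b s x \<partial>\<mu> s))"
    by (intro continuous_intros indefinite_integral_continuous_1 weak_smooth(1)[OF \<phi>])
  then show ?thesis by (rule continuous_on_eq) (use weak_smooth(2)[OF \<phi>] in auto)
qed

text \<open>Smooth test functions give continuity in time directly; a continuous \<open>f\<close> is
  uniformly approximated by polynomials on the ball that carries all the measures.\<close>

sublocale narrow_path \<mu> T R
proof
  fix f :: "real^'n \<Rightarrow> real" assume f: "continuous_on UNIV f"
  show "continuous_on {0..T} (\<lambda>t. \<integral>x. f x \<partial>\<mu> t)"
    unfolding continuous_on_iff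
  proof (intro ballI allI impI)
    fix t e :: real assume t: "t \<in> {0..T}" and e: "e > 0"
    obtain p where p: "real_polynomial_function p" "\<And>x. x \<in> cball 0 R \<Longrightarrow> \<bar>f x - p x\<bar> < e / 3"
      using Stone_Weierstrass_real_polynomial_function[OF compact_cball continuous_on_subset[OF f subset_UNIV], of "e / 3" 0 R] e
      by auto
    have Cp: "Ck k p" for k using p(1) by (rule Ck_real_polynomial)
    have pc: "continuous_on UNIV p" using Cp[of 0] by simp
    obtain d where d: "d > 0" "\<And>s. s \<in> {0..T} \<Longrightarrow> dist s t < d \<Longrightarrow> dist (\<integral>x. p x \<partial>\<mu> s) (\<integral>x. p x \<partial>\<mu> t) < e / 3"
      using smooth_cont[OF Cp] t e unfolding continuous_on_iff by (metis divide_pos_pos zero_less_numeral)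
    have close: "\<bar>(\<integral>x. f x \<partial>\<mu> s) - (\<integral>x. p x \<partial>\<mu> s)\<bar> \<le> e / 3" if "s \<in> {0..T}" for s
      using less_imp_le[OF p(2)] bdd[OF that] by (intro integral_diff_le_Pc Pc that f pc) blast
    show "\<exists>d>0. \<forall>s\<in>{0..T}. dist s t < d \<longrightarrow> dist (\<integral>x. f x \<partial>\<mu> s) (\<integral>x. f x \<partial>\<mu> t) < e"
    proof (intro exI[of _ d] conjI ballI impI d)
      fix s assume s: "s \<in> {0..T}" "dist s t < d"
      show "dist (\<integral>x. f x \<partial>\<mu> s) (\<integral>x. f x \<partial>\<mu> t) < e"
        using close[OF s(1)] close[OF t] d(2)[OF s] unfolding dist_real_def by linarith
    qed
  qed
qed (use Pc bdd in auto)

end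

locale lipschitz_weak_path = weak_path \<mu> b \<mu>0 T R + lipschitz_field b T L
  for \<mu> :: "real \<Rightarrow> (real^'n) measure" and b \<mu>0 T R L
begin

text \<open>The derivative of \<open>\<integral>x. g t x \<partial>\<mu> t\<close> is the integral
  of \<open>gt + grad g \<bullet> b\<close>. The weak equation admits time-independent test
  functions only, so near a time \<open>t\<close> the integrand \<open>g s\<close> is split into
  \<open>g t\<close>, handled by the equation, and \<open>g s - g t\<close>, handled by a mean of
  \<open>gt\<close>.\<close>

lemma weak_monotone:
  assumes g: "\<And>t k. t \<in> {0..T} \<Longrightarrow> Ck k (g t)"
    and gt: "\<And>t x. t \<in> {0..T} \<Longrightarrow> ((\<lambda>s. g s x) has_real_derivative gt t x) (at t within {0..T})"
    and gtc: "continuous_on ({0..T} \<times> UNIV) (\<lambda>(t, x). gt t x)"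
    and le: "\<And>t x. t \<in> {0..T} \<Longrightarrow> gt t x + grad (g t) x \<bullet> b t x \<ge> 0"
    and t: "t \<in> {0..T}"
  shows "(\<integral>x. g 0 x \<partial>\<mu>0) \<le> (\<integral>x. g t x \<partial>\<mu> t)"
proof -
  have gc: "continuous_on UNIV (g t)" if "t \<in> {0..T}" for t using g[OF that, of 0] by simp
  have deriv: "((\<lambda>s. \<integral>x. g s x \<partial>\<mu> s) has_real_derivative (\<integral>x. gt t x + grad (g t) x \<bullet> b t x \<partial>\<mu> t)) (at t within {0..T})"
    if t: "t \<in> {0..T}" for t
  proof -
    \<comment> \<open>The difference quotient of \<open>g\<close> in time between \<open>t\<close>
      and \<open>s\<close>, written as a mean of \<open>gt\<close>, so that it extends continuously
      to \<open>s = t\<close> with value \<open>gt t x\<close>.\<close>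
    define q where "q s x = integral {0..1} (\<lambda>\<theta>. gt (t + \<theta> * (s - t)) x)" for s x
    have seg: "t + \<theta> * (s - t) \<in> {0..T}" if "s \<in> {0..T}" "\<theta> \<in> {0..1}" for s \<theta>
    proof -
      have "t + \<theta> * (s - t) = (1 - \<theta>) * t + \<theta> * s" by (simp add: algebra_simps)
      moreover have "(1 - \<theta>) *\<^sub>R t + \<theta> *\<^sub>R s \<in> {0..T}"
        using that t by (intro convexD) auto
      ultimately show ?thesis by simp
    qed
    have "continuous_on (({0..T} \<times> UNIV) \<times> cbox 0 1) (\<lambda>(p, \<theta>). gt (t + \<theta> * (fst p - t)) (snd p))"
      unfolding split_beta using seg
      by (intro continuous_on_pair_compose[OF gtc] continuous_intros) auto
    then have "continuous_on ({0..T} \<times> UNIV) (\<lambda>p. integral (cbox 0 1) (\<lambda>\<theta>. gt (t + \<theta> * (fst p - t)) (snd p)))"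
      by (rule integral_continuous_on_param)
    then have qc: "continuous_on ({0..T} \<times> UNIV) (\<lambda>(s, x). q s x)" by (simp add: q_def split_beta)
    have q: "g s x - g t x = (s - t) * q s x" if s: "s \<in> {0..T}" for s x
    proof -
      have "((\<lambda>\<theta>. (s - t) * gt (t + \<theta> * (s - t)) x) has_integral g (t + 1 * (s - t)) x - g (t + 0 * (s - t)) x) {0..1}"
      proof (rule fundamental_theorem_of_calculus)
        fix \<theta> :: real assume \<theta>: "\<theta> \<in> {0..1}"
        have "((\<lambda>s. g s x) has_real_derivative gt (t + \<theta> * (s - t)) x) (at (t + \<theta> * (s - t)) within (\<lambda>\<theta>. t + \<theta> * (s - t)) ` {0..1})"
          by (rule DERIV_subset[OF gt]) (use seg s \<theta> in auto)
        moreover have "((\<lambda>\<theta>. t + \<theta> * (s - t)) has_real_derivative (s - t)) (at \<theta> within {0..1})"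
          by (auto intro!: derivative_eq_intros)
        ultimately have "((\<lambda>\<theta>. g (t + \<theta> * (s - t)) x) has_real_derivative gt (t + \<theta> * (s - t)) x * (s - t)) (at \<theta> within {0..1})"
          by (rule DERIV_image_chain[unfolded comp_def])
        then show "((\<lambda>\<theta>. g (t + \<theta> * (s - t)) x) has_vector_derivative (s - t) * gt (t + \<theta> * (s - t)) x) (at \<theta> within {0..1})"
          by (simp add: has_real_derivative_iff_has_vector_derivative mult.commute)
      qed simp
      from integral_unique[OF this] show ?thesis by (simp add: q_def)
    qed
    have qcx: "continuous_on UNIV (q s)" if "s \<in> {0..T}" for s
      by (rule continuous_on_pair_compose[OF qc continuous_on_const continuous_on_id]) (rule that)
    have qt: "q t x = gt t x" for x by (simp add: q_def)
    define Q where "Q s = (\<integral>x. q s x \<partial>\<mu> s)" for s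
    have Qc: "continuous_on {0..T} Q" unfolding Q_def by (rule continuous_param[OF qc])
    define k where "k s = (\<integral>x. grad (g t) x \<bullet> b s x \<partial>\<mu> s)" for s
    have "continuous_on ({0..T} \<times> UNIV) (\<lambda>p. grad (g t) (snd p))"
      by (rule continuous_on_compose2[OF continuous_grad[OF g[OF t]]]) (auto intro: continuous_intros)
    then have "continuous_on ({0..T} \<times> UNIV) (\<lambda>(s, x). grad (g t) x \<bullet> b s x)"
      unfolding split_beta by (intro continuous_intros b_cont_comp) auto
    then have kc: "continuous_on {0..T} k" unfolding k_def by (rule continuous_param)
    have eq: "(\<integral>x. g s x \<partial>\<mu> s) = (s - t) * Q s + ((\<integral>x. g t x \<partial>\<mu>0) + integral {0..s} k)" if s: "s \<in> {0..T}" for s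
    proof -
      have "(\<integral>x. g s x \<partial>\<mu> s) - (\<integral>x. g t x \<partial>\<mu> s) = (\<integral>x. g s x - g t x \<partial>\<mu> s)"
        by (rule Bochner_Integration.integral_diff[symmetric]) (intro integrable_continuous_Pc Pc s gc t)+
      also have "\<dots> = (s - t) * Q s" by (simp add: q[OF s] Q_def)
      finally show ?thesis using weak_smooth(2)[OF g[OF t] s] by (simp add: k_def[abs_def])
    qed
    \<comment> \<open>\<open>Q\<close> is merely continuous. The factor \<open>s - t\<close>
      vanishes at \<open>t\<close>, so the product is still differentiable there, with derivative
      \<open>Q t\<close>.\<close>
    have d1: "((\<lambda>s. (s - t) * Q s) has_real_derivative Q t) (at t within {0..T})"
    proof -
      have "(Q \<longlongrightarrow> Q t) (at t within {0..T})" using Qc t by (simp add: continuous_on_def)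
      then have "((\<lambda>s. ((s - t) * Q s - (t - t) * Q t) / (s - t)) \<longlongrightarrow> Q t) (at t within {0..T})"
        by (rule Lim_transform_eventually) (auto simp: eventually_at_filter)
      then show ?thesis by (simp add: has_field_derivative_iff)
    qed
    have d2: "((\<lambda>s. integral {0..s} k) has_real_derivative k t) (at t within {0..T})"
      by (rule integral_has_real_derivative[OF kc t])
    have "((\<lambda>s. (s - t) * Q s + ((\<integral>x. g t x \<partial>\<mu>0) + integral {0..s} k)) has_real_derivative Q t + (0 + k t)) (at t within {0..T})"
      by (intro DERIV_add d1 d2 DERIV_const)
    then have "((\<lambda>s. \<integral>x. g s x \<partial>\<mu> s) has_real_derivative Q t + (0 + k t)) (at t within {0..T})"
      by (rule has_field_derivative_transform_within[OF _ zero_less_one t]) (use eq in auto)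
    moreover have "Q t + (0 + k t) = (\<integral>x. gt t x + grad (g t) x \<bullet> b t x \<partial>\<mu> t)"
    proof -
      have "integrable (\<mu> t) (\<lambda>x. gt t x)" using qcx[OF t] by (intro integrable_continuous_Pc Pc t) (simp add: qt)
      moreover have "integrable (\<mu> t) (\<lambda>x. grad (g t) x \<bullet> b t x)"
        by (intro integrable_continuous_Pc Pc t continuous_intros bx continuous_grad[OF g[OF t]])
      ultimately show ?thesis by (simp add: Q_def k_def qt)
    qed
    ultimately show ?thesis by simp
  qed
  have nonneg: "(\<integral>x. gt t x + grad (g t) x \<bullet> b t x \<partial>\<mu> t) \<ge> 0" if "t \<in> {0..T}" for t
    using le[OF that] by (intro integral_nonneg_AE AE_I2) auto
  have "(\<integral>x. g 0 x \<partial>\<mu> 0) \<le> (\<integral>x. g t x \<partial>\<mu> t)"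
  proof (rule DERIV_nonneg_imp_increasing_open[of 0 t "\<lambda>s. \<integral>x. g s x \<partial>\<mu> s"])
    show "0 \<le> t" using t by simp
    show "continuous_on {0..t} (\<lambda>s. \<integral>x. g s x \<partial>\<mu> s)"
      using t by (intro continuous_on_subset[OF DERIV_continuous_on[OF deriv]]) auto
    fix s assume s: "0 < s" "s < t"
    then have "at s within {0..T} = at s" using t by (intro at_within_Icc_at) auto
    then show "\<exists>y. ((\<lambda>s. \<integral>x. g s x \<partial>\<mu> s) has_real_derivative y) (at s) \<and> 0 \<le> y"
      using deriv[of s] nonneg[of s] s t by auto
  qed
  moreover have "(\<integral>x. g 0 x \<partial>\<mu> 0) = (\<integral>x. g 0 x \<partial>\<mu>0)"
    using weak_smooth(2)[OF g[of 0], of 0] T by simp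
  ultimately show ?thesis by simp
qed

end

lemma measure_nbhd_tendsto:
  fixes M :: "'a::metric_space measure"
  assumes "finite_measure M" "sets M = sets borel" "closed C" "C \<noteq> {}"
  shows "(\<lambda>n. measure M {x. infdist x C \<le> 1 / real (Suc n)}) \<longlonglongrightarrow> measure M C"
proof -
  interpret finite_measure M by fact
  have m: "{x. infdist x C \<le> 1 / real (Suc n)} \<in> sets M" for n
    unfolding assms(2) by (intro borel_closed closed_Collect_le continuous_intros)
  have "(\<lambda>n. measure M {x. infdist x C \<le> 1 / real (Suc n)}) \<longlonglongrightarrow> measure M (\<Inter>n. {x. infdist x C \<le> 1 / real (Suc n)})"
  proof (rule finite_Lim_measure_decseq)
    show "decseq (\<lambda>n. {x. infdist x C \<le> 1 / real (Suc n)})"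
    proof (rule decseq_SucI, rule subsetI)
      fix n x assume "x \<in> {x. infdist x C \<le> 1 / real (Suc (Suc n))}"
      moreover have "1 / real (Suc (Suc n)) \<le> 1 / real (Suc n)" by (intro divide_left_mono) auto
      ultimately show "x \<in> {x. infdist x C \<le> 1 / real (Suc n)}" by auto
    qed
  qed (use m in auto)
  also have "(\<Inter>n. {x. infdist x C \<le> 1 / real (Suc n)}) = C"
  proof (intro equalityI subsetI)
    fix x assume x: "x \<in> (\<Inter>n. {x. infdist x C \<le> 1 / real (Suc n)})"
    have "infdist x C \<le> 0"
    proof (rule LIMSEQ_le_const)
      show "(\<lambda>n. 1 / real (Suc n)) \<longlonglongrightarrow> 0" using LIMSEQ_inverse_real_of_nat by (simp add: inverse_eq_divide)
    qed (use x in auto)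
    then show "x \<in> C" using assms(3,4) infdist_nonneg[of x C] by (simp add: in_closed_iff_infdist_zero)
  qed (use assms in \<open>auto simp: infdist_zero\<close>)
  finally show ?thesis .
qed

text \<open>Because both total masses are 1, the hypothesis on complements of open neighbourhoods of
  \<open>C\<close> gives the reverse inequality on those neighbourhoods, and these shrink to
  \<open>C\<close>.\<close>

lemma prob_measure_eq_closed_le:
  fixes M N :: "'a::metric_space measure"
  assumes M: "prob_space M" "sets M = sets borel" and N: "prob_space N" "sets N = sets borel"
    and le: "\<And>C. closed C \<Longrightarrow> measure N C \<le> measure M C"
  shows "M = N"
proof -
  interpret M: prob_space M by fact
  interpret N: prob_space N by fact
  have eq: "measure M C = measure N C" if C: "closed C" for C
  proof (cases "C = {}")
    case False
    have "measure M C \<le> measure N {x. infdist x C \<le> 1 / real (Suc n)}" for n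
    proof -
      let ?O = "{x. infdist x C < 1 / real (Suc n)}"
      have O: "open ?O" by (intro open_Collect_less continuous_intros)
      have "measure M C \<le> measure M ?O"
        using O M(2) C False by (intro M.finite_measure_mono) (auto simp: infdist_zero)
      also have "\<dots> = 1 - measure M (- ?O)"
        using M.prob_compl[of ?O] O M(2) sets_eq_imp_space_eq[OF M(2)] by (simp add: Compl_eq_Diff_UNIV)
      also have "\<dots> \<le> 1 - measure N (- ?O)" using le[of "- ?O"] O by (simp add: closed_Compl)
      also have "\<dots> = measure N ?O"
        using N.prob_compl[of ?O] O N(2) sets_eq_imp_space_eq[OF N(2)] by (simp add: Compl_eq_Diff_UNIV)
      also have "\<dots> \<le> measure N {x. infdist x C \<le> 1 / real (Suc n)}"
        using N(2) by (intro N.finite_measure_mono) (auto intro!: borel_closed closed_Collect_le continuous_intros)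
      finally show ?thesis .
    qed
    then have "measure M C \<le> measure N C"
      using measure_nbhd_tendsto[OF N.finite_measure_axioms N(2) C False] by (intro LIMSEQ_le_const) auto
    then show ?thesis using le[OF C] by simp
  qed simp
  show ?thesis
  proof (rule measure_eqI_generator_eq[where E="{C. closed C}" and A="\<lambda>_. UNIV" and \<Omega>=UNIV])
    show "sets M = sigma_sets UNIV {C. closed C}" "sets N = sigma_sets UNIV {C. closed C}"
      using M(2) N(2) by (simp_all add: borel_eq_closed)
  qed (auto simp: eq M.emeasure_eq_measure N.emeasure_eq_measure Int_stable_def)
qed

context lipschitz_weak_path
begin

text \<open>The function \<open>g\<close> below separates a compact set \<open>A\<close> from far away points; it is built
  from squared distances to finitely many trajectories, damped by \<open>exp (- 2 L t)\<close>, so that it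
  increases along every trajectory. No differentiability of the flow is needed.\<close>

theorem representation:
  assumes \<Phi>: "flow_of b T \<Phi>" and t: "t \<in> {0..T}"
  shows "\<mu> t = distr \<mu>0 borel (\<Phi> t)"
proof -
  interpret \<mu>: prob_space "\<mu> t" using Pc[OF t] by (rule Pc_prob)
  interpret \<mu>0: prob_space \<mu>0 using Pc0 by (rule Pc_prob)
  have \<Phi>m: "\<Phi> t \<in> borel_measurable \<mu>0"
    using borel_measurable_continuous_onI[OF flow_cont_x[OF \<Phi> t]] by (simp only: measurable_cong_sets[OF Pc_sets[OF Pc0] refl])
  have \<Phi>c: "continuous_on {0..T} (\<lambda>t. \<Phi> t z)" for z using \<Phi> by (simp add: flow_of_def)
  have key: "measure \<mu>0 A \<le> measure (\<mu> t) {x. infdist x B \<le> \<epsilon>}"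
    if A: "compact A" and B: "\<Phi> t ` A \<subseteq> B" and \<epsilon>: "\<epsilon> > 0" for A B \<epsilon>
  proof -
    \<comment> \<open>The radius is fixed by
      \<open>\<epsilon>\<^sup>2 = 4 * (r\<^sup>2 / e t)\<close> at the final time. There a point
      farther than \<open>\<epsilon>\<close> from a trajectory has \<open>a \<le> 0\<close>, whereas
      at time 0 a point within \<open>r\<close> of a centre has \<open>a \<ge> 1\<close>.\<close>
    define r where "r = \<epsilon> / (2 * exp (L * t))"
    have r: "r > 0" using \<epsilon> by (simp add: r_def)
    obtain Z where Z: "finite Z" "Z \<subseteq> A" "A \<subseteq> (\<Union>z\<in>Z. ball z r)"
      using compactE_image[OF A, of A "\<lambda>z. ball z r"] r by (metis UN_I centre_in_ball open_ball subsetI)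
    define e where "e t = exp (- (2 * L * t))" for t
    define v where "v z t x = x - \<Phi> t z" for z t x
    define a where "a z t x = 2 - e t / r\<^sup>2 * (v z t x \<bullet> v z t x)" for z t x
    \<comment> \<open>A sum over the centres replaces the maximum, which would not be smooth. The
      outer step in \<open>g\<close> brings the sum back to values between 0 and 1.\<close>
    define N where "N t x = (\<Sum>z\<in>Z. sstep (a z t x))" for t x
    define g where "g t x = sstep (N t x)" for t x
    define a' where "a' z t x = (2 * L * e t * (v z t x \<bullet> v z t x) + 2 * e t * (v z t x \<bullet> b t (\<Phi> t z))) / r\<^sup>2" for z t x
    define gt where "gt t x = sstep' (N t x) * (\<Sum>z\<in>Z. sstep' (a z t x) * a' z t x)" for t x
    have Ca: "Ck k (a z t)" for k z t
    proof -
      have "Ck k (\<lambda>x. 2 + - (e t / r\<^sup>2) * ((x - \<Phi> t z) \<bullet> (x - \<Phi> t z)))"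
        by (intro Ck_add Ck_const Ck_cmult Ck_inner_self)
      then show ?thesis by (simp add: a_def[abs_def] v_def)
    qed
    have CN: "Ck k (N t)" for k t
      unfolding N_def using Z(1) by (intro Ck_sum Ck_sstep Ca)
    have "(\<integral>x. g 0 x \<partial>\<mu>0) \<le> (\<integral>x. g t x \<partial>\<mu> t)"
    proof (rule weak_monotone[of g gt, OF _ _ _ _ t])
      show "Ck k (g t)" for k t unfolding g_def by (intro Ck_sstep CN)
    next
      fix t x assume t: "t \<in> {0..T}"
      have "((\<lambda>t. v z t x) has_vector_derivative - b t (\<Phi> t z)) (at t within {0..T})" for z
        unfolding v_def using flow_deriv[OF \<Phi> t, of z] by (auto intro!: derivative_eq_intros)
      then have v': "((\<lambda>t. v z t x) has_derivative (\<lambda>h. h *\<^sub>R - b t (\<Phi> t z))) (at t within {0..T})" for z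
        by (simp add: has_vector_derivative_def)
      have "((\<lambda>t. v z t x \<bullet> v z t x) has_real_derivative 2 * (v z t x \<bullet> - b t (\<Phi> t z))) (at t within {0..T})" for z
        unfolding has_field_derivative_def
        by (rule has_derivative_eq_rhs[OF has_derivative_inner[OF v' v']]) (auto simp: inner_commute)
      moreover have "(e has_real_derivative - (2 * L * e t)) (at t within {0..T})"
        unfolding e_def by (auto intro!: derivative_eq_intros)
      ultimately have "((\<lambda>t. a z t x) has_real_derivative a' z t x) (at t within {0..T})" for z
        unfolding a_def a'_def using r by (auto intro!: derivative_eq_intros simp: field_simps)
      then have "((\<lambda>t. sstep (a z t x)) has_real_derivative sstep' (a z t x) * a' z t x) (at t within {0..T})" for z
        by (rule DERIV_chain2[OF sstep_deriv])
      then have "((\<lambda>t. N t x) has_real_derivative (\<Sum>z\<in>Z. sstep' (a z t x) * a' z t x)) (at t within {0..T})"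
        unfolding N_def by (intro DERIV_sum)
      then show "((\<lambda>s. g s x) has_real_derivative gt t x) (at t within {0..T})"
        unfolding g_def gt_def by (rule DERIV_chain2[OF sstep_deriv])
    next
      have vc: "continuous_on ({0..T} \<times> UNIV) (\<lambda>p. v z (fst p) (snd p))" for z
        unfolding v_def by (intro continuous_intros continuous_on_compose2[OF \<Phi>c continuous_on_fst]) auto
      have ac: "continuous_on ({0..T} \<times> UNIV) (\<lambda>p. a z (fst p) (snd p))" for z
        unfolding a_def e_def by (intro continuous_intros vc) (use r in auto)
      have sc: "continuous_on S (\<lambda>p. sstep (f p))" if "continuous_on S f" for S :: "(real \<times> (real^'n)) set" and f
      proof -
        have "continuous_on UNIV sstep"
          using DERIV_isCont[OF sstep_deriv] by (simp add: continuous_on_eq_continuous_at)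
        then show ?thesis by (rule continuous_on_compose2[OF _ that]) simp
      qed
      have sc': "continuous_on S (\<lambda>p. sstep' (f p))" if "continuous_on S f" for S :: "(real \<times> (real^'n)) set" and f
        by (rule continuous_on_compose2[OF continuous_sstep' that]) simp
      have bc: "continuous_on ({0..T} \<times> UNIV) (\<lambda>p :: real \<times> (real^'n). b (fst p) (\<Phi> (fst p) z))" for z
        by (intro b_cont_comp continuous_on_fst continuous_on_id continuous_on_compose2[OF \<Phi>c continuous_on_fst]) auto
      show "continuous_on ({0..T} \<times> UNIV) (\<lambda>(t, x). gt t x)"
        unfolding gt_def a'_def N_def e_def split_beta
        by (intro continuous_intros sc sc' ac vc bc) (use r in auto)
    next
      fix t x assume t: "t \<in> {0..T}"
      have sd: "((\<lambda>x. sstep (f x)) has_derivative (\<lambda>h. f' h * sstep' (f x))) (at x)"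
        if "(f has_derivative f') (at x)" for f f' and x :: "real^'n"
        using has_derivative_compose[OF that sstep_deriv[unfolded has_field_derivative_def]]
        by (rule has_derivative_eq_rhs) (simp add: mult.commute)
      have "(a z t has_derivative (\<lambda>h. - (2 * e t / r\<^sup>2) * (v z t x \<bullet> h))) (at x)" for z
      proof -
        have "((\<lambda>x. 2 - c * ((x - p) \<bullet> (x - p))) has_derivative (\<lambda>h. - (2 * c) * ((x - p) \<bullet> h))) (at x)" for c and p :: "real^'n"
          by (auto intro!: derivative_eq_intros simp: inner_commute algebra_simps)
        from this[of "e t / r\<^sup>2" "\<Phi> t z"] show ?thesis unfolding a_def[abs_def] v_def by simp
      qed
      then have "((\<lambda>x. sstep (a z t x)) has_derivative (\<lambda>h. (- (2 * e t / r\<^sup>2) * (v z t x \<bullet> h)) * sstep' (a z t x))) (at x)" for z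
        by (rule sd)
      then have "(N t has_derivative (\<lambda>h. \<Sum>z\<in>Z. (- (2 * e t / r\<^sup>2) * (v z t x \<bullet> h)) * sstep' (a z t x))) (at x)"
        unfolding N_def by (intro has_derivative_sum)
      then have "(g t has_derivative (\<lambda>h. (\<Sum>z\<in>Z. (- (2 * e t / r\<^sup>2) * (v z t x \<bullet> h)) * sstep' (a z t x)) * sstep' (N t x))) (at x)"
        unfolding g_def by (rule sd)
      note 1 = this
      have 2: "(g t has_derivative (\<lambda>h. grad (g t) x \<bullet> h)) (at x)"
        unfolding g_def[abs_def] by (intro Ck_has_grad[of 0] Ck_sstep CN)
      have "grad (g t) x \<bullet> b t x = (\<Sum>z\<in>Z. (- (2 * e t / r\<^sup>2) * (v z t x \<bullet> b t x)) * sstep' (a z t x)) * sstep' (N t x)"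
        using fun_cong[OF has_derivative_unique[OF 2 1], of "b t x"] .
      then have "gt t x + grad (g t) x \<bullet> b t x = sstep' (N t x) *
          (\<Sum>z\<in>Z. sstep' (a z t x) * (2 * e t / r\<^sup>2 * (L * (v z t x \<bullet> v z t x) + v z t x \<bullet> (b t (\<Phi> t z) - b t x))))"
        by (simp add: gt_def a'_def sum.distrib[symmetric] sum_distrib_left algebra_simps inner_diff_right add_divide_distrib diff_divide_distrib)
      \<comment> \<open>Two points moving with a Lipschitz field separate at rate at most
        \<open>L\<close>, so their squared distance grows at rate at most \<open>2 * L\<close>,
        exactly what the damping factor \<open>e\<close> compensates.\<close>
      moreover have "L * (v z t x \<bullet> v z t x) + v z t x \<bullet> (b t (\<Phi> t z) - b t x) \<ge> 0" for z
      proof -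
        have "- (v z t x \<bullet> (b t (\<Phi> t z) - b t x)) \<le> norm (v z t x) * norm (b t (\<Phi> t z) - b t x)"
          using Cauchy_Schwarz_ineq2[of "v z t x" "b t (\<Phi> t z) - b t x"] by linarith
        also have "\<dots> \<le> norm (v z t x) * (L * norm (v z t x))"
          using b_lip[OF t, of "\<Phi> t z" x] by (intro mult_left_mono) (auto simp: v_def norm_minus_commute)
        also have "\<dots> = L * (v z t x \<bullet> v z t x)" by (simp add: power2_norm_eq_inner[symmetric] power2_eq_square)
        finally show ?thesis by simp
      qed
      ultimately show "gt t x + grad (g t) x \<bullet> b t x \<ge> 0"
        using sstep'_nonneg r by (auto intro!: mult_nonneg_nonneg sum_nonneg divide_nonneg_nonneg simp: e_def)
    qed
    moreover have "measure \<mu>0 A \<le> (\<integral>x. g 0 x \<partial>\<mu>0)"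
    proof -
      have "g 0 x = 1" if "x \<in> A" for x
      proof -
        obtain z where z: "z \<in> Z" "x \<in> ball z r" using Z(3) \<open>x \<in> A\<close> by auto
        have "norm (x - z) \<le> r" using z(2) by (simp add: dist_norm norm_minus_commute)
        then have "(norm (x - z))\<^sup>2 \<le> r\<^sup>2" by (intro power_mono) auto
        then have "a z 0 x \<ge> 1" using r by (simp add: a_def e_def v_def flow_0[OF \<Phi>] power2_norm_eq_inner)
        then have "1 \<le> sstep (a z 0 x)" by (simp add: sstep_1)
        also have "\<dots> \<le> N 0 x" unfolding N_def using Z(1) z(1) sstep_range by (intro member_le_sum) auto
        finally show ?thesis by (simp add: g_def sstep_1)
      qed
      then have "indicator A x \<le> g 0 x" for x using sstep_range by (auto simp: indicator_def g_def)
      moreover have "A \<in> sets \<mu>0" using A Pc_sets[OF Pc0] by (auto intro: borel_compact)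
      moreover have "integrable \<mu>0 (g 0)"
        using Ck_sstep[OF CN, of 0] by (intro integrable_continuous_Pc Pc0) (simp add: g_def[abs_def])
      ultimately have "(\<integral>x. indicator A x \<partial>\<mu>0) \<le> (\<integral>x. g 0 x \<partial>\<mu>0)"
        by (intro integral_mono integrable_real_indicator) (auto simp: \<mu>0.emeasure_eq_measure)
      then show ?thesis using \<open>A \<in> sets \<mu>0\<close> by simp
    qed
    moreover have "(\<integral>x. g t x \<partial>\<mu> t) \<le> measure (\<mu> t) {x. infdist x B \<le> \<epsilon>}"
    proof -
      have zero: "g t x = 0" if far: "infdist x B > \<epsilon>" for x
      proof -
        have "a z t x \<le> 0" if z: "z \<in> Z" for z
        proof -
          have "\<Phi> t z \<in> B" using z Z(2) B by auto
          then have "\<epsilon> < norm (v z t x)" using infdist_le[of "\<Phi> t z" B x] far by (simp add: v_def dist_norm)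
          then have "\<epsilon>\<^sup>2 \<le> v z t x \<bullet> v z t x"
            using \<epsilon> power_mono[of \<epsilon> "norm (v z t x)" 2] by (simp add: power2_norm_eq_inner)
          moreover have "\<epsilon>\<^sup>2 = 4 * (r\<^sup>2 / e t)"
            by (simp add: r_def e_def power_divide power_mult_distrib exp_minus exp_double[symmetric] field_simps mult.assoc)
          moreover have "e t / r\<^sup>2 * (4 * (r\<^sup>2 / e t)) = 4" using r by (simp add: e_def)
          ultimately have "4 \<le> e t / r\<^sup>2 * (v z t x \<bullet> v z t x)"
            using mult_left_mono[of "\<epsilon>\<^sup>2" "v z t x \<bullet> v z t x" "e t / r\<^sup>2"] by (simp add: e_def)
          then show ?thesis by (simp add: a_def)
        qed
        then have "N t x = 0" unfolding N_def by (intro sum.neutral) (simp add: sstep_0)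
        then show ?thesis by (simp add: g_def sstep_0)
      qed
      have m: "{x. infdist x B \<le> \<epsilon>} \<in> sets (\<mu> t)"
        unfolding Pc_sets[OF Pc[OF t]] by (intro borel_closed closed_Collect_le continuous_intros)
      have "g t x \<le> indicator {x. infdist x B \<le> \<epsilon>} x" for x
        using zero[of x] sstep_range by (auto simp: indicator_def g_def)
      moreover have "integrable (\<mu> t) (g t)"
        using Ck_sstep[OF CN, of 0] by (intro integrable_continuous_Pc Pc t) (simp add: g_def[abs_def])
      ultimately have "(\<integral>x. g t x \<partial>\<mu> t) \<le> (\<integral>x. indicator {x. infdist x B \<le> \<epsilon>} x \<partial>\<mu> t)"
        using m by (intro integral_mono integrable_real_indicator) (auto simp: \<mu>.emeasure_eq_measure)
      then show ?thesis using m by simp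
    qed
    ultimately show ?thesis by linarith
  qed
  show ?thesis
  proof (rule prob_measure_eq_closed_le)
    show "prob_space (distr \<mu>0 borel (\<Phi> t))" using \<Phi>m by (rule \<mu>0.prob_space_distr)
    fix B :: "(real^'n) set" assume B: "closed B"
    \<comment> \<open>Cutting the preimage with a ball that contains \<open>supp \<mu>0\<close>
      makes it compact and keeps its mass.\<close>
    define A where "A = \<Phi> t -` B \<inter> cball 0 R"
    have A: "compact A"
      unfolding A_def using flow_cont_x[OF \<Phi> t] B by (metis closed_vimage compact_Int_closed compact_cball inf_commute)
    have "measure (distr \<mu>0 borel (\<Phi> t)) B = measure \<mu>0 (\<Phi> t -` B \<inter> space \<mu>0)"
      using \<Phi>m B by (simp add: measure_distr)
    also have "\<dots> = measure \<mu>0 A"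
    proof (rule measure_eq_AE)
      show "AE x in \<mu>0. (x \<in> \<Phi> t -` B \<inter> space \<mu>0) = (x \<in> A)"
        using AE_supp[OF Pc0]
      proof eventually_elim
        case (elim x)
        then have "x \<in> cball 0 R" using bdd0 by auto
        then show ?case using sets_eq_imp_space_eq[OF Pc_sets[OF Pc0]] by (simp add: A_def)
      qed
      show "\<Phi> t -` B \<inter> space \<mu>0 \<in> sets \<mu>0" using \<Phi>m B by (auto intro: measurable_sets)
      show "A \<in> sets \<mu>0" using A Pc_sets[OF Pc0] by (auto intro: borel_compact)
    qed
    also have "\<dots> \<le> measure (\<mu> t) B"
    proof (cases "B = {}")
      case True then show ?thesis by (simp add: A_def)
    next
      case False
      have "measure \<mu>0 A \<le> measure (\<mu> t) {x. infdist x B \<le> 1 / real (Suc n)}" for n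
        by (rule key[OF A]) (auto simp: A_def)
      then show ?thesis
        using measure_nbhd_tendsto[OF \<mu>.finite_measure_axioms Pc_sets[OF Pc[OF t]] B False] by (intro LIMSEQ_le_const) auto
    qed
    finally show "measure (distr \<mu>0 borel (\<Phi> t)) B \<le> measure (\<mu> t) B" .
  qed (use Pc_sets[OF Pc[OF t]] \<mu>.prob_space_axioms in auto)
qed

end

subsection \<open>Interchanging integrals\<close>

lemma fubini_dominated:
  fixes f :: "real \<Rightarrow> 'a \<Rightarrow> real"
  assumes \<nu>: "finite_measure \<nu>"
    and m: "(\<lambda>(s, x). indicator {a..b} s * f s x) \<in> borel_measurable (lborel \<Otimes>\<^sub>M \<nu>)"
    and k: "integrable \<nu> k" and le: "\<And>s. s \<in> {a..b} \<Longrightarrow> AE x in \<nu>. \<bar>f s x\<bar> \<le> k x"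
  shows "(\<integral>x. (LINT s:{a..b}|lborel. f s x) \<partial>\<nu>) = (LINT s:{a..b}|lborel. \<integral>x. f s x \<partial>\<nu>)"
    and "set_integrable lborel {a..b} (\<lambda>s. \<integral>x. f s x \<partial>\<nu>)"
proof -
  interpret \<nu>: finite_measure \<nu> by fact
  interpret pair_sigma_finite lborel \<nu> ..
  let ?f = "\<lambda>s x. indicator {a..b} s * f s x"
  have mx: "?f s \<in> borel_measurable \<nu>" for s using measurable_compose[OF measurable_Pair1' m, of s] by simp
  have le': "AE x in \<nu>. norm (?f s x) \<le> norm (indicator {a..b} s * k x)" for s
  proof (cases "s \<in> {a..b}")
    case True
    then show ?thesis using le[OF True] by (auto elim!: eventually_mono intro: order_trans[OF _ abs_ge_self])
  qed simp
  have ix: "integrable \<nu> (?f s)" for s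
    using Bochner_Integration.integrable_bound[OF _ mx le'] k by auto
  have int: "integrable (lborel \<Otimes>\<^sub>M \<nu>) (\<lambda>(s, x). ?f s x)"
  proof (rule Fubini_integrable[OF m])
    show "AE s in lborel. integrable \<nu> (\<lambda>x. case (s, x) of (s, x) \<Rightarrow> ?f s x)" using ix by simp
    have m2: "(\<lambda>s. \<integral>x. norm (?f s x) \<partial>\<nu>) \<in> borel_measurable lborel"
      using m by (intro \<nu>.borel_measurable_lebesgue_integral) (simp add: split_beta')
    show "integrable lborel (\<lambda>s. \<integral>x. norm (case (s, x) of (s, x) \<Rightarrow> ?f s x) \<partial>\<nu>)"
      unfolding prod.case
    proof (rule Bochner_Integration.integrable_bound[OF _ m2])
      show "integrable lborel (\<lambda>s. indicator {a..b} s * (\<integral>x. \<bar>k x\<bar> \<partial>\<nu>))" by (intro integrable_mult_left) (auto simp: emeasure_lborel_Icc_eq)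
      show "AE s in lborel. norm (\<integral>x. norm (?f s x) \<partial>\<nu>) \<le> norm (indicator {a..b} s * (\<integral>x. \<bar>k x\<bar> \<partial>\<nu>))"
      proof (rule AE_I2)
        fix s
        have "(\<integral>x. norm (?f s x) \<partial>\<nu>) \<le> (\<integral>x. norm (indicator {a..b} s * k x) \<partial>\<nu>)"
          using le'[of s] ix k by (intro integral_mono_AE integrable_norm) auto
        also have "\<dots> = indicator {a..b} s * (\<integral>x. \<bar>k x\<bar> \<partial>\<nu>)" by (simp add: abs_mult)
        finally show "norm (\<integral>x. norm (?f s x) \<partial>\<nu>) \<le> norm (indicator {a..b} s * (\<integral>x. \<bar>k x\<bar> \<partial>\<nu>))" by simp
      qed
    qed
  qed
  show "(\<integral>x. (LINT s:{a..b}|lborel. f s x) \<partial>\<nu>) = (LINT s:{a..b}|lborel. \<integral>x. f s x \<partial>\<nu>)"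
    using Fubini_integral[OF int] by (simp add: set_lebesgue_integral_def)
  show "set_integrable lborel {a..b} (\<lambda>s. \<integral>x. f s x \<partial>\<nu>)"
    using integrable_fst'[OF int] by (simp add: set_integrable_def)
qed

lemma continuous_on_bounded_times:
  fixes g :: "'a::metric_space \<Rightarrow> 'b::metric_space \<Rightarrow> 'c::real_normed_vector"
  assumes "continuous_on (S \<times> UNIV) (\<lambda>(s, x). g s x)" "compact S" "compact K"
  obtains B where "B > 0" "\<forall>s\<in>S. \<forall>x\<in>K. norm (g s x) \<le> B"
proof -
  have "compact ((\<lambda>(s, x). g s x) ` (S \<times> K))"
    using assms by (intro compact_continuous_image compact_Times continuous_on_subset[OF assms(1)]) auto
  then have "bounded ((\<lambda>(s, x). g s x) ` (S \<times> K))" by (rule compact_imp_bounded)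
  then obtain B where "B > 0" "\<forall>y\<in>(\<lambda>(s, x). g s x) ` (S \<times> K). norm y \<le> B"
    unfolding bounded_pos by blast
  then show thesis by (intro that[of B]) auto
qed

lemma borel_measurable_indicator_times:
  fixes g :: "real \<Rightarrow> 'a::euclidean_space \<Rightarrow> 'c::euclidean_space"
  assumes g: "continuous_on ({a..b} \<times> UNIV) (\<lambda>(s, x). g s x)" and \<nu>: "sets \<nu> = sets borel"
  shows "(\<lambda>(s, x). indicator {a..b} s *\<^sub>R g s x) \<in> borel_measurable (lborel \<Otimes>\<^sub>M \<nu>)"
proof -
  have "(\<lambda>p. indicator ({a..b} \<times> UNIV) p *\<^sub>R (\<lambda>(s, x). g s x) p) \<in> borel_measurable borel"
    using g by (intro borel_measurable_continuous_on_indicator) (auto intro!: borel_closed closed_Times)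
  also have "(\<lambda>p. indicator ({a..b} \<times> UNIV) p *\<^sub>R (\<lambda>(s, x). g s x) p) = (\<lambda>(s, x). indicator {a..b} s *\<^sub>R g s x)"
    by (auto simp: indicator_def)
  also have "borel_measurable borel = borel_measurable (lborel \<Otimes>\<^sub>M \<nu>)"
    using \<nu> by (intro measurable_cong_sets) (simp_all add: borel_prod[symmetric] cong: sets_pair_measure_cong)
  finally show ?thesis .
qed

lemma fubini_inner:
  fixes g :: "real \<Rightarrow> real^'n \<Rightarrow> 'e::euclidean_space" and p :: "real^'n \<Rightarrow> 'e"
  assumes \<nu>: "\<nu> \<in> Pc" and g: "continuous_on ({a..b} \<times> UNIV) (\<lambda>(s, x). g s x)"
    and p: "integrable \<nu> p"
  shows "(\<integral>x. p x \<bullet> integral {a..b} (\<lambda>s. g s x) \<partial>\<nu>) = (LINT s:{a..b}|lborel. \<integral>x. p x \<bullet> g s x \<partial>\<nu>)"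
    and "set_integrable lborel {a..b} (\<lambda>s. \<integral>x. p x \<bullet> g s x \<partial>\<nu>)"
proof -
  interpret prob_space \<nu> using \<nu> by (rule Pc_prob)
  obtain B where B: "B > 0" "\<forall>s\<in>{a..b}. \<forall>x\<in>supp \<nu>. norm (g s x) \<le> B"
    using continuous_on_bounded_times[OF g compact_Icc Pc_compact[OF \<nu>]] by blast
  have "(\<lambda>(s, x). p x \<bullet> (indicator {a..b} s *\<^sub>R g s x)) \<in> borel_measurable (lborel \<Otimes>\<^sub>M \<nu>)"
    using borel_measurable_indicator_times[OF g Pc_sets[OF \<nu>]] borel_measurable_integrable[OF p] unfolding split_beta'
    by (intro borel_measurable_inner) simp_all
  then have m: "(\<lambda>(s, x). indicator {a..b} s * (p x \<bullet> g s x)) \<in> borel_measurable (lborel \<Otimes>\<^sub>M \<nu>)" by simp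
  have k: "integrable \<nu> (\<lambda>x. norm (p x) * B)" using p by simp
  have le: "AE x in \<nu>. \<bar>p x \<bullet> g s x\<bar> \<le> norm (p x) * B" if s: "s \<in> {a..b}" for s
    using AE_supp[OF \<nu>]
  proof eventually_elim
    case (elim x)
    have "norm (p x) * norm (g s x) \<le> norm (p x) * B" using B(2) s elim by (intro mult_left_mono) auto
    then show ?case using Cauchy_Schwarz_ineq2[of "p x" "g s x"] by linarith
  qed
  have "p x \<bullet> integral {a..b} (\<lambda>s. g s x) = (LINT s:{a..b}|lborel. p x \<bullet> g s x)" for x
  proof -
    have gx: "continuous_on {a..b} (\<lambda>s. g s x)"
      by (rule continuous_on_pair_compose[OF g continuous_on_id continuous_on_const])
    then have "integral {a..b} (\<lambda>s. p x \<bullet> g s x) = p x \<bullet> integral {a..b} (\<lambda>s. g s x)"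
      using integral_linear[OF integrable_continuous_real[OF gx] bounded_linear_inner_right, of "p x"] by (simp add: comp_def)
    moreover have "(LINT s:{a..b}|lborel. p x \<bullet> g s x) = integral {a..b} (\<lambda>s. p x \<bullet> g s x)"
      by (intro set_borel_integral_eq_integral borel_integrable_atLeastAtMost' continuous_intros gx)
    ultimately show ?thesis by simp
  qed
  then show "(\<integral>x. p x \<bullet> integral {a..b} (\<lambda>s. g s x) \<partial>\<nu>) = (LINT s:{a..b}|lborel. \<integral>x. p x \<bullet> g s x \<partial>\<nu>)"
    using fubini_dominated(1)[OF finite_measure_axioms m k le] by simp
  show "set_integrable lborel {a..b} (\<lambda>s. \<integral>x. p x \<bullet> g s x \<partial>\<nu>)"
    by (rule fubini_dominated(2)[OF finite_measure_axioms m k le])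
qed

subsection \<open>The coupled system\<close>

lemma is_flow_imp_flow_of:
  assumes T: "T > 0" and f: "is_flow F T \<mu> y \<Phi>"
  shows "flow_of (\<lambda>s x. F (\<mu> s) x (y s)) T \<Phi>"
  unfolding flow_of_def
proof (intro allI conjI ballI)
  fix x
  have i: "(\<lambda>s. F (\<mu> s) (\<Phi> s x) (y s)) integrable_on {0..T}"
    using f T unfolding is_flow_def by (intro set_borel_integral_eq_integral(1)) auto
  show eq: "\<Phi> t x = x + integral {0..t} (\<lambda>s. F (\<mu> s) (\<Phi> s x) (y s))" if t: "t \<in> {0..T}" for t
  proof -
    have "set_integrable lborel {0..t} (\<lambda>s. F (\<mu> s) (\<Phi> s x) (y s))"
      and "\<Phi> t x = x + (LINT s:{0..t}|lborel. F (\<mu> s) (\<Phi> s x) (y s))"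
      using f t by (auto simp: is_flow_def)
    then show ?thesis by (simp only: set_borel_integral_eq_integral(2))
  qed
  have "continuous_on {0..T} (\<lambda>t. x + integral {0..t} (\<lambda>s. F (\<mu> s) (\<Phi> s x) (y s)))"
    by (intro continuous_intros indefinite_integral_continuous_1 i)
  then show "continuous_on {0..T} (\<lambda>t. \<Phi> t x)" by (rule continuous_on_eq) (use eq in auto)
qed

locale lip_system =
  fixes F :: "(real^'d) measure \<Rightarrow> real^'d \<Rightarrow> real^'c \<Rightarrow> real^'d" and G :: "(real^'d) measure \<Rightarrow> real^'c \<Rightarrow> real^'c"
    and L T :: real and \<mu>0 :: "(real^'d) measure" and y0 :: "real^'c"
  assumes T: "T > 0" and L: "L > 0" and Pc0: "\<mu>0 \<in> Pc"
    and F_lip: "\<And>\<mu>1 \<mu>2 x1 x2 y1 y2. \<mu>1 \<in> Pc \<Longrightarrow> \<mu>2 \<in> Pc \<Longrightarrow>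
        norm (F \<mu>1 x1 y1 - F \<mu>2 x2 y2) \<le> L * (norm (x1 - x2) + (W2 \<mu>1 \<mu>2 + norm (y1 - y2)))"
    and G_lip: "\<And>\<mu>1 \<mu>2 y1 y2. \<mu>1 \<in> Pc \<Longrightarrow> \<mu>2 \<in> Pc \<Longrightarrow>
        norm (G \<mu>1 y1 - G \<mu>2 y2) \<le> L * (W2 \<mu>1 \<mu>2 + norm (y1 - y2))"
begin

lemma W2_self: "\<nu> \<in> Pc \<Longrightarrow> W2 \<nu> \<nu> = 0"
proof -
  assume \<nu>: "\<nu> \<in> Pc"
  have [measurable]: "(\<lambda>x. x) \<in> borel_measurable \<nu>" using Pc_sets[OF \<nu>] by (rule measurable_ident_sets)
  have "W2 (distr \<nu> borel (\<lambda>x. x)) (distr \<nu> borel (\<lambda>x. x)) \<le> 0"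
    by (rule W2_distr_le[OF Pc_prob[OF \<nu>]]) auto
  moreover have "distr \<nu> borel (\<lambda>x. x) = \<nu>" using Pc_sets[OF \<nu>] by (intro distr_id2) auto
  ultimately show ?thesis using W2_nonneg[of \<nu> \<nu>] by simp
qed

lemma F_cont_x:
  assumes \<nu>: "\<nu> \<in> Pc" shows "continuous_on S (\<lambda>x. F \<nu> x y)"
proof (rule continuous_on_subset[OF lipschitz_on_continuous_on])
  show "L-lipschitz_on UNIV (\<lambda>x. F \<nu> x y)"
    using F_lip[OF \<nu> \<nu>, of _ y _ y] L by (intro lipschitz_onI) (auto simp: dist_norm W2_self[OF \<nu>])
qed simp

text \<open>\<open>\<mu>\<close> is the image of \<open>\<mu>0\<close> under \<open>\<Phi>\<close>, and the controls enter through their primitive \<open>V\<close>.\<close>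

definition lagrangian :: "(real \<Rightarrow> real^'c) \<Rightarrow> (real \<Rightarrow> (real^'d) measure) \<Rightarrow> (real \<Rightarrow> real^'c) \<Rightarrow> (real \<Rightarrow> real^'d \<Rightarrow> real^'d) \<Rightarrow> bool" where
  "lagrangian V \<mu> y \<Phi> \<longleftrightarrow>
     continuous_on ({0..T} \<times> UNIV) (\<lambda>(t, x). \<Phi> t x) \<and> continuous_on {0..T} y \<and>
     (\<forall>t\<in>{0..T}. \<mu> t = distr \<mu>0 borel (\<Phi> t)) \<and>
     (\<forall>t\<in>{0..T}. \<forall>x\<in>supp \<mu>0. \<Phi> t x = x + integral {0..t} (\<lambda>s. F (\<mu> s) (\<Phi> s x) (y s))) \<and>
     (\<forall>t\<in>{0..T}. y t = y0 + integral {0..t} (\<lambda>s. G (\<mu> s) (y s)) + V t)"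

context
  fixes V \<mu> y \<Phi> assumes lag: "lagrangian V \<mu> y \<Phi>"
begin

lemma lag_cont: "continuous_on ({0..T} \<times> UNIV) (\<lambda>(t, x). \<Phi> t x)"
  and lag_y_cont: "continuous_on {0..T} y"
  and lag_distr: "t \<in> {0..T} \<Longrightarrow> \<mu> t = distr \<mu>0 borel (\<Phi> t)"
  and lag_eq: "t \<in> {0..T} \<Longrightarrow> x \<in> supp \<mu>0 \<Longrightarrow> \<Phi> t x = x + integral {0..t} (\<lambda>s. F (\<mu> s) (\<Phi> s x) (y s))"
  and lag_y: "t \<in> {0..T} \<Longrightarrow> y t = y0 + integral {0..t} (\<lambda>s. G (\<mu> s) (y s)) + V t"
  using lag by (auto simp: lagrangian_def)

lemma lag_cont_x: "t \<in> {0..T} \<Longrightarrow> continuous_on UNIV (\<Phi> t)"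
  by (rule continuous_on_pair_compose[OF lag_cont continuous_on_const continuous_on_id])

lemma lag_measurable: "t \<in> {0..T} \<Longrightarrow> \<Phi> t \<in> borel_measurable borel" "t \<in> {0..T} \<Longrightarrow> \<Phi> t \<in> borel_measurable \<mu>0"
  using borel_measurable_continuous_onI[OF lag_cont_x] by (auto simp: measurable_cong_sets[OF Pc_sets[OF Pc0] refl])

lemma lag_Pc: "t \<in> {0..T} \<Longrightarrow> \<mu> t \<in> Pc"
  using lag_distr[of t] Pc_distr(1)[OF Pc0 lag_measurable(1) continuous_on_subset[OF lag_cont_x]] by auto

lemma lag_supp: assumes "t \<in> {0..T}" shows "supp (\<mu> t) \<subseteq> \<Phi> t ` supp \<mu>0"
  unfolding lag_distr[OF assms]
  by (intro Pc_distr(2) Pc0 lag_measurable(1) continuous_on_subset[OF lag_cont_x] assms subset_UNIV)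

lemma lag_bounded:
  obtains R where "R > 0" "\<forall>t\<in>{0..T}. \<forall>x\<in>supp \<mu>0. norm (\<Phi> t x) \<le> R"
    "\<forall>t\<in>{0..T}. supp (\<mu> t) \<subseteq> cball 0 R"
proof -
  obtain R where R: "R > 0" "\<forall>t\<in>{0..T}. \<forall>x\<in>supp \<mu>0. norm (\<Phi> t x) \<le> R"
    using continuous_on_bounded_times[OF lag_cont compact_Icc Pc_compact[OF Pc0]] by blast
  moreover have "supp (\<mu> t) \<subseteq> cball 0 R" if t: "t \<in> {0..T}" for t
    using lag_supp[OF t] R(2) t by fastforce
  ultimately show thesis by (intro that[of R]) auto
qed

lemma lag_W2_cont:
  assumes t: "t \<in> {0..T}" and e: "e > 0"
  shows "\<exists>d>0. \<forall>s\<in>{0..T}. dist s t < d \<longrightarrow> W2 (\<mu> t) (\<mu> s) < e"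
proof -
  interpret prob_space \<mu>0 using Pc0 by (rule Pc_prob)
  have "uniformly_continuous_on ({0..T} \<times> supp \<mu>0) (\<lambda>(t, x). \<Phi> t x)"
    by (intro compact_uniformly_continuous continuous_on_subset[OF lag_cont] compact_Times Pc_compact Pc0) auto
  then obtain d where d: "d > 0" "\<And>p q. p \<in> {0..T} \<times> supp \<mu>0 \<Longrightarrow> q \<in> {0..T} \<times> supp \<mu>0 \<Longrightarrow> dist q p < d \<Longrightarrow>
      dist (case q of (t, x) \<Rightarrow> \<Phi> t x) (case p of (t, x) \<Rightarrow> \<Phi> t x) < e / 2"
    unfolding uniformly_continuous_on_def using e by (metis half_gt_zero)
  show ?thesis
  proof (intro exI[of _ d] conjI ballI impI d)
    fix s assume s: "s \<in> {0..T}" "dist s t < d"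
    have "W2 (distr \<mu>0 borel (\<Phi> t)) (distr \<mu>0 borel (\<Phi> s)) \<le> e / 2"
    proof (rule W2_distr_le[OF prob_space_axioms lag_measurable(2)[OF t] lag_measurable(2)[OF s(1)]])
      show "AE x in \<mu>0. dist (\<Phi> t x) (\<Phi> s x) \<le> e / 2"
        using AE_supp[OF Pc0]
      proof eventually_elim
        case (elim x)
        then show ?case using d(2)[of "(s, x)" "(t, x)"] s t by (simp add: dist_Pair_Pair dist_commute less_imp_le)
      qed
    qed (use e in auto)
    then show "W2 (\<mu> t) (\<mu> s) < e" using e lag_distr t s by simp
  qed
qed

lemma lag_F_cont: "continuous_on ({0..T} \<times> UNIV) (\<lambda>(t, x). F (\<mu> t) x (y t))"
  and lag_G_cont: "continuous_on {0..T} (\<lambda>t. G (\<mu> t) (y t))"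
proof -
  have *: "\<exists>d>0. \<forall>s\<in>{0..T}. dist s t < d \<longrightarrow> L * (W2 (\<mu> t) (\<mu> s) + norm (y t - y s)) < e"
    if t: "t \<in> {0..T}" and e: "e > 0" for t e
  proof -
    have e': "e / (2 * L) > 0" using e L by simp
    obtain d1 where d1: "d1 > 0" "\<And>s. s \<in> {0..T} \<Longrightarrow> dist s t < d1 \<Longrightarrow> W2 (\<mu> t) (\<mu> s) < e / (2 * L)"
      using lag_W2_cont[OF t e'] by blast
    obtain d2 where d2: "d2 > 0" "\<And>s. s \<in> {0..T} \<Longrightarrow> dist s t < d2 \<Longrightarrow> dist (y s) (y t) < e / (2 * L)"
      using lag_y_cont t e' unfolding continuous_on_iff by blast
    show ?thesis
    proof (intro exI[of _ "min d1 d2"] conjI ballI impI)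
      fix s assume s: "s \<in> {0..T}" "dist s t < min d1 d2"
      have "W2 (\<mu> t) (\<mu> s) + norm (y t - y s) < e / (2 * L) + e / (2 * L)"
        using d1(2)[OF s(1)] d2(2)[OF s(1)] s(2) by (intro add_strict_mono) (auto simp: dist_norm norm_minus_commute)
      then show "L * (W2 (\<mu> t) (\<mu> s) + norm (y t - y s)) < e" using L by (simp add: field_simps)
    qed (use d1 d2 in auto)
  qed
  show "continuous_on {0..T} (\<lambda>t. G (\<mu> t) (y t))"
    unfolding continuous_on_iff
  proof (intro ballI allI impI)
    fix t e :: real assume t: "t \<in> {0..T}" and e: "e > 0"
    show "\<exists>d>0. \<forall>s\<in>{0..T}. dist s t < d \<longrightarrow> dist (G (\<mu> s) (y s)) (G (\<mu> t) (y t)) < e"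
      using *[OF t e] G_lip[OF lag_Pc[OF t] lag_Pc, of _ "y t" "y _"] unfolding dist_norm norm_minus_commute[of "G (\<mu> _) (y _)" "G (\<mu> t) (y t)"]
      by (meson le_less_trans)
  qed
  show "continuous_on ({0..T} \<times> UNIV) (\<lambda>(t, x). F (\<mu> t) x (y t))"
    unfolding continuous_on_iff
  proof (intro ballI allI impI)
    fix p :: "real \<times> (real^'d)" and e :: real assume p: "p \<in> {0..T} \<times> UNIV" and e: "e > 0"
    obtain t x where tx: "p = (t, x)" "t \<in> {0..T}" using p by auto
    obtain d where d: "d > 0" "\<And>s. s \<in> {0..T} \<Longrightarrow> dist s t < d \<Longrightarrow> L * (W2 (\<mu> t) (\<mu> s) + norm (y t - y s)) < e / 2"
      using *[OF tx(2), of "e / 2"] e by auto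
    show "\<exists>d>0. \<forall>q\<in>{0..T} \<times> UNIV. dist q p < d \<longrightarrow>
        dist (case q of (t, x) \<Rightarrow> F (\<mu> t) x (y t)) (case p of (t, x) \<Rightarrow> F (\<mu> t) x (y t)) < e"
    proof (intro exI[of _ "min d (e / (2 * L))"] conjI ballI impI)
      fix q :: "real \<times> (real^'d)" assume q: "q \<in> {0..T} \<times> UNIV" "dist q p < min d (e / (2 * L))"
      obtain s x' where sx: "q = (s, x')" "s \<in> {0..T}" using q by auto
      have "dist s t < d" using q(2) dist_fst_le[of q p] by (simp add: tx sx)
      then have 1: "L * (W2 (\<mu> t) (\<mu> s) + norm (y t - y s)) < e / 2" by (rule d(2)[OF sx(2)])
      have "norm (x - x') < e / (2 * L)" using q(2) dist_snd_le[of q p] by (simp add: tx sx dist_norm norm_minus_commute)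
      then have 2: "L * norm (x - x') < e / 2" using L by (simp add: field_simps)
      have "norm (F (\<mu> t) x (y t) - F (\<mu> s) x' (y s)) < e"
        using 1 2 F_lip[OF lag_Pc[OF tx(2)] lag_Pc[OF sx(2)], of x "y t" x' "y s"] by (simp add: distrib_left)
      then show "dist (case q of (t, x) \<Rightarrow> F (\<mu> t) x (y t)) (case p of (t, x) \<Rightarrow> F (\<mu> t) x (y t)) < e"
        by (simp add: tx sx dist_norm norm_minus_commute)
    qed (use d e L in auto)
  qed
qed

lemma lag_F_flow_cont: "continuous_on ({0..T} \<times> UNIV) (\<lambda>(t, x). F (\<mu> t) (\<Phi> t x) (y t))"
proof -
  have "continuous_on ({0..T} \<times> UNIV) (\<lambda>p. F (\<mu> (fst p)) (\<Phi> (fst p) (snd p)) (y (fst p)))"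
    by (rule continuous_on_pair_compose[OF lag_F_cont]) (use lag_cont in \<open>auto simp: split_beta intro: continuous_intros\<close>)
  then show ?thesis by (simp add: split_beta)
qed

lemma lag_F_flow_cont_t: "continuous_on {0..T} (\<lambda>t. F (\<mu> t) (\<Phi> t x) (y t))"
  by (rule continuous_on_pair_compose[OF lag_F_flow_cont continuous_on_id continuous_on_const]) simp

text \<open>The weak equation is the chain rule along each trajectory, integrated over the starting
  points, with the two integrals exchanged. The trajectories are known to solve the equation from
  \<open>supp \<mu>0\<close>, so the comparison of integrands is almost everywhere.\<close>

lemma lag_is_solution:
  assumes u: "\<And>t. t \<in> {0..T} \<Longrightarrow> set_integrable lborel {0..t} u \<and> V t = (LINT s:{0..t}|lborel. u s)"
  shows "is_solution F G \<mu>0 y0 T u \<mu> y"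
  unfolding is_solution_def
proof (intro conjI ballI allI impI)
  show "\<mu> t \<in> Pc" if "t \<in> {0..T}" for t using that by (rule lag_Pc)
  obtain R where "\<forall>t\<in>{0..T}. supp (\<mu> t) \<subseteq> cball 0 R" by (rule lag_bounded)
  then show "\<exists>K. compact K \<and> (\<forall>t\<in>{0..T}. supp (\<mu> t) \<subseteq> K)" by (intro exI[of _ "cball 0 R"]) auto
next
  fix t assume t: "t \<in> {0..T}"
  have "continuous_on {0..t} (\<lambda>s. G (\<mu> s) (y s))" using t by (intro continuous_on_subset[OF lag_G_cont]) auto
  then have G: "set_integrable lborel {0..t} (\<lambda>s. G (\<mu> s) (y s))" by (rule borel_integrable_atLeastAtMost')
  show "set_integrable lborel {0..t} (\<lambda>s. G (\<mu> s) (y s) + u s)"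
    using G u[OF t] by (intro set_integral_add) auto
  show "y t = y0 + (LINT s:{0..t}|lborel. G (\<mu> s) (y s) + u s)"
    using lag_y[OF t] u[OF t] G by (simp add: set_integral_add(2) set_borel_integral_eq_integral(2))
next
  fix \<phi> :: "real^'d \<Rightarrow> real" and t assume \<phi>: "test_fun \<phi>" and t: "t \<in> {0..T}"
  have C\<phi>: "Ck k \<phi>" for k using \<phi> by (simp add: test_fun_def)
  have \<phi>c: "continuous_on UNIV \<phi>" using C\<phi>[of 0] by simp
  define h where "h s x = grad \<phi> (\<Phi> s x) \<bullet> F (\<mu> s) (\<Phi> s x) (y s)" for s x
  have "continuous_on ({0..T} \<times> UNIV) (\<lambda>(s, x). h s x)"
    unfolding h_def split_beta using lag_F_flow_cont lag_cont
    by (intro continuous_intros continuous_on_compose2[OF continuous_grad[OF C\<phi>]]) (auto simp: split_beta)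
  then have hc: "continuous_on ({0..t} \<times> UNIV) (\<lambda>(s, x). h s x)"
    by (rule continuous_on_subset) (use t in auto)
  have hx: "continuous_on {0..t} (\<lambda>s. h s x)" for x
    by (rule continuous_on_pair_compose[OF hc continuous_on_id continuous_on_const])
  have heq: "(\<integral>x. h s x \<partial>\<mu>0) = (\<integral>x. grad \<phi> x \<bullet> F (\<mu> s) x (y s) \<partial>\<mu> s)" if s: "s \<in> {0..T}" for s
  proof -
    have "continuous_on UNIV (\<lambda>x. grad \<phi> x \<bullet> F (\<mu> s) x (y s))"
      by (intro continuous_intros continuous_grad[OF C\<phi>] F_cont_x lag_Pc s)
    then have "(\<lambda>x. grad \<phi> x \<bullet> F (\<mu> s) x (y s)) \<in> borel_measurable borel" by (rule borel_measurable_continuous_onI)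
    then have "(\<integral>x. grad \<phi> x \<bullet> F (\<mu> s) x (y s) \<partial>distr \<mu>0 borel (\<Phi> s)) = (\<integral>x. h s x \<partial>\<mu>0)"
      unfolding h_def by (intro integral_distr lag_measurable s)
    then show ?thesis by (simp add: lag_distr[OF s, symmetric])
  qed
  have hint: "set_integrable lborel {0..t} (\<lambda>s. \<integral>x. h s x \<partial>\<mu>0)"
    and fub: "(\<integral>x. integral {0..t} (\<lambda>s. h s x) \<partial>\<mu>0) = (LINT s:{0..t}|lborel. \<integral>x. h s x \<partial>\<mu>0)"
    using fubini_inner[OF Pc0 hc, of "\<lambda>_. 1"] integrable_continuous_Pc[OF Pc0 continuous_on_const] by auto
  have cong: "s \<in> {0..t} \<Longrightarrow> (\<integral>x. h s x \<partial>\<mu>0) = (\<integral>x. grad \<phi> x \<bullet> F (\<mu> s) x (y s) \<partial>\<mu> s)" for s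
    using t by (intro heq) auto
  show "set_integrable lborel {0..t} (\<lambda>s. \<integral>x. grad \<phi> x \<bullet> F (\<mu> s) x (y s) \<partial>\<mu> s)"
    using hint by (subst (asm) set_integrable_cong[OF refl refl cong]) auto
  have ftc: "\<phi> (\<Phi> t x) = \<phi> x + integral {0..t} (\<lambda>s. h s x)" if x: "x \<in> supp \<mu>0" for x
  proof -
    have "((\<lambda>s. h s x) has_integral \<phi> (\<Phi> t x) - \<phi> (\<Phi> 0 x)) {0..t}"
    proof (rule fundamental_theorem_of_calculus)
      fix s assume s: "s \<in> {0..t}"
      then have sT: "s \<in> {0..T}" using t by auto
      have "((\<lambda>s. integral {0..s} (\<lambda>s. F (\<mu> s) (\<Phi> s x) (y s))) has_vector_derivative F (\<mu> s) (\<Phi> s x) (y s)) (at s within {0..T})"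
        by (rule integral_has_vector_derivative[OF lag_F_flow_cont_t sT])
      then have "((\<lambda>s. x + integral {0..s} (\<lambda>s. F (\<mu> s) (\<Phi> s x) (y s))) has_vector_derivative 0 + F (\<mu> s) (\<Phi> s x) (y s)) (at s within {0..T})"
        by (intro has_vector_derivative_add has_vector_derivative_const)
      then have "((\<lambda>s. \<Phi> s x) has_vector_derivative 0 + F (\<mu> s) (\<Phi> s x) (y s)) (at s within {0..T})"
        by (rule has_vector_derivative_transform[OF sT, rotated]) (use lag_eq x in auto)
      then have "((\<lambda>s. \<Phi> s x) has_vector_derivative F (\<mu> s) (\<Phi> s x) (y s)) (at s within {0..t})"
        using t by (auto intro: has_vector_derivative_within_subset)
      then have d: "((\<lambda>s. \<Phi> s x) has_derivative (\<lambda>h. h *\<^sub>R F (\<mu> s) (\<Phi> s x) (y s))) (at s within {0..t})"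
        by (simp add: has_vector_derivative_def)
      have "((\<lambda>s. \<phi> (\<Phi> s x)) has_derivative (\<lambda>h'. grad \<phi> (\<Phi> s x) \<bullet> (h' *\<^sub>R F (\<mu> s) (\<Phi> s x) (y s)))) (at s within {0..t})"
        by (rule has_derivative_compose[OF d Ck_has_grad[OF C\<phi>]])
      then show "((\<lambda>s. \<phi> (\<Phi> s x)) has_vector_derivative h s x) (at s within {0..t})"
        by (simp add: has_vector_derivative_def h_def)
    qed (use t in auto)
    moreover have "\<Phi> 0 x = x" using lag_eq[of 0 x] x T by simp
    ultimately show ?thesis by (simp add: integral_unique)
  qed
  have i\<phi>: "integrable \<mu>0 \<phi>" by (rule integrable_continuous_Pc[OF Pc0 \<phi>c])
  have i\<phi>\<Phi>: "integrable \<mu>0 (\<lambda>x. \<phi> (\<Phi> t x))"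
    by (intro integrable_continuous_Pc[OF Pc0] continuous_on_compose2[OF \<phi>c lag_cont_x[OF t]]) auto
  have ih: "integrable \<mu>0 (\<lambda>x. integral {0..t} (\<lambda>s. h s x))"
  proof (rule integrable_continuous_Pc[OF Pc0])
    have "continuous_on (UNIV \<times> cbox 0 t) (\<lambda>(x, s). h s x)"
      unfolding split_beta by (rule continuous_on_pair_compose[OF hc]) (auto intro: continuous_intros)
    then show "continuous_on UNIV (\<lambda>x. integral {0..t} (\<lambda>s. h s x))"
      using integral_continuous_on_param[of UNIV 0 t "\<lambda>x s. h s x"] by simp
  qed
  have "(\<integral>x. \<phi> x \<partial>\<mu> t) = (\<integral>x. \<phi> (\<Phi> t x) \<partial>\<mu>0)"
    unfolding lag_distr[OF t] using lag_measurable(2)[OF t] \<phi>c by (intro integral_distr borel_measurable_continuous_onI)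
  also have "\<dots> = (\<integral>x. \<phi> x + integral {0..t} (\<lambda>s. h s x) \<partial>\<mu>0)"
    using AE_supp[OF Pc0] ftc i\<phi> i\<phi>\<Phi> ih by (intro integral_cong_AE) (auto elim!: eventually_mono)
  also have "\<dots> = (\<integral>x. \<phi> x \<partial>\<mu>0) + (LINT s:{0..t}|lborel. \<integral>x. h s x \<partial>\<mu>0)" using i\<phi> ih by (simp add: fub)
  also have "(LINT s:{0..t}|lborel. \<integral>x. h s x \<partial>\<mu>0) = (LINT s:{0..t}|lborel. \<integral>x. grad \<phi> x \<bullet> F (\<mu> s) x (y s) \<partial>\<mu> s)"
    using cong by (intro set_lebesgue_integral_cong) auto
  finally show "(\<integral>x. \<phi> x \<partial>\<mu> t) = (\<integral>x. \<phi> x \<partial>\<mu>0) + (LINT s:{0..t}|lborel. \<integral>x. grad \<phi> x \<bullet> F (\<mu> s) x (y s) \<partial>\<mu> s)" .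
qed

end

lemma solution_lipschitz_path:
  assumes sol: "is_solution F G \<mu>0 y0 T u \<mu> y"
  obtains R where "lipschitz_weak_path \<mu> (\<lambda>s x. F (\<mu> s) x (y s)) \<mu>0 T R L" "continuous_on {0..T} y"
proof -
  obtain K where K: "compact K" "\<And>t. t \<in> {0..T} \<Longrightarrow> supp (\<mu> t) \<subseteq> K" using sol unfolding is_solution_def by blast
  obtain R1 where R1: "\<And>x. x \<in> K \<Longrightarrow> norm x \<le> R1" using compact_imp_bounded[OF K(1)] by (auto simp: bounded_iff)
  obtain R2 where R2: "supp \<mu>0 \<subseteq> cball 0 R2" using Pc_bounded[OF Pc0] by blast
  define R where "R = max R1 R2"
  have Pc: "\<mu> t \<in> Pc" if "t \<in> {0..T}" for t using sol that by (simp add: is_solution_def)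
  interpret w: weak_path \<mu> "\<lambda>s x. F (\<mu> s) x (y s)" \<mu>0 T R
  proof
    show "supp (\<mu> t) \<subseteq> cball 0 R" if "t \<in> {0..T}" for t using K(2)[OF that] R1 by (force simp: R_def)
    show "supp \<mu>0 \<subseteq> cball 0 R" using R2 by (force simp: R_def)
    show "continuous_on UNIV (\<lambda>x. F (\<mu> t) x (y t))" if "t \<in> {0..T}" for t by (intro F_cont_x Pc that)
  qed (use sol T Pc0 Pc in \<open>auto simp: is_solution_def\<close>)
  have i: "(\<lambda>s. G (\<mu> s) (y s) + u s) integrable_on {0..T}"
    using sol T unfolding is_solution_def by (intro set_borel_integral_eq_integral(1)) auto
  have yeq: "y t = y0 + integral {0..t} (\<lambda>s. G (\<mu> s) (y s) + u s)" if "t \<in> {0..T}" for t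
  proof -
    have "set_integrable lborel {0..t} (\<lambda>s. G (\<mu> s) (y s) + u s)"
      and "y t = y0 + (LINT s:{0..t}|lborel. G (\<mu> s) (y s) + u s)"
      using sol that by (auto simp: is_solution_def)
    then show ?thesis by (simp only: set_borel_integral_eq_integral(2))
  qed
  have "continuous_on {0..T} (\<lambda>t. y0 + integral {0..t} (\<lambda>s. G (\<mu> s) (y s) + u s))"
    by (intro continuous_intros indefinite_integral_continuous_1 i)
  then have yc: "continuous_on {0..T} y" by (rule continuous_on_eq) (use yeq in auto)
  have "lipschitz_field (\<lambda>s x. F (\<mu> s) x (y s)) T L"
  proof
    show "norm (F (\<mu> t) x1 (y t) - F (\<mu> t) x2 (y t)) \<le> L * norm (x1 - x2)" if "t \<in> {0..T}" for t x1 x2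
      using F_lip[OF Pc[OF that] Pc[OF that], of x1 "y t" x2 "y t"] W2_self[OF Pc[OF that]] by simp
    show "continuous_on ({0..T} \<times> UNIV) (\<lambda>(t, x). F (\<mu> t) x (y t))"
      unfolding continuous_on_sequentially
    proof (intro allI ballI impI, elim conjE)
      fix f :: "nat \<Rightarrow> real \<times> (real^'d)" and p assume p: "p \<in> {0..T} \<times> UNIV" and f: "\<forall>n. f n \<in> {0..T} \<times> UNIV" "f \<longlonglongrightarrow> p"
      obtain t x where tx: "p = (t, x)" "t \<in> {0..T}" using p by auto
      have fT: "fst (f n) \<in> {0..T}" for n using f(1) by (auto simp: mem_Times_iff)
      have f1: "(\<lambda>n. fst (f n)) \<longlonglongrightarrow> t" "(\<lambda>n. snd (f n)) \<longlonglongrightarrow> x" using tendsto_fst[OF f(2)] tendsto_snd[OF f(2)] by (simp_all add: tx)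
      have W: "(\<lambda>n. W2 (\<mu> t) (\<mu> (fst (f n)))) \<longlonglongrightarrow> 0" by (rule w.W2_tendsto[OF tx(2) fT f1(1)])
      have Y: "(\<lambda>n. y (fst (f n))) \<longlonglongrightarrow> y t" using continuous_on_tendsto_compose[OF yc f1(1) tx(2)] fT by simp
      have "(\<lambda>n. L * (norm (x - snd (f n)) + (W2 (\<mu> t) (\<mu> (fst (f n))) + norm (y t - y (fst (f n)))))) \<longlonglongrightarrow> L * (norm (x - x) + (0 + norm (y t - y t)))"
        by (intro tendsto_intros W Y f1)
      then have lim: "(\<lambda>n. L * (norm (x - snd (f n)) + (W2 (\<mu> t) (\<mu> (fst (f n))) + norm (y t - y (fst (f n)))))) \<longlonglongrightarrow> 0" by simp
      have "(\<lambda>n. F (\<mu> t) x (y t) - F (\<mu> (fst (f n))) (snd (f n)) (y (fst (f n)))) \<longlonglongrightarrow> 0"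
        by (rule Lim_null_comparison[OF always_eventually lim]) (intro allI F_lip Pc tx fT)
      then have "(\<lambda>n. F (\<mu> (fst (f n))) (snd (f n)) (y (fst (f n)))) \<longlonglongrightarrow> F (\<mu> t) x (y t)"
        using tendsto_diff[OF tendsto_const, of _ 0 sequentially "F (\<mu> t) x (y t)"] by fastforce
      then show "((\<lambda>(t, x). F (\<mu> t) x (y t)) \<circ> f) \<longlonglongrightarrow> (case p of (t, x) \<Rightarrow> F (\<mu> t) x (y t))"
        by (simp add: tx comp_def split_beta)
    qed
  qed (use T L in auto)
  then have "lipschitz_weak_path \<mu> (\<lambda>s x. F (\<mu> s) x (y s)) \<mu>0 T R L"
    by (intro lipschitz_weak_path.intro w.weak_path_axioms)
  then show thesis using yc by (rule that)
qed

lemma solution_flow_exists: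
  assumes sol: "is_solution F G \<mu>0 y0 T u \<mu> y"
  obtains \<Phi> where "flow_of (\<lambda>s x. F (\<mu> s) x (y s)) T \<Phi>"
proof -
  obtain R where "lipschitz_weak_path \<mu> (\<lambda>s x. F (\<mu> s) x (y s)) \<mu>0 T R L" using solution_lipschitz_path[OF sol] by blast
  then interpret lipschitz_weak_path \<mu> "\<lambda>s x. F (\<mu> s) x (y s)" \<mu>0 T R L .
  show thesis using flow_exists that by blast
qed

lemma solution_lagrangian:
  assumes sol: "is_solution F G \<mu>0 y0 T u \<mu> y"
    and u: "\<And>t. t \<in> {0..T} \<Longrightarrow> set_integrable lborel {0..t} u \<and> V t = (LINT s:{0..t}|lborel. u s)"
    and \<Phi>: "flow_of (\<lambda>s x. F (\<mu> s) x (y s)) T \<Phi>"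
  shows "lagrangian V \<mu> y \<Phi>"
proof -
  obtain R where R: "lipschitz_weak_path \<mu> (\<lambda>s x. F (\<mu> s) x (y s)) \<mu>0 T R L" and yc: "continuous_on {0..T} y"
    using solution_lipschitz_path[OF sol] by blast
  interpret lipschitz_weak_path \<mu> "\<lambda>s x. F (\<mu> s) x (y s)" \<mu>0 T R L by (rule R)
  show ?thesis
    unfolding lagrangian_def
  proof (intro conjI ballI flow_cont[OF \<Phi>] yc representation[OF \<Phi>])
    show "\<Phi> t x = x + integral {0..t} (\<lambda>s. F (\<mu> s) (\<Phi> s x) (y s))" if "t \<in> {0..T}" for t x
      using \<Phi> that by (simp add: flow_of_def)
    fix t assume t: "t \<in> {0..T}"
    have Gu: "set_integrable lborel {0..t} (\<lambda>s. G (\<mu> s) (y s) + u s)"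
      and y: "y t = y0 + (LINT s:{0..t}|lborel. G (\<mu> s) (y s) + u s)"
      using sol t by (auto simp: is_solution_def)
    have Gi: "set_integrable lborel {0..t} (\<lambda>s. G (\<mu> s) (y s))"
      using set_integral_diff(1)[OF Gu, of u] u[OF t] by simp
    show "y t = y0 + integral {0..t} (\<lambda>s. G (\<mu> s) (y s)) + V t"
      using y u[OF t] Gi by (simp add: set_integral_add(2) set_borel_integral_eq_integral(2))
  qed
qed

end

subsection \<open>Weak compactness of the admissible controls\<close>

lemma borel_measurable_vec_component [measurable]:
  fixes f :: "'a \<Rightarrow> real^'n"
  assumes "f \<in> borel_measurable M"
  shows "(\<lambda>x. f x $ i) \<in> borel_measurable M"
proof -
  have "(\<lambda>y :: real^'n. y $ i) \<in> borel_measurable borel"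
    by (intro borel_measurable_continuous_onI linear_continuous_on bounded_linear_vec_nth)
  then show ?thesis using assms by (rule measurable_compose[rotated])
qed

text \<open>Lebesgue measure on the time interval normalised to mass 1, so that the graph of a
  control carries a probability measure to which \<open>prokhorov_skorohod\<close> applies.\<close>

definition unif :: "real \<Rightarrow> real measure" where
  "unif T = density lborel (\<lambda>t. ennreal (indicator {0..T} t / T))"

lemma sets_unif [simp, measurable_cong]: "sets (unif T) = sets borel"
  by (simp add: unif_def)

lemma prob_space_unif: assumes "T > 0" shows "prob_space (unif T)"
proof
  have "emeasure (unif T) UNIV = (\<integral>\<^sup>+t. ennreal (1 / T) * indicator {0..T} t \<partial>lborel)"
    using assms by (subst unif_def, subst emeasure_density) (auto intro!: nn_integral_cong simp: indicator_def)
  also have "\<dots> = ennreal (1 / T) * ennreal T"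
    using assms by (subst nn_integral_cmult_indicator) auto
  also have "\<dots> = 1" using assms by (simp add: ennreal_mult[symmetric])
  finally show "emeasure (unif T) (space (unif T)) = 1" by (simp add: unif_def)
qed

lemma integral_unif:
  fixes f :: "real \<Rightarrow> real"
  assumes "T > 0" and [measurable]: "f \<in> borel_measurable borel"
  shows "(\<integral>t. f t \<partial>unif T) = (LINT t:{0..T}|lborel. f t) / T"
  unfolding unif_def set_lebesgue_integral_def using assms(1) by (subst integral_real_density) auto

lemma AE_unif: "T > 0 \<Longrightarrow> (AE t in unif T. P t) \<longleftrightarrow> (AE t in lborel. t \<in> {0..T} \<longrightarrow> P t)"
  unfolding unif_def by (subst AE_density) (auto simp: ennreal_zero_less_divide indicator_def intro!: AE_cong)

lemma admissible_bounded:
  assumes "compact U" obtains M where "M > 0" "\<And>x. x \<in> U \<Longrightarrow> norm x \<le> M"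
  using compact_imp_bounded[OF assms] by (auto simp: bounded_pos)

lemma admissible_integrable:
  assumes U: "compact U" and u: "admissible U T u"
  shows "set_integrable lborel {0..T} u"
proof -
  obtain M where M: "M > 0" "\<And>x. x \<in> U \<Longrightarrow> norm x \<le> M" using U by (rule admissible_bounded) blast
  show ?thesis
    unfolding set_integrable_def
  proof (rule Bochner_Integration.integrable_bound)
    show "integrable lborel (\<lambda>t. indicator {0..T} t * M)" by (intro integrable_mult_left) (auto simp: emeasure_lborel_Icc_eq)
    show "(\<lambda>t. indicator {0..T} t *\<^sub>R u t) \<in> borel_measurable lborel" using u by (simp add: admissible_def set_borel_measurable_def)
    show "AE t in lborel. norm (indicator {0..T} t *\<^sub>R u t) \<le> norm (indicator {0..T} t * M)"
      using conjunct2[OF u[unfolded admissible_def]]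
    proof eventually_elim
      case (elim t) then show ?case using M by (auto simp: indicator_def)
    qed
  qed
qed

lemma primitive_lipschitz:
  assumes U: "compact U" and M: "\<And>x. x \<in> U \<Longrightarrow> norm x \<le> M" and u: "admissible U T u"
    and st: "s \<in> {0..T}" "t \<in> {0..T}"
  shows "norm ((LINT r:{0..t}|lborel. u r) - (LINT r:{0..s}|lborel. u r)) \<le> M * \<bar>t - s\<bar>"
proof -
  have *: "norm ((LINT r:{0..t}|lborel. u r) - (LINT r:{0..s}|lborel. u r)) \<le> M * (t - s)" if "0 \<le> s" "s \<le> t" "t \<le> T" for s t
  proof -
    have i: "set_integrable lborel A u" if "A \<subseteq> {0..T}" "A \<in> sets borel" for A
      using set_integrable_subset[OF admissible_integrable[OF U u]] that by auto
    have "{0..t} = {0..s} \<union> {s<..t}" using \<open>0 \<le> s\<close> \<open>s \<le> t\<close> by auto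
    then have "(LINT r:{0..t}|lborel. u r) = (LINT r:{0..s}|lborel. u r) + (LINT r:{s<..t}|lborel. u r)"
      using that by (simp only:) (intro set_integral_Un i, auto)
    moreover have "norm (LINT r:{s<..t}|lborel. u r) \<le> (LINT r:{s<..t}|lborel. M)"
      unfolding set_lebesgue_integral_def
    proof -
      have 1: "integrable lborel (\<lambda>r. indicator {s<..t} r *\<^sub>R u r)" 
      proof -
        have "{s<..t} \<subseteq> {0..T}" using that by auto
        then show ?thesis using i[of "{s<..t}"] by (simp add: set_integrable_def)
      qed
      have 2: "integrable lborel (\<lambda>r. indicator {s<..t} r *\<^sub>R M)" using that by (intro integrable_scaleR_left) (auto simp: emeasure_lborel_Ioc)
      have "AE r in lborel. norm (indicator {s<..t} r *\<^sub>R u r) \<le> indicator {s<..t} r *\<^sub>R M"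
        using conjunct2[OF u[unfolded admissible_def]]
      proof eventually_elim
        case (elim r) then show ?case using M that by (auto simp: indicator_def)
      qed
      then have "(LBINT r. norm (indicator {s<..t} r *\<^sub>R u r)) \<le> (LBINT r. indicator {s<..t} r *\<^sub>R M)"
        by (intro integral_mono_AE integrable_norm 1 2)
      then show "norm (LBINT r. indicator {s<..t} r *\<^sub>R u r) \<le> (LBINT r. indicator {s<..t} r *\<^sub>R M)"
        using integral_norm_bound[of lborel "\<lambda>r. indicator {s<..t} r *\<^sub>R u r"] by linarith
    qed
    moreover have "(LINT r:{s<..t}|lborel. M) = M * (t - s)" using that by (simp add: set_lebesgue_integral_def)
    ultimately show ?thesis by simp
  qed
  show ?thesis
  proof (cases "s \<le> t")
    case True then show ?thesis using *[of s t] st by auto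
  next
    case False then show ?thesis using *[of t s] st by (auto simp: norm_minus_commute)
  qed
qed

text \<open>The limit control is the barycentre of the limiting Young measure, i.e. the conditional expectation
  of the second coordinate given the first one in the limit of the graph measures.\<close>

theorem control_compactness:
  fixes U :: "(real^'c) set"
  assumes T: "T > 0" and U: "compact U" "convex U" and u: "\<And>n. admissible U T (u n)"
  obtains r v where "strict_mono (r :: nat \<Rightarrow> nat)" "admissible U T v"
    "\<forall>t\<in>{0..T}. (\<lambda>n. LINT s:{0..t}|lborel. u (r n) s) \<longlonglongrightarrow> (LINT s:{0..t}|lborel. v s)"
proof -
  interpret unif: prob_space "unif T" using T by (rule prob_space_unif)
  obtain M where M: "M > 0" "\<And>x. x \<in> U \<Longrightarrow> norm x \<le> M" using U(1) by (rule admissible_bounded) blast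
  \<comment> \<open>A control is measurable on \<open>[0, T]\<close> only; its truncation is
    measurable on the whole line.\<close>
  define w where "w n t = indicator {0..T} t *\<^sub>R u n t" for n t
  have w [measurable]: "w n \<in> borel_measurable borel" for n
    using u[of n] by (simp add: w_def[abs_def] admissible_def set_borel_measurable_def)
  have wU: "AE t in unif T. t \<in> {0..T} \<and> w n t \<in> U" for n
    unfolding AE_unif[OF T] using conjunct2[OF u[of n, unfolded admissible_def]]
    by eventually_elim (simp add: w_def)
  define \<gamma> where "\<gamma> n = distr (unif T) borel (\<lambda>t. (t, w n t))" for n
  have "AE x in \<gamma> n. norm x \<le> T + M" for n
    unfolding \<gamma>_def
  proof (subst AE_distr_iff)
    show "AE t in unif T. norm (t, w n t) \<le> T + M"
      using wU[of n]
    proof eventually_elim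
      case (elim t)
      then show ?case using norm_Pair_le[of t "w n t"] M(2)[of "w n t"] by auto
    qed
  qed auto
  moreover have "prob_space (\<gamma> n)" for n unfolding \<gamma>_def by (rule unif.prob_space_distr) measurable
  moreover have "sets (\<gamma> n) = sets borel" for n by (simp add: \<gamma>_def)
  ultimately have "\<exists>r (\<Omega> :: real measure) Z Z'. strict_mono (r :: nat \<Rightarrow> nat) \<and> prob_space \<Omega> \<and>
    (\<forall>n. Z n \<in> borel_measurable \<Omega>) \<and> (\<forall>n. distr \<Omega> borel (Z n) = \<gamma> (r n)) \<and> Z' \<in> borel_measurable \<Omega> \<and>
    (\<forall>\<omega>\<in>space \<Omega>. (\<lambda>n. Z n \<omega>) \<longlonglongrightarrow> Z' \<omega>)"
    by (intro prokhorov_skorohod[of \<gamma> "T + M"])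
  then obtain r and \<Omega> :: "real measure" and Z Z' where r: "strict_mono (r :: nat \<Rightarrow> nat)" and \<Omega>: "prob_space \<Omega>"
    and Zm: "\<forall>n. Z n \<in> borel_measurable \<Omega>" and Z: "\<forall>n. distr \<Omega> borel (Z n) = \<gamma> (r n)"
    and Z'm: "Z' \<in> borel_measurable \<Omega>" and Zlim: "\<forall>\<omega>\<in>space \<Omega>. (\<lambda>n. Z n \<omega>) \<longlonglongrightarrow> Z' \<omega>"
    by blast
  interpret \<Omega>: prob_space \<Omega> by (rule \<Omega>)
  have [measurable]: "Z n \<in> borel_measurable \<Omega>" "Z' \<in> borel_measurable \<Omega>" for n using Zm Z'm by auto
  have push: "(\<integral>\<omega>. f (Z n \<omega>) \<partial>\<Omega>) = (LINT t:{0..T}|lborel. f (t, w (r n) t)) / T"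
    if [measurable]: "f \<in> borel_measurable borel" for f :: "real \<times> (real^'c) \<Rightarrow> real" and n
  proof -
    have "(\<integral>\<omega>. f (Z n \<omega>) \<partial>\<Omega>) = (\<integral>z. f z \<partial>\<gamma> (r n))" unfolding Z[rule_format, symmetric] by (subst integral_distr) auto
    also have "\<dots> = (\<integral>t. f (t, w (r n) t) \<partial>unif T)" unfolding \<gamma>_def by (subst integral_distr) auto
    also have "\<dots> = (LINT t:{0..T}|lborel. f (t, w (r n) t)) / T" by (rule integral_unif[OF T]) measurable
    finally show ?thesis .
  qed
  have ZU: "AE \<omega> in \<Omega>. \<forall>n. snd (Z n \<omega>) \<in> U"
    unfolding AE_all_countable
  proof
    fix n
    have [measurable]: "U \<in> sets borel" using U(1) by (intro borel_closed compact_imp_closed)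
    have sU: "{z \<in> space borel. snd z \<in> U} \<in> sets borel" by measurable
    have "AE z in distr \<Omega> borel (Z n). snd z \<in> U"
      unfolding Z[rule_format] \<gamma>_def using wU[of "r n"] sU
      by (subst AE_distr_iff) (auto elim!: eventually_mono)
    then show "AE \<omega> in \<Omega>. snd (Z n \<omega>) \<in> U" using sU by (subst (asm) AE_distr_iff) auto
  qed
  define X where "X \<omega> = fst (Z' \<omega>)" for \<omega>
  define Y where "Y \<omega> = snd (Z' \<omega>)" for \<omega>
  have [measurable]: "X \<in> borel_measurable \<Omega>" "Y \<in> borel_measurable \<Omega>" unfolding X_def Y_def by measurable
  have YU: "AE \<omega> in \<Omega>. Y \<omega> \<in> U"
    using ZU AE_space
  proof eventually_elim
    case (elim \<omega>)
    then show ?case unfolding Y_def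
      using closed_sequentially[OF compact_imp_closed[OF U(1)], of "\<lambda>n. snd (Z n \<omega>)"] tendsto_snd[OF Zlim[rule_format]] by auto
  qed
  have X: "distr \<Omega> borel X = unif T"
  proof (rule measure_eq_continuous)
    show "finite_measure (distr \<Omega> borel X)" by (rule \<Omega>.finite_measure_distr) measurable
    show "finite_measure (unif T)" by unfold_locales
    fix f :: "real \<Rightarrow> real" assume f: "continuous_on UNIV f" "\<And>x. 0 \<le> f x \<and> f x \<le> 1"
    have [measurable]: "f \<in> borel_measurable borel" using f(1) by (rule borel_measurable_continuous_onI)
    have "(\<lambda>n. \<integral>\<omega>. f (fst (Z n \<omega>)) \<partial>\<Omega>) \<longlonglongrightarrow> (\<integral>\<omega>. f (X \<omega>) \<partial>\<Omega>)"
    proof (rule integral_dominated_convergence[where w="\<lambda>_. 1"])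
      show "AE \<omega> in \<Omega>. (\<lambda>n. f (fst (Z n \<omega>))) \<longlonglongrightarrow> f (X \<omega>)"
        unfolding X_def using f(1) Zlim
        by (intro AE_I2) (auto intro!: continuous_on_tendsto_compose[of UNIV f] tendsto_fst)
    qed (use f(2) in auto)
    moreover have "(\<integral>\<omega>. f (fst (Z n \<omega>)) \<partial>\<Omega>) = (\<integral>t. f t \<partial>unif T)" for n
      using push[of "\<lambda>z. f (fst z)" n] by (simp add: integral_unif[OF T])
    ultimately have "(\<integral>t. f t \<partial>unif T) = (\<integral>\<omega>. f (X \<omega>) \<partial>\<Omega>)" by (simp add: LIMSEQ_const_iff)
    then show "(\<integral>x. f x \<partial>distr \<Omega> borel X) = (\<integral>x. f x \<partial>unif T)" by (subst integral_distr) auto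
  qed auto
  have "\<exists>v. v \<in> borel_measurable borel \<and> integrable (unif T) v \<and>
      (\<forall>A\<in>sets borel. (\<integral>\<omega>. indicator A (X \<omega>) * (Y \<omega> $ i) \<partial>\<Omega>) = (\<integral>t. indicator A t * v t \<partial>unif T))" for i
  proof -
    \<comment> \<open>The density of this measure with respect to the uniform law is the conditional
      expectation of \<open>Y $ i + M\<close> given \<open>X\<close>. The shift by \<open>M\<close>
      makes the weight nonnegative and is undone in \<open>v\<close>.\<close>
    define N where "N = distr (density \<Omega> (\<lambda>\<omega>. ennreal (Y \<omega> $ i + M))) borel X"
    have Ypos: "AE \<omega> in \<Omega>. 0 \<le> Y \<omega> $ i + M \<and> Y \<omega> $ i + M \<le> 2 * M"
      using YU
    proof eventually_elim
      case (elim \<omega>)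
      then show ?case using component_le_norm_cart[of "Y \<omega>" i] M(2)[of "Y \<omega>"] by auto
    qed
    have emN: "emeasure N A = (\<integral>\<^sup>+\<omega>. ennreal (Y \<omega> $ i + M) * indicator A (X \<omega>) \<partial>\<Omega>)" if [measurable]: "A \<in> sets borel" for A
      unfolding N_def by (subst emeasure_distr, measurable, subst emeasure_density, measurable)
        (auto intro!: nn_integral_cong simp: indicator_def)
    have "absolutely_continuous (unif T) N"
      unfolding absolutely_continuous_def
    proof
      fix A assume A: "A \<in> null_sets (unif T)"
      then have [measurable]: "A \<in> sets borel" by (auto simp: null_sets_def)
      have "emeasure (distr \<Omega> borel X) A = 0" using A by (simp add: X null_sets_def)
      then have "AE \<omega> in \<Omega>. X \<omega> \<notin> A"
        by (intro AE_I[of _ _ "X -` A \<inter> space \<Omega>"]) (auto simp: emeasure_distr)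
      then have "emeasure N A = (\<integral>\<^sup>+\<omega>. 0 \<partial>\<Omega>)"
        unfolding emN[OF \<open>A \<in> sets borel\<close>] by (intro nn_integral_cong_AE) (auto elim!: eventually_mono simp: indicator_def)
      then show "A \<in> null_sets N" by (auto simp: null_sets_def N_def)
    qed
    from unif.Radon_Nikodym[OF this] obtain f where f [measurable]: "f \<in> borel_measurable (unif T)" and fN: "density (unif T) f = N"
      by (auto simp: N_def)
    have [measurable]: "f \<in> borel_measurable borel" using f by simp
    have fint: "(\<integral>\<^sup>+t. f t * indicator A t \<partial>unif T) = (\<integral>\<^sup>+\<omega>. ennreal (Y \<omega> $ i + M) * indicator A (X \<omega>) \<partial>\<Omega>)" if "A \<in> sets borel" for A
      using emN[OF that] that unfolding fN[symmetric] by (simp add: emeasure_density)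
    have "(\<integral>\<^sup>+t. f t \<partial>unif T) = (\<integral>\<^sup>+\<omega>. ennreal (Y \<omega> $ i + M) \<partial>\<Omega>)" using fint[of UNIV] by simp
    also have "\<dots> \<le> (\<integral>\<^sup>+\<omega>. ennreal (2 * M) \<partial>\<Omega>)"
    proof (rule nn_integral_mono_AE)
      show "AE \<omega> in \<Omega>. ennreal (Y \<omega> $ i + M) \<le> ennreal (2 * M)"
        using Ypos by eventually_elim (auto intro!: ennreal_leI)
    qed
    finally have ffin: "(\<integral>\<^sup>+t. f t \<partial>unif T) < \<infinity>" by (simp add: \<Omega>.emeasure_space_1 le_less_trans)
    then have fAE: "AE t in unif T. f t \<noteq> \<infinity>" by (intro nn_integral_PInf_AE) auto
    define v where "v t = enn2real (f t) - M" for t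
    have vm [measurable]: "v \<in> borel_measurable borel" unfolding v_def by measurable
    have ienn: "integrable (unif T) (\<lambda>t. enn2real (f t))"
    proof (rule integrableI_nonneg)
      have "(\<integral>\<^sup>+t. ennreal (enn2real (f t)) \<partial>unif T) = (\<integral>\<^sup>+t. f t \<partial>unif T)"
        using fAE by (intro nn_integral_cong_AE) (auto elim!: eventually_mono simp: less_top)
      then show "(\<integral>\<^sup>+t. ennreal (enn2real (f t)) \<partial>unif T) < \<infinity>" using ffin by simp
    qed auto
    then have iv: "integrable (unif T) v" unfolding v_def by (intro Bochner_Integration.integrable_diff) auto
    show ?thesis
    proof (intro exI[of _ v] ballI conjI iv vm)
      fix A :: "real set" assume A [measurable]: "A \<in> sets borel"
      have "(\<integral>t. indicator A t * enn2real (f t) \<partial>unif T) = enn2real (\<integral>\<^sup>+t. f t * indicator A t \<partial>unif T)"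
      proof (subst integral_eq_nn_integral)
        show "enn2real (\<integral>\<^sup>+t. ennreal (indicator A t * enn2real (f t)) \<partial>unif T) = enn2real (\<integral>\<^sup>+t. f t * indicator A t \<partial>unif T)"
          using fAE by (intro arg_cong[where f=enn2real] nn_integral_cong_AE) (auto elim!: eventually_mono simp: less_top indicator_def)
      qed auto
      also have "\<dots> = (\<integral>\<omega>. indicator A (X \<omega>) * (Y \<omega> $ i + M) \<partial>\<Omega>)"
        unfolding fint[OF A]
      proof (subst integral_eq_nn_integral)
        show "enn2real (\<integral>\<^sup>+\<omega>. ennreal (Y \<omega> $ i + M) * indicator A (X \<omega>) \<partial>\<Omega>)
           = enn2real (\<integral>\<^sup>+\<omega>. ennreal (indicator A (X \<omega>) * (Y \<omega> $ i + M)) \<partial>\<Omega>)"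
          by (intro arg_cong[where f=enn2real] nn_integral_cong) (auto simp: indicator_def)
      qed (use Ypos in \<open>auto elim!: eventually_mono\<close>)
      finally have 1: "(\<integral>t. indicator A t * enn2real (f t) \<partial>unif T) = (\<integral>\<omega>. indicator A (X \<omega>) * (Y \<omega> $ i + M) \<partial>\<Omega>)" .
      have i1: "integrable \<Omega> (\<lambda>\<omega>. indicator A (X \<omega>) * (Y \<omega> $ i))"
      proof (rule \<Omega>.integrable_const_bound[of _ M])
        show "AE \<omega> in \<Omega>. norm (indicator A (X \<omega>) * (Y \<omega> $ i)) \<le> M"
          using Ypos by eventually_elim (use M(1) in \<open>auto simp: indicator_def abs_le_iff\<close>)
      qed measurable
      have i2: "integrable \<Omega> (\<lambda>\<omega>. indicator A (X \<omega>) * M)"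
        using M(1) by (intro \<Omega>.integrable_const_bound[of _ M]) (auto simp: indicator_def)
      have i3: "integrable (unif T) (\<lambda>t. indicator A t * enn2real (f t))"
        using integrable_mult_indicator[OF _ ienn, of A] by simp
      have i4: "integrable (unif T) (\<lambda>t. indicator A t * M)"
        using M(1) by (intro unif.integrable_const_bound[of _ M]) (auto simp: indicator_def)
      have "(\<integral>t. indicator A t * v t \<partial>unif T) = (\<integral>t. indicator A t * enn2real (f t) \<partial>unif T) - (\<integral>t. indicator A t * M \<partial>unif T)"
        unfolding v_def right_diff_distrib by (rule Bochner_Integration.integral_diff[OF i3 i4])
      also have "(\<integral>t. indicator A t * M \<partial>unif T) = (\<integral>\<omega>. indicator A (X \<omega>) * M \<partial>\<Omega>)"
        unfolding X[symmetric] by (subst integral_distr) auto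
      also have "(\<integral>t. indicator A t * enn2real (f t) \<partial>unif T) - (\<integral>\<omega>. indicator A (X \<omega>) * M \<partial>\<Omega>) = (\<integral>\<omega>. indicator A (X \<omega>) * (Y \<omega> $ i) \<partial>\<Omega>)"
        unfolding 1 using i1 i2 by (simp add: distrib_left)
      finally show "(\<integral>\<omega>. indicator A (X \<omega>) * (Y \<omega> $ i) \<partial>\<Omega>) = (\<integral>t. indicator A t * v t \<partial>unif T)" by simp
    qed
  qed
  then obtain v where vm: "\<And>i. v i \<in> borel_measurable borel" and vi: "\<And>i. integrable (unif T) (v i)"
    and v: "\<And>i A. A \<in> sets borel \<Longrightarrow> (\<integral>\<omega>. indicator A (X \<omega>) * (Y \<omega> $ i) \<partial>\<Omega>) = (\<integral>t. indicator A t * v i t \<partial>unif T)"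
    by metis
  define V where "V t = (\<chi> i. v i t)" for t
  note [measurable] = vm
  have Vm [measurable]: "V \<in> borel_measurable borel"
    by (subst borel_measurable_euclidean_space) (auto simp: Basis_vec_def V_def inner_axis vm)
  have "AE t in unif T. V t \<in> U"
  proof -
    \<comment> \<open>Open half-spaces disjoint from \<open>U\<close>. By separation they cover the
      complement of the closed convex set, and countably many of them already do, so a single null
      set of times suffices.\<close>
    define \<F> where "\<F> = {{x. a \<bullet> x > h} |a h. \<forall>x\<in>U. a \<bullet> x \<le> h}"
    obtain \<F>' where \<F>': "\<F>' \<subseteq> \<F>" "countable \<F>'" "\<Union>\<F>' = \<Union>\<F>"
    proof -
      have "\<And>S. S \<in> \<F> \<Longrightarrow> open S" by (auto simp: \<F>_def open_halfspace_gt)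
      then show thesis using Lindelof[of \<F>] that by metis
    qed
    have "AE t in unif T. \<forall>S\<in>\<F>'. V t \<notin> S"
      unfolding AE_ball_countable[OF \<F>'(2)]
    proof
      fix S assume "S \<in> \<F>'"
      then obtain a h where S: "S = {x. a \<bullet> x > h}" and h: "\<forall>x\<in>U. a \<bullet> x \<le> h" using \<F>'(1) by (auto simp: \<F>_def)
      \<comment> \<open>The times at which \<open>V\<close> violates one half-space bound. The
        average of \<open>a \<bullet> Y\<close> over \<open>X\<close> in \<open>A\<close> obeys the
        bound because \<open>Y\<close> lies in \<open>U\<close>, and the same average of
        \<open>a \<bullet> V\<close> exceeds it unless \<open>A\<close> is null.\<close>
      define A where "A = {t. a \<bullet> V t > h}"
      have A [measurable]: "A \<in> sets borel" unfolding A_def by measurable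
      have iA: "integrable (unif T) (\<lambda>t. indicator A t * v i t)" for i
        using integrable_mult_indicator[OF _ vi, of A] by simp
      have iY: "integrable \<Omega> (\<lambda>\<omega>. indicator A (X \<omega>) * (Y \<omega> $ i))" for i
      proof (rule \<Omega>.integrable_const_bound[of _ M])
        show "AE \<omega> in \<Omega>. norm (indicator A (X \<omega>) * (Y \<omega> $ i)) \<le> M"
          using YU
        proof eventually_elim
          case (elim \<omega>)
          then show ?case using component_le_norm_cart[of "Y \<omega>" i] M(2)[of "Y \<omega>"] by (auto simp: indicator_def)
        qed
      qed measurable
      have ih: "integrable (unif T) (\<lambda>t. indicator A t * h)" by (rule unif.integrable_const_bound[of _ "\<bar>h\<bar>"]) (auto simp: indicator_def)
      have ih': "integrable \<Omega> (\<lambda>\<omega>. indicator A (X \<omega>) * h)" by (rule \<Omega>.integrable_const_bound[of _ "\<bar>h\<bar>"]) (auto simp: indicator_def)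
      have e1: "(\<integral>t. (\<Sum>i\<in>UNIV. a $ i * (indicator A t * v i t)) \<partial>unif T) = (\<integral>\<omega>. (\<Sum>i\<in>UNIV. a $ i * (indicator A (X \<omega>) * (Y \<omega> $ i))) \<partial>\<Omega>)"
        using iA iY v[OF A] by (simp add: integral_sum)
      also have "\<dots> \<le> (\<integral>\<omega>. indicator A (X \<omega>) * h \<partial>\<Omega>)"
      proof (rule integral_mono_AE)
        show "AE \<omega> in \<Omega>. (\<Sum>i\<in>UNIV. a $ i * (indicator A (X \<omega>) * (Y \<omega> $ i))) \<le> indicator A (X \<omega>) * h"
          using YU
        proof eventually_elim
          case (elim \<omega>)
          then show ?case using h by (auto simp: indicator_def inner_vec_def)
        qed
      qed (use iY ih' in auto)
      also have "\<dots> = (\<integral>t. indicator A t * h \<partial>unif T)"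
        unfolding X[symmetric] by (subst integral_distr) auto
      finally have "(\<integral>t. (\<Sum>i\<in>UNIV. a $ i * (indicator A t * v i t)) - indicator A t * h \<partial>unif T) \<le> 0"
        using iA ih by (subst Bochner_Integration.integral_diff) auto
      moreover have eqI: "(\<Sum>i\<in>UNIV. a $ i * (indicator A t * v i t)) - indicator A t * h = indicator A t * (a \<bullet> V t - h)" for t
        by (auto simp: indicator_def inner_vec_def V_def)
      ultimately have le: "(\<integral>t. indicator A t * (a \<bullet> V t - h) \<partial>unif T) \<le> 0" by simp
      have int: "integrable (unif T) (\<lambda>t. indicator A t * (a \<bullet> V t - h))"
        unfolding eqI[symmetric] using iA ih by auto
      have nn: "indicator A t * (a \<bullet> V t - h) \<ge> 0" for t by (auto simp: indicator_def A_def)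
      have "(\<integral>t. indicator A t * (a \<bullet> V t - h) \<partial>unif T) = 0"
        by (rule antisym[OF le Bochner_Integration.integral_nonneg]) (rule nn)
      then have "AE t in unif T. indicator A t * (a \<bullet> V t - h) = 0"
        using integral_nonneg_eq_0_iff_AE[OF int] nn by auto
      then show "AE t in unif T. V t \<notin> S"
        by eventually_elim (auto simp: S A_def indicator_def split: if_splits)
    qed
    then show ?thesis
    proof eventually_elim
      case (elim t)
      show "V t \<in> U"
      proof (rule ccontr)
        assume n: "V t \<notin> U"
        have "V t \<in> \<Union>\<F>"
        proof (cases "U = {}")
          case True
          \<comment> \<open>For empty \<open>U\<close> the zero normal vector with level -1 yields
            the whole space as one of the half-spaces.\<close>
          have "{x. (0::real^'c) \<bullet> x > -1} \<in> \<F>"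
            unfolding \<F>_def by (rule CollectI, rule exI[of _ 0], rule exI[of _ "-1"]) (simp add: True)
          moreover have "V t \<in> {x. (0::real^'c) \<bullet> x > -1}" by simp
          ultimately show ?thesis by blast
        next
          case False
          obtain a b where ab: "a \<bullet> V t < b" "\<And>x. x \<in> U \<Longrightarrow> a \<bullet> x > b"
            using separating_hyperplane_closed_point[OF U(2) compact_imp_closed[OF U(1)] n] by blast
          have "{x. (- a) \<bullet> x > - b} \<in> \<F>" 
            unfolding \<F>_def by (rule CollectI, rule exI[of _ "- a"], rule exI[of _ "- b"]) (use ab in \<open>auto intro: less_imp_le\<close>)
          moreover have "V t \<in> {x. (- a) \<bullet> x > - b}" using ab by simp
          ultimately show ?thesis by blast
        qed
        then show False using elim \<F>'(3) by auto
      qed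
    qed
  qed
  then have adm: "admissible U T V"
    unfolding admissible_def AE_unif[OF T] by (auto simp: set_borel_measurable_def)
  have Vint: "set_integrable lborel {0..T} V" by (rule admissible_integrable[OF U(1) adm])
  have "(\<lambda>n. LINT s:{0..t}|lborel. u (r n) s) \<longlonglongrightarrow> (LINT s:{0..t}|lborel. V s)" if t: "t \<in> {0..T}" for t
  proof (rule vec_tendstoI)
    fix i
    have comp: "(LINT s:{0..t}|lborel. f s) $ i = (LINT s:{0..T}|lborel. indicator {..t} s * f s $ i)"
      if f: "set_integrable lborel {0..T} f" for f :: "real \<Rightarrow> real^'c"
    proof -
      have "set_integrable lborel {0..t} f" using set_integrable_subset[OF f] t by auto
      then have "(LINT s:{0..t}|lborel. f s) $ i = (\<integral>s. (indicator {0..t} s *\<^sub>R f s) $ i \<partial>lborel)"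
        unfolding set_lebesgue_integral_def set_integrable_def
        by (rule integral_bounded_linear[OF bounded_linear_vec_nth, symmetric])
      also have "\<dots> = (LINT s:{0..T}|lborel. indicator {..t} s * f s $ i)"
        unfolding set_lebesgue_integral_def using t by (intro Bochner_Integration.integral_cong) (auto simp: indicator_def)
      finally show ?thesis .
    qed
    have lim: "(\<lambda>n. \<integral>\<omega>. indicator {..t} (fst (Z n \<omega>)) * snd (Z n \<omega>) $ i \<partial>\<Omega>) \<longlonglongrightarrow> (\<integral>\<omega>. indicator {..t} (X \<omega>) * Y \<omega> $ i \<partial>\<Omega>)"
    proof (rule integral_dominated_convergence[where w="\<lambda>_. M"])
      \<comment> \<open>The indicator of \<open>{..t}\<close> jumps at \<open>t\<close> only, and
        the uniform law of \<open>X\<close> has no atom there, so dominated convergence applies to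
        it.\<close>
      have "AE x in lborel. x \<noteq> t" by (rule AE_lborel_singleton)
      then have "AE s in unif T. s \<noteq> t" unfolding AE_unif[OF T] by (auto elim!: eventually_mono)
      then have "AE s in distr \<Omega> borel X. s \<noteq> t" by (simp only: X)
      then have Xt: "AE \<omega> in \<Omega>. X \<omega> \<noteq> t" by (subst (asm) AE_distr_iff) auto
      show "AE \<omega> in \<Omega>. (\<lambda>n. indicator {..t} (fst (Z n \<omega>)) * snd (Z n \<omega>) $ i) \<longlonglongrightarrow> indicator {..t} (X \<omega>) * Y \<omega> $ i"
        using Xt AE_space
      proof eventually_elim
        case (elim \<omega>)
        have l: "(\<lambda>n. fst (Z n \<omega>)) \<longlonglongrightarrow> X \<omega>" unfolding X_def using Zlim elim by (intro tendsto_fst) auto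
        have "(\<lambda>n. indicator {..t} (fst (Z n \<omega>)) :: real) \<longlonglongrightarrow> indicator {..t} (X \<omega>)"
        proof (cases "X \<omega> < t")
          case True
          then have "\<forall>\<^sub>F n in sequentially. fst (Z n \<omega>) < t" using order_tendstoD(2)[OF l] by auto
          then show ?thesis using True by (intro tendsto_eventually) (auto elim!: eventually_mono)
        next
          case False
          then have "\<forall>\<^sub>F n in sequentially. fst (Z n \<omega>) > t" using order_tendstoD(1)[OF l, of t] elim by auto
          then show ?thesis using False elim by (intro tendsto_eventually) (auto elim!: eventually_mono)
        qed
        then show ?case unfolding Y_def using Zlim elim by (intro tendsto_mult tendsto_vec_nth tendsto_snd) auto
      qed
      show "AE \<omega> in \<Omega>. norm (indicator {..t} (fst (Z n \<omega>)) * snd (Z n \<omega>) $ i) \<le> M" for n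
        using ZU
      proof eventually_elim
        case (elim \<omega>)
        then show ?case using component_le_norm_cart[of "snd (Z n \<omega>)" i] M(2)[of "snd (Z n \<omega>)"] M(1) by (auto simp: indicator_def)
      qed
    qed measurable
    have 1: "(\<integral>\<omega>. indicator {..t} (fst (Z n \<omega>)) * snd (Z n \<omega>) $ i \<partial>\<Omega>) = (LINT s:{0..t}|lborel. u (r n) s) $ i / T" for n
    proof -
      have "(\<integral>\<omega>. indicator {..t} (fst (Z n \<omega>)) * snd (Z n \<omega>) $ i \<partial>\<Omega>) = (LINT s:{0..T}|lborel. indicator {..t} s * w (r n) s $ i) / T"
        using push[of "\<lambda>z. indicator {..t} (fst z) * snd z $ i" n] by simp
      also have "(LINT s:{0..T}|lborel. indicator {..t} s * w (r n) s $ i) = (LINT s:{0..T}|lborel. indicator {..t} s * u (r n) s $ i)"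
        by (intro set_lebesgue_integral_cong) (auto simp: w_def)
      finally show ?thesis using comp[OF admissible_integrable[OF U(1) u]] by simp
    qed
    have "(\<integral>\<omega>. indicator {..t} (X \<omega>) * Y \<omega> $ i \<partial>\<Omega>) = (\<integral>s. indicator {..t} s * v i s \<partial>unif T)" by (rule v) simp
    also have "\<dots> = (LINT s:{0..T}|lborel. indicator {..t} s * v i s) / T" by (rule integral_unif[OF T]) measurable
    also have "\<dots> = (LINT s:{0..t}|lborel. V s) $ i / T" using comp[OF Vint] by (simp add: V_def)
    finally have "(\<lambda>n. (LINT s:{0..t}|lborel. u (r n) s) $ i / T) \<longlonglongrightarrow> (LINT s:{0..t}|lborel. V s) $ i / T"
      using lim by (simp add: 1)
    from tendsto_mult_right[OF this, of T] show "(\<lambda>n. (LINT s:{0..t}|lborel. u (r n) s) $ i) \<longlonglongrightarrow> (LINT s:{0..t}|lborel. V s) $ i"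
      using T by simp
  qed
  then show thesis using r adm by (intro that[of r V]) auto
qed

subsection \<open>Existence and stability of solutions\<close>

text \<open>Makes the space of bounded continuous displacement fields, and hence its product with
  the state space, a Banach space as \<open>picard\<close> requires.\<close>

instance bcontfun :: (metric_space, banach) banach ..

context lip_system
begin

text \<open>The unknown is the displacement \<open>D\<close> of the flow, a bounded continuous
  field. The identity is unbounded, so it is replaced by the projection \<open>P\<close> onto a ball
  containing \<open>supp \<mu>0\<close>; on the support nothing changes. The law of
  \<open>P + D\<close> depends on \<open>D\<close> with Lipschitz constant 1 in \<open>W2\<close>,
  so the whole coupled system is an equation with globally Lipschitz right-hand side in a Banach
  space.\<close>

lemma lagrangian_exists:
  assumes V: "continuous_on {0..T} V"
  obtains \<mu> y \<Phi> where "lagrangian V \<mu> y \<Phi>"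
proof -
  interpret prob_space \<mu>0 using Pc0 by (rule Pc_prob)
  obtain R where R: "R > 0" "supp \<mu>0 \<subseteq> cball 0 R" using Pc_bounded[OF Pc0] by blast
  define P where "P = closest_point (cball 0 R :: (real^'d) set)"
  have Pc: "continuous_on UNIV P" unfolding P_def using R(1) by (intro continuous_on_closest_point) auto
  have PK: "norm (P x) \<le> R" for x unfolding P_def using closest_point_in_set[of "cball 0 R :: (real^'d) set" x] R(1) by auto
  have Pid: "P x = x" if "x \<in> supp \<mu>0" for x unfolding P_def using that R(2) by (intro closest_point_self) auto
  define \<phi> where "\<phi> D x = P x + apply_bcontfun D x" for D :: "(real^'d) \<Rightarrow>\<^sub>C (real^'d)" and x
  have \<phi>c: "continuous_on UNIV (\<phi> D)" for D unfolding \<phi>_def by (intro continuous_intros Pc continuous_on_apply_bcontfun)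
  have \<phi>m: "\<phi> D \<in> borel_measurable \<mu>0" for D
    using borel_measurable_continuous_onI[OF \<phi>c] by (simp add: measurable_cong_sets[OF Pc_sets[OF Pc0] refl])
  define M where "M D = distr \<mu>0 borel (\<phi> D)" for D
  have MP: "M D \<in> Pc" for D
    unfolding M_def by (intro Pc_distr(1) Pc0 borel_measurable_continuous_onI \<phi>c continuous_on_subset[OF \<phi>c subset_UNIV])
  have W: "W2 (M D) (M D') \<le> norm (D - D')" for D D'
    unfolding M_def
  proof (rule W2_distr_le[OF prob_space_axioms \<phi>m \<phi>m])
    show "AE x in \<mu>0. dist (\<phi> D x) (\<phi> D' x) \<le> norm (D - D')"
      using dist_bounded[of D _ D'] by (intro AE_I2) (simp add: \<phi>_def dist_norm)
  qed simp
  define b1 where "b1 p x = F (M (fst p)) (\<phi> (fst p) x) (snd p)" for p x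
  have b1: "b1 p \<in> bcontfun" for p
  proof (rule bcontfun_normI)
    show "continuous_on UNIV (b1 p)" unfolding b1_def
      by (rule continuous_on_compose2[OF F_cont_x[OF MP, of UNIV] \<phi>c]) simp
    show "norm (b1 p x) \<le> norm (F (M (fst p)) 0 (snd p)) + L * (R + norm (fst p))" for x
    proof -
      have "norm (\<phi> (fst p) x) \<le> R + norm (fst p)"
        unfolding \<phi>_def by (rule norm_triangle_le[OF add_mono[OF PK norm_bounded]])
      then have "L * norm (\<phi> (fst p) x) \<le> L * (R + norm (fst p))" using L by (intro mult_left_mono) auto
      moreover have "norm (b1 p x - F (M (fst p)) 0 (snd p)) \<le> L * norm (\<phi> (fst p) x)"
        using F_lip[OF MP MP, of "fst p" "\<phi> (fst p) x" "snd p" "fst p" 0 "snd p"] by (simp add: b1_def W2_self[OF MP])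
      ultimately show ?thesis using norm_triangle_sub[of "b1 p x" "F (M (fst p)) 0 (snd p)"] by linarith
    qed
  qed
  define b where "b p = (Bcontfun (b1 p), G (M (fst p)) (snd p))" for p
  \<comment> \<open>Three summands from \<open>F\<close> (position, measure, state) and two from
    \<open>G\<close> (measure, state), each at most \<open>L * norm (p - q)\<close>, make the factor
    5.\<close>
  have lip: "norm (b p - b q) \<le> 5 * L * norm (p - q)" for p q
  proof -
    have 1: "norm (fst p - fst q) \<le> norm (p - q)" "norm (snd p - snd q) \<le> norm (p - q)"
      using norm_fst_le[of "fst (p - q)" "snd (p - q)"] norm_snd_le[of "snd (p - q)" "fst (p - q)"] unfolding prod.collapse by simp_all
    have W': "W2 (M (fst p)) (M (fst q)) \<le> norm (p - q)" using W[of "fst p" "fst q"] 1 by linarith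
    have "norm (Bcontfun (b1 p) - Bcontfun (b1 q)) \<le> L * (3 * norm (p - q))"
    proof (rule norm_bound)
      fix x
      have "norm (\<phi> (fst p) x - \<phi> (fst q) x) \<le> norm (p - q)"
        using dist_bounded[of "fst p" x "fst q"] 1 by (simp add: \<phi>_def dist_norm)
      then have "L * (norm (\<phi> (fst p) x - \<phi> (fst q) x) + (W2 (M (fst p)) (M (fst q)) + norm (snd p - snd q))) \<le> L * (3 * norm (p - q))"
        using W' 1 L by (intro mult_left_mono) auto
      then show "norm (apply_bcontfun (Bcontfun (b1 p) - Bcontfun (b1 q)) x) \<le> L * (3 * norm (p - q))"
        using F_lip[OF MP MP, of "fst p" "\<phi> (fst p) x" "snd p" "fst q" "\<phi> (fst q) x" "snd q"]
        by (simp add: Bcontfun_inverse[OF b1]) (simp add: b1_def)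
    qed
    moreover have "norm (G (M (fst p)) (snd p) - G (M (fst q)) (snd q)) \<le> L * (2 * norm (p - q))"
      using G_lip[OF MP MP, of "fst p" "snd p" "fst q" "snd q"] W' 1 L
      by (elim order_trans) (intro mult_left_mono, auto)
    moreover have "norm (b p - b q) \<le> norm (Bcontfun (b1 p) - Bcontfun (b1 q)) + norm (G (M (fst p)) (snd p) - G (M (fst q)) (snd q))"
      unfolding b_def diff_Pair by (rule norm_Pair_le)
    ultimately show ?thesis by simp
  qed
  have bc: "continuous_on UNIV b"
    using L lip by (intro lipschitz_on_continuous_on[of "5 * L"] lipschitz_onI) (auto simp: dist_norm)
  \<comment> \<open>The second component of \<open>w\<close> is \<open>y - V\<close>. This places
    \<open>V\<close> inside the right-hand side, where continuity of \<open>V\<close> is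
    enough.\<close>
  obtain w where wc: "continuous_on {0..T} w"
    and w: "\<And>t. t \<in> {0..T} \<Longrightarrow> w t = (0, y0) + integral {0..t} (\<lambda>s. b (w s + (0, V s)))"
  proof (rule picard[of T "5 * L" "\<lambda>s v. b (v + (0, V s))" "(0, y0)"])
    show "continuous_on {0..T} (\<lambda>s. b (w s + (0, V s)))" if "continuous_on {0..T} w" for w
      using that V by (intro continuous_on_compose2[OF bc] continuous_intros) auto
    show "norm (b (v + (0, V s)) - b (w + (0, V s))) \<le> 5 * L * norm (v - w)" for s v w
      using lip[of "v + (0, V s)" "w + (0, V s)"] by simp
  qed (use T L in auto)
  define \<mu> where "\<mu> t = M (fst (w t))" for t
  define y where "y t = snd (w t) + V t" for t
  define \<Phi> where "\<Phi> t = \<phi> (fst (w t))" for t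
  have bw: "continuous_on {0..T} (\<lambda>s. b (w s + (0, V s)))"
    using wc V by (intro continuous_on_compose2[OF bc] continuous_intros) auto
  have bi: "(\<lambda>s. b (w s + (0, V s))) integrable_on {0..t}" if "t \<in> {0..T}" for t
    using that by (intro integrable_continuous_real continuous_on_subset[OF bw]) auto
  have bcomp: "b (w s + (0, V s)) = (Bcontfun (\<lambda>x. F (\<mu> s) (\<Phi> s x) (y s)), G (\<mu> s) (y s))" for s
    by (simp add: b_def b1_def[abs_def] \<mu>_def \<Phi>_def y_def)
  have bF: "(\<lambda>x. F (\<mu> s) (\<Phi> s x) (y s)) \<in> bcontfun" for s
    using b1[of "w s + (0, V s)"] by (simp add: b1_def[abs_def] \<mu>_def \<Phi>_def y_def)
  show thesis
  proof (rule that[of \<mu> y \<Phi>], unfold lagrangian_def, intro conjI ballI)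
    have dc: "continuous_on {0..T} (\<lambda>t. fst (w t))" using wc by (intro continuous_intros)
    show "continuous_on ({0..T} \<times> UNIV) (\<lambda>(t, x). \<Phi> t x)"
      unfolding continuous_on_sequentially
    proof (intro allI ballI impI, elim conjE)
      fix f :: "nat \<Rightarrow> real \<times> (real^'d)" and p assume p: "p \<in> {0..T} \<times> UNIV" and f: "\<forall>n. f n \<in> {0..T} \<times> UNIV" "f \<longlonglongrightarrow> p"
      obtain t x where tx: "p = (t, x)" "t \<in> {0..T}" using p by auto
      have f1: "(\<lambda>n. fst (f n)) \<longlonglongrightarrow> t" "(\<lambda>n. snd (f n)) \<longlonglongrightarrow> x" using tendsto_fst[OF f(2)] tendsto_snd[OF f(2)] by (simp_all add: tx)
      have "(\<lambda>n. fst (w (fst (f n)))) \<longlonglongrightarrow> fst (w t)"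
        using continuous_on_tendsto_compose[OF dc f1(1) tx(2)] f(1) by (auto simp: mem_Times_iff)
      then have d0: "(\<lambda>n. norm (fst (w (fst (f n))) - fst (w t))) \<longlonglongrightarrow> 0" by (simp add: tendsto_norm_zero LIM_zero)
      have "(\<lambda>n. \<Phi> (fst (f n)) (snd (f n)) - \<Phi> t (snd (f n))) \<longlonglongrightarrow> 0"
      proof (rule Lim_null_comparison[OF always_eventually d0], rule allI)
        fix n
        show "norm (\<Phi> (fst (f n)) (snd (f n)) - \<Phi> t (snd (f n))) \<le> norm (fst (w (fst (f n))) - fst (w t))"
          using dist_bounded[of "fst (w (fst (f n)))" "snd (f n)" "fst (w t)"] by (simp add: \<Phi>_def \<phi>_def dist_norm)
      qed
      moreover have "(\<lambda>n. \<Phi> t (snd (f n))) \<longlonglongrightarrow> \<Phi> t x"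
        unfolding \<Phi>_def by (rule continuous_on_tendsto_compose[OF \<phi>c f1(2)]) auto
      ultimately have "(\<lambda>n. (\<Phi> (fst (f n)) (snd (f n)) - \<Phi> t (snd (f n))) + \<Phi> t (snd (f n))) \<longlonglongrightarrow> 0 + \<Phi> t x"
        by (rule tendsto_add)
      then show "((\<lambda>(t, x). \<Phi> t x) \<circ> f) \<longlonglongrightarrow> (case p of (t, x) \<Rightarrow> \<Phi> t x)"
        by (simp add: tx comp_def split_beta)
    qed
    show "continuous_on {0..T} y" unfolding y_def using wc V by (intro continuous_intros)
    fix t assume t: "t \<in> {0..T}"
    show "\<mu> t = distr \<mu>0 borel (\<Phi> t)" by (simp add: \<mu>_def M_def \<Phi>_def)
    have "snd (w t) = y0 + integral {0..t} (\<lambda>s. snd (b (w s + (0, V s))))"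
      using w[OF t] integral_linear[OF bi[OF t] bounded_linear_snd] by (simp add: comp_def)
    then show "y t = y0 + integral {0..t} (\<lambda>s. G (\<mu> s) (y s)) + V t" by (simp add: y_def[of t] bcomp)
    fix x assume x: "x \<in> supp \<mu>0"
    \<comment> \<open>Evaluation at a point is a bounded linear functional and commutes with the
      Banach-valued integral, which turns the abstract equation into one equation per starting
      point.\<close>
    have bl: "bounded_linear (\<lambda>D :: (real^'d) \<Rightarrow>\<^sub>C (real^'d). apply_bcontfun D x)"
      by (rule bounded_linear_intro[of _ 1]) (auto simp: norm_bounded)
    have "fst (w t) = integral {0..t} (\<lambda>s. fst (b (w s + (0, V s))))"
      using w[OF t] integral_linear[OF bi[OF t] bounded_linear_fst] by (simp add: comp_def)
    moreover have "(\<lambda>s. fst (b (w s + (0, V s)))) integrable_on {0..t}"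
      using integrable_linear[OF bi[OF t] bounded_linear_fst] by (simp add: comp_def)
    ultimately have "apply_bcontfun (fst (w t)) x = integral {0..t} (\<lambda>s. apply_bcontfun (fst (b (w s + (0, V s)))) x)"
      using integral_linear[OF _ bl, of "\<lambda>s. fst (b (w s + (0, V s)))" "{0..t}"] by (simp add: comp_def)
    then show "\<Phi> t x = x + integral {0..t} (\<lambda>s. F (\<mu> s) (\<Phi> s x) (y s))"
      by (simp add: \<Phi>_def[of t] \<phi>_def Pid[OF x] bcomp Bcontfun_inverse[OF bF])
  qed
qed

lemma lag_W2_le:
  assumes 1: "lagrangian V1 \<mu>1 y1 \<Phi>1" and 2: "lagrangian V2 \<mu>2 y2 \<Phi>2" and t: "t \<in> {0..T}"
    and le: "\<And>x. x \<in> supp \<mu>0 \<Longrightarrow> norm (\<Phi>1 t x - \<Phi>2 t x) \<le> c" and c: "c \<ge> 0"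
  shows "W2 (\<mu>1 t) (\<mu>2 t) \<le> c"
  unfolding lag_distr[OF 1 t] lag_distr[OF 2 t]
proof (rule W2_distr_le[OF Pc_prob[OF Pc0] lag_measurable(2)[OF 1 t] lag_measurable(2)[OF 2 t] _ c])
  show "AE x in \<mu>0. dist (\<Phi>1 t x) (\<Phi>2 t x) \<le> c"
    using AE_supp[OF Pc0] by eventually_elim (simp add: dist_norm le)
qed

text \<open>The distance \<open>W2\<close> of the two measures at a time is bounded through all
  trajectories at once, so the estimate cannot be closed along a single one. The argument of
  \<open>gronwall\<close> is therefore run at a weighted maximum over time and starting point
  together.\<close>

theorem stability:
  assumes 1: "lagrangian V1 \<mu>1 y1 \<Phi>1" and 2: "lagrangian V2 \<mu>2 y2 \<Phi>2"
    and v: "\<And>t. t \<in> {0..T} \<Longrightarrow> norm (V1 t - V2 t) \<le> v"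
    and t: "t \<in> {0..T}" and x: "x \<in> supp \<mu>0"
  shows "norm (\<Phi>1 t x - \<Phi>2 t x) + norm (y1 t - y2 t) \<le> 2 * v * exp (8 * L * T)"
proof -
  \<comment> \<open>The weight is that of \<open>weighted_integral_bound\<close> for the constant
    \<open>4 * L\<close>: the position and the state integral are then each at most a quarter of the
    weighted maximum, leaving half of it to absorb \<open>v\<close>.\<close>
  define \<Delta> where "\<Delta> p = exp (- (8 * L * fst p)) * (norm (\<Phi>1 (fst p) (snd p) - \<Phi>2 (fst p) (snd p)) + norm (y1 (fst p) - y2 (fst p)))"
    for p :: "real \<times> (real^'d)"
  have cf: "continuous_on ({0..T} \<times> supp \<mu>0) (\<lambda>p. \<Phi> (fst p) (snd p))" if "lagrangian V \<mu> y \<Phi>" for V \<mu> y \<Phi>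
    using continuous_on_subset[OF lag_cont[OF that], of "{0..T} \<times> supp \<mu>0"] by (auto simp: split_beta)
  have cy: "continuous_on ({0..T} \<times> supp \<mu>0) (\<lambda>p. y (fst p))" if "lagrangian V \<mu> y \<Phi>" for V \<mu> y \<Phi>
    by (rule continuous_on_compose2[OF lag_y_cont[OF that] continuous_on_fst[OF continuous_on_id]]) auto
  have "continuous_on ({0..T} \<times> supp \<mu>0) \<Delta>"
    unfolding \<Delta>_def by (intro continuous_intros cf[OF 1] cf[OF 2] cy[OF 1] cy[OF 2])
  moreover have "compact ({0..T} \<times> supp \<mu>0)" by (intro compact_Times compact_Icc Pc_compact Pc0)
  moreover have "{0..T} \<times> supp \<mu>0 \<noteq> {}" using t x by auto
  ultimately have "\<exists>p\<in>{0..T} \<times> supp \<mu>0. \<forall>q\<in>{0..T} \<times> supp \<mu>0. \<Delta> q \<le> \<Delta> p"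
    by (intro continuous_attains_sup)
  then obtain t0 x0 where p: "t0 \<in> {0..T}" "x0 \<in> supp \<mu>0" and max: "\<And>q. q \<in> {0..T} \<times> supp \<mu>0 \<Longrightarrow> \<Delta> q \<le> \<Delta> (t0, x0)" by auto
  define N where "N = \<Delta> (t0, x0)"
  have N0: "N \<ge> 0" by (simp add: N_def \<Delta>_def)
  have le: "norm (\<Phi>1 s z - \<Phi>2 s z) + norm (y1 s - y2 s) \<le> N * exp (8 * L * s)" if "s \<in> {0..T}" "z \<in> supp \<mu>0" for s z
    using max[of "(s, z)"] that unfolding N_def[symmetric] by (simp add: \<Delta>_def exp_minus field_simps)
  have W: "W2 (\<mu>1 s) (\<mu>2 s) \<le> N * exp (8 * L * s)" if s: "s \<in> {0..T}" for s
  proof (rule lag_W2_le[OF 1 2 s])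
    show "norm (\<Phi>1 s z - \<Phi>2 s z) \<le> N * exp (8 * L * s)" if "z \<in> supp \<mu>0" for z
      using le[OF s that] norm_ge_zero[of "y1 s - y2 s"] by linarith
  qed (use N0 in simp)
  have t0: "0 \<le> t0" "{0..t0} \<subseteq> {0..T}" using p(1) by auto
  have sT: "s \<in> {0..T}" if "s \<in> {0..t0}" for s using that t0 by auto
  have Fi: "(\<lambda>s. F (\<mu> s) (\<Phi> s x0) (y s)) integrable_on {0..t0}" if "lagrangian V \<mu> y \<Phi>" for V \<mu> y \<Phi>
    by (intro integrable_continuous_real continuous_on_subset[OF lag_F_flow_cont_t[OF that] t0(2)])
  have Gi: "(\<lambda>s. G (\<mu> s) (y s)) integrable_on {0..t0}" if "lagrangian V \<mu> y \<Phi>" for V \<mu> y \<Phi>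
    by (intro integrable_continuous_real continuous_on_subset[OF lag_G_cont[OF that] t0(2)])
  have "norm (\<Phi>1 t0 x0 - \<Phi>2 t0 x0) \<le> exp (2 * (4 * L) * t0) * (N / 2) / 2"
  proof -
    have "\<Phi>1 t0 x0 - \<Phi>2 t0 x0 = integral {0..t0} (\<lambda>s. F (\<mu>1 s) (\<Phi>1 s x0) (y1 s) - F (\<mu>2 s) (\<Phi>2 s x0) (y2 s))"
      using lag_eq[OF 1 p] lag_eq[OF 2 p] by (simp add: integral_diff[OF Fi[OF 1] Fi[OF 2]])
    also have "norm \<dots> \<le> exp (2 * (4 * L) * t0) * (N / 2) / 2"
    proof (rule weighted_integral_bound)
      fix s assume s: "s \<in> {0..t0}"
      have "norm (F (\<mu>1 s) (\<Phi>1 s x0) (y1 s) - F (\<mu>2 s) (\<Phi>2 s x0) (y2 s))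
        \<le> L * (norm (\<Phi>1 s x0 - \<Phi>2 s x0) + (W2 (\<mu>1 s) (\<mu>2 s) + norm (y1 s - y2 s)))"
        by (intro F_lip lag_Pc[OF 1] lag_Pc[OF 2] sT s)
      also have "\<dots> \<le> L * (2 * (N * exp (8 * L * s)))"
        using le[OF sT[OF s] p(2)] W[OF sT[OF s]] L by (intro mult_left_mono) auto
      finally show "norm (F (\<mu>1 s) (\<Phi>1 s x0) (y1 s) - F (\<mu>2 s) (\<Phi>2 s x0) (y2 s)) \<le> 4 * L * exp (2 * (4 * L) * s) * (N / 2)"
        by (simp add: mult_ac)
    qed (use t0 L N0 in \<open>auto intro!: integrable_diff[OF Fi[OF 1] Fi[OF 2]]\<close>)
    finally show ?thesis .
  qed
  moreover have "norm (y1 t0 - y2 t0) \<le> exp (2 * (4 * L) * t0) * (N / 2) / 2 + v"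
  proof -
    have eq: "y1 t0 - y2 t0 = integral {0..t0} (\<lambda>s. G (\<mu>1 s) (y1 s) - G (\<mu>2 s) (y2 s)) + (V1 t0 - V2 t0)"
      using lag_y[OF 1 p(1)] lag_y[OF 2 p(1)] by (simp add: integral_diff[OF Gi[OF 1] Gi[OF 2]])
    have "norm (integral {0..t0} (\<lambda>s. G (\<mu>1 s) (y1 s) - G (\<mu>2 s) (y2 s))) \<le> exp (2 * (4 * L) * t0) * (N / 2) / 2"
    proof (rule weighted_integral_bound)
      fix s assume s: "s \<in> {0..t0}"
      have "norm (G (\<mu>1 s) (y1 s) - G (\<mu>2 s) (y2 s)) \<le> L * (W2 (\<mu>1 s) (\<mu>2 s) + norm (y1 s - y2 s))"
        by (intro G_lip lag_Pc[OF 1] lag_Pc[OF 2] sT s)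
      also have "\<dots> \<le> L * (2 * (N * exp (8 * L * s)))"
        using le[OF sT[OF s] p(2)] W[OF sT[OF s]] norm_ge_zero[of "\<Phi>1 s x0 - \<Phi>2 s x0"] L by (intro mult_left_mono) linarith+
      finally show "norm (G (\<mu>1 s) (y1 s) - G (\<mu>2 s) (y2 s)) \<le> 4 * L * exp (2 * (4 * L) * s) * (N / 2)"
        by (simp add: mult_ac)
    qed (use t0 L N0 in \<open>auto intro!: integrable_diff[OF Gi[OF 1] Gi[OF 2]]\<close>)
    then show ?thesis unfolding eq by (rule order_trans[OF norm_triangle_ineq add_mono[OF _ v[OF p(1)]]])
  qed
  moreover have "norm (\<Phi>1 t0 x0 - \<Phi>2 t0 x0) + norm (y1 t0 - y2 t0) = N * exp (8 * L * t0)"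
    by (simp add: N_def \<Delta>_def exp_minus field_simps)
  ultimately have "N * exp (8 * L * t0) \<le> 2 * v" by (simp add: mult.assoc mult.commute)
  moreover have "N * 1 \<le> N * exp (8 * L * t0)" using N0 t0 L by (intro mult_left_mono) auto
  ultimately have "N \<le> 2 * v" by simp
  have "norm (\<Phi>1 t x - \<Phi>2 t x) + norm (y1 t - y2 t) \<le> N * exp (8 * L * t)" by (rule le[OF t x])
  also have "\<dots> \<le> 2 * v * exp (8 * L * T)"
    using \<open>N \<le> 2 * v\<close> N0 t L by (intro mult_mono) auto
  finally show ?thesis .
qed

subsection \<open>Existence of optimal controls\<close>

definition prim :: "(real \<Rightarrow> real^'c) \<Rightarrow> real \<Rightarrow> real^'c" where
  "prim u t = (LINT s:{0..t}|lborel. u s)"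

context
  fixes U :: "(real^'c) set"
  assumes U: "compact U" "convex U"
begin

lemma admissible_prim:
  assumes "admissible U T u" "t \<in> {0..T}"
  shows "set_integrable lborel {0..t} u \<and> prim u t = (LINT s:{0..t}|lborel. u s)"
  using set_integrable_subset[OF admissible_integrable[OF U(1) assms(1)], of "{0..t}"] assms(2) by (auto simp: prim_def)

lemma prim_cont: assumes u: "admissible U T u" shows "continuous_on {0..T} (prim u)"
proof -
  obtain M where M: "M > 0" "\<And>x. x \<in> U \<Longrightarrow> norm x \<le> M" using U(1) by (rule admissible_bounded) blast
  have "M-lipschitz_on {0..T} (prim u)"
    using primitive_lipschitz[OF U(1) M(2) u] M(1) by (intro lipschitz_onI) (auto simp: dist_norm prim_def norm_minus_commute abs_minus_commute)
  then show ?thesis by (rule lipschitz_on_continuous_on)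
qed

lemma solution_exists:
  assumes u: "admissible U T u"
  obtains \<mu> y where "is_solution F G \<mu>0 y0 T u \<mu> y"
proof -
  obtain \<mu> y \<Phi> where "lagrangian (prim u) \<mu> y \<Phi>" using lagrangian_exists[OF prim_cont[OF u]] by blast
  from lag_is_solution[OF this admissible_prim[OF u]] show thesis by (rule that)
qed

lemma admissible_solution_lagrangian:
  assumes "admissible U T u" "is_solution F G \<mu>0 y0 T u \<mu> y"
  obtains \<Phi> where "lagrangian (prim u) \<mu> y \<Phi>"
proof -
  obtain \<Phi> where "flow_of (\<lambda>s x. F (\<mu> s) x (y s)) T \<Phi>" using solution_flow_exists[OF assms(2)] by blast
  from solution_lagrangian[OF assms(2) admissible_prim[OF assms(1)] this] show thesis by (rule that)
qed

text \<open>All primitives share the Lipschitz constant \<open>M\<close>, so convergence on a finite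
  net of mesh \<open>e / (4 * M)\<close> is convergence everywhere up to \<open>e\<close>.\<close>

lemma uniform_primitives:
  assumes u: "\<And>n. admissible U T (u n)" and v: "admissible U T v"
    and lim: "\<forall>t\<in>{0..T}. (\<lambda>n. prim (u n) t) \<longlonglongrightarrow> prim v t" and e: "e > 0"
  shows "\<forall>\<^sub>F n in sequentially. \<forall>t\<in>{0..T}. norm (prim (u n) t - prim v t) \<le> e"
proof -
  obtain M where M: "M > 0" "\<And>x. x \<in> U \<Longrightarrow> norm x \<le> M" using U(1) by (rule admissible_bounded) blast
  have lip: "norm (prim u t - prim u s) \<le> M * \<bar>t - s\<bar>" if "admissible U T u" "s \<in> {0..T}" "t \<in> {0..T}" for u s t
    using primitive_lipschitz[OF U(1) M(2) that] by (simp add: prim_def)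
  define d where "d = e / (4 * M)"
  have d: "d > 0" using e M by (simp add: d_def)
  obtain Z where Z: "finite Z" "Z \<subseteq> {0..T}" "{0..T} \<subseteq> (\<Union>z\<in>Z. ball z d)"
    using compactE_image[OF compact_Icc[of 0 T], of "{0..T}" "\<lambda>z. ball z d"] d by (metis UN_I centre_in_ball open_ball subsetI)
  have "\<forall>\<^sub>F n in sequentially. \<forall>z\<in>Z. norm (prim (u n) z - prim v z) < e / 2"
    using Z(1,2) lim e by (intro eventually_ball_finite) (auto dest!: tendstoD[of _ _ _ "e / 2"] simp: dist_norm subset_iff)
  then show ?thesis
  proof eventually_elim
    case (elim n)
    show ?case
    proof
      fix t assume t: "t \<in> {0..T}"
      then obtain z where z: "z \<in> Z" "dist z t < d" using Z(3) by auto
      then have zT: "z \<in> {0..T}" using Z(2) by auto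
      have "M * \<bar>t - z\<bar> \<le> M * d" using z(2) M by (intro mult_left_mono) (auto simp: dist_real_def)
      also have "\<dots> = e / 4" using M by (simp add: d_def)
      finally have "norm (prim (u n) t - prim (u n) z) \<le> e / 4" "norm (prim v t - prim v z) \<le> e / 4"
        using lip[OF u[of n] zT t] lip[OF v zT t] by linarith+
      moreover have "norm (prim (u n) z - prim v z) < e / 2" using elim z(1) by blast
      moreover have eq: "prim (u n) t - prim v t = (prim (u n) t - prim (u n) z) + (prim (u n) z - prim v z) - (prim v t - prim v z)" by simp
      ultimately show "norm (prim (u n) t - prim v t) \<le> e"
        unfolding eq using norm_triangle_ineq4[of "(prim (u n) t - prim (u n) z) + (prim (u n) z - prim v z)" "prim v t - prim v z"]
          norm_triangle_ineq[of "prim (u n) t - prim (u n) z" "prim (u n) z - prim v z"] by linarith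
    qed
  qed
qed

theorem minimizer_exists:
  assumes lsc: "W2_lsc \<psi>" and ne: "U \<noteq> {}"
  obtains u \<mu> y where "admissible U T u" "is_solution F G \<mu>0 y0 T u \<mu> y"
    "\<And>u' \<mu>' y'. admissible U T u' \<Longrightarrow> is_solution F G \<mu>0 y0 T u' \<mu>' y' \<Longrightarrow> \<psi> (\<mu> T) \<le> \<psi> (\<mu>' T)"
proof -
  \<comment> \<open>The values are taken over all pairs of a control and a solution, in the extended
    reals, where an infimum is available before the cost is known to be bounded below.\<close>
  define S where "S = {ereal (\<psi> (\<mu> T)) |u \<mu> y. admissible U T u \<and> is_solution F G \<mu>0 y0 T u \<mu> y}"
  obtain c where c: "c \<in> U" using ne by auto
  have ac: "admissible U T (\<lambda>_. c)" using c by (simp add: admissible_def set_borel_measurable_def)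
  obtain \<mu>c yc where "is_solution F G \<mu>0 y0 T (\<lambda>_. c) \<mu>c yc" by (rule solution_exists[OF ac])
  then have "ereal (\<psi> (\<mu>c T)) \<in> S" unfolding S_def using ac by blast
  then have "S \<noteq> {}" by blast
  from Inf_countable_INF[OF this] obtain f where f: "decseq f" "range f \<subseteq> S" "Inf S = (INF i. f i)" by auto
  have flim: "f \<longlonglongrightarrow> Inf S" unfolding f(3) using f(1) by (rule LIMSEQ_INF)
  have "\<exists>p. f n = ereal (\<psi> (fst (snd p) T)) \<and> admissible U T (fst p) \<and> is_solution F G \<mu>0 y0 T (fst p) (fst (snd p)) (snd (snd p))" for n
  proof -
    have "f n \<in> S" using f(2) by auto
    then obtain u \<mu> y where "f n = ereal (\<psi> (\<mu> T))" "admissible U T u" "is_solution F G \<mu>0 y0 T u \<mu> y"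
      unfolding S_def by blast
    then show ?thesis by (intro exI[of _ "(u, \<mu>, y)"]) simp
  qed
  then obtain p where p: "\<And>n. f n = ereal (\<psi> (fst (snd (p n)) T)) \<and> admissible U T (fst (p n)) \<and>
      is_solution F G \<mu>0 y0 T (fst (p n)) (fst (snd (p n))) (snd (snd (p n)))" by metis
  define u \<mu> y where "u n = fst (p n)" and "\<mu> n = fst (snd (p n))" and "y n = snd (snd (p n))" for n
  have u: "f n = ereal (\<psi> (\<mu> n T))" "admissible U T (u n)" "is_solution F G \<mu>0 y0 T (u n) (\<mu> n) (y n)" for n
    using p[of n] by (simp_all add: u_def \<mu>_def y_def)
  obtain r v where r: "strict_mono (r :: nat \<Rightarrow> nat)" and v: "admissible U T v"
    and lim: "\<forall>t\<in>{0..T}. (\<lambda>n. LINT s:{0..t}|lborel. u (r n) s) \<longlonglongrightarrow> (LINT s:{0..t}|lborel. v s)"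
    by (rule control_compactness[OF T U u(2)])
  obtain \<mu>' y' \<Phi>' where lag': "lagrangian (prim v) \<mu>' y' \<Phi>'" using lagrangian_exists[OF prim_cont[OF v]] by blast
  have sol': "is_solution F G \<mu>0 y0 T v \<mu>' y'" by (rule lag_is_solution[OF lag' admissible_prim[OF v]])
  have "T \<in> {0..T}" using T by simp
  have le: "ereal (\<psi> (\<mu>' T)) \<le> s" if s: "s \<in> S" for s
  proof (rule ereal_le_epsilon2)
    fix e :: real assume e: "e > 0"
    have P: "\<mu>' T \<in> P2" using lag_Pc[OF lag' \<open>T \<in> {0..T}\<close>] Pc_subset_P2 by auto
    obtain d where d: "d > 0" "\<And>\<nu>. \<nu> \<in> P2 \<Longrightarrow> W2 (\<mu>' T) \<nu> < d \<Longrightarrow> \<psi> \<nu> > \<psi> (\<mu>' T) - e / 2"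
      using lsc P e unfolding W2_lsc_def by (metis half_gt_zero)
    \<comment> \<open>With this tolerance on primitives, \<open>stability\<close> bounds the
      distance of the final measures by \<open>d / 2\<close>, inside the neighbourhood given by
      lower semicontinuity.\<close>
    define v0 where "v0 = d / (4 * exp (8 * L * T))"
    have v0: "v0 > 0" using d by (simp add: v0_def)
    have ev1: "\<forall>\<^sub>F n in sequentially. \<forall>t\<in>{0..T}. norm (prim (u (r n)) t - prim v t) \<le> v0"
      using lim by (intro uniform_primitives u(2) v v0) (simp add: prim_def)
    have ev2: "\<forall>\<^sub>F n in sequentially. f (r n) < s + ereal (e / 2)"
    proof -
      have "(\<lambda>n. f (r n)) \<longlonglongrightarrow> Inf S" using LIMSEQ_subseq_LIMSEQ[OF flim r] by (simp add: comp_def)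
      moreover have "Inf S < s + ereal (e / 2)"
      proof -
        obtain a where "s = ereal a" using s unfolding S_def by auto
        then have "s < s + ereal (e / 2)" using e by simp
        then show ?thesis using Inf_lower[OF s] by (rule le_less_trans[rotated])
      qed
      ultimately show ?thesis by (rule order_tendstoD(2))
    qed
    obtain n where n: "\<forall>t\<in>{0..T}. norm (prim (u (r n)) t - prim v t) \<le> v0" "f (r n) < s + ereal (e / 2)"
      using eventually_happens[OF eventually_conj[OF ev1 ev2]] by auto
    obtain \<Phi> where lag: "lagrangian (prim (u (r n))) (\<mu> (r n)) (y (r n)) \<Phi>"
      using admissible_solution_lagrangian[OF u(2,3)] by blast
    have "W2 (\<mu>' T) (\<mu> (r n) T) \<le> 2 * v0 * exp (8 * L * T)"
    proof (rule lag_W2_le[OF lag' lag \<open>T \<in> {0..T}\<close>])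
      fix x assume x: "x \<in> supp \<mu>0"
      have "norm (prim v t - prim (u (r n)) t) \<le> v0" if "t \<in> {0..T}" for t using n(1) that by (simp add: norm_minus_commute)
      from stability[OF lag' lag this \<open>T \<in> {0..T}\<close> x]
      show "norm (\<Phi>' T x - \<Phi> T x) \<le> 2 * v0 * exp (8 * L * T)" using norm_ge_zero[of "y' T - y (r n) T"] by linarith
    qed (use v0 in auto)
    also have "\<dots> < d" using d by (simp add: v0_def)
    finally have "\<psi> (\<mu> (r n) T) > \<psi> (\<mu>' T) - e / 2"
      using lag_Pc[OF lag \<open>T \<in> {0..T}\<close>] Pc_subset_P2 by (intro d(2)) auto
    then have "ereal (\<psi> (\<mu>' T)) \<le> f (r n) + ereal (e / 2)" by (simp add: u(1))
    also have "\<dots> \<le> s + ereal (e / 2) + ereal (e / 2)" using n(2) by (intro add_right_mono less_imp_le)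
    also have "\<dots> = s + ereal e" by (simp add: add.assoc)
    finally show "ereal (\<psi> (\<mu>' T)) \<le> s + ereal e" .
  qed
  show thesis
  proof (rule that[OF v sol'])
    fix u'' \<mu>'' y'' assume "admissible U T u''" "is_solution F G \<mu>0 y0 T u'' \<mu>'' y''"
    then have "ereal (\<psi> (\<mu>'' T)) \<in> S" unfolding S_def by blast
    from le[OF this] show "\<psi> (\<mu>' T) \<le> \<psi> (\<mu>'' T)" by simp
  qed
qed

end

end

subsection \<open>Integrals depending on parameters\<close>

lemma norm_matrix_vector_le: "norm (A *v x) \<le> norm A * norm (x :: real^'n)" for A :: "real^'n^'m"
proof -
  have "norm (A *v x) = L2_set (\<lambda>i. norm (A $ i \<bullet> x)) UNIV"
    by (simp add: norm_vec_def matrix_vector_mul_component)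
  also have "\<dots> \<le> L2_set (\<lambda>i. norm (A $ i) * norm x) UNIV"
    by (intro L2_set_mono) (auto simp: Cauchy_Schwarz_ineq2)
  also have "\<dots> = norm A * norm x" by (simp add: norm_vec_def[of A] L2_set_left_distrib)
  finally show ?thesis .
qed

lemma continuous_on_matrix_vector [continuous_intros]:
  fixes A :: "'a::topological_space \<Rightarrow> real^'n^'m"
  assumes "continuous_on S A" "continuous_on S v"
  shows "continuous_on S (\<lambda>x. A x *v v x)"
  unfolding matrix_vector_mult_def using assms by (intro continuous_intros) auto

lemma inner_transpose: "(transpose A *v a) \<bullet> b = a \<bullet> (A *v b)" for A :: "real^'n^'m"
  by (simp add: transpose_matrix_vector dot_lmul_matrix)

lemma integrable_inner_continuous:
  fixes g :: "real^'n \<Rightarrow> 'e::euclidean_space"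
  assumes \<nu>: "\<nu> \<in> Pc" and p: "integrable \<nu> p" and g: "continuous_on UNIV g"
  shows "integrable \<nu> (\<lambda>x. p x \<bullet> g x)"
proof -
  have "compact (g ` supp \<nu>)"
    using g Pc_compact[OF \<nu>] by (intro compact_continuous_image) (auto intro: continuous_on_subset)
  then obtain B where B: "\<And>x. x \<in> supp \<nu> \<Longrightarrow> norm (g x) \<le> B" using compact_imp_bounded by (fastforce simp: bounded_iff)
  have m: "(\<lambda>x. p x \<bullet> g x) \<in> borel_measurable \<nu>"
  proof (rule borel_measurable_inner[OF borel_measurable_integrable[OF p]])
    show "g \<in> borel_measurable \<nu>"
      using borel_measurable_continuous_onI[OF g] by (simp only: measurable_cong_sets[OF Pc_sets[OF \<nu>] refl])
  qed
  have le: "AE x in \<nu>. norm (p x \<bullet> g x) \<le> norm (norm (p x) * B)"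
    using AE_supp[OF \<nu>]
  proof eventually_elim
    case (elim x)
    have "norm (p x) * norm (g x) \<le> norm (p x) * B" using B[OF elim] by (intro mult_left_mono) auto
    then show ?case using Cauchy_Schwarz_ineq2[of "p x" "g x"] by simp
  qed
  show ?thesis using p by (intro Bochner_Integration.integrable_bound[OF _ m le]) auto
qed

text \<open>The difference of two pairings splits into \<open>(p (\<tau> \<sigma>) - p (\<tau>
  \<sigma>0)) \<bullet> g \<sigma>\<close>, small by L1 continuity of \<open>p\<close> and
  boundedness of \<open>g\<close> on the support, and
  \<open>p (\<tau> \<sigma>0) \<bullet> (g \<sigma> - g \<sigma>0)\<close>, small because
  \<open>g\<close> varies uniformly over the compact support.\<close>

lemma continuous_pairing:
  fixes p :: "real \<Rightarrow> real^'n \<Rightarrow> 'e::euclidean_space" and g :: "'s::metric_space \<Rightarrow> real^'n \<Rightarrow> 'e"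
  assumes \<nu>: "\<nu> \<in> Pc" and g: "continuous_on (S \<times> UNIV) (\<lambda>(\<sigma>, x). g \<sigma> x)"
    and p: "\<And>t. t \<in> I \<Longrightarrow> integrable \<nu> (p t)"
    and pc: "\<And>t e. t \<in> I \<Longrightarrow> e > 0 \<Longrightarrow> \<exists>d>0. \<forall>s\<in>I. dist s t < d \<longrightarrow> (\<integral>x. norm (p s x - p t x) \<partial>\<nu>) < e"
    and \<tau>: "continuous_on S \<tau>" "\<And>\<sigma>. \<sigma> \<in> S \<Longrightarrow> \<tau> \<sigma> \<in> I"
  shows "continuous_on S (\<lambda>\<sigma>. \<integral>x. p (\<tau> \<sigma>) x \<bullet> g \<sigma> x \<partial>\<nu>)"
proof -
  have gx: "continuous_on UNIV (g \<sigma>)" if "\<sigma> \<in> S" for \<sigma>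
    by (rule continuous_on_pair_compose[OF g continuous_on_const continuous_on_id]) (rule that)
  have key: "\<exists>d>0. \<forall>\<sigma>\<in>S. dist \<sigma> \<sigma>0 < d \<longrightarrow>
      dist (\<integral>x. p (\<tau> \<sigma>) x \<bullet> g \<sigma> x \<partial>\<nu>) (\<integral>x. p (\<tau> \<sigma>0) x \<bullet> g \<sigma>0 x \<partial>\<nu>) < e"
    if \<sigma>0: "\<sigma>0 \<in> S" and e: "e > 0" for \<sigma>0 e
  proof -
    let ?p0 = "\<integral>x. norm (p (\<tau> \<sigma>0) x) \<partial>\<nu>"
    have "compact (g \<sigma>0 ` supp \<nu>)"
      using gx[OF \<sigma>0] Pc_compact[OF \<nu>] by (intro compact_continuous_image) (auto intro: continuous_on_subset)
    then have "bounded (g \<sigma>0 ` supp \<nu>)" by (rule compact_imp_bounded)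
    then obtain B where B: "B > 0" "\<forall>y\<in>g \<sigma>0 ` supp \<nu>. norm y \<le> B" unfolding bounded_pos by blast
    have p0: "?p0 \<ge> 0" by simp
    \<comment> \<open>The cap 1 bounds \<open>g \<sigma>\<close> by \<open>B + 1\<close> near
      \<open>\<sigma>0\<close>; the quotient keeps the share of
      \<open>g \<sigma> - g \<sigma>0\<close> below \<open>e / 2\<close>, and the summand 1 covers a
      vanishing integral of \<open>p\<close>.\<close>
    define \<eta> where "\<eta> = min 1 (e / (2 * (?p0 + 1)))"
    have \<eta>: "\<eta> > 0" "\<eta> \<le> 1" "\<eta> * ?p0 < e / 2"
    proof -
      have pp: "?p0 + 1 > 0" using p0 by linarith
      then have "e / (2 * (?p0 + 1)) > 0" using e by simp
      then show "\<eta> > 0" "\<eta> \<le> 1" unfolding \<eta>_def by linarith+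
      have "\<eta> * ?p0 \<le> e / (2 * (?p0 + 1)) * ?p0" using p0 by (intro mult_right_mono) (auto simp: \<eta>_def)
      also have "\<dots> = e / 2 * (?p0 / (?p0 + 1))" by (simp add: divide_simps)
      also have "\<dots> < e / 2 * 1" using e pp by (intro mult_strict_left_mono) (auto simp: pos_divide_less_eq)
      also have "\<dots> = e / 2" by simp
      finally show "\<eta> * ?p0 < e / 2" .
    qed
    obtain X0 where X0: "\<sigma>0 \<in> X0" "open X0"
      and X0g: "\<forall>\<sigma>\<in>X0 \<inter> S. \<forall>x\<in>supp \<nu>. dist ((\<lambda>(\<sigma>, x). g \<sigma> x) (\<sigma>, x)) ((\<lambda>(\<sigma>, x). g \<sigma> x) (\<sigma>0, x)) \<le> \<eta>"
      by (rule continuous_on_prod_compactE[OF continuous_on_subset[OF g] Pc_compact[OF \<nu>] \<sigma>0 \<eta>(1)]) auto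
    obtain d1 where d1: "d1 > 0" "ball \<sigma>0 d1 \<subseteq> X0" using X0 openE by blast
    have e2: "e / (2 * (B + 1)) > 0" using e B by simp
    obtain d2 where d2: "d2 > 0" "\<forall>s\<in>I. dist s (\<tau> \<sigma>0) < d2 \<longrightarrow> (\<integral>x. norm (p s x - p (\<tau> \<sigma>0) x) \<partial>\<nu>) < e / (2 * (B + 1))"
      using pc[OF \<tau>(2)[OF \<sigma>0] e2] by blast
    obtain d3 where d3: "d3 > 0" "\<forall>\<sigma>\<in>S. dist \<sigma> \<sigma>0 < d3 \<longrightarrow> dist (\<tau> \<sigma>) (\<tau> \<sigma>0) < d2"
      using \<tau>(1) \<sigma>0 d2(1) unfolding continuous_on_iff by blast
    show ?thesis
    proof (intro exI[of _ "min d1 d3"] conjI ballI impI)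
      fix \<sigma> assume \<sigma>: "\<sigma> \<in> S" "dist \<sigma> \<sigma>0 < min d1 d3"
      have gd: "norm (g \<sigma> x - g \<sigma>0 x) \<le> \<eta>" if "x \<in> supp \<nu>" for x
      proof -
        have "\<sigma> \<in> X0" using \<sigma>(2) d1(2) by (auto simp: dist_commute)
        then show ?thesis using X0g \<sigma>(1) that by (simp add: dist_norm)
      qed
      have gB: "norm (g \<sigma> x) \<le> B + 1" if "x \<in> supp \<nu>" for x
        using gd[OF that] B(2) that \<eta>(2) norm_triangle_sub[of "g \<sigma> x" "g \<sigma>0 x"] by force
      have i1: "integrable \<nu> (\<lambda>x. p (\<tau> \<sigma>) x \<bullet> g \<sigma> x)" by (intro integrable_inner_continuous \<nu> p \<tau> \<sigma> gx)
      have i2: "integrable \<nu> (\<lambda>x. p (\<tau> \<sigma>0) x \<bullet> g \<sigma>0 x)" by (intro integrable_inner_continuous \<nu> p \<tau> \<sigma>0 gx)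
      have ipd: "integrable \<nu> (\<lambda>x. norm (p (\<tau> \<sigma>) x - p (\<tau> \<sigma>0) x))"
        by (intro integrable_norm Bochner_Integration.integrable_diff p \<tau> \<sigma> \<sigma>0)
      have ip: "integrable \<nu> (\<lambda>x. norm (p (\<tau> \<sigma>0) x))" by (intro integrable_norm p \<tau> \<sigma>0)
      have "dist (\<integral>x. p (\<tau> \<sigma>) x \<bullet> g \<sigma> x \<partial>\<nu>) (\<integral>x. p (\<tau> \<sigma>0) x \<bullet> g \<sigma>0 x \<partial>\<nu>)
          = \<bar>\<integral>x. p (\<tau> \<sigma>) x \<bullet> g \<sigma> x - p (\<tau> \<sigma>0) x \<bullet> g \<sigma>0 x \<partial>\<nu>\<bar>"
        using i1 i2 by (simp add: dist_real_def)
      also have "\<dots> \<le> (\<integral>x. \<bar>p (\<tau> \<sigma>) x \<bullet> g \<sigma> x - p (\<tau> \<sigma>0) x \<bullet> g \<sigma>0 x\<bar> \<partial>\<nu>)" by (rule integral_abs_bound)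
      also have "\<dots> \<le> (\<integral>x. norm (p (\<tau> \<sigma>) x - p (\<tau> \<sigma>0) x) * (B + 1) + norm (p (\<tau> \<sigma>0) x) * \<eta> \<partial>\<nu>)"
      proof (rule integral_mono_AE)
        show "AE x in \<nu>. \<bar>p (\<tau> \<sigma>) x \<bullet> g \<sigma> x - p (\<tau> \<sigma>0) x \<bullet> g \<sigma>0 x\<bar>
            \<le> norm (p (\<tau> \<sigma>) x - p (\<tau> \<sigma>0) x) * (B + 1) + norm (p (\<tau> \<sigma>0) x) * \<eta>"
          using AE_supp[OF \<nu>]
        proof eventually_elim
          case (elim x)
          have "p (\<tau> \<sigma>) x \<bullet> g \<sigma> x - p (\<tau> \<sigma>0) x \<bullet> g \<sigma>0 x = (p (\<tau> \<sigma>) x - p (\<tau> \<sigma>0) x) \<bullet> g \<sigma> x + p (\<tau> \<sigma>0) x \<bullet> (g \<sigma> x - g \<sigma>0 x)"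
            by (simp add: inner_diff_left inner_diff_right)
          also have "\<bar>\<dots>\<bar> \<le> norm (p (\<tau> \<sigma>) x - p (\<tau> \<sigma>0) x) * norm (g \<sigma> x) + norm (p (\<tau> \<sigma>0) x) * norm (g \<sigma> x - g \<sigma>0 x)"
            by (rule order_trans[OF abs_triangle_ineq add_mono[OF Cauchy_Schwarz_ineq2 Cauchy_Schwarz_ineq2]])
          also have "\<dots> \<le> norm (p (\<tau> \<sigma>) x - p (\<tau> \<sigma>0) x) * (B + 1) + norm (p (\<tau> \<sigma>0) x) * \<eta>"
            by (intro add_mono mult_left_mono gB gd elim norm_ge_zero)
          finally show ?case .
        qed
      qed (use i1 i2 ipd ip in auto)
      also have "\<dots> = (\<integral>x. norm (p (\<tau> \<sigma>) x - p (\<tau> \<sigma>0) x) \<partial>\<nu>) * (B + 1) + ?p0 * \<eta>" using ipd ip by simp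
      also have "\<dots> < e / (2 * (B + 1)) * (B + 1) + e / 2"
        using d2(2) d3(2) \<sigma> \<tau>(2) B \<eta>(3) by (intro add_strict_mono mult_strict_right_mono) (auto simp: mult.commute)
      also have "\<dots> = e" using B by (simp add: field_simps)
      finally show "dist (\<integral>x. p (\<tau> \<sigma>) x \<bullet> g \<sigma> x \<partial>\<nu>) (\<integral>x. p (\<tau> \<sigma>0) x \<bullet> g \<sigma>0 x \<partial>\<nu>) < e" .
    qed (use d1 d3 in auto)
  qed
  then show ?thesis unfolding continuous_on_iff by blast
qed

lemma continuous_integral_Pc:
  fixes g :: "'s::metric_space \<Rightarrow> real^'n \<Rightarrow> 'e::euclidean_space"
  assumes \<nu>: "\<nu> \<in> Pc" and g: "continuous_on (S \<times> UNIV) (\<lambda>(\<sigma>, x). g \<sigma> x)"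
  shows "continuous_on S (\<lambda>\<sigma>. \<integral>x. g \<sigma> x \<partial>\<nu>)"
proof (subst continuous_on_componentwise, rule ballI)
  fix i :: 'e assume i: "i \<in> Basis"
  have gx: "continuous_on UNIV (g \<sigma>)" if "\<sigma> \<in> S" for \<sigma>
    by (rule continuous_on_pair_compose[OF g continuous_on_const continuous_on_id]) (rule that)
  have "continuous_on S (\<lambda>\<sigma>. \<integral>x. (\<lambda>_ _. i) (0::real) x \<bullet> g \<sigma> x \<partial>\<nu>)"
    by (rule continuous_pairing[OF \<nu> g, of "{0}" "\<lambda>_ _. i" "\<lambda>_. 0"]) (auto intro: integrable_continuous_Pc[OF \<nu>] exI[of _ "1::real"])
  then show "continuous_on S (\<lambda>\<sigma>. (\<integral>x. g \<sigma> x \<partial>\<nu>) \<bullet> i)"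
    by (rule continuous_on_eq) (simp add: inner_commute integral_inner_right integrable_continuous_Pc[OF \<nu> gx] flip: integral_inner_left)
qed

text \<open>The two variables are treated unequally: in the first the derivative exists everywhere
  and is continuous, in the second it is known only on the line \<open>r = t\<close>. The increment
  in the first variable is estimated at the moving second argument \<open>s\<close>, by the mean
  value theorem.\<close>

lemma diag_deriv:
  fixes H H' :: "real \<Rightarrow> real \<Rightarrow> real"
  assumes t: "t \<in> {0..T}"
    and H: "\<And>r s. r \<in> {0..T} \<Longrightarrow> s \<in> {0..T} \<Longrightarrow> ((\<lambda>r. H r s) has_real_derivative H' r s) (at r within {0..T})"
    and H': "continuous_on ({0..T} \<times> {0..T}) (\<lambda>(r, s). H' r s)"
    and h: "((\<lambda>s. H t s) has_real_derivative h) (at t within {0..T})"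
  shows "((\<lambda>s. H s s) has_real_derivative H' t t + h) (at t within {0..T})"
proof -
  have "((\<lambda>s. H s s - H t s) has_real_derivative H' t t) (at t within {0..T})"
    unfolding has_field_derivative_def has_derivative_within_alt2
  proof (intro conjI allI impI)
    fix e :: real assume e: "e > 0"
    have "(t, t) \<in> {0..T} \<times> {0..T}" using t by auto
    moreover have "e / 3 > 0" using e by simp
    ultimately obtain d where d: "d > 0" "\<forall>q\<in>{0..T} \<times> {0..T}. dist q (t, t) < d \<longrightarrow> dist (case q of (r, s) \<Rightarrow> H' r s) (case (t, t) of (r, s) \<Rightarrow> H' r s) < e / 3"
      using H' unfolding continuous_on_iff by blast
    have near: "\<bar>H' r s - H' t t\<bar> \<le> e / 3" if "r \<in> {0..T}" "s \<in> {0..T}" "\<bar>r - t\<bar> < d / 2" "\<bar>s - t\<bar> < d / 2" for r s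
    proof -
      have "dist (r, s) (t, t) \<le> \<bar>r - t\<bar> + \<bar>s - t\<bar>"
        using sqrt_sum_squares_le_sum_abs[of "r - t" "s - t"] by (simp add: dist_Pair_Pair dist_real_def)
      then have "dist (r, s) (t, t) < d" using that by linarith
      then show ?thesis using d(2) that(1,2) by (force simp: dist_real_def intro: less_imp_le)
    qed
    have "\<forall>\<^sub>F s in at t within {0..T}. s \<in> {0..T} \<and> \<bar>s - t\<bar> < d / 2"
      using d(1) unfolding eventually_at by (intro exI[of _ "d / 2"]) (auto simp: dist_real_def)
    then show "\<forall>\<^sub>F s in at t within {0..T}. norm (H s s - H t s - (H t t - H t t) - H' t t * (s - t)) \<le> e * norm (s - t)"
    proof eventually_elim
      case (elim s)
      have seg: "r \<in> {0..T} \<and> \<bar>r - t\<bar> < d / 2" if "r \<in> closed_segment t s" for r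
        using that elim t by (auto simp: closed_segment_eq_real_ivl split: if_splits)
      have "norm (H s s - H t s - (s - t) *\<^sub>R H' t s) \<le> norm (s - t) * (2 * e / 3)"
      proof (rule vector_differentiable_bound_linearization[where S="closed_segment t s" and f="\<lambda>r. H r s" and f'="\<lambda>r. H' r s"])
        fix r assume r: "r \<in> closed_segment t s"
        have "closed_segment t s \<subseteq> {0..T}" using seg by blast
        then show "((\<lambda>r. H r s) has_vector_derivative H' r s) (at r within closed_segment t s)"
          using DERIV_subset[OF H[of r s]] seg[OF r] elim by (auto simp: has_real_derivative_iff_has_vector_derivative)
        show "norm (H' r s - H' t s) \<le> 2 * e / 3"
        proof -
          have "\<bar>H' r s - H' t t\<bar> \<le> e / 3" "\<bar>H' t s - H' t t\<bar> \<le> e / 3"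
            using near[of r s] near[of t s] seg[OF r] elim t d(1) by auto
          then show ?thesis unfolding real_norm_def by linarith
        qed
      qed auto
      moreover have "\<bar>s - t\<bar> * \<bar>H' t s - H' t t\<bar> \<le> \<bar>s - t\<bar> * (e / 3)"
        using near[of t s] elim t d(1) by (intro mult_left_mono) auto
      then have "\<bar>(s - t) * H' t s - (s - t) * H' t t\<bar> \<le> \<bar>s - t\<bar> * (e / 3)"
        by (simp add: abs_mult[symmetric] right_diff_distrib)
      moreover have "norm (s - t) * (2 * e / 3) = 2 * (\<bar>s - t\<bar> * (e / 3))" "e * norm (s - t) = 3 * (\<bar>s - t\<bar> * (e / 3))" by simp_all
      ultimately have "\<bar>H s s - H t s - (s - t) * H' t t\<bar> \<le> e * norm (s - t)" unfolding real_norm_def real_scaleR_def by linarith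
      then show ?case by (simp add: mult.commute[of "H' t t"])
    qed
  qed (rule bounded_linear_mult_right)
  then have "((\<lambda>s. (H s s - H t s) + H t s) has_real_derivative H' t t + h) (at t within {0..T})"
    using h by (rule DERIV_add)
  then show ?thesis by simp
qed

lemma fubini_finite:
  fixes f :: "'a \<Rightarrow> 'b \<Rightarrow> real"
  assumes M: "finite_measure M" and N: "finite_measure N"
    and m: "(\<lambda>(x, y). f x y) \<in> borel_measurable (M \<Otimes>\<^sub>M N)"
    and k: "integrable N k" and le: "AE x in M. AE y in N. \<bar>f x y\<bar> \<le> k y"
  shows "(\<integral>y. (\<integral>x. f x y \<partial>M) \<partial>N) = (\<integral>x. (\<integral>y. f x y \<partial>N) \<partial>M)"
    and "integrable M (\<lambda>x. \<integral>y. f x y \<partial>N)" and "integrable N (\<lambda>y. \<integral>x. f x y \<partial>M)"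
proof -
  interpret M: finite_measure M by fact
  interpret N: finite_measure N by fact
  interpret pair_sigma_finite M N ..
  have mx: "AE x in M. f x \<in> borel_measurable N"
    using measurable_compose[OF measurable_Pair1' m] by (intro AE_I2) simp
  have ix: "AE x in M. integrable N (f x)"
    using le mx
  proof eventually_elim
    case (elim x)
    show ?case by (rule Bochner_Integration.integrable_bound[OF k elim(2)])
      (use elim(1) in \<open>auto elim!: eventually_mono intro: order_trans[OF _ abs_ge_self]\<close>)
  qed
  have int: "integrable (M \<Otimes>\<^sub>M N) (\<lambda>(x, y). f x y)"
  proof (rule Fubini_integrable[OF m])
    show "AE x in M. integrable N (\<lambda>y. case (x, y) of (x, y) \<Rightarrow> f x y)" using ix by simp
    have m2: "(\<lambda>x. \<integral>y. norm (f x y) \<partial>N) \<in> borel_measurable M"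
      using m by (intro N.borel_measurable_lebesgue_integral) (simp add: split_beta')
    show "integrable M (\<lambda>x. \<integral>y. norm (case (x, y) of (x, y) \<Rightarrow> f x y) \<partial>N)"
      unfolding prod.case
    proof (rule M.integrable_const_bound[OF _ m2])
      show "AE x in M. norm (\<integral>y. norm (f x y) \<partial>N) \<le> (\<integral>y. k y \<partial>N)"
        using le ix by eventually_elim (auto intro!: integral_mono_AE k)
    qed
  qed
  show "(\<integral>y. (\<integral>x. f x y \<partial>M) \<partial>N) = (\<integral>x. (\<integral>y. f x y \<partial>N) \<partial>M)" using Fubini_integral[OF int] .
  show "integrable M (\<lambda>x. \<integral>y. f x y \<partial>N)" using integrable_fst'[OF int] by simp
  show "integrable N (\<lambda>y. \<integral>x. f x y \<partial>M)" using integrable_snd[OF int] by simp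
qed

text \<open>On a probability space this is the pointwise bound of \<open>norm (f x)\<close> by
  \<open>((norm (f x))\<^sup>2 / e + e) / 2\<close>, integrated.\<close>

lemma L2_imp_L1:
  assumes \<nu>: "prob_space \<nu>" and f: "f \<in> borel_measurable \<nu>" and e: "e > 0"
    and le: "(\<integral>\<^sup>+ x. ennreal ((norm (f x :: real^'n))\<^sup>2) \<partial>\<nu>) < ennreal (e\<^sup>2)"
  shows "integrable \<nu> f" "(\<integral>x. norm (f x) \<partial>\<nu>) < e"
proof -
  interpret prob_space \<nu> by fact
  have i2: "integrable \<nu> (\<lambda>x. (norm (f x))\<^sup>2)"
    using le f by (intro integrableI_nonneg) (auto intro: less_trans simp del: ennreal_power)
  have v2: "(\<integral>x. (norm (f x))\<^sup>2 \<partial>\<nu>) < e\<^sup>2"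
    using le e unfolding nn_integral_eq_integral[OF i2, simplified] by (subst (asm) ennreal_less_iff) auto
  have bd: "norm (f x) \<le> ((norm (f x))\<^sup>2 / e + e) / 2" for x
  proof -
    have "0 \<le> (norm (f x) - e)\<^sup>2" by simp
    then show ?thesis using e by (simp add: power2_diff field_simps power2_eq_square)
  qed
  have ib: "integrable \<nu> (\<lambda>x. ((norm (f x))\<^sup>2 / e + e) / 2)" using i2 by auto
  show fi: "integrable \<nu> f"
    by (rule Bochner_Integration.integrable_bound[OF ib f]) (use bd in \<open>auto intro!: AE_I2 intro: order_trans[OF _ abs_ge_self]\<close>)
  have "(\<integral>x. norm (f x) \<partial>\<nu>) \<le> (\<integral>x. ((norm (f x))\<^sup>2 / e + e) / 2 \<partial>\<nu>)"
    using fi ib bd by (intro integral_mono integrable_norm) auto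
  also have "\<dots> = ((\<integral>x. (norm (f x))\<^sup>2 \<partial>\<nu>) / e + e) / 2" using i2 by (simp add: prob_space)
  also have "\<dots> < (e\<^sup>2 / e + e) / 2" using v2 e by (intro divide_strict_right_mono add_strict_right_mono) auto
  also have "\<dots> = e" using e by (simp add: power2_eq_square)
  finally show "(\<integral>x. norm (f x) \<partial>\<nu>) < e" .
qed

subsection \<open>The linearised operator along a trajectory\<close>

locale diff_system = lip_system F G L T \<mu>0 y0
  for F :: "(real^'d) measure \<Rightarrow> real^'d \<Rightarrow> real^'c \<Rightarrow> real^'d" and G :: "(real^'d) measure \<Rightarrow> real^'c \<Rightarrow> real^'c"
    and L T :: real and \<mu>0 :: "(real^'d) measure" and y0 :: "real^'c" +
  fixes DxF :: "(real^'d) measure \<Rightarrow> real^'d \<Rightarrow> real^'c \<Rightarrow> real^'d^'d"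
    and DyF :: "(real^'d) measure \<Rightarrow> real^'d \<Rightarrow> real^'c \<Rightarrow> real^'c^'d"
    and DyG :: "(real^'d) measure \<Rightarrow> real^'c \<Rightarrow> real^'c^'c"
    and DmuF :: "(real^'d) measure \<Rightarrow> real^'d \<Rightarrow> real^'c \<Rightarrow> real^'d \<Rightarrow> real^'d^'d"
    and DmuG :: "(real^'d) measure \<Rightarrow> real^'c \<Rightarrow> real^'d \<Rightarrow> real^'d^'c"
  assumes h1: "H1 F G DxF DyF DyG DmuF DmuG" and h2: "H2 DxF DyF DyG" and h3: "H3 DmuF DmuG"
begin

context
  fixes V \<mu> y \<Phi> assumes lag: "lagrangian V \<mu> y \<Phi>"
begin

text \<open>\<open>W2\<close> enters as a plain function on measures rather than through a metric
  type, so composition with the path \<open>\<mu>\<close> is carried out by hand, once for the five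
  coefficients. The single parameter \<open>X\<close> bundles their remaining arguments.\<close>

lemma lag_W2_compose:
  fixes E :: "(real^'d) measure \<Rightarrow> 'x::metric_space \<Rightarrow> 'b::real_normed_vector" and X :: "'s::metric_space \<Rightarrow> 'x"
  assumes E: "\<And>\<nu> x e. \<nu> \<in> Pc \<Longrightarrow> e > 0 \<Longrightarrow> \<exists>\<delta>>0. \<forall>\<nu>'\<in>Pc. \<forall>x'. W2 \<nu> \<nu>' < \<delta> \<and> dist x x' < \<delta> \<longrightarrow> norm (E \<nu>' x' - E \<nu> x) < e"
    and \<tau>: "continuous_on S \<tau>" "\<And>\<sigma>. \<sigma> \<in> S \<Longrightarrow> \<tau> \<sigma> \<in> {0..T}" and X: "continuous_on S X"
  shows "continuous_on S (\<lambda>\<sigma>. E (\<mu> (\<tau> \<sigma>)) (X \<sigma>))"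
  unfolding continuous_on_iff
proof (intro ballI allI impI)
  fix \<sigma>0 and e :: real assume \<sigma>0: "\<sigma>0 \<in> S" and e: "e > 0"
  obtain \<delta> where \<delta>: "\<delta> > 0" "\<forall>\<nu>'\<in>Pc. \<forall>x'. W2 (\<mu> (\<tau> \<sigma>0)) \<nu>' < \<delta> \<and> dist (X \<sigma>0) x' < \<delta> \<longrightarrow> norm (E \<nu>' x' - E (\<mu> (\<tau> \<sigma>0)) (X \<sigma>0)) < e"
    using E[OF lag_Pc[OF lag \<tau>(2)[OF \<sigma>0]] e] by blast
  obtain d1 where d1: "d1 > 0" "\<forall>s\<in>{0..T}. dist s (\<tau> \<sigma>0) < d1 \<longrightarrow> W2 (\<mu> (\<tau> \<sigma>0)) (\<mu> s) < \<delta>"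
    using lag_W2_cont[OF lag \<tau>(2)[OF \<sigma>0] \<delta>(1)] by blast
  obtain d2 where d2: "d2 > 0" "\<forall>\<sigma>\<in>S. dist \<sigma> \<sigma>0 < d2 \<longrightarrow> dist (\<tau> \<sigma>) (\<tau> \<sigma>0) < d1"
    using \<tau>(1) \<sigma>0 d1(1) unfolding continuous_on_iff by blast
  obtain d3 where d3: "d3 > 0" "\<forall>\<sigma>\<in>S. dist \<sigma> \<sigma>0 < d3 \<longrightarrow> dist (X \<sigma>) (X \<sigma>0) < \<delta>"
    using X \<sigma>0 \<delta>(1) unfolding continuous_on_iff by blast
  show "\<exists>d>0. \<forall>\<sigma>\<in>S. dist \<sigma> \<sigma>0 < d \<longrightarrow> dist (E (\<mu> (\<tau> \<sigma>)) (X \<sigma>)) (E (\<mu> (\<tau> \<sigma>0)) (X \<sigma>0)) < e"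
  proof (intro exI[of _ "min d2 d3"] conjI ballI impI)
    fix \<sigma> assume \<sigma>: "\<sigma> \<in> S" "dist \<sigma> \<sigma>0 < min d2 d3"
    have "W2 (\<mu> (\<tau> \<sigma>0)) (\<mu> (\<tau> \<sigma>)) < \<delta>" using d1(2) d2(2) \<sigma> \<tau>(2) by auto
    moreover have "dist (X \<sigma>0) (X \<sigma>) < \<delta>" using d3(2) \<sigma> by (auto simp: dist_commute)
    ultimately show "dist (E (\<mu> (\<tau> \<sigma>)) (X \<sigma>)) (E (\<mu> (\<tau> \<sigma>0)) (X \<sigma>0)) < e"
      using \<delta>(2) lag_Pc[OF lag \<tau>(2)[OF \<sigma>(1)]] unfolding dist_norm by blast
  qed (use d2 d3 in auto)
qed

lemma coefficients_continuous:
  fixes S :: "'s::metric_space set" and X Z :: "'s \<Rightarrow> real^'d"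
  assumes \<tau>: "continuous_on S \<tau>" "\<And>\<sigma>. \<sigma> \<in> S \<Longrightarrow> \<tau> \<sigma> \<in> {0..T}" and X: "continuous_on S X" and Z: "continuous_on S Z"
  shows "continuous_on S (\<lambda>\<sigma>. DxF (\<mu> (\<tau> \<sigma>)) (\<Phi> (\<tau> \<sigma>) (X \<sigma>)) (y (\<tau> \<sigma>)))"
    "continuous_on S (\<lambda>\<sigma>. DyF (\<mu> (\<tau> \<sigma>)) (\<Phi> (\<tau> \<sigma>) (X \<sigma>)) (y (\<tau> \<sigma>)))"
    "continuous_on S (\<lambda>\<sigma>. DyG (\<mu> (\<tau> \<sigma>)) (y (\<tau> \<sigma>)))"
    "continuous_on S (\<lambda>\<sigma>. DmuF (\<mu> (\<tau> \<sigma>)) (\<Phi> (\<tau> \<sigma>) (X \<sigma>)) (y (\<tau> \<sigma>)) (\<Phi> (\<tau> \<sigma>) (Z \<sigma>)))"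
    "continuous_on S (\<lambda>\<sigma>. DmuG (\<mu> (\<tau> \<sigma>)) (y (\<tau> \<sigma>)) (\<Phi> (\<tau> \<sigma>) (Z \<sigma>)))"
proof -
  have \<Phi>: "continuous_on S (\<lambda>\<sigma>. \<Phi> (\<tau> \<sigma>) (X \<sigma>))" "continuous_on S (\<lambda>\<sigma>. \<Phi> (\<tau> \<sigma>) (Z \<sigma>))"
    using \<tau> by (intro continuous_on_pair_compose[OF lag_cont[OF lag]] X Z; blast)+
  have yc: "continuous_on S (\<lambda>\<sigma>. y (\<tau> \<sigma>))"
    by (rule continuous_on_compose2[OF lag_y_cont[OF lag] \<tau>(1)]) (use \<tau>(2) in auto)
  have small: "W2 \<nu> \<nu>' + dist (fst p) (fst p') + dist (snd p) (snd p') < \<delta>"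
    if "W2 \<nu> \<nu>' < \<delta> / 4 \<and> dist p p' < \<delta> / 4" "\<delta> > 0" for \<nu> \<nu>' :: "(real^'d) measure" and p p' :: "'u::metric_space \<times> 'v::metric_space" and \<delta>
    using that dist_fst_le[of p p'] dist_snd_le[of p p'] by linarith
  have small3: "W2 \<nu> \<nu>' + dist (fst p) (fst p') + dist (fst (snd p)) (fst (snd p')) + dist (snd (snd p)) (snd (snd p')) < \<delta>"
    if "W2 \<nu> \<nu>' < \<delta> / 4 \<and> dist p p' < \<delta> / 4" "\<delta> > 0"
    for \<nu> \<nu>' :: "(real^'d) measure" and p p' :: "'u::metric_space \<times> 'v::metric_space \<times> 'w::metric_space" and \<delta>
    using that dist_fst_le[of p p'] dist_snd_le[of p p'] dist_fst_le[of "snd p" "snd p'"] dist_snd_le[of "snd p" "snd p'"] by linarith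
  have "continuous_on S (\<lambda>\<sigma>. (\<lambda>\<nu> p. DxF \<nu> (fst p) (snd p)) (\<mu> (\<tau> \<sigma>)) (\<Phi> (\<tau> \<sigma>) (X \<sigma>), y (\<tau> \<sigma>)))"
  proof (rule lag_W2_compose[OF _ \<tau> continuous_on_Pair[OF \<Phi>(1) yc]])
    fix \<nu> :: "(real^'d) measure" and p :: "(real^'d) \<times> (real^'c)" and e :: real assume \<nu>: "\<nu> \<in> Pc" and e: "e > 0"
    obtain \<delta> where \<delta>: "\<delta> > 0" "\<forall>\<mu>'\<in>Pc. \<forall>x' y'. W2 \<nu> \<mu>' + dist (fst p) x' + dist (snd p) y' < \<delta> \<longrightarrow>
        norm (DxF \<mu>' x' y' - DxF \<nu> (fst p) (snd p)) < e \<and> norm (DyF \<mu>' x' y' - DyF \<nu> (fst p) (snd p)) < e"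
      using h2[unfolded H2_def, THEN conjunct1, rule_format, OF \<nu> e, of "fst p" "snd p"] by (elim exE conjE) (rule that; assumption)
    show "\<exists>\<delta>>0. \<forall>\<nu>'\<in>Pc. \<forall>x'. W2 \<nu> \<nu>' < \<delta> \<and> dist p x' < \<delta> \<longrightarrow> norm (DxF \<nu>' (fst x') (snd x') - DxF \<nu> (fst p) (snd p)) < e"
      by (intro exI[of _ "\<delta> / 4"] conjI ballI allI impI)
        (simp add: \<delta>(1), rule \<delta>(2)[rule_format, THEN conjunct1], assumption, rule small, assumption, rule \<delta>(1))
  qed
  then show "continuous_on S (\<lambda>\<sigma>. DxF (\<mu> (\<tau> \<sigma>)) (\<Phi> (\<tau> \<sigma>) (X \<sigma>)) (y (\<tau> \<sigma>)))" by simp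
  have "continuous_on S (\<lambda>\<sigma>. (\<lambda>\<nu> p. DyF \<nu> (fst p) (snd p)) (\<mu> (\<tau> \<sigma>)) (\<Phi> (\<tau> \<sigma>) (X \<sigma>), y (\<tau> \<sigma>)))"
  proof (rule lag_W2_compose[OF _ \<tau> continuous_on_Pair[OF \<Phi>(1) yc]])
    fix \<nu> :: "(real^'d) measure" and p :: "(real^'d) \<times> (real^'c)" and e :: real assume \<nu>: "\<nu> \<in> Pc" and e: "e > 0"
    obtain \<delta> where \<delta>: "\<delta> > 0" "\<forall>\<mu>'\<in>Pc. \<forall>x' y'. W2 \<nu> \<mu>' + dist (fst p) x' + dist (snd p) y' < \<delta> \<longrightarrow>
        norm (DxF \<mu>' x' y' - DxF \<nu> (fst p) (snd p)) < e \<and> norm (DyF \<mu>' x' y' - DyF \<nu> (fst p) (snd p)) < e"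
      using h2[unfolded H2_def, THEN conjunct1, rule_format, OF \<nu> e, of "fst p" "snd p"] by (elim exE conjE) (rule that; assumption)
    show "\<exists>\<delta>>0. \<forall>\<nu>'\<in>Pc. \<forall>x'. W2 \<nu> \<nu>' < \<delta> \<and> dist p x' < \<delta> \<longrightarrow> norm (DyF \<nu>' (fst x') (snd x') - DyF \<nu> (fst p) (snd p)) < e"
      by (intro exI[of _ "\<delta> / 4"] conjI ballI allI impI)
        (simp add: \<delta>(1), rule \<delta>(2)[rule_format, THEN conjunct2], assumption, rule small, assumption, rule \<delta>(1))
  qed
  then show "continuous_on S (\<lambda>\<sigma>. DyF (\<mu> (\<tau> \<sigma>)) (\<Phi> (\<tau> \<sigma>) (X \<sigma>)) (y (\<tau> \<sigma>)))" by simp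
  show "continuous_on S (\<lambda>\<sigma>. DyG (\<mu> (\<tau> \<sigma>)) (y (\<tau> \<sigma>)))"
  proof (rule lag_W2_compose[OF _ \<tau> yc])
    fix \<nu> :: "(real^'d) measure" and p :: "real^'c" and e :: real assume \<nu>: "\<nu> \<in> Pc" and e: "e > 0"
    obtain \<delta> where \<delta>: "\<delta> > 0" "\<forall>\<mu>'\<in>Pc. \<forall>y'. W2 \<nu> \<mu>' + dist p y' < \<delta> \<longrightarrow> norm (DyG \<mu>' y' - DyG \<nu> p) < e"
      using h2[unfolded H2_def, THEN conjunct2, rule_format, OF \<nu> e, of p] by (elim exE conjE) (rule that; assumption)
    show "\<exists>\<delta>>0. \<forall>\<nu>'\<in>Pc. \<forall>x'. W2 \<nu> \<nu>' < \<delta> \<and> dist p x' < \<delta> \<longrightarrow> norm (DyG \<nu>' x' - DyG \<nu> p) < e"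
      proof (intro exI[of _ "\<delta> / 2"] conjI ballI allI impI)
      fix \<nu>' x' assume "\<nu>' \<in> Pc" "W2 \<nu> \<nu>' < \<delta> / 2 \<and> dist p x' < \<delta> / 2"
      then show "norm (DyG \<nu>' x' - DyG \<nu> p) < e" by (intro \<delta>(2)[rule_format]) linarith+
    qed (use \<delta> in simp)
  qed
  have "continuous_on S (\<lambda>\<sigma>. (\<lambda>\<nu> p. DmuF \<nu> (fst p) (fst (snd p)) (snd (snd p))) (\<mu> (\<tau> \<sigma>)) (\<Phi> (\<tau> \<sigma>) (X \<sigma>), y (\<tau> \<sigma>), \<Phi> (\<tau> \<sigma>) (Z \<sigma>)))"
  proof (rule lag_W2_compose[OF _ \<tau> continuous_on_Pair[OF \<Phi>(1) continuous_on_Pair[OF yc \<Phi>(2)]]])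
    fix \<nu> :: "(real^'d) measure" and p :: "(real^'d) \<times> (real^'c) \<times> (real^'d)" and e :: real assume \<nu>: "\<nu> \<in> Pc" and e: "e > 0"
    obtain \<delta> where \<delta>: "\<delta> > 0" "\<forall>\<mu>'\<in>Pc. \<forall>x' y' \<zeta>'. W2 \<nu> \<mu>' + dist (fst p) x' + dist (fst (snd p)) y' + dist (snd (snd p)) \<zeta>' < \<delta> \<longrightarrow>
        norm (DmuF \<mu>' x' y' \<zeta>' - DmuF \<nu> (fst p) (fst (snd p)) (snd (snd p))) < e"
      using h3[unfolded H3_def, THEN conjunct1, rule_format, OF \<nu> e, of "fst p" "fst (snd p)" "snd (snd p)"] by (elim exE conjE) (rule that; assumption)
    show "\<exists>\<delta>>0. \<forall>\<nu>'\<in>Pc. \<forall>x'. W2 \<nu> \<nu>' < \<delta> \<and> dist p x' < \<delta> \<longrightarrow>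
        norm (DmuF \<nu>' (fst x') (fst (snd x')) (snd (snd x')) - DmuF \<nu> (fst p) (fst (snd p)) (snd (snd p))) < e"
      by (intro exI[of _ "\<delta> / 4"] conjI ballI allI impI)
        (simp add: \<delta>(1), rule \<delta>(2)[rule_format], assumption, rule small3, assumption, rule \<delta>(1))
  qed
  then show "continuous_on S (\<lambda>\<sigma>. DmuF (\<mu> (\<tau> \<sigma>)) (\<Phi> (\<tau> \<sigma>) (X \<sigma>)) (y (\<tau> \<sigma>)) (\<Phi> (\<tau> \<sigma>) (Z \<sigma>)))" by simp
  have "continuous_on S (\<lambda>\<sigma>. (\<lambda>\<nu> p. DmuG \<nu> (fst p) (snd p)) (\<mu> (\<tau> \<sigma>)) (y (\<tau> \<sigma>), \<Phi> (\<tau> \<sigma>) (Z \<sigma>)))"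
  proof (rule lag_W2_compose[OF _ \<tau> continuous_on_Pair[OF yc \<Phi>(2)]])
    fix \<nu> :: "(real^'d) measure" and p :: "(real^'c) \<times> (real^'d)" and e :: real assume \<nu>: "\<nu> \<in> Pc" and e: "e > 0"
    obtain \<delta> where \<delta>: "\<delta> > 0" "\<forall>\<mu>'\<in>Pc. \<forall>y' \<zeta>'. W2 \<nu> \<mu>' + dist (fst p) y' + dist (snd p) \<zeta>' < \<delta> \<longrightarrow>
        norm (DmuG \<mu>' y' \<zeta>' - DmuG \<nu> (fst p) (snd p)) < e"
      using h3[unfolded H3_def, THEN conjunct2, rule_format, OF \<nu> e, of "fst p" "snd p"] by (elim exE conjE) (rule that; assumption)
    show "\<exists>\<delta>>0. \<forall>\<nu>'\<in>Pc. \<forall>x'. W2 \<nu> \<nu>' < \<delta> \<and> dist p x' < \<delta> \<longrightarrow> norm (DmuG \<nu>' (fst x') (snd x') - DmuG \<nu> (fst p) (snd p)) < e"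
      by (intro exI[of _ "\<delta> / 4"] conjI ballI allI impI)
        (simp add: \<delta>(1), rule \<delta>(2)[rule_format], assumption, rule small, assumption, rule \<delta>(1))
  qed
  then show "continuous_on S (\<lambda>\<sigma>. DmuG (\<mu> (\<tau> \<sigma>)) (y (\<tau> \<sigma>)) (\<Phi> (\<tau> \<sigma>) (Z \<sigma>)))" by simp
qed

text \<open>\<open>Aw\<close> and \<open>Av\<close> are the two components of the linearised
  operator A(s), applied to functions instead of classes in L2.\<close>

definition Aw :: "real \<Rightarrow> (real^'d \<Rightarrow> real^'d) \<Rightarrow> real^'c \<Rightarrow> real^'d \<Rightarrow> real^'d" where
  "Aw s w v x = DxF (\<mu> s) (\<Phi> s x) (y s) *v w x + DyF (\<mu> s) (\<Phi> s x) (y s) *v v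
     + (\<integral>\<zeta>. DmuF (\<mu> s) (\<Phi> s x) (y s) (\<Phi> s \<zeta>) *v w \<zeta> \<partial>\<mu>0)"

definition Av :: "real \<Rightarrow> (real^'d \<Rightarrow> real^'d) \<Rightarrow> real^'c \<Rightarrow> real^'c" where
  "Av s w v = DyG (\<mu> s) (y s) *v v + (\<integral>\<zeta>. DmuG (\<mu> s) (y s) (\<Phi> s \<zeta>) *v w \<zeta> \<partial>\<mu>0)"

lemma A_continuous:
  fixes S :: "'s::metric_space set"
  assumes \<tau>: "continuous_on S \<tau>" "\<And>\<sigma>. \<sigma> \<in> S \<Longrightarrow> \<tau> \<sigma> \<in> {0..T}"
    and w: "continuous_on (S \<times> UNIV) (\<lambda>(\<sigma>, x). w \<sigma> x)" and v: "continuous_on S v"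
  shows "continuous_on (S \<times> UNIV) (\<lambda>(\<sigma>, x). Aw (\<tau> \<sigma>) (w \<sigma>) (v \<sigma>) x)"
    "continuous_on S (\<lambda>\<sigma>. Av (\<tau> \<sigma>) (w \<sigma>) (v \<sigma>))"
proof -
  have f: "continuous_on (S \<times> (UNIV :: (real^'d) set)) fst" "continuous_on (S \<times> (UNIV :: (real^'d) set)) snd"
    by (intro continuous_on_fst continuous_on_snd continuous_on_id)+
  have \<tau>f: "continuous_on (S \<times> (UNIV :: (real^'d) set)) (\<lambda>p. \<tau> (fst p))"
    by (rule continuous_on_compose2[OF \<tau>(1) f(1)]) auto
  have vf: "continuous_on (S \<times> (UNIV :: (real^'d) set)) (\<lambda>p. v (fst p))"
    by (rule continuous_on_compose2[OF v f(1)]) auto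
  have wf: "continuous_on (S \<times> UNIV) (\<lambda>p. w (fst p) (snd p))" using w by (simp add: split_beta)
  let ?S2 = "(S \<times> (UNIV :: (real^'d) set)) \<times> (UNIV :: (real^'d) set)"
  have f2: "continuous_on ?S2 (\<lambda>p. \<tau> (fst (fst p)))" "continuous_on ?S2 (\<lambda>p. snd (fst p))" "continuous_on ?S2 snd"
    by (intro continuous_on_compose2[OF \<tau>(1)] continuous_intros; force)+
  have "continuous_on ?S2 (\<lambda>p. DmuF (\<mu> (\<tau> (fst (fst p)))) (\<Phi> (\<tau> (fst (fst p))) (snd (fst p))) (y (\<tau> (fst (fst p)))) (\<Phi> (\<tau> (fst (fst p))) (snd p)) *v w (fst (fst p)) (snd p))"
    by (intro continuous_on_matrix_vector coefficients_continuous(4) f2 continuous_on_pair_compose[OF w] continuous_intros) (use \<tau>(2) in auto)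
  then have "continuous_on (S \<times> UNIV) (\<lambda>p. \<integral>\<zeta>. DmuF (\<mu> (\<tau> (fst p))) (\<Phi> (\<tau> (fst p)) (snd p)) (y (\<tau> (fst p))) (\<Phi> (\<tau> (fst p)) \<zeta>) *v w (fst p) \<zeta> \<partial>\<mu>0)"
    by (intro continuous_integral_Pc[OF Pc0]) (simp add: split_beta)
  then show "continuous_on (S \<times> UNIV) (\<lambda>(\<sigma>, x). Aw (\<tau> \<sigma>) (w \<sigma>) (v \<sigma>) x)"
    unfolding Aw_def split_beta
    by (intro continuous_on_add continuous_on_matrix_vector coefficients_continuous(1,2)[OF \<tau>f _ f(2) f(2)] vf wf) (use \<tau>(2) in auto)
  have "continuous_on (S \<times> UNIV) (\<lambda>p. DmuG (\<mu> (\<tau> (fst p))) (y (\<tau> (fst p))) (\<Phi> (\<tau> (fst p)) (snd p)) *v w (fst p) (snd p))"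
    by (intro continuous_on_matrix_vector coefficients_continuous(5)[OF \<tau>f _ f(2) f(2)] wf) (use \<tau>(2) in auto)
  then have "continuous_on S (\<lambda>\<sigma>. \<integral>\<zeta>. DmuG (\<mu> (\<tau> \<sigma>)) (y (\<tau> \<sigma>)) (\<Phi> (\<tau> \<sigma>) \<zeta>) *v w \<sigma> \<zeta> \<partial>\<mu>0)"
    by (intro continuous_integral_Pc[OF Pc0]) (simp add: split_beta)
  then show "continuous_on S (\<lambda>\<sigma>. Av (\<tau> \<sigma>) (w \<sigma>) (v \<sigma>))"
    unfolding Av_def
    by (intro continuous_on_add continuous_on_matrix_vector coefficients_continuous(3)[OF \<tau> continuous_on_const continuous_on_const] v)
qed

text \<open>Matrices move across the inner product by transposition. In the \<open>DmuF\<close> term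
  the point where the field is evaluated and the point where the measure is displaced are both
  integrated; exchanging the two integrals produces the adjoint kernel.\<close>

lemma adjoint_pairing:
  assumes s: "s \<in> {0..T}" and p: "integrable \<mu>0 p" and w: "continuous_on UNIV w"
  shows "(\<integral>x. Astar_w DxF DmuG DmuF \<mu> y \<Phi> \<mu>0 s p q x \<bullet> w x \<partial>\<mu>0) + Astar_v DyF DyG \<mu> y \<Phi> \<mu>0 s p q \<bullet> v
     = (\<integral>x. p x \<bullet> Aw s w v x \<partial>\<mu>0) + q \<bullet> Av s w v"
proof -
  interpret prob_space \<mu>0 using Pc0 by (rule Pc_prob)
  have c: "continuous_on (S :: (real^'d) set) (\<lambda>_. s)" for S by (rule continuous_on_const)
  have cx: "continuous_on UNIV (\<lambda>x. DxF (\<mu> s) (\<Phi> s x) (y s))" "continuous_on UNIV (\<lambda>x. DyF (\<mu> s) (\<Phi> s x) (y s))"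
    "continuous_on UNIV (\<lambda>x. DmuG (\<mu> s) (y s) (\<Phi> s x))"
    using coefficients_continuous[OF c, of UNIV, OF _ continuous_on_id continuous_on_id] s by auto
  have "continuous_on UNIV (\<lambda>p :: (real^'d) \<times> (real^'d). DmuF (\<mu> s) (\<Phi> s (fst p)) (y s) (\<Phi> s (snd p)))"
    using s by (intro coefficients_continuous(4)[of UNIV "\<lambda>_. s"] continuous_intros) auto
  then have cF: "continuous_on UNIV (\<lambda>x. DmuF (\<mu> s) (\<Phi> s (a x)) (y s) (\<Phi> s (b x)))" if "continuous_on UNIV a" "continuous_on UNIV b"
    for a b :: "'z::topological_space \<Rightarrow> real^'d"
    using continuous_on_compose2[OF _ continuous_on_Pair[OF that]] by fastforce
  let ?B = "\<lambda>\<zeta> x. DmuF (\<mu> s) (\<Phi> s \<zeta>) (y s) (\<Phi> s x)"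
  have mp: "p \<in> borel_measurable \<mu>0" using p by (rule borel_measurable_integrable)
  have iT: "integrable \<mu>0 (\<lambda>\<zeta>. transpose (A \<zeta>) *v p \<zeta>)" if A: "continuous_on UNIV A" for A :: "real^'d \<Rightarrow> real^'m^'d"
  proof -
    have "integrable \<mu>0 (\<lambda>\<zeta>. (transpose (A \<zeta>) *v p \<zeta>) \<bullet> i)" for i
      unfolding inner_transpose by (intro integrable_inner_continuous Pc0 p continuous_intros A)
    then have 1: "integrable \<mu>0 (\<lambda>\<zeta>. \<Sum>i\<in>Basis. ((transpose (A \<zeta>) *v p \<zeta>) \<bullet> i) *\<^sub>R i)"
      by (intro Bochner_Integration.integrable_sum integrable_scaleR_left)
    have "(\<lambda>\<zeta>. \<Sum>i\<in>Basis. ((transpose (A \<zeta>) *v p \<zeta>) \<bullet> i) *\<^sub>R i) = (\<lambda>\<zeta>. transpose (A \<zeta>) *v p \<zeta>)"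
      by (rule ext, rule euclidean_representation)
    then show ?thesis using 1 by simp
  qed
  let ?h = "\<lambda>x \<zeta>. p \<zeta> \<bullet> (?B \<zeta> x *v w x)"
  have fub: "(\<integral>\<zeta>. (\<integral>x. ?h x \<zeta> \<partial>\<mu>0) \<partial>\<mu>0) = (\<integral>x. (\<integral>\<zeta>. ?h x \<zeta> \<partial>\<mu>0) \<partial>\<mu>0)"
    and fubi: "integrable \<mu>0 (\<lambda>x. \<integral>\<zeta>. ?h x \<zeta> \<partial>\<mu>0)"
  proof -
    have cB: "continuous_on UNIV (\<lambda>z :: (real^'d) \<times> (real^'d). ?B (snd z) (fst z) *v w (fst z))"
      by (intro continuous_on_matrix_vector cF continuous_on_compose2[OF w] continuous_intros) auto
    have "compact ((\<lambda>z. ?B (snd z) (fst z) *v w (fst z)) ` (supp \<mu>0 \<times> supp \<mu>0))"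
      by (intro compact_continuous_image continuous_on_subset[OF cB] compact_Times Pc_compact Pc0) auto
    then have "bounded ((\<lambda>z. ?B (snd z) (fst z) *v w (fst z)) ` (supp \<mu>0 \<times> supp \<mu>0))" by (rule compact_imp_bounded)
    then obtain K where K: "K > 0" "\<forall>u\<in>(\<lambda>z. ?B (snd z) (fst z) *v w (fst z)) ` (supp \<mu>0 \<times> supp \<mu>0). norm u \<le> K"
      unfolding bounded_pos by blast
    have "(\<lambda>z. ?B (snd z) (fst z) *v w (fst z)) \<in> borel_measurable (\<mu>0 \<Otimes>\<^sub>M \<mu>0)"
    proof -
      have "borel_measurable (\<mu>0 \<Otimes>\<^sub>M \<mu>0) = (borel_measurable borel :: ((real^'d) \<times> (real^'d) \<Rightarrow> real^'d) set)"
        using Pc_sets[OF Pc0] by (intro measurable_cong_sets) (simp_all add: borel_prod[symmetric] cong: sets_pair_measure_cong)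
      then show ?thesis using borel_measurable_continuous_onI[OF cB] by simp
    qed
    then have m: "(\<lambda>(x, \<zeta>). ?h x \<zeta>) \<in> borel_measurable (\<mu>0 \<Otimes>\<^sub>M \<mu>0)"
      unfolding split_beta' using mp by (intro borel_measurable_inner) simp_all
    have k: "integrable \<mu>0 (\<lambda>\<zeta>. norm (p \<zeta>) * K)" using p by simp
    have le: "AE x in \<mu>0. AE \<zeta> in \<mu>0. \<bar>?h x \<zeta>\<bar> \<le> norm (p \<zeta>) * K"
      using AE_supp[OF Pc0]
    proof eventually_elim
      case x: (elim x)
      show ?case using AE_supp[OF Pc0]
      proof eventually_elim
        case (elim \<zeta>)
        have "norm (p \<zeta>) * norm (?B \<zeta> x *v w x) \<le> norm (p \<zeta>) * K"
          using K(2) elim x by (intro mult_left_mono) force+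
        then show ?case using Cauchy_Schwarz_ineq2[of "p \<zeta>" "?B \<zeta> x *v w x"] by linarith
      qed
    qed
    show "(\<integral>\<zeta>. (\<integral>x. ?h x \<zeta> \<partial>\<mu>0) \<partial>\<mu>0) = (\<integral>x. (\<integral>\<zeta>. ?h x \<zeta> \<partial>\<mu>0) \<partial>\<mu>0)"
      by (rule fubini_finite(1)[OF finite_measure_axioms finite_measure_axioms m k le])
    show "integrable \<mu>0 (\<lambda>x. \<integral>\<zeta>. ?h x \<zeta> \<partial>\<mu>0)"
      by (rule fubini_finite(2)[OF finite_measure_axioms finite_measure_axioms m k le])
  qed
  have 3: "(\<integral>\<zeta>. transpose (?B \<zeta> x) *v p \<zeta> \<partial>\<mu>0) \<bullet> w x = (\<integral>\<zeta>. ?h x \<zeta> \<partial>\<mu>0)" for x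
  proof -
    have "integrable \<mu>0 (\<lambda>\<zeta>. transpose (?B \<zeta> x) *v p \<zeta>)" by (intro iT cF continuous_intros)
    then have "(\<integral>\<zeta>. transpose (?B \<zeta> x) *v p \<zeta> \<partial>\<mu>0) \<bullet> w x = (\<integral>\<zeta>. (transpose (?B \<zeta> x) *v p \<zeta>) \<bullet> w x \<partial>\<mu>0)"
      by (rule integral_inner_left[symmetric])
    then show ?thesis by (simp only: inner_transpose)
  qed
  have iw: "integrable \<mu>0 (\<lambda>\<zeta>. ?B x \<zeta> *v w \<zeta>)" for x by (intro integrable_continuous_Pc Pc0 continuous_on_matrix_vector cF w continuous_intros)
  have iG: "integrable \<mu>0 (\<lambda>\<zeta>. DmuG (\<mu> s) (y s) (\<Phi> s \<zeta>) *v w \<zeta>)" by (intro integrable_continuous_Pc Pc0 continuous_on_matrix_vector cx w)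
  have i1: "integrable \<mu>0 (\<lambda>x. p x \<bullet> (DxF (\<mu> s) (\<Phi> s x) (y s) *v w x))"
    by (intro integrable_inner_continuous Pc0 p continuous_on_matrix_vector cx w)
  have i2: "integrable \<mu>0 (\<lambda>x. p x \<bullet> (DyF (\<mu> s) (\<Phi> s x) (y s) *v v))"
    by (intro integrable_inner_continuous Pc0 p continuous_on_matrix_vector cx continuous_on_const)
  have i4: "integrable \<mu>0 (\<lambda>x. q \<bullet> (DmuG (\<mu> s) (y s) (\<Phi> s x) *v w x))" using iG by (rule integrable_inner_right)
  have cI: "continuous_on UNIV (\<lambda>x. \<integral>\<zeta>. ?B x \<zeta> *v w \<zeta> \<partial>\<mu>0)"
    using w by (intro continuous_integral_Pc[OF Pc0]) (auto simp: split_beta intro!: continuous_on_matrix_vector cF continuous_on_compose2[OF w] continuous_intros)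
  have i5: "integrable \<mu>0 (\<lambda>x. p x \<bullet> (\<integral>\<zeta>. ?B x \<zeta> *v w \<zeta> \<partial>\<mu>0))" by (intro integrable_inner_continuous Pc0 p cI)
  have "(\<integral>x. Astar_w DxF DmuG DmuF \<mu> y \<Phi> \<mu>0 s p q x \<bullet> w x \<partial>\<mu>0)
      = (\<integral>x. p x \<bullet> (DxF (\<mu> s) (\<Phi> s x) (y s) *v w x) + q \<bullet> (DmuG (\<mu> s) (y s) (\<Phi> s x) *v w x) + (\<integral>\<zeta>. ?h x \<zeta> \<partial>\<mu>0) \<partial>\<mu>0)"
    by (simp add: Astar_w_def inner_add_left inner_transpose 3 del: transpose_matrix_vector)
  also have "\<dots> = (\<integral>x. p x \<bullet> (DxF (\<mu> s) (\<Phi> s x) (y s) *v w x) \<partial>\<mu>0) + q \<bullet> (\<integral>x. DmuG (\<mu> s) (y s) (\<Phi> s x) *v w x \<partial>\<mu>0)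
      + (\<integral>\<zeta>. (\<integral>x. ?h x \<zeta> \<partial>\<mu>0) \<partial>\<mu>0)"
    using i1 i4 fubi iG by (simp add: fub integral_inner_right)
  also have "(\<integral>\<zeta>. (\<integral>x. ?h x \<zeta> \<partial>\<mu>0) \<partial>\<mu>0) = (\<integral>\<zeta>. p \<zeta> \<bullet> (\<integral>x. ?B \<zeta> x *v w x \<partial>\<mu>0) \<partial>\<mu>0)"
    using iw by (simp add: integral_inner_right)
  finally have W: "(\<integral>x. Astar_w DxF DmuG DmuF \<mu> y \<Phi> \<mu>0 s p q x \<bullet> w x \<partial>\<mu>0)
      = (\<integral>x. p x \<bullet> (DxF (\<mu> s) (\<Phi> s x) (y s) *v w x) \<partial>\<mu>0) + q \<bullet> (\<integral>x. DmuG (\<mu> s) (y s) (\<Phi> s x) *v w x \<partial>\<mu>0)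
      + (\<integral>\<zeta>. p \<zeta> \<bullet> (\<integral>x. ?B \<zeta> x *v w x \<partial>\<mu>0) \<partial>\<mu>0)" .
  have "(\<integral>\<zeta>. transpose (DyF (\<mu> s) (\<Phi> s \<zeta>) (y s)) *v p \<zeta> \<partial>\<mu>0) \<bullet> v = (\<integral>\<zeta>. (transpose (DyF (\<mu> s) (\<Phi> s \<zeta>) (y s)) *v p \<zeta>) \<bullet> v \<partial>\<mu>0)"
    using iT[OF cx(2)] by (rule integral_inner_left[symmetric])
  then have "Astar_v DyF DyG \<mu> y \<Phi> \<mu>0 s p q \<bullet> v = (\<integral>x. p x \<bullet> (DyF (\<mu> s) (\<Phi> s x) (y s) *v v) \<partial>\<mu>0) + q \<bullet> (DyG (\<mu> s) (y s) *v v)"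
    by (simp add: Astar_v_def inner_add_left inner_transpose del: transpose_matrix_vector)
  then show ?thesis using W i1 i2 i5 by (simp add: Aw_def Av_def inner_add_right)
qed

end

end

subsection \<open>Duality\<close>

lemma square_integrable_imp_integrable:
  fixes f :: "'a \<Rightarrow> real^'n"
  assumes \<nu>: "prob_space \<nu>" and f: "f \<in> borel_measurable \<nu>"
    and fin: "(\<integral>\<^sup>+ x. ennreal ((norm (f x))\<^sup>2) \<partial>\<nu>) < \<infinity>"
  shows "integrable \<nu> f"
proof -
  let ?r = "enn2real (\<integral>\<^sup>+ x. ennreal ((norm (f x))\<^sup>2) \<partial>\<nu>)"
  have r: "?r \<ge> 0" by simp
  have "c < (c + 1)\<^sup>2" if "c \<ge> 0" for c :: real
    using that by (simp add: power2_eq_square algebra_simps add_pos_nonneg)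
  from this[OF r] have "ennreal ?r < ennreal ((?r + 1)\<^sup>2)" using r by (subst ennreal_less_iff)
  moreover have "ennreal ?r = (\<integral>\<^sup>+ x. ennreal ((norm (f x))\<^sup>2) \<partial>\<nu>)" using fin by (simp add: ennreal_enn2real)
  moreover have "?r + 1 > 0" using r by linarith
  ultimately show ?thesis using L2_imp_L1(1)[OF \<nu> f] by metis
qed

lemma matrix_mean_value:
  fixes f :: "real^'n \<Rightarrow> real^'m"
  assumes f: "\<And>x. x \<in> closed_segment a b \<Longrightarrow> (f has_derivative (\<lambda>h. M x *v h)) (at x)"
    and M: "\<And>x. x \<in> closed_segment a b \<Longrightarrow> norm (M x - A) \<le> e"
  shows "norm (f b - f a - A *v (b - a)) \<le> e * norm (b - a)"
proof -
  have A: "bounded_linear (\<lambda>h. A *v h)" by (rule matrix_vector_mul_bounded_linear)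
  have "norm ((f b - A *v b) - (f a - A *v a)) \<le> e * norm (b - a)"
  proof (rule differentiable_bound[where S="closed_segment a b" and f="\<lambda>x. f x - A *v x" and f'="\<lambda>x h. (M x - A) *v h"])
    fix x assume x: "x \<in> closed_segment a b"
    have "((\<lambda>x. f x - A *v x) has_derivative (\<lambda>h. M x *v h - A *v h)) (at x)"
      by (intro has_derivative_diff f x bounded_linear_imp_has_derivative A)
    then show "((\<lambda>x. f x - A *v x) has_derivative (\<lambda>h. (M x - A) *v h)) (at x within closed_segment a b)"
      unfolding matrix_vector_mult_diff_rdistrib by (rule has_derivative_at_withinI)
    show "onorm (\<lambda>h. (M x - A) *v h) \<le> e"
    proof (rule onorm_bound)
      show "0 \<le> e" using M[OF x] norm_ge_zero order_trans by blast
      show "norm ((M x - A) *v h) \<le> e * norm h" for h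
        using norm_matrix_vector_le[of "M x - A" h] mult_right_mono[OF M[OF x] norm_ge_zero[of h]] by linarith
    qed
  qed auto
  then show ?thesis by (simp add: matrix_vector_mult_diff_distrib algebra_simps)
qed

context diff_system
begin

text \<open>The joint law of \<open>X\<close> and \<open>Y n\<close> is an admissible coupling in
  \<open>wgrad_coupling\<close>, with cost at most \<open>(C * \<epsilon> n)\<^sup>2\<close>. So the
  remainder, small relative to the transport distance, is small relative to
  \<open>\<epsilon> n\<close>.\<close>

lemma gradient_remainder:
  fixes X :: "real^'d \<Rightarrow> real^'d"
  assumes w: "wgrad D \<phi> (distr \<mu>0 borel X) \<xi>" and P: "distr \<mu>0 borel X \<in> Pc"
    and X [measurable]: "X \<in> borel_measurable \<mu>0" and Y [measurable]: "\<And>n. Y n \<in> borel_measurable \<mu>0"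
    and PY: "\<And>n. distr \<mu>0 borel (Y n) \<in> D \<inter> Pc"
    and le: "\<And>n x. x \<in> supp \<mu>0 \<Longrightarrow> norm (Y n x - X x) \<le> C * \<epsilon> n" and C: "C > 0"
    and \<epsilon>: "\<And>n. \<epsilon> n > 0" "\<epsilon> \<longlonglongrightarrow> 0"
  shows "(\<lambda>n. (\<phi> (distr \<mu>0 borel (Y n)) - \<phi> (distr \<mu>0 borel X) - (\<integral>x. \<xi> (X x) \<bullet> (Y n x - X x) \<partial>\<mu>0)) / \<epsilon> n) \<longlonglongrightarrow> 0"
proof (rule LIMSEQ_I)
  interpret prob_space \<mu>0 using Pc0 by (rule Pc_prob)
  fix e :: real assume e: "e > 0"
  have e': "e / (2 * C) > 0" using e C by simp
  obtain \<delta> where \<delta>: "\<delta> > 0" "\<And>\<nu> \<gamma> c. \<nu> \<in> D \<Longrightarrow> \<nu> \<in> Pc \<Longrightarrow> \<gamma> \<in> couplings (distr \<mu>0 borel X) \<nu> \<Longrightarrow> transport_cost \<gamma> \<le> ennreal (c\<^sup>2) \<Longrightarrow>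
    0 < c \<Longrightarrow> c < \<delta> \<Longrightarrow> \<bar>\<phi> \<nu> - \<phi> (distr \<mu>0 borel X) - (\<integral>z. \<xi> (fst z) \<bullet> (snd z - fst z) \<partial>\<gamma>)\<bar> \<le> e / (2 * C) * c"
    using wgrad_coupling[OF w P e'] by blast
  have "\<forall>\<^sub>F n in sequentially. \<epsilon> n < \<delta> / C" using \<epsilon>(2) \<delta>(1) C by (intro order_tendstoD) auto
  then have "\<forall>\<^sub>F n in sequentially. norm ((\<phi> (distr \<mu>0 borel (Y n)) - \<phi> (distr \<mu>0 borel X) - (\<integral>x. \<xi> (X x) \<bullet> (Y n x - X x) \<partial>\<mu>0)) / \<epsilon> n - 0) < e"
  proof eventually_elim
    case (elim n)
    let ?\<gamma> = "distr \<mu>0 borel (\<lambda>x. (X x, Y n x))"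
    have mp: "(\<lambda>x. (X x, Y n x)) \<in> measurable \<mu>0 borel" by (rule borel_measurable_Pair) measurable
    have f: "fst \<in> borel_measurable (borel :: ((real^'d) \<times> (real^'d)) measure)" "snd \<in> borel_measurable (borel :: ((real^'d) \<times> (real^'d)) measure)"
      by (intro borel_measurable_continuous_onI continuous_intros)+
    have "\<xi> \<in> borel_measurable borel" using w by (simp add: wgrad_def in_Tan_def)
    from measurable_compose[OF f(1) this]
    have m: "(\<lambda>z. \<xi> (fst z) \<bullet> (snd z - fst z)) \<in> borel_measurable borel"
      using f by (intro borel_measurable_inner borel_measurable_diff)
    have "transport_cost ?\<gamma> \<le> ennreal ((C * \<epsilon> n)\<^sup>2)"
    proof -
      have "transport_cost ?\<gamma> \<le> (\<integral>\<^sup>+ x. ennreal ((C * \<epsilon> n)\<^sup>2) \<partial>\<mu>0)"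
        unfolding transport_cost_distr[OF X Y]
      proof (rule nn_integral_mono_AE)
        show "AE x in \<mu>0. ennreal ((dist (X x) (Y n x))\<^sup>2) \<le> ennreal ((C * \<epsilon> n)\<^sup>2)"
          using AE_supp[OF Pc0]
        proof eventually_elim
          case (elim x) then show ?case
            using le[of x n] by (intro ennreal_leI power_mono) (auto simp: dist_norm norm_minus_commute)
        qed
      qed
      then show ?thesis by (simp add: emeasure_space_1)
    qed
    then have "\<bar>\<phi> (distr \<mu>0 borel (Y n)) - \<phi> (distr \<mu>0 borel X) - (\<integral>z. \<xi> (fst z) \<bullet> (snd z - fst z) \<partial>?\<gamma>)\<bar> \<le> e / (2 * C) * (C * \<epsilon> n)"
      using PY[of n] C \<epsilon>(1)[of n] elim by (intro \<delta>(2) coupling_distr X Y) (auto simp: field_simps)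
    also have "(\<integral>z. \<xi> (fst z) \<bullet> (snd z - fst z) \<partial>?\<gamma>) = (\<integral>x. \<xi> (X x) \<bullet> (Y n x - X x) \<partial>\<mu>0)"
      by (subst integral_distr[OF mp m]) simp
    finally have "\<bar>\<phi> (distr \<mu>0 borel (Y n)) - \<phi> (distr \<mu>0 borel X) - (\<integral>x. \<xi> (X x) \<bullet> (Y n x - X x) \<partial>\<mu>0)\<bar> \<le> e / 2 * \<epsilon> n"
      using C by (simp add: field_simps)
    also have "\<dots> < e * \<epsilon> n" using e \<epsilon>(1)[of n] by simp
    finally show ?case using \<epsilon>(1)[of n] by (simp add: pos_divide_less_eq)
  qed
  then show "\<exists>no. \<forall>n\<ge>no. norm ((\<phi> (distr \<mu>0 borel (Y n)) - \<phi> (distr \<mu>0 borel X) - (\<integral>x. \<xi> (X x) \<bullet> (Y n x - X x) \<partial>\<mu>0)) / \<epsilon> n - 0) < e"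
    by (simp add: eventually_sequentially)
qed

context
  fixes V \<mu> y \<Phi> assumes lag: "lagrangian V \<mu> y \<Phi>"
begin

context
  fixes p q assumes adj: "adjoint_solution DxF DyF DyG DmuF DmuG \<mu>0 T \<mu> y \<Phi> p q"
begin

lemma adj_integrable: "t \<in> {0..T} \<Longrightarrow> integrable \<mu>0 (p t)"
  using adj by (intro square_integrable_imp_integrable Pc_prob Pc0) (auto simp: adjoint_solution_def in_L2_def)

lemma adj_close:
  assumes t: "t \<in> {0..T}" and e: "e > 0"
  shows "\<exists>d>0. \<forall>s\<in>{0..T}. dist s t < d \<longrightarrow> (\<integral>x. norm (p s x - p t x) \<partial>\<mu>0) < e \<and> norm (q s - q t) < e"
proof -
  have "e\<^sup>2 > 0" using e by simp
  then obtain d where d: "d > 0" "\<forall>s\<in>{0..T}. \<bar>s - t\<bar> < d \<longrightarrow>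
      (\<integral>\<^sup>+ x. ennreal ((norm (p s x - p t x))\<^sup>2) \<partial>\<mu>0) + ennreal ((norm (q s - q t))\<^sup>2) < ennreal (e\<^sup>2)"
    using adj t unfolding adjoint_solution_def by blast
  show ?thesis
  proof (intro exI[of _ d] conjI ballI impI d(1))
    fix s assume s: "s \<in> {0..T}" and "dist s t < d"
    then have *: "(\<integral>\<^sup>+ x. ennreal ((norm (p s x - p t x))\<^sup>2) \<partial>\<mu>0) + ennreal ((norm (q s - q t))\<^sup>2) < ennreal (e\<^sup>2)"
      using d(2) by (simp add: dist_real_def)
    have "(\<lambda>x. p s x - p t x) \<in> borel_measurable \<mu>0"
      using adj_integrable s t by (intro borel_measurable_diff borel_measurable_integrable)
    moreover have "(\<integral>\<^sup>+ x. ennreal ((norm (p s x - p t x))\<^sup>2) \<partial>\<mu>0) < ennreal (e\<^sup>2)"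
      by (rule le_less_trans[OF _ *]) simp
    ultimately show "(\<integral>x. norm (p s x - p t x) \<partial>\<mu>0) < e" by (intro L2_imp_L1(2) Pc_prob Pc0 e)
    have "ennreal ((norm (q s - q t))\<^sup>2) < ennreal (e\<^sup>2)"
      by (rule le_less_trans[OF _ *]) simp
    then have "(norm (q s - q t))\<^sup>2 < e\<^sup>2" by (subst (asm) ennreal_less_iff) auto
    then show "norm (q s - q t) < e" using e by (rule power2_less_imp_less[OF _ less_imp_le])
  qed
qed

lemma adj_L1_cont:
  "t \<in> {0..T} \<Longrightarrow> e > 0 \<Longrightarrow> \<exists>d>0. \<forall>s\<in>{0..T}. dist s t < d \<longrightarrow> (\<integral>x. norm (p s x - p t x) \<partial>\<mu>0) < e"
  using adj_close by meson

lemma adj_q_cont: "continuous_on {0..T} q"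
  unfolding continuous_on_iff dist_norm[of "q _"] using adj_close by meson

text \<open>By \<open>adjoint_pairing\<close> this is the integrand of the backward equation tested
  with \<open>(w, v)\<close>. With the operator on the smooth side, continuity in time follows from
  \<open>continuous_pairing\<close>.\<close>

definition dual_form :: "real \<Rightarrow> (real^'d \<Rightarrow> real^'d) \<Rightarrow> real^'c \<Rightarrow> real" where
  "dual_form r w v = (\<integral>x. p r x \<bullet> Aw \<mu> y \<Phi> r w v x \<partial>\<mu>0) + q r \<bullet> Av \<mu> y \<Phi> r w v"

lemma dual_form_cont:
  fixes S :: "'s::metric_space set"
  assumes \<tau>: "continuous_on S \<tau>" "\<And>\<sigma>. \<sigma> \<in> S \<Longrightarrow> \<tau> \<sigma> \<in> {0..T}"
    and w: "continuous_on (S \<times> UNIV) (\<lambda>(\<sigma>, x). w \<sigma> x)" and v: "continuous_on S v"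
  shows "continuous_on S (\<lambda>\<sigma>. dual_form (\<tau> \<sigma>) (w \<sigma>) (v \<sigma>))"
proof -
  have qc: "continuous_on S (\<lambda>\<sigma>. q (\<tau> \<sigma>))"
    by (rule continuous_on_compose2[OF adj_q_cont \<tau>(1)]) (use \<tau>(2) in auto)
  have "continuous_on S (\<lambda>\<sigma>. \<integral>x. p (\<tau> \<sigma>) x \<bullet> Aw \<mu> y \<Phi> (\<tau> \<sigma>) (w \<sigma>) (v \<sigma>) x \<partial>\<mu>0)"
    by (rule continuous_pairing[OF Pc0 A_continuous(1)[OF lag \<tau> w v] adj_integrable adj_L1_cont \<tau>])
  then show ?thesis
    unfolding dual_form_def by (intro continuous_on_add continuous_on_inner qc A_continuous(2)[OF lag \<tau> w v])
qed

lemma dual_form_Astar: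
  assumes "s \<in> {0..T}" "continuous_on UNIV w"
  shows "(\<integral>x. Astar_w DxF DmuG DmuF \<mu> y \<Phi> \<mu>0 s (p s) (q s) x \<bullet> w x \<partial>\<mu>0) + Astar_v DyF DyG \<mu> y \<Phi> \<mu>0 s (p s) (q s) \<bullet> v = dual_form s w v"
  unfolding dual_form_def by (rule adjoint_pairing[OF lag assms(1) adj_integrable assms(2)]) fact

lemma adj_eq:
  assumes t: "t \<in> {0..T}" and w: "continuous_on UNIV w"
  shows "(\<integral>x. p t x \<bullet> w x \<partial>\<mu>0) + q t \<bullet> v = (\<integral>x. p T x \<bullet> w x \<partial>\<mu>0) + q T \<bullet> v + integral {t..T} (\<lambda>s. dual_form s w v)"
proof -
  interpret prob_space \<mu>0 using Pc0 by (rule Pc_prob)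
  have "in_L2 \<mu>0 w"
  proof -
    have "w \<in> borel_measurable \<mu>0" by (rule borel_measurable_integrable[OF integrable_continuous_Pc[OF Pc0 w]])
    moreover have "integrable \<mu>0 (\<lambda>x. (norm (w x))\<^sup>2)" by (intro integrable_continuous_Pc Pc0 continuous_intros w)
    ultimately show ?thesis unfolding in_L2_def using nn_integral_eq_integral[of \<mu>0 "\<lambda>x. (norm (w x))\<^sup>2"] by simp
  qed
  then have "(\<integral>x. p t x \<bullet> w x \<partial>\<mu>0) + q t \<bullet> v = (\<integral>x. p T x \<bullet> w x \<partial>\<mu>0) + q T \<bullet> v +
          (LINT s:{t..T}|lborel.
             (\<integral>x. Astar_w DxF DmuG DmuF \<mu> y \<Phi> \<mu>0 s (p s) (q s) x \<bullet> w x \<partial>\<mu>0)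
             + Astar_v DyF DyG \<mu> y \<Phi> \<mu>0 s (p s) (q s) \<bullet> v)"
    using adj t unfolding adjoint_solution_def by blast
  also have "(LINT s:{t..T}|lborel.
             (\<integral>x. Astar_w DxF DmuG DmuF \<mu> y \<Phi> \<mu>0 s (p s) (q s) x \<bullet> w x \<partial>\<mu>0)
             + Astar_v DyF DyG \<mu> y \<Phi> \<mu>0 s (p s) (q s) \<bullet> v) = (LINT s:{t..T}|lborel. dual_form s w v)"
    using dual_form_Astar w t by (intro set_lebesgue_integral_cong) auto
  also have "\<dots> = integral {t..T} (\<lambda>s. dual_form s w v)"
  proof (intro set_borel_integral_eq_integral(2) borel_integrable_atLeastAtMost')
    show "continuous_on {t..T} (\<lambda>s. dual_form s w v)"
      using t continuous_on_compose2[OF w continuous_on_snd[OF continuous_on_id]]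
      by (intro dual_form_cont[where \<tau>="\<lambda>s. s"]) (auto intro: continuous_on_id simp: split_beta)
  qed
  finally show ?thesis .
qed

text \<open>Only \<open>t \<mapsto> \<langle>p t, w\<rangle>\<close> for fixed \<open>w\<close> is known to be differentiable, so the product rule is applied to
  \<open>H r s = \<langle>p r, W s\<rangle>\<close>, which is differentiated in each variable separately.\<close>

lemma duality:
  assumes gF: "continuous_on ({0..T} \<times> UNIV) (\<lambda>(t, x). gF t x)" and gG: "continuous_on {0..T} gG"
    and W: "continuous_on ({0..T} \<times> UNIV) (\<lambda>(t, x). W t x)"
    and Weq: "\<And>t x. t \<in> {0..T} \<Longrightarrow> x \<in> supp \<mu>0 \<Longrightarrow> W t x = integral {0..t} (\<lambda>s. gF s x)"
    and zeq: "\<And>t. t \<in> {0..T} \<Longrightarrow> z t = integral {0..t} gG"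
  shows "(\<integral>x. p T x \<bullet> W T x \<partial>\<mu>0) + q T \<bullet> z T
    = integral {0..T} (\<lambda>t. (\<integral>x. p t x \<bullet> gF t x \<partial>\<mu>0) + q t \<bullet> gG t - dual_form t (W t) (z t))"
proof -
  let ?H = "\<lambda>r s. (\<integral>x. p r x \<bullet> W s x \<partial>\<mu>0) + q r \<bullet> z s"
  have z: "continuous_on {0..T} z"
    using indefinite_integral_continuous_1[OF integrable_continuous_real[OF gG]]
    by (rule continuous_on_eq) (simp add: zeq)
  have Ws: "continuous_on UNIV (W s)" if "s \<in> {0..T}" for s
    by (rule continuous_on_pair_compose[OF W continuous_on_const continuous_on_id]) (rule that)
  have Kc: "continuous_on ({0..T} \<times> {0..T}) (\<lambda>(r, s). dual_form r (W s) (z s))"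
    unfolding split_beta
    by (intro dual_form_cont continuous_on_compose2[OF z] continuous_intros)
      (auto simp: split_beta intro!: continuous_on_pair_compose[OF W] continuous_intros)
  have H: "((\<lambda>r. ?H r s) has_real_derivative - dual_form r (W s) (z s)) (at r within {0..T})"
    if r: "r \<in> {0..T}" and s: "s \<in> {0..T}" for r s
  proof -
    have "continuous_on {0..T} (\<lambda>r. (\<lambda>(r, s). dual_form r (W s) (z s)) (r, s))"
      using s by (intro continuous_on_compose2[OF Kc]) (auto intro!: continuous_intros)
    then have "((\<lambda>r. (\<integral>x. p T x \<bullet> W s x \<partial>\<mu>0) + q T \<bullet> z s + integral {r..T} (\<lambda>r. dual_form r (W s) (z s))) has_real_derivative 0 + - dual_form r (W s) (z s)) (at r within {0..T})"
      using r by (intro DERIV_add DERIV_const integral_has_real_derivative') auto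
    then show ?thesis
      unfolding add_0 by (rule has_field_derivative_transform_within[OF _ zero_less_one r]) (rule adj_eq[OF _ Ws[OF s], symmetric])
  qed
  have D: "((\<lambda>s. ?H s s) has_real_derivative - dual_form t (W t) (z t) + ((\<integral>x. p t x \<bullet> gF t x \<partial>\<mu>0) + q t \<bullet> gG t)) (at t within {0..T})"
    if t: "t \<in> {0..T}" for t
  proof (rule diag_deriv[OF t H])
    show "continuous_on ({0..T} \<times> {0..T}) (\<lambda>(r, s). - dual_form r (W s) (z s))"
      using continuous_on_minus[OF Kc] by (simp add: split_beta)
    have c: "continuous_on {0..T} (\<lambda>s. \<integral>x. p t x \<bullet> gF s x \<partial>\<mu>0)"
      using adj_integrable[OF t] by (intro continuous_pairing[OF Pc0 gF, of "{t}" p "\<lambda>_. t"]) (auto intro: exI[of _ "1::real"])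
    have "((\<lambda>s. integral {0..s} (\<lambda>s. \<integral>x. p t x \<bullet> gF s x \<partial>\<mu>0)) has_real_derivative (\<integral>x. p t x \<bullet> gF t x \<partial>\<mu>0)) (at t within {0..T})"
      by (rule integral_has_real_derivative[OF c t])
    moreover have "((\<lambda>s. q t \<bullet> integral {0..s} gG) has_real_derivative q t \<bullet> gG t) (at t within {0..T})"
      unfolding has_real_derivative_iff_has_vector_derivative
      by (intro bounded_linear.has_vector_derivative[OF bounded_linear_inner_right] integral_has_vector_derivative gG t)
    ultimately have "((\<lambda>s. integral {0..s} (\<lambda>s. \<integral>x. p t x \<bullet> gF s x \<partial>\<mu>0) + q t \<bullet> integral {0..s} gG) has_real_derivative
        (\<integral>x. p t x \<bullet> gF t x \<partial>\<mu>0) + q t \<bullet> gG t) (at t within {0..T})" by (rule DERIV_add)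
    then show "((\<lambda>s. ?H t s) has_real_derivative (\<integral>x. p t x \<bullet> gF t x \<partial>\<mu>0) + q t \<bullet> gG t) (at t within {0..T})"
    proof (rule has_field_derivative_transform_within[OF _ zero_less_one t])
      fix s assume s: "s \<in> {0..T}"
      have gFs: "continuous_on ({0..s} \<times> UNIV) (\<lambda>(t, x). gF t x)" using s by (intro continuous_on_subset[OF gF]) auto
      have "AE x in \<mu>0. p t x \<bullet> W s x = p t x \<bullet> integral {0..s} (\<lambda>r. gF r x)"
        using AE_supp[OF Pc0] by eventually_elim (simp only: Weq[OF s])
      moreover have 1: "integrable \<mu>0 (\<lambda>x. p t x \<bullet> W s x)"
        by (intro integrable_inner_continuous Pc0 adj_integrable t Ws s)
      moreover have 2: "integrable \<mu>0 (\<lambda>x. p t x \<bullet> integral {0..s} (\<lambda>r. gF r x))"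
      proof (intro integrable_inner_continuous Pc0 adj_integrable t)
        have "continuous_on (UNIV \<times> cbox 0 s) (\<lambda>(x, r). gF r x)"
          using s unfolding split_beta by (intro continuous_on_pair_compose[OF gF] continuous_intros) auto
        from integral_continuous_on_param[OF this] show "continuous_on UNIV (\<lambda>x. integral {0..s} (\<lambda>r. gF r x))" by simp
      qed
      ultimately have "(\<integral>x. p t x \<bullet> W s x \<partial>\<mu>0) = (\<integral>x. p t x \<bullet> integral {0..s} (\<lambda>r. gF r x) \<partial>\<mu>0)"
        by (intro integral_cong_AE borel_measurable_integrable)
      also have "\<dots> = (LINT r:{0..s}|lborel. \<integral>x. p t x \<bullet> gF r x \<partial>\<mu>0)"
        by (rule fubini_inner(1)[OF Pc0 gFs adj_integrable[OF t]])
      also have "\<dots> = integral {0..s} (\<lambda>r. \<integral>x. p t x \<bullet> gF r x \<partial>\<mu>0)"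
        using s by (intro set_borel_integral_eq_integral(2) borel_integrable_atLeastAtMost' continuous_on_subset[OF c]) auto
      finally show "integral {0..s} (\<lambda>s. \<integral>x. p t x \<bullet> gF s x \<partial>\<mu>0) + q t \<bullet> integral {0..s} gG = ?H t s"
        by (simp only: zeq[OF s])
    qed
  qed
  have "((\<lambda>t. - dual_form t (W t) (z t) + ((\<integral>x. p t x \<bullet> gF t x \<partial>\<mu>0) + q t \<bullet> gG t)) has_integral (?H T T - ?H 0 0)) {0..T}"
    using T D by (intro fundamental_theorem_of_calculus) (auto simp: has_real_derivative_iff_has_vector_derivative)
  moreover have "(\<integral>x. p 0 x \<bullet> W 0 x \<partial>\<mu>0) = 0"
  proof (rule integral_eq_zero_AE)
    show "AE x in \<mu>0. p 0 x \<bullet> W 0 x = 0" using AE_supp[OF Pc0] by eventually_elim (use T in \<open>simp add: Weq\<close>)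
  qed
  moreover have "z 0 = 0" using T by (simp add: zeq)
  ultimately show ?thesis by (simp add: integral_unique algebra_simps)
qed

end

end

end

subsection \<open>Linearisation of the perturbed trajectories\<close>

text \<open>The function \<open>f n\<close> itself changes with \<open>n\<close>, since it carries
  the perturbed measure or state. Its derivatives are compared with the one fixed matrix
  \<open>A\<close> on a neighbourhood of \<open>a\<close> that shrinks with
  \<open>\<epsilon> n\<close>.\<close>

lemma mean_value_limit:
  fixes f :: "nat \<Rightarrow> real^'n \<Rightarrow> real^'m"
  assumes f: "\<And>n x. (f n has_derivative (\<lambda>h. M n x *v h)) (at x)"
    and M: "\<And>e. e > 0 \<Longrightarrow> \<forall>\<^sub>F n in sequentially. \<forall>x. norm (x - a) \<le> C * \<epsilon> n \<longrightarrow> norm (M n x - A) \<le> e"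
    and b: "\<And>n. norm (b n - a) \<le> C * \<epsilon> n" and C: "C > 0" and \<epsilon>: "\<And>n. \<epsilon> n > (0::real)"
  shows "(\<lambda>n. (1 / \<epsilon> n) *\<^sub>R (f n (b n) - f n a - A *v (b n - a))) \<longlonglongrightarrow> 0"
proof (rule LIMSEQ_I)
  fix e :: real assume e: "e > 0"
  then have "e / (2 * C) > 0" using C by simp
  from M[OF this] have "\<forall>\<^sub>F n in sequentially. norm ((1 / \<epsilon> n) *\<^sub>R (f n (b n) - f n a - A *v (b n - a)) - 0) < e"
  proof eventually_elim
    case (elim n)
    have "norm (f n (b n) - f n a - A *v (b n - a)) \<le> e / (2 * C) * norm (b n - a)"
    proof (rule matrix_mean_value[OF f])
      fix x assume "x \<in> closed_segment a (b n)"
      then have "norm (x - a) \<le> norm (b n - a)" by (rule segment_bound1)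
      also have "\<dots> \<le> C * \<epsilon> n" by (rule b)
      finally show "norm (M n x - A) \<le> e / (2 * C)" using elim by blast
    qed
    also have "\<dots> \<le> e / (2 * C) * (C * \<epsilon> n)" using b[of n] e C by (intro mult_left_mono) auto
    also have "\<dots> = e / 2 * \<epsilon> n" using C by simp
    also have "\<dots> < e * \<epsilon> n" using e \<epsilon>[of n] by simp
    finally show ?case using \<epsilon>[of n] by (simp add: pos_divide_less_eq)
  qed
  then show "\<exists>no. \<forall>n\<ge>no. norm ((1 / \<epsilon> n) *\<^sub>R (f n (b n) - f n a - A *v (b n - a)) - 0) < e"
    by (simp add: eventually_sequentially)
qed

context diff_system
begin

context
  fixes V \<mu> y \<Phi> and D :: "real \<Rightarrow> real^'c" and B :: real and \<epsilon> :: "nat \<Rightarrow> real" and \<mu>n yn \<Phi>n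
  assumes lag: "lagrangian V \<mu> y \<Phi>" and D_cont: "continuous_on {0..T} D"
    and B: "B > 0" "\<And>t. t \<in> {0..T} \<Longrightarrow> norm (D t) \<le> B"
    and \<epsilon>: "\<And>n. \<epsilon> n > 0" "\<epsilon> \<longlonglongrightarrow> 0"
    and lagn: "\<And>n. lagrangian (\<lambda>t. V t + \<epsilon> n *\<^sub>R D t) (\<mu>n n) (yn n) (\<Phi>n n)"
begin

text \<open>The constant that \<open>stability\<close> yields when the primitives differ by at most
  \<open>\<epsilon> n * B\<close>.\<close>

abbreviation "lipC \<equiv> 2 * B * exp (8 * L * T)"
abbreviation "dPhi n t x \<equiv> \<Phi>n n t x - \<Phi> t x"
abbreviation "dy n t \<equiv> yn n t - y t"
abbreviation "dF n t x \<equiv> F (\<mu>n n t) (\<Phi>n n t x) (yn n t) - F (\<mu> t) (\<Phi> t x) (y t)"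
abbreviation "dG n t \<equiv> G (\<mu>n n t) (yn n t) - G (\<mu> t) (y t)"
text \<open>The part of the increment of the right-hand side that the linearised operator does not
  capture, on the scale of \<open>\<epsilon> n\<close>.\<close>

abbreviation "rF n t x \<equiv> (1 / \<epsilon> n) *\<^sub>R (dF n t x - Aw \<mu> y \<Phi> t (dPhi n t) (dy n t) x)"
abbreviation "rG n t \<equiv> (1 / \<epsilon> n) *\<^sub>R (dG n t - Av \<mu> y \<Phi> t (dPhi n t) (dy n t))"

lemma lipC_pos: "lipC > 0" using B by simp

lemma perturbation_le:
  assumes t: "t \<in> {0..T}"
  shows "x \<in> supp \<mu>0 \<Longrightarrow> norm (dPhi n t x) \<le> lipC * \<epsilon> n" and "norm (dy n t) \<le> lipC * \<epsilon> n"
    and "W2 (\<mu> t) (\<mu>n n t) \<le> lipC * \<epsilon> n" "W2 (\<mu>n n t) (\<mu> t) \<le> lipC * \<epsilon> n"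
proof -
  have st: "norm (dPhi n t x) + norm (dy n t) \<le> lipC * \<epsilon> n" if x: "x \<in> supp \<mu>0" for x
  proof -
    have "norm (dPhi n t x) + norm (dy n t) \<le> 2 * (\<epsilon> n * B) * exp (8 * L * T)"
      using \<epsilon>(1)[of n] B(2) by (intro stability[OF lagn lag _ t x]) (simp add: mult_left_mono)
    then show ?thesis by (simp add: mult_ac)
  qed
  show 1: "norm (dPhi n t x) \<le> lipC * \<epsilon> n" if "x \<in> supp \<mu>0" for x
    using st[OF that] norm_ge_zero[of "dy n t"] by linarith
  obtain x where "x \<in> supp \<mu>0" using supp_nonempty[OF Pc0] by blast
  from st[OF this] show "norm (dy n t) \<le> lipC * \<epsilon> n" using norm_ge_zero[of "dPhi n t x"] by linarith
  have c: "0 \<le> lipC * \<epsilon> n" using lipC_pos \<epsilon>(1)[of n] by simp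
  show "W2 (\<mu>n n t) (\<mu> t) \<le> lipC * \<epsilon> n" by (rule lag_W2_le[OF lagn lag t 1 c])
  show "W2 (\<mu> t) (\<mu>n n t) \<le> lipC * \<epsilon> n"
    by (rule lag_W2_le[OF lag lagn t _ c]) (use 1 in \<open>simp add: norm_minus_commute\<close>)
qed

lemma perturbation_small:
  assumes "\<delta> > 0" shows "\<forall>\<^sub>F n in sequentially. lipC * \<epsilon> n < \<delta>"
proof -
  have "(\<lambda>n. lipC * \<epsilon> n) \<longlonglongrightarrow> lipC * 0" by (intro tendsto_mult_left \<epsilon>)
  then show ?thesis using assms by (intro order_tendstoD) simp
qed

lemma perturbation_cont:
  "continuous_on ({0..T} \<times> UNIV) (\<lambda>(t, x). dPhi n t x)" "continuous_on {0..T} (dy n)"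
  "continuous_on ({0..T} \<times> UNIV) (\<lambda>(t, x). dF n t x)" "continuous_on {0..T} (dG n)"
  "t \<in> {0..T} \<Longrightarrow> continuous_on UNIV (dPhi n t)"
  using lag_cont[OF lag] lag_cont[OF lagn, of n] lag_F_flow_cont[OF lag] lag_F_flow_cont[OF lagn, of n]
    lag_G_cont[OF lag] lag_G_cont[OF lagn, of n] lag_y_cont[OF lag] lag_y_cont[OF lagn, of n]
    lag_cont_x[OF lag] lag_cont_x[OF lagn, of t n]
  by (auto simp: split_beta intro!: continuous_on_diff)

lemma A_perturbation_cont:
  "continuous_on ({0..T} \<times> UNIV) (\<lambda>(t, x). Aw \<mu> y \<Phi> t (dPhi n t) (dy n t) x)"
  "continuous_on {0..T} (\<lambda>t. Av \<mu> y \<Phi> t (dPhi n t) (dy n t))"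
  by (rule A_continuous[OF lag continuous_on_id _ perturbation_cont(1,2)]; simp)+

lemma remainder_cont:
  "continuous_on ({0..T} \<times> UNIV) (\<lambda>(t, x). rF n t x)" "continuous_on {0..T} (rG n)"
proof -
  show "continuous_on ({0..T} \<times> UNIV) (\<lambda>(t, x). rF n t x)"
    using continuous_on_scaleR[OF continuous_on_const continuous_on_diff[OF perturbation_cont(3)[of n] A_perturbation_cont(1)[of n]]]
    by (simp add: split_beta)
  show "continuous_on {0..T} (rG n)"
    by (rule continuous_on_scaleR[OF continuous_on_const continuous_on_diff[OF perturbation_cont(4)[of n] A_perturbation_cont(2)[of n]]])
qed

lemma measure_remainder:
  fixes \<phi> :: "(real^'d) measure \<Rightarrow> real^'m"
  assumes t: "t \<in> {0..T}" and w: "\<And>i. wgrad Pc (\<lambda>\<nu>. \<phi> \<nu> $ i) (\<mu> t) (\<lambda>\<zeta>. \<Xi> \<zeta> $ i)"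
    and c: "continuous_on UNIV (\<lambda>\<zeta>. \<Xi> (\<Phi> t \<zeta>))"
  shows "(\<lambda>n. (1 / \<epsilon> n) *\<^sub>R (\<phi> (\<mu>n n t) - \<phi> (\<mu> t) - (\<integral>\<zeta>. \<Xi> (\<Phi> t \<zeta>) *v dPhi n t \<zeta> \<partial>\<mu>0))) \<longlonglongrightarrow> 0"
proof (rule vec_tendstoI)
  fix i
  have 1: "\<mu> t = distr \<mu>0 borel (\<Phi> t)" by (rule lag_distr[OF lag t])
  have 2: "\<mu>n n t = distr \<mu>0 borel (\<Phi>n n t)" for n by (rule lag_distr[OF lagn t])
  have P: "distr \<mu>0 borel (\<Phi> t) \<in> Pc" using lag_Pc[OF lag t] 1 by simp
  have Pn: "distr \<mu>0 borel (\<Phi>n n t) \<in> Pc \<inter> Pc" for n using lag_Pc[OF lagn[of n] t] unfolding 2[of n] by simp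
  have int: "(\<integral>\<zeta>. \<Xi> (\<Phi> t \<zeta>) *v dPhi n t \<zeta> \<partial>\<mu>0) $ i = (\<integral>\<zeta>. \<Xi> (\<Phi> t \<zeta>) $ i \<bullet> dPhi n t \<zeta> \<partial>\<mu>0)" for n
  proof -
    have "integrable \<mu>0 (\<lambda>\<zeta>. \<Xi> (\<Phi> t \<zeta>) *v dPhi n t \<zeta>)"
      by (intro integrable_continuous_Pc Pc0 continuous_on_matrix_vector c perturbation_cont t)
    from integral_bounded_linear[OF bounded_linear_vec_nth this]
    show ?thesis by (simp add: matrix_vector_mul_component)
  qed
  have "(\<lambda>n. (\<phi> (distr \<mu>0 borel (\<Phi>n n t)) $ i - \<phi> (distr \<mu>0 borel (\<Phi> t)) $ i
      - (\<integral>\<zeta>. \<Xi> (\<Phi> t \<zeta>) $ i \<bullet> dPhi n t \<zeta> \<partial>\<mu>0)) / \<epsilon> n) \<longlonglongrightarrow> 0"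
    by (rule gradient_remainder[OF w[of i, unfolded 1] P lag_measurable(2)[OF lag t] lag_measurable(2)[OF lagn t] Pn perturbation_le(1)[OF t] lipC_pos \<epsilon>])
  then show "(\<lambda>n. ((1 / \<epsilon> n) *\<^sub>R (\<phi> (\<mu>n n t) - \<phi> (\<mu> t) - (\<integral>\<zeta>. \<Xi> (\<Phi> t \<zeta>) *v dPhi n t \<zeta> \<partial>\<mu>0))) $ i) \<longlonglongrightarrow> 0 $ i"
    by (simp add: int 1 2)
qed

lemma coefficients_cont_x:
  assumes "t \<in> {0..T}"
  shows "continuous_on UNIV (\<lambda>\<zeta>. DmuF (\<mu> t) (\<Phi> t x) (y t) (\<Phi> t \<zeta>))" "continuous_on UNIV (\<lambda>\<zeta>. DmuG (\<mu> t) (y t) (\<Phi> t \<zeta>))"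
  using coefficients_continuous(4,5)[OF lag, of UNIV "\<lambda>_. t" "\<lambda>_. x" "\<lambda>\<zeta>. \<zeta>"] assms by (auto intro: continuous_intros)

text \<open>The increment telescopes: first the position moves, then the state, then the measure.
  The order matters. The first two moves take place at the perturbed measure, where (H2) controls
  the derivatives; the last one starts from the reference data, where the Wasserstein gradient
  expands the functional.\<close>

lemma remainder_pointwise:
  assumes t: "t \<in> {0..T}"
  shows "x \<in> supp \<mu>0 \<Longrightarrow> (\<lambda>n. rF n t x) \<longlonglongrightarrow> 0" and "(\<lambda>n. rG n t) \<longlonglongrightarrow> 0"
proof -
  have P: "\<mu> t \<in> Pc" "\<mu>n n t \<in> Pc" for n using lag_Pc[OF lag t] lag_Pc[OF lagn t] by auto
  have near: "W2 (\<mu> t) (\<mu>n n t) + r + s < \<delta>" if "lipC * \<epsilon> n < \<delta> / 3" "r \<le> lipC * \<epsilon> n" "s \<le> lipC * \<epsilon> n" for n r s \<delta>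
    using perturbation_le(3)[OF t, of n] that by linarith
  show "(\<lambda>n. rF n t x) \<longlonglongrightarrow> 0" if x: "x \<in> supp \<mu>0"
  proof -
    have 1: "(\<lambda>n. (1 / \<epsilon> n) *\<^sub>R (F (\<mu>n n t) (\<Phi>n n t x) (yn n t) - F (\<mu>n n t) (\<Phi> t x) (yn n t) - DxF (\<mu> t) (\<Phi> t x) (y t) *v dPhi n t x)) \<longlonglongrightarrow> 0"
    proof (rule mean_value_limit[where f="\<lambda>n x. F (\<mu>n n t) x (yn n t)" and M="\<lambda>n x. DxF (\<mu>n n t) x (yn n t)" and C=lipC])
      fix e :: real assume e: "e > 0"
      obtain \<delta> where \<delta>: "\<delta> > 0" "\<forall>\<mu>'\<in>Pc. \<forall>x' y'. W2 (\<mu> t) \<mu>' + dist (\<Phi> t x) x' + dist (y t) y' < \<delta> \<longrightarrow>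
        norm (DxF \<mu>' x' y' - DxF (\<mu> t) (\<Phi> t x) (y t)) < e \<and> norm (DyF \<mu>' x' y' - DyF (\<mu> t) (\<Phi> t x) (y t)) < e"
        using h2[unfolded H2_def, THEN conjunct1, rule_format, OF P(1) e, of "\<Phi> t x" "y t"] by (elim exE conjE) (rule that; assumption)
      have "\<delta> / 3 > 0" using \<delta> by simp
      from perturbation_small[OF this] show "\<forall>\<^sub>F n in sequentially. \<forall>x'. norm (x' - \<Phi> t x) \<le> lipC * \<epsilon> n \<longrightarrow>
          norm (DxF (\<mu>n n t) x' (yn n t) - DxF (\<mu> t) (\<Phi> t x) (y t)) \<le> e"
      proof eventually_elim
        case (elim n)
        show ?case
        proof (intro allI impI)
          fix x' assume "norm (x' - \<Phi> t x) \<le> lipC * \<epsilon> n"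
          then have "W2 (\<mu> t) (\<mu>n n t) + dist (\<Phi> t x) x' + dist (y t) (yn n t) < \<delta>"
            using perturbation_le(2)[OF t, of n] by (intro near elim) (simp_all add: dist_norm norm_minus_commute)
          then show "norm (DxF (\<mu>n n t) x' (yn n t) - DxF (\<mu> t) (\<Phi> t x) (y t)) \<le> e"
            by (intro less_imp_le \<delta>(2)[rule_format, THEN conjunct1] P)
        qed
      qed
    qed (use h1 P perturbation_le(1)[OF t x] lipC_pos \<epsilon>(1) in \<open>simp_all add: H1_def\<close>)
    have 2: "(\<lambda>n. (1 / \<epsilon> n) *\<^sub>R (F (\<mu>n n t) (\<Phi> t x) (yn n t) - F (\<mu>n n t) (\<Phi> t x) (y t) - DyF (\<mu> t) (\<Phi> t x) (y t) *v dy n t)) \<longlonglongrightarrow> 0"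
    proof (rule mean_value_limit[where f="\<lambda>n y'. F (\<mu>n n t) (\<Phi> t x) y'" and M="\<lambda>n y'. DyF (\<mu>n n t) (\<Phi> t x) y'" and C=lipC])
      fix e :: real assume e: "e > 0"
      obtain \<delta> where \<delta>: "\<delta> > 0" "\<forall>\<mu>'\<in>Pc. \<forall>x' y'. W2 (\<mu> t) \<mu>' + dist (\<Phi> t x) x' + dist (y t) y' < \<delta> \<longrightarrow>
        norm (DxF \<mu>' x' y' - DxF (\<mu> t) (\<Phi> t x) (y t)) < e \<and> norm (DyF \<mu>' x' y' - DyF (\<mu> t) (\<Phi> t x) (y t)) < e"
        using h2[unfolded H2_def, THEN conjunct1, rule_format, OF P(1) e, of "\<Phi> t x" "y t"] by (elim exE conjE) (rule that; assumption)
      have "\<delta> / 3 > 0" using \<delta> by simp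
      from perturbation_small[OF this] show "\<forall>\<^sub>F n in sequentially. \<forall>y'. norm (y' - y t) \<le> lipC * \<epsilon> n \<longrightarrow>
          norm (DyF (\<mu>n n t) (\<Phi> t x) y' - DyF (\<mu> t) (\<Phi> t x) (y t)) \<le> e"
      proof eventually_elim
        case (elim n)
        show ?case
        proof (intro allI impI)
          fix y' assume "norm (y' - y t) \<le> lipC * \<epsilon> n"
          then have "W2 (\<mu> t) (\<mu>n n t) + dist (\<Phi> t x) (\<Phi> t x) + dist (y t) y' < \<delta>"
            using lipC_pos \<epsilon>(1)[of n] by (intro near elim) (simp_all add: dist_norm norm_minus_commute)
          then show "norm (DyF (\<mu>n n t) (\<Phi> t x) y' - DyF (\<mu> t) (\<Phi> t x) (y t)) \<le> e"
            by (intro less_imp_le \<delta>(2)[rule_format, THEN conjunct2] P)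
        qed
      qed
    qed (use h1 P perturbation_le(2)[OF t] lipC_pos \<epsilon>(1) in \<open>simp_all add: H1_def\<close>)
    have 3: "(\<lambda>n. (1 / \<epsilon> n) *\<^sub>R (F (\<mu>n n t) (\<Phi> t x) (y t) - F (\<mu> t) (\<Phi> t x) (y t)
        - (\<integral>\<zeta>. DmuF (\<mu> t) (\<Phi> t x) (y t) (\<Phi> t \<zeta>) *v dPhi n t \<zeta> \<partial>\<mu>0))) \<longlonglongrightarrow> 0"
      using h1 P by (intro measure_remainder t coefficients_cont_x) (simp add: H1_def)
    have "c *\<^sub>R (a1 - a2 - b1) + c *\<^sub>R (a2 - a3 - b2) + c *\<^sub>R (a3 - a4 - b3) = c *\<^sub>R (a1 - a4 - (b1 + b2 + b3))"
      for c :: real and a1 a2 a3 a4 b1 b2 b3 :: "real^'d" by (simp add: scaleR_add_right[symmetric])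
    with tendsto_add[OF tendsto_add[OF 1 2] 3] show ?thesis unfolding Aw_def[OF lag] by (simp only: add_0)
  qed
  have 1: "(\<lambda>n. (1 / \<epsilon> n) *\<^sub>R (G (\<mu>n n t) (yn n t) - G (\<mu>n n t) (y t) - DyG (\<mu> t) (y t) *v dy n t)) \<longlonglongrightarrow> 0"
  proof (rule mean_value_limit[where f="\<lambda>n y'. G (\<mu>n n t) y'" and M="\<lambda>n y'. DyG (\<mu>n n t) y'" and C=lipC])
    fix e :: real assume e: "e > 0"
    obtain \<delta> where \<delta>: "\<delta> > 0" "\<forall>\<mu>'\<in>Pc. \<forall>y'. W2 (\<mu> t) \<mu>' + dist (y t) y' < \<delta> \<longrightarrow> norm (DyG \<mu>' y' - DyG (\<mu> t) (y t)) < e"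
      using h2[unfolded H2_def, THEN conjunct2, rule_format, OF P(1) e, of "y t"] by (elim exE conjE) (rule that; assumption)
    have "\<delta> / 3 > 0" using \<delta> by simp
    from perturbation_small[OF this] show "\<forall>\<^sub>F n in sequentially. \<forall>y'. norm (y' - y t) \<le> lipC * \<epsilon> n \<longrightarrow>
        norm (DyG (\<mu>n n t) y' - DyG (\<mu> t) (y t)) \<le> e"
    proof eventually_elim
      case (elim n)
      show ?case
      proof (intro allI impI)
        fix y' assume "norm (y' - y t) \<le> lipC * \<epsilon> n"
        then have "W2 (\<mu> t) (\<mu>n n t) + 0 + dist (y t) y' < \<delta>"
          using lipC_pos \<epsilon>(1)[of n] by (intro near elim) (simp_all add: dist_norm norm_minus_commute)
        then show "norm (DyG (\<mu>n n t) y' - DyG (\<mu> t) (y t)) \<le> e"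
          by (intro less_imp_le \<delta>(2)[rule_format] P) simp
      qed
    qed
  qed (use h1 P perturbation_le(2)[OF t] lipC_pos \<epsilon>(1) in \<open>simp_all add: H1_def\<close>)
  have 3: "(\<lambda>n. (1 / \<epsilon> n) *\<^sub>R (G (\<mu>n n t) (y t) - G (\<mu> t) (y t)
      - (\<integral>\<zeta>. DmuG (\<mu> t) (y t) (\<Phi> t \<zeta>) *v dPhi n t \<zeta> \<partial>\<mu>0))) \<longlonglongrightarrow> 0"
    using h1 P by (intro measure_remainder t coefficients_cont_x) (simp add: H1_def)
  have "c *\<^sub>R (a1 - a2 - b1) + c *\<^sub>R (a2 - a3 - b2) = c *\<^sub>R (a1 - a3 - (b1 + b2))"
    for c :: real and a1 a2 a3 b1 b2 :: "real^'c" by (simp add: scaleR_add_right[symmetric])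
  with tendsto_add[OF 1 3] show "(\<lambda>n. rG n t) \<longlonglongrightarrow> 0" unfolding Av_def[OF lag] by (simp only: add_0)
qed


lemma coefficients_bound:
  obtains Bc where "Bc > 0"
    "\<And>t x \<zeta>. t \<in> {0..T} \<Longrightarrow> x \<in> supp \<mu>0 \<Longrightarrow> \<zeta> \<in> supp \<mu>0 \<Longrightarrow>
      norm (DxF (\<mu> t) (\<Phi> t x) (y t)) \<le> Bc \<and> norm (DyF (\<mu> t) (\<Phi> t x) (y t)) \<le> Bc \<and> norm (DyG (\<mu> t) (y t)) \<le> Bc
      \<and> norm (DmuF (\<mu> t) (\<Phi> t x) (y t) (\<Phi> t \<zeta>)) \<le> Bc \<and> norm (DmuG (\<mu> t) (y t) (\<Phi> t \<zeta>)) \<le> Bc"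
proof -
  let ?S = "{0..T} \<times> supp \<mu>0 \<times> supp \<mu>0"
  let ?M = "\<lambda>\<sigma>. norm (DxF (\<mu> (fst \<sigma>)) (\<Phi> (fst \<sigma>) (fst (snd \<sigma>))) (y (fst \<sigma>)))
    + norm (DyF (\<mu> (fst \<sigma>)) (\<Phi> (fst \<sigma>) (fst (snd \<sigma>))) (y (fst \<sigma>))) + norm (DyG (\<mu> (fst \<sigma>)) (y (fst \<sigma>)))
    + norm (DmuF (\<mu> (fst \<sigma>)) (\<Phi> (fst \<sigma>) (fst (snd \<sigma>))) (y (fst \<sigma>)) (\<Phi> (fst \<sigma>) (snd (snd \<sigma>))))
    + norm (DmuG (\<mu> (fst \<sigma>)) (y (fst \<sigma>)) (\<Phi> (fst \<sigma>) (snd (snd \<sigma>))))"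
  have c: "continuous_on ?S fst" "continuous_on ?S (\<lambda>\<sigma>. fst (snd \<sigma>))" "continuous_on ?S (\<lambda>\<sigma>. snd (snd \<sigma>))"
    by (intro continuous_intros)+
  have "continuous_on ?S ?M"
    by (intro continuous_on_add continuous_on_norm coefficients_continuous[OF lag c(1) _ c(2,3)]; auto)
  then have "compact (?M ` ?S)"
    by (intro compact_continuous_image compact_Times compact_Icc Pc_compact Pc0)
  then have "bounded (?M ` ?S)" by (rule compact_imp_bounded)
  then obtain Bc where Bc: "Bc > 0" "\<forall>m\<in>?M ` ?S. norm m \<le> Bc" unfolding bounded_pos by blast
  show thesis
  proof (rule that[OF Bc(1)])
    fix t x \<zeta> assume "t \<in> {0..T}" "x \<in> supp \<mu>0" "\<zeta> \<in> supp \<mu>0"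
    then have "norm (?M (t, x, \<zeta>)) \<le> Bc" using Bc(2) by blast
    then show "norm (DxF (\<mu> t) (\<Phi> t x) (y t)) \<le> Bc \<and> norm (DyF (\<mu> t) (\<Phi> t x) (y t)) \<le> Bc \<and> norm (DyG (\<mu> t) (y t)) \<le> Bc
      \<and> norm (DmuF (\<mu> t) (\<Phi> t x) (y t) (\<Phi> t \<zeta>)) \<le> Bc \<and> norm (DmuG (\<mu> t) (y t) (\<Phi> t \<zeta>)) \<le> Bc"
      by (simp add: abs_of_nonneg add_nonneg_nonneg) (smt (verit) norm_ge_zero)
  qed
qed

text \<open>Both parts of the numerator are separately of order \<open>\<epsilon> n\<close>: the
  increment by the Lipschitz condition, the linearised term by boundedness of the coefficients on
  the compact support. The bound serves as the majorant in \<open>remainder_limit\<close>.\<close>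

lemma remainder_bounded:
  obtains k where "k > 0" "\<And>n t x. t \<in> {0..T} \<Longrightarrow> x \<in> supp \<mu>0 \<Longrightarrow> norm (rF n t x) \<le> k"
    "\<And>n t. t \<in> {0..T} \<Longrightarrow> norm (rG n t) \<le> k"
proof -
  interpret prob_space \<mu>0 using Pc0 by (rule Pc_prob)
  obtain Bc where Bc: "Bc > 0"
    "\<And>t x \<zeta>. t \<in> {0..T} \<Longrightarrow> x \<in> supp \<mu>0 \<Longrightarrow> \<zeta> \<in> supp \<mu>0 \<Longrightarrow>
      norm (DxF (\<mu> t) (\<Phi> t x) (y t)) \<le> Bc \<and> norm (DyF (\<mu> t) (\<Phi> t x) (y t)) \<le> Bc \<and> norm (DyG (\<mu> t) (y t)) \<le> Bc
      \<and> norm (DmuF (\<mu> t) (\<Phi> t x) (y t) (\<Phi> t \<zeta>)) \<le> Bc \<and> norm (DmuG (\<mu> t) (y t) (\<Phi> t \<zeta>)) \<le> Bc"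
    using coefficients_bound by metis
  obtain x0 where x0: "x0 \<in> supp \<mu>0" using supp_nonempty[OF Pc0] by blast
  have mv: "norm (A *v h) \<le> Bc * (lipC * \<epsilon> n)" if "norm A \<le> Bc" "norm h \<le> lipC * \<epsilon> n"
    for A :: "real^'m^'k" and h :: "real^'m" and n
    using norm_matrix_vector_le[of A h] mult_mono[OF that] Bc(1) by (smt (verit) norm_ge_zero)
  have int: "norm (\<integral>\<zeta>. A \<zeta> *v dPhi n t \<zeta> \<partial>\<mu>0) \<le> Bc * (lipC * \<epsilon> n)"
    if t: "t \<in> {0..T}" and c: "continuous_on UNIV A" and b: "\<And>\<zeta>. \<zeta> \<in> supp \<mu>0 \<Longrightarrow> norm (A \<zeta>) \<le> Bc"
    for A :: "real^'d \<Rightarrow> real^'d^'k" and n t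
  proof -
    have i: "integrable \<mu>0 (\<lambda>\<zeta>. A \<zeta> *v dPhi n t \<zeta>)"
      by (intro integrable_continuous_Pc Pc0 continuous_on_matrix_vector c perturbation_cont t)
    have "norm (\<integral>\<zeta>. A \<zeta> *v dPhi n t \<zeta> \<partial>\<mu>0) \<le> (\<integral>\<zeta>. norm (A \<zeta> *v dPhi n t \<zeta>) \<partial>\<mu>0)" by (rule integral_norm_bound)
    also have "\<dots> \<le> Bc * (lipC * \<epsilon> n)"
    proof (rule integral_le_const[OF integrable_norm[OF i]])
      show "AE \<zeta> in \<mu>0. norm (A \<zeta> *v dPhi n t \<zeta>) \<le> Bc * (lipC * \<epsilon> n)"
        using AE_supp[OF Pc0] by eventually_elim (intro mv b perturbation_le t)
    qed
    finally show ?thesis .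
  qed
  have scale: "norm ((1 / \<epsilon> n) *\<^sub>R (a - b)) \<le> 3 * lipC * (L + Bc)"
    if "norm a \<le> L * (lipC * \<epsilon> n + (lipC * \<epsilon> n + lipC * \<epsilon> n))" "norm b \<le> 3 * (Bc * (lipC * \<epsilon> n))" for a b :: "'v::real_normed_vector" and n
  proof -
    have "norm (a - b) \<le> L * (lipC * \<epsilon> n + (lipC * \<epsilon> n + lipC * \<epsilon> n)) + 3 * (Bc * (lipC * \<epsilon> n))"
      using norm_triangle_ineq4[of a b] that by linarith
    also have "\<dots> = (3 * lipC * (L + Bc)) * \<epsilon> n" by (simp add: algebra_simps)
    finally show ?thesis using \<epsilon>(1)[of n] by (simp add: pos_divide_le_eq)
  qed
  show thesis
  proof (rule that)
    show "3 * lipC * (L + Bc) > 0" using B(1) L Bc(1) by (intro mult_pos_pos add_pos_pos) simp_all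
    fix n t assume t: "t \<in> {0..T}"
    have P: "\<mu> t \<in> Pc" "\<mu>n n t \<in> Pc" using lag_Pc[OF lag t] lag_Pc[OF lagn t] by auto
    have c0: "0 \<le> lipC * \<epsilon> n" using lipC_pos \<epsilon>(1)[of n] by simp
    show "norm (rF n t x) \<le> 3 * lipC * (L + Bc)" if x: "x \<in> supp \<mu>0" for x
    proof (rule scale)
      have "norm (dF n t x) \<le> L * (norm (dPhi n t x) + (W2 (\<mu>n n t) (\<mu> t) + norm (dy n t)))" by (rule F_lip[OF P(2,1)])
      also have "\<dots> \<le> L * (lipC * \<epsilon> n + (lipC * \<epsilon> n + lipC * \<epsilon> n))"
        using L by (intro mult_left_mono add_mono perturbation_le t x) simp
      finally show "norm (dF n t x) \<le> L * (lipC * \<epsilon> n + (lipC * \<epsilon> n + lipC * \<epsilon> n))" .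
      have "norm (\<integral>\<zeta>. DmuF (\<mu> t) (\<Phi> t x) (y t) (\<Phi> t \<zeta>) *v dPhi n t \<zeta> \<partial>\<mu>0) \<le> Bc * (lipC * \<epsilon> n)"
        using Bc(2)[OF t x] by (intro int t coefficients_cont_x) blast
      moreover have "norm (DxF (\<mu> t) (\<Phi> t x) (y t) *v dPhi n t x) \<le> Bc * (lipC * \<epsilon> n)"
        "norm (DyF (\<mu> t) (\<Phi> t x) (y t) *v dy n t) \<le> Bc * (lipC * \<epsilon> n)"
        using Bc(2)[OF t x x] by (intro mv perturbation_le t x; blast)+
      ultimately show "norm (Aw \<mu> y \<Phi> t (dPhi n t) (dy n t) x) \<le> 3 * (Bc * (lipC * \<epsilon> n))"
        unfolding Aw_def[OF lag] by (smt (verit) norm_triangle_ineq)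
    qed
    show "norm (rG n t) \<le> 3 * lipC * (L + Bc)"
    proof (rule scale)
      have "norm (dG n t) \<le> L * (W2 (\<mu>n n t) (\<mu> t) + norm (dy n t))" by (rule G_lip[OF P(2,1)])
      also have "\<dots> \<le> L * (0 + (lipC * \<epsilon> n + lipC * \<epsilon> n))"
        unfolding add_0 using L by (intro mult_left_mono add_mono perturbation_le t) simp
      also have "\<dots> \<le> L * (lipC * \<epsilon> n + (lipC * \<epsilon> n + lipC * \<epsilon> n))"
        by (intro mult_left_mono add_mono order_refl c0 less_imp_le[OF L])
      finally show "norm (dG n t) \<le> L * (lipC * \<epsilon> n + (lipC * \<epsilon> n + lipC * \<epsilon> n))" .
      have "norm (\<integral>\<zeta>. DmuG (\<mu> t) (y t) (\<Phi> t \<zeta>) *v dPhi n t \<zeta> \<partial>\<mu>0) \<le> Bc * (lipC * \<epsilon> n)"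
        using Bc(2)[OF t x0] by (intro int t coefficients_cont_x) blast
      moreover have "norm (DyG (\<mu> t) (y t) *v dy n t) \<le> Bc * (lipC * \<epsilon> n)"
        using Bc(2)[OF t x0 x0] by (intro mv perturbation_le t) blast
      moreover have "0 \<le> Bc * (lipC * \<epsilon> n)" by (rule mult_nonneg_nonneg[OF less_imp_le[OF Bc(1)] c0])
      ultimately show "norm (Av \<mu> y \<Phi> t (dPhi n t) (dy n t)) \<le> 3 * (Bc * (lipC * \<epsilon> n))"
        unfolding Av_def[OF lag] by (smt (verit) norm_triangle_ineq)
    qed
  qed
qed

context
  fixes p q assumes adj: "adjoint_solution DxF DyF DyG DmuF DmuG \<mu>0 T \<mu> y \<Phi> p q"
begin

lemma remainder_pairing_cont:
  "continuous_on {0..T} (\<lambda>t. (\<integral>x. p t x \<bullet> rF n t x \<partial>\<mu>0) + q t \<bullet> rG n t)"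
  by (intro continuous_on_add continuous_on_inner adj_q_cont[OF lag adj] remainder_cont
      continuous_pairing[OF Pc0 remainder_cont(1) adj_integrable[OF lag adj] adj_L1_cont[OF lag adj] continuous_on_id])

text \<open>The remainders vanish pointwise in time and starting point, so dominated convergence is
  applied twice: in space with majorant \<open>norm (p t x) * k\<close>, then in time with
  \<open>k\<close> times the L1 norm of \<open>p t\<close> plus
  \<open>k * norm (q t)\<close>.\<close>

lemma remainder_limit:
  "(\<lambda>n. integral {0..T} (\<lambda>t. (\<integral>x. p t x \<bullet> rF n t x \<partial>\<mu>0) + q t \<bullet> rG n t)) \<longlonglongrightarrow> 0"
proof -
  obtain k where k: "k > 0" "\<And>n t x. t \<in> {0..T} \<Longrightarrow> x \<in> supp \<mu>0 \<Longrightarrow> norm (rF n t x) \<le> k"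
    "\<And>n t. t \<in> {0..T} \<Longrightarrow> norm (rG n t) \<le> k" by (rule remainder_bounded) blast
  have rFx: "continuous_on UNIV (rF n t)" if "t \<in> {0..T}" for n t
    by (rule continuous_on_pair_compose[OF remainder_cont(1) continuous_on_const continuous_on_id]) (rule that)
  have bF: "AE x in \<mu>0. norm (p t x \<bullet> rF n t x) \<le> norm (p t x) * k" if t: "t \<in> {0..T}" for n t
    using AE_supp[OF Pc0]
  proof eventually_elim
    case (elim x)
    show ?case using Cauchy_Schwarz_ineq2[of "p t x" "rF n t x"] mult_left_mono[OF k(2)[OF t elim, of n] norm_ge_zero[of "p t x"]]
      unfolding real_norm_def by linarith
  qed
  have ip: "integrable \<mu>0 (\<lambda>x. norm (p t x) * k)" if "t \<in> {0..T}" for t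
    using adj_integrable[OF lag adj that] by simp
  have iF: "integrable \<mu>0 (\<lambda>x. p t x \<bullet> rF n t x)" if "t \<in> {0..T}" for n t
    by (intro integrable_inner_continuous Pc0 adj_integrable[OF lag adj] rFx that)
  have pc: "continuous_on {0..T} (\<lambda>t. (\<integral>x. norm (p t x) \<partial>\<mu>0))"
    unfolding continuous_on_iff
  proof (intro ballI allI impI)
    fix t and e :: real assume t: "t \<in> {0..T}" and "e > 0"
    then obtain d where d: "d > 0" "\<forall>s\<in>{0..T}. dist s t < d \<longrightarrow> (\<integral>x. norm (p s x - p t x) \<partial>\<mu>0) < e"
      using adj_L1_cont[OF lag adj] by blast
    have le: "dist (\<integral>x. norm (p s x) \<partial>\<mu>0) (\<integral>x. norm (p t x) \<partial>\<mu>0) \<le> (\<integral>x. norm (p s x - p t x) \<partial>\<mu>0)" if s: "s \<in> {0..T}" for s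
    proof -
      have i: "integrable \<mu>0 (p s)" "integrable \<mu>0 (p t)" using adj_integrable[OF lag adj] s t by auto
      have "\<bar>\<integral>x. norm (p s x) - norm (p t x) \<partial>\<mu>0\<bar> \<le> (\<integral>x. \<bar>norm (p s x) - norm (p t x)\<bar> \<partial>\<mu>0)" by (rule integral_abs_bound)
      also have "\<dots> \<le> (\<integral>x. norm (p s x - p t x) \<partial>\<mu>0)"
        using i by (intro integral_mono integrable_abs Bochner_Integration.integrable_diff integrable_norm) (auto simp: norm_triangle_ineq3)
      finally show ?thesis using i by (simp add: dist_real_def)
    qed
    show "\<exists>d>0. \<forall>s\<in>{0..T}. dist s t < d \<longrightarrow> dist (\<integral>x. norm (p s x) \<partial>\<mu>0) (\<integral>x. norm (p t x) \<partial>\<mu>0) < e"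
      using d(2) by (intro exI[of _ d] conjI ballI impI d(1)) (blast intro: le_less_trans[OF le])
  qed
  let ?h = "\<lambda>t. k * (\<integral>x. norm (p t x) \<partial>\<mu>0) + k * norm (q t)"
  have hi: "?h integrable_on {0..T}"
    by (intro integrable_continuous_real continuous_on_add continuous_on_mult continuous_on_norm continuous_on_const pc adj_q_cont[OF lag adj])
  have "(\<lambda>n. integral {0..T} (\<lambda>t. (\<integral>x. p t x \<bullet> rF n t x \<partial>\<mu>0) + q t \<bullet> rG n t)) \<longlonglongrightarrow> integral {0..T} (\<lambda>t. 0)"
  proof (rule dominated_convergence(2)[OF integrable_continuous_real[OF remainder_pairing_cont] hi])
    fix n t assume t: "t \<in> {0..T}"
    have "\<bar>\<integral>x. p t x \<bullet> rF n t x \<partial>\<mu>0\<bar> \<le> (\<integral>x. norm (p t x \<bullet> rF n t x) \<partial>\<mu>0)"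
      using integral_norm_bound[of \<mu>0 "\<lambda>x. p t x \<bullet> rF n t x"] by simp
    also have "\<dots> \<le> (\<integral>x. norm (p t x) * k \<partial>\<mu>0)"
      by (intro integral_mono_AE integrable_norm iF ip t bF)
    finally have 1: "\<bar>\<integral>x. p t x \<bullet> rF n t x \<partial>\<mu>0\<bar> \<le> k * (\<integral>x. norm (p t x) \<partial>\<mu>0)" by (simp add: mult.commute)
    have "\<bar>q t \<bullet> rG n t\<bar> \<le> norm (q t) * norm (rG n t)" by (rule Cauchy_Schwarz_ineq2)
    also have "\<dots> \<le> norm (q t) * k" by (intro mult_left_mono k(3)[OF t] norm_ge_zero)
    finally have 2: "\<bar>q t \<bullet> rG n t\<bar> \<le> k * norm (q t)" by (simp only: mult.commute)
    show "norm ((\<integral>x. p t x \<bullet> rF n t x \<partial>\<mu>0) + q t \<bullet> rG n t) \<le> ?h t"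
      unfolding real_norm_def by (rule order_trans[OF abs_triangle_ineq add_mono[OF 1 2]])
  next
    fix t assume t: "t \<in> {0..T}"
    have "(\<lambda>n. \<integral>x. p t x \<bullet> rF n t x \<partial>\<mu>0) \<longlonglongrightarrow> (\<integral>x. 0 \<partial>\<mu>0)"
    proof (rule integral_dominated_convergence[OF _ _ ip[OF t]])
      show "AE x in \<mu>0. (\<lambda>n. p t x \<bullet> rF n t x) \<longlonglongrightarrow> 0"
        using AE_supp[OF Pc0]
      proof eventually_elim
        case (elim x)
        show ?case using tendsto_inner[OF tendsto_const remainder_pointwise(1)[OF t elim], of "p t x"] by simp
      qed
      show "(\<lambda>x. p t x \<bullet> rF n t x) \<in> borel_measurable \<mu>0" for n by (rule borel_measurable_integrable[OF iF[OF t]])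
    qed (use bF[OF t] in simp_all)
    from tendsto_add[OF this tendsto_inner[OF tendsto_const remainder_pointwise(2)[OF t], of "q t"]]
    show "(\<lambda>n. (\<integral>x. p t x \<bullet> rF n t x \<partial>\<mu>0) + q t \<bullet> rG n t) \<longlonglongrightarrow> 0" by simp
  qed
  then show ?thesis by simp
qed

text \<open>In the pairing of the perturbation with the adjoint state, the linearised operator
  cancels against the adjoint equation. What survives is the remainder, which vanishes in the limit,
  and the contribution of the control through its primitive \<open>D\<close>.\<close>

lemma first_variation:
  assumes qT: "q T = 0"
  shows "(\<lambda>n. (\<integral>x. p T x \<bullet> dPhi n T x \<partial>\<mu>0) / \<epsilon> n) \<longlonglongrightarrow> integral {0..T} (\<lambda>t. dual_form \<mu> y \<Phi> p q t (\<lambda>_. 0) (D t))"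
proof -
  let ?dual = "dual_form \<mu> y \<Phi> p q"
  have K0c: "continuous_on {0..T} (\<lambda>t. ?dual t (\<lambda>_. 0) (D t))"
    by (rule dual_form_cont[OF lag adj continuous_on_id _ _ D_cont]) (simp_all add: split_beta)
  have eq: "(\<integral>x. p T x \<bullet> dPhi n T x \<partial>\<mu>0) / \<epsilon> n
      = integral {0..T} (\<lambda>t. (\<integral>x. p t x \<bullet> rF n t x \<partial>\<mu>0) + q t \<bullet> rG n t) + integral {0..T} (\<lambda>t. ?dual t (\<lambda>_. 0) (D t))" for n
  proof -
    \<comment> \<open>\<open>D\<close> is merely continuous. Removing it from the state perturbation
      leaves the primitive of the continuous function \<open>dG n\<close>, as \<open>duality\<close>
      requires.\<close>
    let ?z = "\<lambda>t. dy n t - \<epsilon> n *\<^sub>R D t"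
    have int: "(\<lambda>s. a s) integrable_on {0..t}" if "t \<in> {0..T}" "continuous_on {0..T} a" for t and a :: "real \<Rightarrow> 'v::banach"
      using that by (intro integrable_continuous_real continuous_on_subset[OF that(2)]) auto
    have "(\<integral>x. p T x \<bullet> dPhi n T x \<partial>\<mu>0) + q T \<bullet> ?z T
        = integral {0..T} (\<lambda>t. (\<integral>x. p t x \<bullet> dF n t x \<partial>\<mu>0) + q t \<bullet> dG n t - ?dual t (dPhi n t) (?z t))"
    proof (rule duality[OF lag adj perturbation_cont(3,4,1)])
      fix t assume t: "t \<in> {0..T}"
      show "dPhi n t x = integral {0..t} (\<lambda>s. dF n s x)" if x: "x \<in> supp \<mu>0" for x
        unfolding lag_eq[OF lag t x] lag_eq[OF lagn t x]
        by (simp add: integral_diff int[OF t] lag_F_flow_cont_t[OF lag] lag_F_flow_cont_t[OF lagn])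
      show "?z t = integral {0..t} (dG n)"
        unfolding lag_y[OF lag t] lag_y[OF lagn t]
        by (simp add: integral_diff int[OF t] lag_G_cont[OF lag] lag_G_cont[OF lagn])
    qed
    also have "\<dots> = integral {0..T} (\<lambda>t. \<epsilon> n * (((\<integral>x. p t x \<bullet> rF n t x \<partial>\<mu>0) + q t \<bullet> rG n t) + ?dual t (\<lambda>_. 0) (D t)))"
    proof (rule integral_cong)
      fix t assume t: "t \<in> {0..T}"
      \<comment> \<open>In the adjoint form the state enters through one inner product, so linearity
        in it is immediate. This is where the removed part \<open>\<epsilon> n *\<^sub>R D t\<close>
        returns.\<close>
      have lin: "?dual t (dPhi n t) (?z t) = ?dual t (dPhi n t) (dy n t) - \<epsilon> n * ?dual t (\<lambda>_. 0) (D t)"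
        unfolding dual_form_Astar[OF lag adj t perturbation_cont(5)[OF t], symmetric] dual_form_Astar[OF lag adj t continuous_on_const, symmetric]
        by (simp add: inner_diff_right)
      have Aw: "continuous_on UNIV (Aw \<mu> y \<Phi> t (dPhi n t) (dy n t))"
        by (rule continuous_on_pair_compose[OF A_perturbation_cont(1) continuous_on_const continuous_on_id]) (rule t)
      have rFx: "continuous_on UNIV (rF n t)"
        by (rule continuous_on_pair_compose[OF remainder_cont(1) continuous_on_const continuous_on_id]) (rule t)
      have F: "dF n t x = \<epsilon> n *\<^sub>R rF n t x + Aw \<mu> y \<Phi> t (dPhi n t) (dy n t) x" for x using \<epsilon>(1)[of n] by simp
      have G: "dG n t = \<epsilon> n *\<^sub>R rG n t + Av \<mu> y \<Phi> t (dPhi n t) (dy n t)" using \<epsilon>(1)[of n] by simp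
      have "integrable \<mu>0 (\<lambda>x. p t x \<bullet> rF n t x)" "integrable \<mu>0 (\<lambda>x. p t x \<bullet> Aw \<mu> y \<Phi> t (dPhi n t) (dy n t) x)"
        by (intro integrable_inner_continuous Pc0 adj_integrable[OF lag adj] rFx Aw t)+
      then have "(\<integral>x. p t x \<bullet> (\<epsilon> n *\<^sub>R rF n t x + Aw \<mu> y \<Phi> t (dPhi n t) (dy n t) x) \<partial>\<mu>0)
          = \<epsilon> n * (\<integral>x. p t x \<bullet> rF n t x \<partial>\<mu>0) + (\<integral>x. p t x \<bullet> Aw \<mu> y \<Phi> t (dPhi n t) (dy n t) x \<partial>\<mu>0)"
        unfolding inner_add_right inner_scaleR_right by (simp only: Bochner_Integration.integral_add integrable_mult_right integral_mult_right_zero)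
      then have "(\<integral>x. p t x \<bullet> dF n t x \<partial>\<mu>0) = \<epsilon> n * (\<integral>x. p t x \<bullet> rF n t x \<partial>\<mu>0) + (\<integral>x. p t x \<bullet> Aw \<mu> y \<Phi> t (dPhi n t) (dy n t) x \<partial>\<mu>0)"
        by (rule trans[OF Bochner_Integration.integral_cong[OF refl arg_cong[OF F]]])
      moreover have "q t \<bullet> dG n t = \<epsilon> n * (q t \<bullet> rG n t) + q t \<bullet> Av \<mu> y \<Phi> t (dPhi n t) (dy n t)"
        by (rule trans[OF arg_cong[OF G]]) (simp only: inner_add_right inner_scaleR_right)
      ultimately show "(\<integral>x. p t x \<bullet> dF n t x \<partial>\<mu>0) + q t \<bullet> dG n t - ?dual t (dPhi n t) (?z t)
          = \<epsilon> n * (((\<integral>x. p t x \<bullet> rF n t x \<partial>\<mu>0) + q t \<bullet> rG n t) + ?dual t (\<lambda>_. 0) (D t))"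
        unfolding lin unfolding dual_form_def[OF lag adj] distrib_left by linarith
    qed
    also have "\<dots> = \<epsilon> n * (integral {0..T} (\<lambda>t. (\<integral>x. p t x \<bullet> rF n t x \<partial>\<mu>0) + q t \<bullet> rG n t) + integral {0..T} (\<lambda>t. ?dual t (\<lambda>_. 0) (D t)))"
      by (simp only: integral_mult_right integral_add[OF integrable_continuous_real[OF remainder_pairing_cont] integrable_continuous_real[OF K0c]])
    finally show ?thesis using \<epsilon>(1)[of n] by (simp add: qT)
  qed
  show ?thesis
    unfolding eq using tendsto_add[OF remainder_limit tendsto_const] by simp
qed

end

end

end

subsection \<open>The first-order expansion of the cost\<close>

context diff_system
begin

lemma lagrangian_cong:
  "lagrangian V \<mu> y \<Phi> \<Longrightarrow> (\<And>t. t \<in> {0..T} \<Longrightarrow> V t = V' t) \<Longrightarrow> lagrangian V' \<mu> y \<Phi>"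
  by (simp add: lagrangian_def)

text \<open>Integration by parts in time, in the form of Fubini's theorem: \<open>q s\<close> is the
  integral of the state component \<open>k\<close> of the adjoint operator from \<open>s\<close> to
  \<open>T\<close>, and \<open>prim du r\<close> is the integral of \<open>du\<close> from 0 to
  \<open>r\<close>. Both sides integrate \<open>k r \<bullet> du s\<close> over the triangle
  \<open>s \<le> r\<close>.\<close>

lemma adjoint_control_pairing:
  fixes du :: "real \<Rightarrow> real^'c"
  assumes lag: "lagrangian V \<mu> y \<Phi>" and adj: "adjoint_solution DxF DyF DyG DmuF DmuG \<mu>0 T \<mu> y \<Phi> p q"
    and qT: "q T = 0" and du: "set_integrable lborel {0..T} du" and Dc: "continuous_on {0..T} (prim du)"
  shows "(LINT s:{0..T}|lborel. q s \<bullet> du s) = integral {0..T} (\<lambda>r. dual_form \<mu> y \<Phi> p q r (\<lambda>_. 0) (prim du r))"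
proof -
  let ?dual = "dual_form \<mu> y \<Phi> p q"
  define k where "k r = Astar_v DyF DyG \<mu> y \<Phi> \<mu>0 r (p r) (q r)" for r
  have Kk: "?dual r (\<lambda>_. 0) v = k r \<bullet> v" if "r \<in> {0..T}" for r v
    using dual_form_Astar[OF lag adj that continuous_on_const, of 0 v] by (simp add: k_def)
  have Kc: "continuous_on {0..T} (\<lambda>r. ?dual r (\<lambda>_. 0) (v r))" if "continuous_on {0..T} v" for v
    by (rule dual_form_cont[OF lag adj continuous_on_id _ _ that]) (simp_all add: split_beta)
  have kc: "continuous_on {0..T} k"
  proof (subst continuous_on_componentwise, rule ballI)
    fix i :: "real^'c"
    show "continuous_on {0..T} (\<lambda>r. k r \<bullet> i)"
      using Kc[OF continuous_on_const, of i] by (rule continuous_on_eq) (rule Kk)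
  qed
  have q: "q s \<bullet> v = integral {s..T} (\<lambda>r. ?dual r (\<lambda>_. 0) v)" if "s \<in> {0..T}" for s v
    using adj_eq[OF lag adj that continuous_on_const, of 0 v] qT by simp
  have "compact (k ` {0..T})" by (intro compact_continuous_image kc compact_Icc)
  then have "bounded (k ` {0..T})" by (rule compact_imp_bounded)
  then obtain b where b: "b > 0" "\<forall>x\<in>k ` {0..T}. norm x \<le> b" unfolding bounded_pos by blast
  define k' where "k' r = indicator {0..T} r *\<^sub>R k r" for r
  define du' where "du' s = indicator {0..T} s *\<^sub>R du s" for s
  have [measurable]: "k' \<in> borel_measurable borel"
    unfolding k'_def by (intro borel_measurable_continuous_on_indicator kc) simp
  have idu: "integrable lborel du'" using du unfolding set_integrable_def du'_def .
  then have "du' \<in> borel_measurable lborel" by (rule borel_measurable_integrable)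
  then have [measurable]: "du' \<in> borel_measurable borel" by simp
  \<comment> \<open>Truncation to \<open>[0, T]\<close> makes both factors measurable on the line;
    the condition \<open>s \<le> r\<close> restricts to the triangle.\<close>
  define f where "f r s = (if s \<le> r then k' r \<bullet> du' s else 0)" for r s
  have mf [measurable]: "(\<lambda>(r, s). f r s) \<in> borel_measurable (borel \<Otimes>\<^sub>M borel)"
    unfolding f_def by measurable
  have k'b: "norm (k' r) \<le> b" for r using b by (auto simp: k'_def indicator_def)
  \<comment> \<open>The normalised measure \<open>unif T\<close> provides the finite measure space
    of \<open>fubini_dominated\<close>; its factor \<open>1 / T\<close> is compensated when the
    integrals are converted back.\<close>
  have fub: "(\<integral>s. (LINT r:{0..T}|lborel. f r s) \<partial>unif T) = (LINT r:{0..T}|lborel. \<integral>s. f r s \<partial>unif T)"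
  proof (rule fubini_dominated(1)[where k="\<lambda>s. b * norm (du' s)"])
    show "finite_measure (unif T)" using prob_space_unif[OF T] by (rule prob_space.finite_measure)
    have "borel_measurable (lborel \<Otimes>\<^sub>M unif T) = (borel_measurable (borel \<Otimes>\<^sub>M borel) :: (real \<times> real \<Rightarrow> real) set)"
      by (intro measurable_cong_sets sets_pair_measure_cong) simp_all
    moreover have "(\<lambda>(r, s). indicator {0..T} r * f r s) \<in> borel_measurable (borel \<Otimes>\<^sub>M borel)"
      using mf unfolding split_beta' by measurable
    ultimately show "(\<lambda>(r, s). indicator {0..T} r * f r s) \<in> borel_measurable (lborel \<Otimes>\<^sub>M unif T)" by simp
    have "integrable lborel (\<lambda>s. (b / T) * norm (du' s))" using idu by (intro integrable_mult_right integrable_norm)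
    moreover have "(\<lambda>s. (b / T) * norm (du' s)) = (\<lambda>s. indicator {0..T} s / T * (b * norm (du' s)))"
      by (rule ext) (simp add: du'_def indicator_def)
    ultimately have "integrable lborel (\<lambda>s. indicator {0..T} s / T * (b * norm (du' s)))" by (simp only:)
    then show "integrable (unif T) (\<lambda>s. b * norm (du' s))"
      unfolding unif_def using T by (subst integrable_real_density) auto
    fix r :: real
    have "\<bar>f r s\<bar> \<le> b * norm (du' s)" for s
    proof -
      have "\<bar>k' r \<bullet> du' s\<bar> \<le> norm (k' r) * norm (du' s)" by (rule Cauchy_Schwarz_ineq2)
      also have "\<dots> \<le> b * norm (du' s)" by (intro mult_right_mono k'b norm_ge_zero)
      finally show ?thesis using b by (simp add: f_def)
    qed
    then show "AE s in unif T. \<bar>f r s\<bar> \<le> b * norm (du' s)" by simp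
  qed
  have 1: "(LINT r:{0..T}|lborel. f r s) = q s \<bullet> du s" if s: "s \<in> {0..T}" for s
  proof -
    have "(LINT r:{0..T}|lborel. f r s) = (LINT r:{s..T}|lborel. ?dual r (\<lambda>_. 0) (du s))"
      unfolding set_lebesgue_integral_def using s
      by (intro Bochner_Integration.integral_cong) (auto simp: f_def k'_def du'_def indicator_def Kk)
    also have "\<dots> = integral {s..T} (\<lambda>r. ?dual r (\<lambda>_. 0) (du s))"
      using s by (intro set_borel_integral_eq_integral(2) borel_integrable_atLeastAtMost' continuous_on_subset[OF Kc[OF continuous_on_const]]) auto
    finally show ?thesis using q[OF s] by simp
  qed
  have 2: "(\<integral>s. f r s \<partial>unif T) = ?dual r (\<lambda>_. 0) (prim du r) / T" if r: "r \<in> {0..T}" for r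
  proof -
    have i: "set_integrable lborel {0..r} du" by (rule set_integrable_subset[OF du]) (use r in auto)
    have m: "f r \<in> borel_measurable borel" unfolding f_def by measurable
    have "(LINT s:{0..T}|lborel. f r s) = (\<integral>s. k r \<bullet> (indicator {0..r} s *\<^sub>R du s) \<partial>lborel)"
      unfolding set_lebesgue_integral_def using r
      by (intro Bochner_Integration.integral_cong) (auto simp: f_def k'_def du'_def indicator_def)
    also have "\<dots> = k r \<bullet> prim du r"
      unfolding prim_def set_lebesgue_integral_def using i unfolding set_integrable_def by (intro integral_inner_right)
    finally show ?thesis by (simp add: integral_unif[OF T m] Kk[OF r])
  qed
  have m1: "(\<lambda>s. LINT r:{0..T}|lborel. f r s) \<in> borel_measurable borel"
    unfolding set_lebesgue_integral_def using mf unfolding split_beta' by measurable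
  have "(LINT s:{0..T}|lborel. q s \<bullet> du s) = (LINT s:{0..T}|lborel. LINT r:{0..T}|lborel. f r s)"
    by (intro set_lebesgue_integral_cong) (simp_all add: 1)
  also have "\<dots> = T * (\<integral>s. (LINT r:{0..T}|lborel. f r s) \<partial>unif T)" using T by (simp add: integral_unif[OF T m1])
  also have "\<dots> = T * (LINT r:{0..T}|lborel. ?dual r (\<lambda>_. 0) (prim du r) / T)"
    unfolding fub by (intro arg_cong[where f="\<lambda>c. T * c"] set_lebesgue_integral_cong) (simp_all add: 2)
  also have "\<dots> = (LINT r:{0..T}|lborel. ?dual r (\<lambda>_. 0) (prim du r))" using T by simp
  also have "\<dots> = integral {0..T} (\<lambda>r. ?dual r (\<lambda>_. 0) (prim du r))"
    by (intro set_borel_integral_eq_integral(2) borel_integrable_atLeastAtMost' Kc Dc)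
  finally show ?thesis .
qed

context
  fixes U :: "(real^'c) set" and us \<mu>s ys \<Phi>s p q and \<psi> :: "(real^'d) measure \<Rightarrow> real" and \<xi>
  assumes U: "compact U" "convex U" and us: "admissible U T us"
    and sol: "is_solution F G \<mu>0 y0 T us \<mu>s ys" and flow: "is_flow F T \<mu>s ys \<Phi>s"
    and adj: "adjoint_solution DxF DyF DyG DmuF DmuG \<mu>0 T \<mu>s ys \<Phi>s p q"
    and \<xi>: "wgrad P2 \<psi> (\<mu>s T) \<xi>" and pT: "AE x in \<mu>0. p T x = \<xi> (\<Phi>s T x)" and qT: "q T = 0"
begin

lemma reference_lagrangian: "lagrangian (prim us) \<mu>s ys \<Phi>s"
  by (rule solution_lagrangian[OF sol _ is_flow_imp_flow_of[OF T flow]]) (rule admissible_prim[OF U us])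

text \<open>The coupling of the final measures by a common starting point expands
  \<open>\<psi>\<close> to first order in the displacement. The terminal condition identifies the
  gradient with \<open>p T\<close>, and \<open>first_variation\<close> evaluates the resulting
  pairing.\<close>

lemma cost_sequence:
  assumes \<epsilon>: "\<And>n. \<epsilon> n > 0" "\<epsilon> \<longlonglongrightarrow> 0" and \<epsilon>0: "\<epsilon>0 > 0" "admissible U T (\<lambda>t. us t + \<epsilon>0 *\<^sub>R du t)"
    and ad: "\<And>n. admissible U T (\<lambda>t. us t + \<epsilon> n *\<^sub>R du t)"
    and sn: "\<And>n. is_solution F G \<mu>0 y0 T (\<lambda>t. us t + \<epsilon> n *\<^sub>R du t) (\<mu>n n) (yn n)"
  shows "(\<lambda>n. (\<psi> (\<mu>n n T) - \<psi> (\<mu>s T)) / \<epsilon> n) \<longlonglongrightarrow> (LINT t:{0..T}|lborel. q t \<bullet> du t)"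
proof -
  note lag = reference_lagrangian
  have TT: "T \<in> {0..T}" using T by simp
  have ius: "set_integrable lborel {0..t} us" and iue: "set_integrable lborel {0..t} (\<lambda>t. us t + \<epsilon>0 *\<^sub>R du t)" if "t \<in> {0..T}" for t
    using admissible_prim[OF U us that] admissible_prim[OF U \<epsilon>0(2) that] by blast+
  \<comment> \<open>Integrability of \<open>du\<close> and continuity of its primitive are read off
    from two admissible controls, \<open>us\<close> and \<open>us + \<epsilon>0 du\<close>.\<close>
  have du_eq: "du = (\<lambda>t. (1 / \<epsilon>0) *\<^sub>R ((us t + \<epsilon>0 *\<^sub>R du t) - us t))" using \<epsilon>0(1) by simp
  have idu: "set_integrable lborel {0..t} du" if "t \<in> {0..T}" for t
    by (subst du_eq) (intro set_integrable_scaleR_right set_integral_diff ius iue that)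
  have prim_add: "prim (\<lambda>t. us t + c *\<^sub>R du t) t = prim us t + c *\<^sub>R prim du t" if "t \<in> {0..T}" for c t
    unfolding prim_def using ius[OF that] idu[OF that]
    by (subst set_integral_add(2)) (auto intro: set_integrable_scaleR_right)
  have Dc: "continuous_on {0..T} (prim du)"
  proof -
    have "continuous_on {0..T} (\<lambda>t. (1 / \<epsilon>0) *\<^sub>R (prim (\<lambda>t. us t + \<epsilon>0 *\<^sub>R du t) t - prim us t))"
      by (intro continuous_on_scaleR continuous_on_const continuous_on_diff prim_cont[OF U] us \<epsilon>0(2))
    then show ?thesis by (rule continuous_on_eq) (use \<epsilon>0(1) in \<open>simp add: prim_add\<close>)
  qed
  have "bounded (prim du ` {0..T})" by (intro compact_imp_bounded compact_continuous_image Dc compact_Icc)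
  then obtain B where B: "B > 0" "\<forall>x\<in>prim du ` {0..T}. norm x \<le> B" unfolding bounded_pos by blast
  have "\<exists>\<Phi>. lagrangian (\<lambda>t. prim us t + \<epsilon> n *\<^sub>R prim du t) (\<mu>n n) (yn n) \<Phi>" for n
  proof -
    obtain \<Phi> where "lagrangian (prim (\<lambda>t. us t + \<epsilon> n *\<^sub>R du t)) (\<mu>n n) (yn n) \<Phi>"
      by (rule admissible_solution_lagrangian[OF U ad sn])
    from lagrangian_cong[OF this] prim_add[of _ "\<epsilon> n"] show ?thesis by (intro exI[of _ \<Phi>]) simp
  qed
  then obtain \<Phi>n where lagn: "\<And>n. lagrangian (\<lambda>t. prim us t + \<epsilon> n *\<^sub>R prim du t) (\<mu>n n) (yn n) (\<Phi>n n)" by metis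
  have B2: "norm (prim du t) \<le> B" if "t \<in> {0..T}" for t using B(2) that by blast
  note pert = lag Dc B(1) B2 \<epsilon>(1) \<epsilon>(2) lagn
  have 1: "\<mu>s T = distr \<mu>0 borel (\<Phi>s T)" by (rule lag_distr[OF lag TT])
  have 2: "\<mu>n n T = distr \<mu>0 borel (\<Phi>n n T)" for n by (rule lag_distr[OF lagn TT])
  have P: "distr \<mu>0 borel (\<Phi>s T) \<in> Pc" using lag_Pc[OF lag TT] 1 by simp
  have Pn: "distr \<mu>0 borel (\<Phi>n n T) \<in> P2 \<inter> Pc" for n
    using lag_Pc[OF lagn[of n] TT] Pc_subset_P2 unfolding 2[of n] by blast
  have C: "2 * B * exp (8 * L * T) > 0" using B(1) by simp
  have le: "norm (\<Phi>n n T x - \<Phi>s T x) \<le> 2 * B * exp (8 * L * T) * \<epsilon> n" if "x \<in> supp \<mu>0" for n x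
    by (rule perturbation_le(1)[OF pert TT that])
  have m\<xi>: "\<xi> \<in> borel_measurable borel" using \<xi> by (simp add: wgrad_def in_Tan_def)
  have "(\<lambda>n. (\<psi> (\<mu>n n T) - \<psi> (\<mu>s T) - (\<integral>x. \<xi> (\<Phi>s T x) \<bullet> (\<Phi>n n T x - \<Phi>s T x) \<partial>\<mu>0)) / \<epsilon> n) \<longlonglongrightarrow> 0"
    unfolding 1 2
    by (rule gradient_remainder[OF \<xi>[unfolded 1] P lag_measurable(2)[OF lag TT] lag_measurable(2)[OF lagn TT] Pn le C \<epsilon>])
  moreover have "(\<integral>x. \<xi> (\<Phi>s T x) \<bullet> (\<Phi>n n T x - \<Phi>s T x) \<partial>\<mu>0) = (\<integral>x. p T x \<bullet> (\<Phi>n n T x - \<Phi>s T x) \<partial>\<mu>0)" for n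
  proof (rule integral_cong_AE)
    have mW: "(\<lambda>x. \<Phi>n n T x - \<Phi>s T x) \<in> borel_measurable \<mu>0"
      using lag_measurable(2)[OF lag TT] lag_measurable(2)[OF lagn TT] by (intro borel_measurable_diff)
    show "(\<lambda>x. \<xi> (\<Phi>s T x) \<bullet> (\<Phi>n n T x - \<Phi>s T x)) \<in> borel_measurable \<mu>0"
      by (intro borel_measurable_inner mW measurable_compose[OF lag_measurable(2)[OF lag TT] m\<xi>])
    show "(\<lambda>x. p T x \<bullet> (\<Phi>n n T x - \<Phi>s T x)) \<in> borel_measurable \<mu>0"
      by (intro borel_measurable_inner mW borel_measurable_integrable[OF adj_integrable[OF lag adj TT]])
    show "AE x in \<mu>0. \<xi> (\<Phi>s T x) \<bullet> (\<Phi>n n T x - \<Phi>s T x) = p T x \<bullet> (\<Phi>n n T x - \<Phi>s T x)"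
      using pT by eventually_elim simp
  qed
  ultimately have a: "(\<lambda>n. (\<psi> (\<mu>n n T) - \<psi> (\<mu>s T) - (\<integral>x. p T x \<bullet> (\<Phi>n n T x - \<Phi>s T x) \<partial>\<mu>0)) / \<epsilon> n) \<longlonglongrightarrow> 0" by simp
  have "(\<lambda>n. (\<integral>x. p T x \<bullet> (\<Phi>n n T x - \<Phi>s T x) \<partial>\<mu>0) / \<epsilon> n) \<longlonglongrightarrow> (LINT t:{0..T}|lborel. q t \<bullet> du t)"
    unfolding adjoint_control_pairing[OF lag adj qT idu[OF TT] Dc] by (rule first_variation[OF pert adj qT])
  from tendsto_add[OF a this] show ?thesis by (simp add: add_divide_distrib[symmetric])
qed

lemma cost_expansion:
  assumes \<epsilon>0: "\<epsilon>0 > 0"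
    and ad: "\<And>\<epsilon>. \<epsilon> \<in> {0<..\<epsilon>0} \<Longrightarrow> admissible U T (\<lambda>t. us t + \<epsilon> *\<^sub>R du t) \<and>
      is_solution F G \<mu>0 y0 T (\<lambda>t. us t + \<epsilon> *\<^sub>R du t) (\<mu>e \<epsilon>) (ye \<epsilon>)"
  shows "((\<lambda>\<epsilon>. (\<psi> (\<mu>e \<epsilon> T) - \<psi> (\<mu>s T) - \<epsilon> * (LINT t:{0..T}|lborel. q t \<bullet> du t)) / \<epsilon>) \<longlongrightarrow> 0) (at_right 0)"
proof (rule tendsto_at_right_sequentially[OF \<epsilon>0])
  fix \<epsilon> :: "nat \<Rightarrow> real"
  assume \<epsilon>: "\<And>n. 0 < \<epsilon> n" "\<And>n. \<epsilon> n < \<epsilon>0" "\<epsilon> \<longlonglongrightarrow> 0"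
  have "(\<lambda>n. (\<psi> (\<mu>e (\<epsilon> n) T) - \<psi> (\<mu>s T)) / \<epsilon> n) \<longlonglongrightarrow> (LINT t:{0..T}|lborel. q t \<bullet> du t)"
    using ad \<epsilon> \<epsilon>0 by (intro cost_sequence[of \<epsilon> \<epsilon>0 du "\<lambda>n. \<mu>e (\<epsilon> n)" "\<lambda>n. ye (\<epsilon> n)"]) (auto simp: less_imp_le)
  from tendsto_diff[OF this tendsto_const[of "LINT t:{0..T}|lborel. q t \<bullet> du t"]]
  have "(\<lambda>n. (\<psi> (\<mu>e (\<epsilon> n) T) - \<psi> (\<mu>s T)) / \<epsilon> n - (LINT t:{0..T}|lborel. q t \<bullet> du t)) \<longlonglongrightarrow> 0" by simp
  moreover have "(\<psi> (\<mu>e (\<epsilon> n) T) - \<psi> (\<mu>s T)) / \<epsilon> n - (LINT t:{0..T}|lborel. q t \<bullet> du t)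
      = (\<psi> (\<mu>e (\<epsilon> n) T) - \<psi> (\<mu>s T) - \<epsilon> n * (LINT t:{0..T}|lborel. q t \<bullet> du t)) / \<epsilon> n" for n
    using \<epsilon>(1)[of n] by (simp add: diff_divide_distrib)
  ultimately show "(\<lambda>n. (\<psi> (\<mu>e (\<epsilon> n) T) - \<psi> (\<mu>s T) - \<epsilon> n * (LINT t:{0..T}|lborel. q t \<bullet> du t)) / \<epsilon> n) \<longlonglongrightarrow> 0" by simp
qed

subsection \<open>The maximum principle\<close>

context
  fixes r :: real
  assumes r: "r > 0"
    and min: "\<And>u \<mu> y. admissible U T u \<Longrightarrow> L2dist_sq T u us < ennreal (r\<^sup>2) \<Longrightarrow>
      is_solution F G \<mu>0 y0 T u \<mu> y \<Longrightarrow> \<psi> (\<mu>s T) \<le> \<psi> (\<mu> T)"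
begin

text \<open>By convexity the segment from \<open>us\<close> to \<open>v\<close> consists of
  admissible controls, and its initial part lies in the L2 ball of local minimality. Hence the
  difference quotients of the cost are nonnegative, and so is their limit.\<close>

lemma variational_inequality:
  assumes v: "admissible U T v"
  shows "(LINT t:{0..T}|lborel. q t \<bullet> (v t - us t)) \<ge> 0"
proof -
  obtain M where M: "M > 0" "\<And>x. x \<in> U \<Longrightarrow> norm x \<le> M" using admissible_bounded[OF U(1)] by metis
  \<comment> \<open>The L2 distance of the perturbed control to \<open>us\<close> is at most
    \<open>\<epsilon> * 2 * M * sqrt T\<close>. Using \<open>T < (T + 1)\<^sup>2\<close> replaces
    the root by \<open>T + 1\<close>.\<close>
  define c where "c = min 1 (r / (2 * M * (T + 1)))"
  have c: "c > 0" "c \<le> 1" "c * (2 * M * (T + 1)) \<le> r"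
  proof -
    have m: "2 * M * (T + 1) > 0" using M T by simp
    then show "c > 0" "c \<le> 1" using r by (simp_all add: c_def)
    have "c \<le> r / (2 * M * (T + 1))" by (simp add: c_def)
    then show "c * (2 * M * (T + 1)) \<le> r" using m by (simp only: pos_le_divide_eq)
  qed
  \<comment> \<open>The shift by 2 makes \<open>\<epsilon> n < c\<close> strict from
    \<open>n = 0\<close> on.\<close>
  define \<epsilon> where "\<epsilon> n = c / real (n + 2)" for n
  have \<epsilon>: "\<epsilon> n > 0" "\<epsilon> n \<le> 1" "\<epsilon> n < c" for n
    using c by (auto simp: \<epsilon>_def field_simps add_pos_nonneg)
  have \<epsilon>0: "\<epsilon> \<longlonglongrightarrow> 0"
    unfolding \<epsilon>_def by (intro LIMSEQ_ignore_initial_segment[of "\<lambda>n. c / real n" 0 2] lim_const_over_n)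
  let ?u = "\<lambda>\<epsilon> t. us t + \<epsilon> *\<^sub>R (v t - us t)"
  have ad: "admissible U T (?u \<epsilon>)" if "0 \<le> \<epsilon>" "\<epsilon> \<le> 1" for \<epsilon>
  proof -
    have "set_borel_measurable lborel {0..T} (?u \<epsilon>)"
    proof -
      have "indicator {0..T} t *\<^sub>R ?u \<epsilon> t = indicator {0..T} t *\<^sub>R us t
          + \<epsilon> *\<^sub>R (indicator {0..T} t *\<^sub>R v t - indicator {0..T} t *\<^sub>R us t)" for t
        by (simp add: indicator_def)
      moreover have m: "(\<lambda>t. indicator {0..T} t *\<^sub>R us t) \<in> borel_measurable lborel"
        "(\<lambda>t. indicator {0..T} t *\<^sub>R v t) \<in> borel_measurable lborel"
        using us v unfolding admissible_def set_borel_measurable_def by blast+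
      ultimately show ?thesis unfolding set_borel_measurable_def
        by (simp only: borel_measurable_add[OF m(1) borel_measurable_scaleR[OF borel_measurable_const borel_measurable_diff[OF m(2,1)]]])
    qed
    moreover have "AE t in lborel. t \<in> {0..T} \<longrightarrow> ?u \<epsilon> t \<in> U"
      using conjunct2[OF us[unfolded admissible_def]] conjunct2[OF v[unfolded admissible_def]]
    proof eventually_elim
      case (elim t)
      have "?u \<epsilon> t = (1 - \<epsilon>) *\<^sub>R us t + \<epsilon> *\<^sub>R v t" by (simp add: algebra_simps)
      then show ?case using elim convexD[OF U(2)] that by auto
    qed
    ultimately show ?thesis by (simp add: admissible_def)
  qed
  have "\<exists>\<mu> y. is_solution F G \<mu>0 y0 T (?u (\<epsilon> n)) \<mu> y" for n
    using solution_exists[OF U ad[of "\<epsilon> n"]] \<epsilon>[of n] by (metis less_imp_le)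
  then obtain \<mu>n yn where sn: "\<And>n. is_solution F G \<mu>0 y0 T (?u (\<epsilon> n)) (\<mu>n n) (yn n)" by metis
  have near: "L2dist_sq T (?u (\<epsilon> n)) us < ennreal (r\<^sup>2)" for n
  proof -
    let ?b = "\<epsilon> n * (2 * M)"
    have b0: "?b \<ge> 0" using \<epsilon>(1)[of n] M by simp
    have "L2dist_sq T (?u (\<epsilon> n)) us \<le> (\<integral>\<^sup>+ t. ennreal (?b\<^sup>2) * indicator {0..T} t \<partial>lborel)"
      unfolding L2dist_sq_def
    proof (rule nn_integral_mono_AE)
      show "AE t in lborel. ennreal ((norm (?u (\<epsilon> n) t - us t))\<^sup>2) * indicator {0..T} t \<le> ennreal (?b\<^sup>2) * indicator {0..T} t"
        using conjunct2[OF us[unfolded admissible_def]] conjunct2[OF v[unfolded admissible_def]]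
      proof eventually_elim
        case (elim t)
        have "norm (\<epsilon> n *\<^sub>R (v t - us t)) \<le> ?b" if "t \<in> {0..T}"
        proof -
          have "norm (v t - us t) \<le> 2 * M"
            using norm_triangle_ineq4[of "v t" "us t"] M(2)[of "v t"] M(2)[of "us t"] elim that by linarith
          then show ?thesis using \<epsilon>(1)[of n] by (simp add: mult_left_mono)
        qed
        then show ?case by (auto simp: indicator_def intro!: ennreal_leI power_mono)
      qed
    qed
    also have "\<dots> = ennreal (?b\<^sup>2) * ennreal T" using T by (subst nn_integral_cmult_indicator) auto
    also have "\<dots> = ennreal (?b\<^sup>2 * T)" using T by (subst ennreal_mult) auto
    also have "\<dots> < ennreal (r\<^sup>2)"
    proof -
      have "?b\<^sup>2 * T < (?b * (T + 1))\<^sup>2"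
      proof -
        have "T < (T + 1)\<^sup>2" using T by (simp add: power2_eq_square algebra_simps add_pos_pos)
        then show ?thesis using \<epsilon>(1)[of n] M(1) by (simp add: power_mult_distrib)
      qed
      also have "\<dots> \<le> r\<^sup>2"
      proof (rule power_mono)
        have "?b * (T + 1) = \<epsilon> n * (2 * M * (T + 1))" by simp
        also have "\<dots> \<le> c * (2 * M * (T + 1))" using \<epsilon>(3)[of n] M T by (intro mult_right_mono) auto
        finally show "?b * (T + 1) \<le> r" using c(3) by linarith
      qed (use b0 T in simp)
      finally show ?thesis using T by (subst ennreal_less_iff) simp_all
    qed
    finally show ?thesis .
  qed
  have "(\<lambda>n. (\<psi> (\<mu>n n T) - \<psi> (\<mu>s T)) / \<epsilon> n) \<longlonglongrightarrow> (LINT t:{0..T}|lborel. q t \<bullet> (v t - us t))"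
    using v \<epsilon> \<epsilon>0 ad sn less_imp_le[OF \<epsilon>(1)] by (intro cost_sequence[of \<epsilon> 1 "\<lambda>t. v t - us t" \<mu>n yn]) auto
  moreover have "(\<psi> (\<mu>n n T) - \<psi> (\<mu>s T)) / \<epsilon> n \<ge> 0" for n
    using min[OF ad[of "\<epsilon> n"] near sn] \<epsilon>[of n] by (intro divide_nonneg_pos) auto
  ultimately show ?thesis by (intro LIMSEQ_le_const) auto
qed

lemma pointwise_minimum:
  assumes \<omega>: "\<omega> \<in> U"
  shows "AE t in lborel. t \<in> {0..T} \<longrightarrow> q t \<bullet> us t \<le> q t \<bullet> \<omega>"
proof -
  have qc: "continuous_on {0..T} q" by (rule adj_q_cont[OF reference_lagrangian adj])
  \<comment> \<open>Measurability of the costate and of the control is available on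
    \<open>[0, T]\<close>; the truncated copies have it on the whole line, which makes the switching
    set measurable.\<close>
  define q' where "q' t = indicator {0..T} t *\<^sub>R q t" for t
  define us' where "us' t = indicator {0..T} t *\<^sub>R us t" for t
  have "q' \<in> borel_measurable borel" unfolding q'_def by (intro borel_measurable_continuous_on_indicator qc) simp
  then have mq [measurable]: "q' \<in> borel_measurable lborel" by simp
  have mu [measurable]: "us' \<in> borel_measurable lborel"
    using us unfolding admissible_def set_borel_measurable_def us'_def by blast
  define v where "v t = (if q t \<bullet> (\<omega> - us t) < 0 then \<omega> else us t)" for t
  have veq: "indicator {0..T} t *\<^sub>R v t = (if q' t \<bullet> (\<omega> - us' t) < 0 then indicator {0..T} t *\<^sub>R \<omega> else us' t)" for t
    by (auto simp: v_def q'_def us'_def indicator_def)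
  have v: "admissible U T v"
    unfolding admissible_def set_borel_measurable_def veq
  proof
    show "(\<lambda>t. if q' t \<bullet> (\<omega> - us' t) < 0 then indicator {0..T} t *\<^sub>R \<omega> else us' t) \<in> borel_measurable lborel"
      by measurable
    show "AE t in lborel. t \<in> {0..T} \<longrightarrow> v t \<in> U"
      using conjunct2[OF us[unfolded admissible_def]] by eventually_elim (use \<omega> in \<open>auto simp: v_def\<close>)
  qed
  let ?g = "\<lambda>t. - (indicator {0..T} t *\<^sub>R (q t \<bullet> (v t - us t)))"
  have g0: "0 \<le> ?g t" for t by (auto simp: v_def indicator_def)
  have "(LINT t|lborel. ?g t) \<le> 0"
    using variational_inequality[OF v] by (simp add: set_lebesgue_integral_def)
  moreover have "integrable lborel ?g"
  proof -
    have "bounded (q ` {0..T})" by (intro compact_imp_bounded compact_continuous_image qc compact_Icc)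
    then obtain b where b: "b > 0" "\<forall>x\<in>q ` {0..T}. norm x \<le> b" unfolding bounded_pos by blast
    have "set_integrable lborel {0..T} (\<lambda>t. v t - us t)"
      by (intro set_integral_diff admissible_integrable[OF U(1)] v us)
    then have i: "integrable lborel (\<lambda>t. b * norm (indicator {0..T} t *\<^sub>R (v t - us t)))"
      unfolding set_integrable_def by (intro integrable_mult_right integrable_norm)
    have eq: "?g t = - (q' t \<bullet> (indicator {0..T} t *\<^sub>R v t - us' t))" for t
      by (auto simp: q'_def us'_def indicator_def)
    have "(\<lambda>t. indicator {0..T} t *\<^sub>R v t) \<in> borel_measurable lborel"
      using v unfolding admissible_def set_borel_measurable_def by blast
    then have "?g \<in> borel_measurable lborel" unfolding eq by measurable
    then show ?thesis
    proof (rule Bochner_Integration.integrable_bound[OF i])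
      show "AE t in lborel. norm (?g t) \<le> norm (b * norm (indicator {0..T} t *\<^sub>R (v t - us t)))"
      proof (rule AE_I2)
        fix t
        have "\<bar>q t \<bullet> (v t - us t)\<bar> \<le> b * norm (v t - us t)" if "t \<in> {0..T}"
        proof -
          have "norm (q t) * norm (v t - us t) \<le> b * norm (v t - us t)" using b(2) that by (intro mult_right_mono) auto
          then show ?thesis using Cauchy_Schwarz_ineq2[of "q t" "v t - us t"] by linarith
        qed
        then show "norm (?g t) \<le> norm (b * norm (indicator {0..T} t *\<^sub>R (v t - us t)))"
          using b(1) by (auto simp: indicator_def)
      qed
    qed
  qed
  moreover have "0 \<le> (LINT t|lborel. ?g t)" by (rule Bochner_Integration.integral_nonneg) (rule g0)
  ultimately have "AE t in lborel. ?g t = 0"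
    using integral_nonneg_eq_0_iff_AE[of lborel ?g] g0 by (simp add: antisym)
  then show ?thesis
  proof eventually_elim
    case (elim t)
    show ?case
    proof
      assume "t \<in> {0..T}"
      then have "q t \<bullet> (v t - us t) = 0" using elim by simp
      then show "q t \<bullet> us t \<le> q t \<bullet> \<omega>" by (simp add: v_def inner_diff_right split: if_splits)
    qed
  qed
qed

lemma maximum_principle: "AE t in lborel. t \<in> {0..T} \<longrightarrow> q t \<bullet> us t = (INF \<omega>\<in>U. q t \<bullet> \<omega>)"
proof -
  \<comment> \<open>The exceptional null set in \<open>pointwise_minimum\<close> depends on the
    competitor, so countably many are taken. For a fixed time the inequality is closed in the
    competitor and passes to all of \<open>U\<close>; the infimum is attained since
    \<open>us t\<close> itself lies in \<open>U\<close> at almost every time.\<close>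
  obtain C where C: "countable C" "C \<subseteq> U" "U \<subseteq> closure C" by (rule separable)
  have "AE t in lborel. \<forall>\<omega>\<in>C. t \<in> {0..T} \<longrightarrow> q t \<bullet> us t \<le> q t \<bullet> \<omega>"
    using pointwise_minimum C(1,2) by (intro AE_ball_countable') auto
  then show ?thesis using conjunct2[OF us[unfolded admissible_def]]
  proof eventually_elim
    case (elim t)
    show ?case
    proof
      assume t: "t \<in> {0..T}"
      have "closed {\<omega>. q t \<bullet> us t \<le> q t \<bullet> \<omega>}" by (intro closed_Collect_le continuous_intros)
      moreover have "C \<subseteq> {\<omega>. q t \<bullet> us t \<le> q t \<bullet> \<omega>}" using elim(1) t by blast
      ultimately have "closure C \<subseteq> {\<omega>. q t \<bullet> us t \<le> q t \<bullet> \<omega>}" by (intro closure_minimal)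
      then have "\<And>\<omega>. \<omega> \<in> U \<Longrightarrow> q t \<bullet> us t \<le> q t \<bullet> \<omega>" using C(3) by blast
      moreover have "us t \<in> U" using elim(2) t by blast
      ultimately show "q t \<bullet> us t = (INF \<omega>\<in>U. q t \<bullet> \<omega>)" by (intro cInf_eq_minimum[symmetric]) auto
    qed
  qed
qed

end

end

end

theorem mainTheorem8:
  fixes F :: "(real^'d) measure \<Rightarrow> real^'d \<Rightarrow> real^'c \<Rightarrow> real^'d"
    and G :: "(real^'d) measure \<Rightarrow> real^'c \<Rightarrow> real^'c"
    and DxF :: "(real^'d) measure \<Rightarrow> real^'d \<Rightarrow> real^'c \<Rightarrow> real^'d^'d"
    and DyF :: "(real^'d) measure \<Rightarrow> real^'d \<Rightarrow> real^'c \<Rightarrow> real^'c^'d"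
    and DyG :: "(real^'d) measure \<Rightarrow> real^'c \<Rightarrow> real^'c^'c"
    and DmuF :: "(real^'d) measure \<Rightarrow> real^'d \<Rightarrow> real^'c \<Rightarrow> real^'d \<Rightarrow> real^'d^'d"
    and DmuG :: "(real^'d) measure \<Rightarrow> real^'c \<Rightarrow> real^'d \<Rightarrow> real^'d^'c"
    and U :: "(real^'c) set"
    and T :: real
    and \<mu>0 :: "(real^'d) measure"
    and y0 :: "real^'c"
    and \<psi> :: "(real^'d) measure \<Rightarrow> real"
  assumes T_pos: "T > 0"
    and U_compact: "compact U" and U_convex: "convex U"
    and lip: "LIP F G" and slg: "SLG F G"
    and h1: "H1 F G DxF DyF DyG DmuF DmuG"
    and h2: "H2 DxF DyF DyG"
    and h3: "H3 DmuF DmuG"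
    and mu0: "\<mu>0 \<in> Pc"
  shows
    \<comment> \<open>(a) existence of a minimizer of J(u) = psi(mu(T;u))\<close>
    "(W2_lsc \<psi> \<and> U \<noteq> {} \<longrightarrow>
       (\<exists>us \<mu>s ys. admissible U T us \<and> is_solution F G \<mu>0 y0 T us \<mu>s ys \<and>
          (\<forall>u \<mu> y. admissible U T u \<and> is_solution F G \<mu>0 y0 T u \<mu> y \<longrightarrow> \<psi> (\<mu>s T) \<le> \<psi> (\<mu> T))))
     \<and>
     (\<forall>us \<mu>s ys \<Phi>s p q.
        admissible U T us \<and> is_solution F G \<mu>0 y0 T us \<mu>s ys \<and> is_flow F T \<mu>s ys \<Phi>s \<and>
        wdiff P2 \<psi> (\<mu>s T) \<and>
        adjoint_solution DxF DyF DyG DmuF DmuG \<mu>0 T \<mu>s ys \<Phi>s p q \<and>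
        (\<exists>\<xi>. wgrad P2 \<psi> (\<mu>s T) \<xi> \<and> (AE x in \<mu>0. p T x = \<xi> (\<Phi>s T x))) \<and> q T = 0
      \<longrightarrow>
        \<comment> \<open>(b) first-order expansion of the cost\<close>
        (\<forall>du \<epsilon>0 \<mu>e ye. L2_on T du \<and> \<epsilon>0 > 0 \<and>
           (\<forall>\<epsilon>\<in>{0<..\<epsilon>0}. admissible U T (\<lambda>t. us t + \<epsilon> *\<^sub>R du t) \<and>
               is_solution F G \<mu>0 y0 T (\<lambda>t. us t + \<epsilon> *\<^sub>R du t) (\<mu>e \<epsilon>) (ye \<epsilon>))
         \<longrightarrow> ((\<lambda>\<epsilon>. (\<psi> (\<mu>e \<epsilon> T) - \<psi> (\<mu>s T) - \<epsilon> * (LINT t:{0..T}|lborel. q t \<bullet> du t)) / \<epsilon>)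
                \<longlongrightarrow> 0) (at_right 0))
        \<and>
        \<comment> \<open>(c) Pontryagin maximum principle at an L2-local minimizer\<close>
        ((\<exists>r>0. \<forall>u \<mu> y. admissible U T u \<and> L2dist_sq T u us < ennreal (r\<^sup>2) \<and>
              is_solution F G \<mu>0 y0 T u \<mu> y \<longrightarrow> \<psi> (\<mu>s T) \<le> \<psi> (\<mu> T))
         \<longrightarrow> (AE t in lborel. t \<in> {0..T} \<longrightarrow> q t \<bullet> us t = (INF \<omega>\<in>U. q t \<bullet> \<omega>))))"
proof -
  obtain L0 where L0: "\<forall>\<mu>1\<in>Pc. \<forall>\<mu>2\<in>Pc. \<forall>x1 x2 y1 y2.
        norm (F \<mu>1 x1 y1 - F \<mu>2 x2 y2) \<le> L0 * (dist x1 x2 + (W2 \<mu>1 \<mu>2 + dist y1 y2))"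
     "\<forall>\<mu>1\<in>Pc. \<forall>\<mu>2\<in>Pc. \<forall>y1 y2. norm (G \<mu>1 y1 - G \<mu>2 y2) \<le> L0 * (W2 \<mu>1 \<mu>2 + dist y1 y2)"
    using lip unfolding LIP_def by blast
  \<comment> \<open>(LIP) does not fix the sign of its constant, whereas the exponential weights
    need a positive one. Enlarging it is harmless because the factors it multiplies are
    nonnegative.\<close>
  define L where "L = max L0 1"
  have L: "L0 * c \<le> L * c" if "c \<ge> 0" for c using that by (intro mult_right_mono) (simp_all add: L_def)
  interpret diff_system F G L T \<mu>0 y0 DxF DyF DyG DmuF DmuG
  proof
    show "T > 0" "L > 0" "\<mu>0 \<in> Pc" using T_pos mu0 by (simp_all add: L_def)
    show "norm (F \<mu>1 x1 y1 - F \<mu>2 x2 y2) \<le> L * (norm (x1 - x2) + (W2 \<mu>1 \<mu>2 + norm (y1 - y2)))"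
      if "\<mu>1 \<in> Pc" "\<mu>2 \<in> Pc" for \<mu>1 \<mu>2 x1 x2 y1 y2
      using L0(1)[rule_format, OF that, of x1 y1 x2 y2] unfolding dist_norm by (rule order_trans) (intro L add_nonneg_nonneg; simp)
    show "norm (G \<mu>1 y1 - G \<mu>2 y2) \<le> L * (W2 \<mu>1 \<mu>2 + norm (y1 - y2))"
      if "\<mu>1 \<in> Pc" "\<mu>2 \<in> Pc" for \<mu>1 \<mu>2 y1 y2
      using L0(2)[rule_format, OF that, of y1 y2] unfolding dist_norm by (rule order_trans) (intro L add_nonneg_nonneg; simp)
  qed (fact h1 h2 h3)+
  show ?thesis
  proof (intro conjI allI impI; (elim conjE exE)?)
    assume "W2_lsc \<psi>" "U \<noteq> {}"
    then obtain u \<mu> y where "admissible U T u" "is_solution F G \<mu>0 y0 T u \<mu> y"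
      "\<And>u' \<mu>' y'. admissible U T u' \<Longrightarrow> is_solution F G \<mu>0 y0 T u' \<mu>' y' \<Longrightarrow> \<psi> (\<mu> T) \<le> \<psi> (\<mu>' T)"
      by (rule minimizer_exists[OF U_compact U_convex]) blast
    then show "\<exists>us \<mu>s ys. admissible U T us \<and> is_solution F G \<mu>0 y0 T us \<mu>s ys \<and>
          (\<forall>u \<mu> y. admissible U T u \<and> is_solution F G \<mu>0 y0 T u \<mu> y \<longrightarrow> \<psi> (\<mu>s T) \<le> \<psi> (\<mu> T))" by blast
  next
    fix us \<mu>s ys \<Phi>s p q du \<epsilon>0 \<mu>e ye \<xi>
    assume "admissible U T us" "is_solution F G \<mu>0 y0 T us \<mu>s ys" "is_flow F T \<mu>s ys \<Phi>s"
      "adjoint_solution DxF DyF DyG DmuF DmuG \<mu>0 T \<mu>s ys \<Phi>s p q"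
      "wgrad P2 \<psi> (\<mu>s T) \<xi>" "AE x in \<mu>0. p T x = \<xi> (\<Phi>s T x)" "q T = 0"
    note facts = U_compact U_convex this
    show "((\<lambda>\<epsilon>. (\<psi> (\<mu>e \<epsilon> T) - \<psi> (\<mu>s T) - \<epsilon> * (LINT t:{0..T}|lborel. q t \<bullet> du t)) / \<epsilon>) \<longlongrightarrow> 0) (at_right 0)"
      if "0 < \<epsilon>0" "\<forall>\<epsilon>\<in>{0<..\<epsilon>0}. admissible U T (\<lambda>t. us t + \<epsilon> *\<^sub>R du t) \<and>
               is_solution F G \<mu>0 y0 T (\<lambda>t. us t + \<epsilon> *\<^sub>R du t) (\<mu>e \<epsilon>) (ye \<epsilon>)"
      by (rule cost_expansion[OF facts that(1)]) (rule that(2)[rule_format])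
    show "AE t in lborel. t \<in> {0..T} \<longrightarrow> q t \<bullet> us t = (INF \<omega>\<in>U. q t \<bullet> \<omega>)"
      if "0 < r" "\<forall>u \<mu> y. admissible U T u \<and> L2dist_sq T u us < ennreal (r\<^sup>2) \<and>
              is_solution F G \<mu>0 y0 T u \<mu> y \<longrightarrow> \<psi> (\<mu>s T) \<le> \<psi> (\<mu> T)" for r
      by (rule maximum_principle[OF facts that(1)]) (use that(2) in blast)
  qed
qed

end
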